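(* Let $\Sigma$ be a topologically transitive countable Markov shift (with countably infinite alphabet $S=\mathbb{N}$) and let $\phi\colon\Sigma\to\mathbb{R}$ be a summable Markov potential, i.e. $\phi(x)=\phi(x_0x_1)$ depends only on the first two coordinates, such that $\mathrm{Var}_1(\phi)<\infty$ and $P_G(\phi)<\infty$. For each $t\geq 1$ let $\mu_t$ be the unique equilibrium state associated to the potential $t\phi$. Then the limit $\mu_\infty=\lim_{t\to\infty}\mu_t$ exists in the weak$^\star$ topology, and $\mu_\infty$ is a $\phi$-maximizing measure.
   Context: Let $S$ be a countable set of states and $A=(A(i,j))_{S\times S}$ a $0$-$1$ matrix with no zero rows or columns. The (one-sided) countable Markov shift is $\Sigma=\{x=(x_0x_1x_2\ldots)\in S^{\mathbb{N}_0}: A(x_i,x_{i+1})=1\ \forall i\ge0\}$ with the topology generated by cylinders $[x_0\ldots x_{n-1}]=\{y\in\Sigma: y_i=x_i, 0\le i\le n-1\}$, Borel $\sigma$-algebra, and shift map $(\sigma x)_i=x_{i+1}$. $\Sigma$ is topologically transitive if for all $a,b\in S$ there is an admissible finite word (path) from $a$ to $b$. For a continuous $\phi\colon\Sigma\to\mathbb{R}$: $S_n\phi=\sum_{i=0}^{n-1}\phi\circ\sigma^i$; $\mathrm{Var}_n(\phi)=\sup\{|\phi(x)-\phi(y)|: x_i=y_i, 0\le i\le n-1\}$; $\phi$ is summable if $\sum_{i\in\mathbb{N}}\exp(\sup\phi|_{[i]})<\infty$. The Gurevich pressure is $P_G(\phi)=\limsup_{n\to\infty}\frac1n\log\sum_{\sigma^nx=x}\exp(S_n\phi(x))\mathbb{1}_{[a]}(x)$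 (independent of $a\in S$ under transitivity). An equilibrium state for $\phi$ is a $\sigma$-invariant Borel probability $\mu$ with $-\int\phi\,d\mu<\infty$ attaining $\sup\{h(\nu)+\int\phi\,d\nu:\nu\ \sigma\text{-invariant},\ -\int\phi\,d\nu<\infty\}$, where $h$ is the metric entropy. Under the hypotheses, for every $t\ge1$ the potential $t\phi$ has a unique equilibrium state. With $\alpha(\phi)=\sup\{\int\phi\,d\nu:\nu\ \sigma\text{-invariant Borel probability}\}$, a $\sigma$-invariant probability $\mu$ is $\phi$-maximizing if $\int\phi\,d\mu=\alpha(\phi)$. *)

theory Defs
  imports "HOL-Probability.Probability"
begin

text \<open>Countable Markov shift over the alphabet S = nat, transition matrix given as a
  0-1 relation A :: nat => nat => bool. Points are sequences nat => nat, carrying the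
  product topology of the discrete nat (= the cylinder topology).\<close>

definition shift :: "(nat \<Rightarrow> nat) \<Rightarrow> (nat \<Rightarrow> nat)" where
  "shift x = (\<lambda>i. x (Suc i))"

definition CMS :: "(nat \<Rightarrow> nat \<Rightarrow> bool) \<Rightarrow> (nat \<Rightarrow> nat) set" where
  "CMS A = {x. \<forall>i. A (x i) (x (Suc i))}"

definition no_zero_rows_cols :: "(nat \<Rightarrow> nat \<Rightarrow> bool) \<Rightarrow> bool" where
  "no_zero_rows_cols A \<longleftrightarrow> (\<forall>i. \<exists>j. A i j) \<and> (\<forall>j. \<exists>i. A i j)"

definition top_transitive :: "(nat \<Rightarrow> nat \<Rightarrow> bool) \<Rightarrow> bool" where
  "top_transitive A \<longleftrightarrow> (\<forall>a b. \<exists>n w. n \<ge> 1 \<and> w 0 = a \<and> w n = b \<and>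
       (\<forall>i<n. A (w i) (w (Suc i))))"

definition cyl1 :: "(nat \<Rightarrow> nat \<Rightarrow> bool) \<Rightarrow> nat \<Rightarrow> (nat \<Rightarrow> nat) set" where
  "cyl1 A i = {x \<in> CMS A. x 0 = i}"

definition birkhoff_sum :: "((nat \<Rightarrow> nat) \<Rightarrow> real) \<Rightarrow> nat \<Rightarrow> (nat \<Rightarrow> nat) \<Rightarrow> real" where
  "birkhoff_sum \<phi> n x = (\<Sum>i<n. \<phi> ((shift ^^ i) x))"

definition finite_var1 :: "(nat \<Rightarrow> nat \<Rightarrow> bool) \<Rightarrow> ((nat \<Rightarrow> nat) \<Rightarrow> real) \<Rightarrow> bool" where
  "finite_var1 A \<phi> \<longleftrightarrow> (\<exists>C. \<forall>x\<in>CMS A. \<forall>y\<in>CMS A. x 0 = y 0 \<longrightarrow> \<bar>\<phi> x - \<phi> y\<bar> \<le> C)"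

definition summable_pot :: "(nat \<Rightarrow> nat \<Rightarrow> bool) \<Rightarrow> ((nat \<Rightarrow> nat) \<Rightarrow> real) \<Rightarrow> bool" where
  "summable_pot A \<phi> \<longleftrightarrow> (\<forall>i. bdd_above (\<phi> ` cyl1 A i)) \<and>
      summable (\<lambda>i. exp (Sup (\<phi> ` cyl1 A i)))"

definition markov_potential :: "(nat \<Rightarrow> nat \<Rightarrow> bool) \<Rightarrow> ((nat \<Rightarrow> nat) \<Rightarrow> real) \<Rightarrow> bool" where
  "markov_potential A \<phi> \<longleftrightarrow> (\<exists>\<psi>. \<forall>x\<in>CMS A. \<phi> x = \<psi> (x 0) (x 1))"

definition partition_fn :: "(nat \<Rightarrow> nat \<Rightarrow> bool) \<Rightarrow> ((nat \<Rightarrow> nat) \<Rightarrow> real) \<Rightarrow> nat \<Rightarrow> nat \<Rightarrow> ennreal" where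
  "partition_fn A \<phi> a n = (\<integral>\<^sup>+ x. ennreal (exp (birkhoff_sum \<phi> n x))
      \<partial>count_space {x \<in> CMS A. (shift ^^ n) x = x \<and> x 0 = a})"

definition log_over_n :: "ennreal \<Rightarrow> nat \<Rightarrow> ereal" where
  "log_over_n z n = (if z = \<infinity> then \<infinity> else if z = 0 then - \<infinity>
      else ereal (ln (enn2real z) / real n))"

definition gurevich_pressure :: "(nat \<Rightarrow> nat \<Rightarrow> bool) \<Rightarrow> ((nat \<Rightarrow> nat) \<Rightarrow> real) \<Rightarrow> nat \<Rightarrow> ereal" where
  "gurevich_pressure A \<phi> a = limsup (\<lambda>n. log_over_n (partition_fn A \<phi> a n) n)"

definition inv_prob :: "(nat \<Rightarrow> nat \<Rightarrow> bool) \<Rightarrow> (nat \<Rightarrow> nat) measure \<Rightarrow> bool" where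
  "inv_prob A M \<longleftrightarrow> prob_space M \<and> space M = CMS A \<and>
      sets M = sets (restrict_space borel (CMS A)) \<and>
      shift \<in> measurable M M \<and> distr M M shift = M"

definition ext_integral :: "'a measure \<Rightarrow> ('a \<Rightarrow> real) \<Rightarrow> ereal" where
  "ext_integral M f = enn2ereal (\<integral>\<^sup>+ x. ennreal (f x) \<partial>M) - enn2ereal (\<integral>\<^sup>+ x. ennreal (- f x) \<partial>M)"

definition fin_partition :: "'a measure \<Rightarrow> 'a set set \<Rightarrow> bool" where
  "fin_partition M P \<longleftrightarrow> finite P \<and> P \<subseteq> sets M \<and> \<Union>P = space M \<and> disjoint P"

definition part_entropy :: "'a measure \<Rightarrow> 'a set set \<Rightarrow> real" where
  "part_entropy M P = - (\<Sum>B\<in>P. measure M B * ln (measure M B))"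

definition iter_join :: "'a measure \<Rightarrow> ('a \<Rightarrow> 'a) \<Rightarrow> 'a set set \<Rightarrow> nat \<Rightarrow> 'a set set" where
  "iter_join M T P n = {(\<Inter>i<n. (T ^^ i) -` f i) \<inter> space M | f. \<forall>i<n. f i \<in> P} - {{}}"

definition entropy_wrt :: "'a measure \<Rightarrow> ('a \<Rightarrow> 'a) \<Rightarrow> 'a set set \<Rightarrow> real" where
  "entropy_wrt M T P = lim (\<lambda>n. part_entropy M (iter_join M T P (Suc n)) / real (Suc n))"

definition metric_entropy :: "'a measure \<Rightarrow> ('a \<Rightarrow> 'a) \<Rightarrow> ereal" where
  "metric_entropy M T = (SUP P\<in>{P. fin_partition M P}. ereal (entropy_wrt M T P))"

definition equilibrium_state :: "(nat \<Rightarrow> nat \<Rightarrow> bool) \<Rightarrow> ((nat \<Rightarrow> nat) \<Rightarrow> real) \<Rightarrow> (nat \<Rightarrow> nat) measure \<Rightarrow> bool" where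
  "equilibrium_state A \<phi> \<mu> \<longleftrightarrow> inv_prob A \<mu> \<and> ext_integral \<mu> \<phi> > - \<infinity> \<and>
     metric_entropy \<mu> shift + ext_integral \<mu> \<phi> =
       (SUP \<nu>\<in>{\<nu>. inv_prob A \<nu> \<and> ext_integral \<nu> \<phi> > - \<infinity>}. metric_entropy \<nu> shift + ext_integral \<nu> \<phi>)"

definition max_integral :: "(nat \<Rightarrow> nat \<Rightarrow> bool) \<Rightarrow> ((nat \<Rightarrow> nat) \<Rightarrow> real) \<Rightarrow> ereal" where
  "max_integral A \<phi> = (SUP \<nu>\<in>{\<nu>. inv_prob A \<nu>}. ext_integral \<nu> \<phi>)"

definition maximizing :: "(nat \<Rightarrow> nat \<Rightarrow> bool) \<Rightarrow> ((nat \<Rightarrow> nat) \<Rightarrow> real) \<Rightarrow> (nat \<Rightarrow> nat) measure \<Rightarrow> bool" where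
  "maximizing A \<phi> \<mu> \<longleftrightarrow> inv_prob A \<mu> \<and> ext_integral \<mu> \<phi> = max_integral A \<phi>"

definition weak_star_lim :: "(nat \<Rightarrow> nat \<Rightarrow> bool) \<Rightarrow> (real \<Rightarrow> (nat \<Rightarrow> nat) measure) \<Rightarrow> (nat \<Rightarrow> nat) measure \<Rightarrow> bool" where
  "weak_star_lim A \<mu> \<mu>' \<longleftrightarrow> (\<forall>f :: (nat \<Rightarrow> nat) \<Rightarrow> real.
      continuous_on (CMS A) f \<and> bounded (f ` CMS A) \<longrightarrow>
      ((\<lambda>t. \<integral>x. f x \<partial>\<mu> t) \<longlongrightarrow> (\<integral>x. f x \<partial>\<mu>')) at_top)"

end

theory Submission
  imports Defs
begin

text \<open>A model (Gibbs inequality) bound on the entropy shows that an equilibrium state of \<open>t \<phi>\<close> is a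
  Markov measure whose pair distribution is \<open>q(i, j) = u i * W i j * v j / l\<close>, where
  \<open>W i j = exp (t * \<phi> i j)\<close> and \<open>l\<close>, \<open>u\<close>, \<open>v\<close> are the leading eigenvalue and eigenvectors: \<open>v\<close> is a limit of
  Perron vectors of finite subsystems, and strict improvement would be possible if the measure were
  not Markov with these transition probabilities.

  For a finite subsystem, eigenvalue and eigenvector ratios are algebraic over the ring of finite sums
  of exponentials \<open>b * exp (c * t)\<close>. Such functions vanish eventually or never, so bounded ones
  converge as \<open>t\<close> tends to infinity: the finite pair distributions converge. Summability makes the
  marginal mass outside a large finite set smaller than any prescribed exponential, whereas the masses
  of edges inside decay at most exponentially; an energy identity for superharmonic functions then shows
  that the infinite system and a finite subsystem have asymptotically the same eigenvector ratios.

  Hence cylinder probabilities converge to those of a finite Markov chain, which is weak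
  convergence. Comparing free energies at \<open>t\<close> and \<open>1\<close> bounds \<open>(t - 1) * \<integral>\<phi> d\<mu>\<^sub>t\<close> below by
  \<open>t * \<integral>\<phi> d\<nu> - const\<close> for every \<open>\<nu>\<close>, so the limit is maximizing.\<close>

section \<open>Rings of functions without oscillation\<close>

text \<open>The eigenvalue of the infinite system is not known to be algebraic over the exponential
  sums, so only finite subsystems are visibly free of oscillation. A truncation error is useful only
  relative to the masses of the edges it is compared with, and these may tend to zero too. This
  forces two nested finite sets: \<open>G\<close> carries all mass in the limit and fixes the
  exponential rate at which its edges can fade; only then is \<open>H\<close> chosen, so large that
  the mass outside \<open>H\<close> decays faster than that rate. Eigenvector ratios of
  \<open>H\<close> and of the full system are compared on \<open>G\<close> alone.

  No eigenvector of the infinite system is given in advance. Its eigenvalue is taken to be the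
  exponential of the maximal free energy, and a lower limit of finite eigenvectors yields, by
  Fatou's lemma, only \<open>W v <= l v\<close>. This suffices: the resulting transition matrix is
  substochastic and hence a legitimate model, and the equality case of the entropy bound then forces
  an honest eigenvector.\<close>

locale hardy_ring =
  fixes R :: "(real \<Rightarrow> real) set"
  assumes const: "(\<lambda>_. c) \<in> R"
    and add: "f \<in> R \<Longrightarrow> g \<in> R \<Longrightarrow> (\<lambda>t. f t + g t) \<in> R"
    and mult: "f \<in> R \<Longrightarrow> g \<in> R \<Longrightarrow> (\<lambda>t. f t * g t) \<in> R"
    and cont: "f \<in> R \<Longrightarrow> continuous_on {1..} f"
    and dichotomy: "f \<in> R \<Longrightarrow> (\<forall>\<^sub>F t in at_top. f t = 0) \<or> (\<forall>\<^sub>F t in at_top. f t \<noteq> 0)"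
begin

lemma uminus: "f \<in> R \<Longrightarrow> (\<lambda>t. - f t) \<in> R"
  using mult[OF const[of "-1"], of f] by simp

lemma diff: "f \<in> R \<Longrightarrow> g \<in> R \<Longrightarrow> (\<lambda>t. f t - g t) \<in> R"
  using add[OF _ uminus, of f g] by simp

lemma sum: "(\<And>k. k \<in> K \<Longrightarrow> f k \<in> R) \<Longrightarrow> (\<lambda>t. \<Sum>k\<in>K. f k t) \<in> R"
  by (induction K rule: infinite_finite_induct) (auto intro: const add)

text \<open>Fraction-free Gaussian elimination, with eventual vanishing in the role of zero. The
  dichotomy makes the ring an integral domain in this sense, which keeps the relation nontrivial
  after multiplication by the pivot.\<close>

lemma linear_dependence:
  assumes "finite F" "finite K" "card F < card K"
    and "\<And>k i. k \<in> K \<Longrightarrow> i \<in> F \<Longrightarrow> x k i \<in> R"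
  shows "\<exists>c. (\<forall>k\<in>K. c k \<in> R) \<and> (\<exists>k\<in>K. \<not> (\<forall>\<^sub>F t in at_top. c k t = 0)) \<and>
    (\<forall>i\<in>F. \<forall>\<^sub>F t in at_top. (\<Sum>k\<in>K. c k t * x k i t) = 0)"
  using assms
proof (induction F arbitrary: K x rule: finite_induct)
  case empty
  then obtain p where "p \<in> K" by fastforce
  then show ?case
    by (intro exI[of _ "\<lambda>_ _. 1"]) (auto intro: const)
next
  case (insert i F)
  show ?case
  proof (cases "\<forall>k\<in>K. \<forall>\<^sub>F t in at_top. x k i t = 0")
    case True
    have "card F < card K" using insert by simp
    then obtain c where c: "\<forall>k\<in>K. c k \<in> R" "\<exists>k\<in>K. \<not> (\<forall>\<^sub>F t in at_top. c k t = 0)"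
      "\<forall>i\<in>F. \<forall>\<^sub>F t in at_top. (\<Sum>k\<in>K. c k t * x k i t) = 0"
      using insert.IH[of K x] insert.prems by blast
    have "\<forall>\<^sub>F t in at_top. \<forall>k\<in>K. x k i t = 0"
      using True insert.prems(1) by (simp add: eventually_ball_finite)
    then have "\<forall>\<^sub>F t in at_top. (\<Sum>k\<in>K. c k t * x k i t) = 0"
      by (rule eventually_mono) simp
    with c show ?thesis by (intro exI[of _ c]) auto
  next
    case False
    then obtain p where p: "p \<in> K" "\<not> (\<forall>\<^sub>F t in at_top. x p i t = 0)" by blast
    define K' where "K' = K - {p}"
    \<comment> \<open>Cross-multiplication with the pivot clears coordinate \<open>i\<close> without
      a division, so the reduced vectors stay in \<open>R\<close>.\<close>
    define y where "y = (\<lambda>k j t. x p i t * x k j t - x k i t * x p j t)"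
    have K': "finite K'" "card F < card K'" "p \<notin> K'" "K = insert p K'"
      using insert p by (auto simp: K'_def)
    have y: "y k j \<in> R" if "k \<in> K'" "j \<in> F" for k j
      unfolding y_def using that insert.prems p by (auto intro!: diff mult simp: K'_def)
    obtain c where c: "\<forall>k\<in>K'. c k \<in> R" "\<exists>k\<in>K'. \<not> (\<forall>\<^sub>F t in at_top. c k t = 0)"
      "\<forall>i\<in>F. \<forall>\<^sub>F t in at_top. (\<Sum>k\<in>K'. c k t * y k i t) = 0"
      using insert.IH[OF K'(1,2), of y] y by blast
    \<comment> \<open>The coefficient of the pivot vector makes coordinate \<open>i\<close> cancel;
      in every other coordinate the combination agrees with the one found for the reduced
      vectors.\<close>
    define c' where "c' = (\<lambda>k t. if k = p then - (\<Sum>l\<in>K'. c l t * x l i t) else c k t * x p i t)"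
    have xR: "x p i \<in> R" using p insert.prems by auto
    have c'_eq: "c' k = (\<lambda>t. c k t * x p i t)" if "k \<in> K'" for k
      using that K' by (auto simp: c'_def)
    have c'R: "c' k \<in> R" if "k \<in> K" for k
    proof (cases "k = p")
      case True
      have "(\<lambda>t. - (\<Sum>l\<in>K'. c l t * x l i t)) \<in> R"
        using c insert.prems K' by (intro uminus sum mult) auto
      with True show ?thesis by (simp add: c'_def)
    next
      case False
      then have "k \<in> K'" using that by (auto simp: K'_def)
      then show ?thesis using c'_eq c xR by (auto intro: mult)
    qed
    have nz: "\<exists>k\<in>K. \<not> (\<forall>\<^sub>F t in at_top. c' k t = 0)"
    proof -
      from c obtain k where k: "k \<in> K'" "\<not> (\<forall>\<^sub>F t in at_top. c k t = 0)" by blast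
      have "\<forall>\<^sub>F t in at_top. c k t \<noteq> 0" using dichotomy[of "c k"] k c by blast
      moreover have "\<forall>\<^sub>F t in at_top. x p i t \<noteq> 0" using dichotomy[OF xR] p by blast
      ultimately have *: "\<forall>\<^sub>F t in at_top. c' k t \<noteq> 0"
        by eventually_elim (simp add: c'_eq[OF k(1)])
      have "\<not> (\<forall>\<^sub>F t in at_top. c' k t = 0)"
      proof
        assume "\<forall>\<^sub>F t in at_top. c' k t = 0"
        with * have "\<forall>\<^sub>F t::real in at_top. False" by eventually_elim simp
        then show False by simp
      qed
      then show ?thesis using k K' by auto
    qed
    have "\<forall>\<^sub>F t in at_top. (\<Sum>k\<in>K. c' k t * x k j t) = 0" if "j \<in> insert i F" for j
    proof -
      have *: "(\<Sum>k\<in>K. c' k t * x k j t) = (\<Sum>k\<in>K'. c k t * y k j t)" for t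
      proof -
        have "(\<Sum>k\<in>K. c' k t * x k j t) = c' p t * x p j t + (\<Sum>k\<in>K'. c' k t * x k j t)"
          using K' by simp
        also have "(\<Sum>k\<in>K'. c' k t * x k j t) = (\<Sum>k\<in>K'. c k t * x p i t * x k j t)"
          by (intro sum.cong) (auto simp: c'_eq)
        finally have "(\<Sum>k\<in>K. c' k t * x k j t) =
            c' p t * x p j t + (\<Sum>k\<in>K'. c k t * x p i t * x k j t)" .
        moreover have "c' p t = - (\<Sum>l\<in>K'. c l t * x l i t)" by (simp add: c'_def)
        ultimately show ?thesis
          by (simp add: y_def sum_distrib_left sum_distrib_right sum_subtractf algebra_simps)
      qed
      show ?thesis
      proof (cases "j = i")
        case True
        then show ?thesis unfolding * by (simp add: y_def algebra_simps)
      next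
        case False
        then show ?thesis unfolding * using c that by auto
      qed
    qed
    with nz c'R show ?thesis by (intro exI[of _ c']) auto
  qed
qed

text \<open>At a boundary point of the zero set of \<open>g\<close>, dividing the relation by the lowest power of
  \<open>g\<close> that occurs shows that the lowest coefficient vanishes there.\<close>

lemma algebraic_dichotomy:
  assumes g: "continuous_on {1..} g"
    and c: "\<And>k. k \<le> d \<Longrightarrow> c k \<in> R"
    and nz: "\<exists>k\<le>d. \<not> (\<forall>\<^sub>F t in at_top. c k t = 0)"
    and eq: "\<forall>\<^sub>F t in at_top. (\<Sum>k\<le>d. c k t * g t ^ k) = 0"
  shows "(\<forall>\<^sub>F t in at_top. g t = 0) \<or> (\<forall>\<^sub>F t in at_top. g t \<noteq> 0)"
proof (rule ccontr)
  assume contra: "\<not> ?thesis"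
  define m where "m = (LEAST k. k \<le> d \<and> \<not> (\<forall>\<^sub>F t in at_top. c k t = 0))"
  have m: "m \<le> d" "\<not> (\<forall>\<^sub>F t in at_top. c m t = 0)"
    using LeastI_ex[OF nz] by (auto simp: m_def)
  have "\<forall>\<^sub>F t in at_top. c k t = 0" if "k < m" for k
    using not_less_Least[of k "\<lambda>k. k \<le> d \<and> \<not> (\<forall>\<^sub>F t in at_top. c k t = 0)"] that m
    by (auto simp: m_def)
  then have "\<forall>\<^sub>F t in at_top. \<forall>k\<in>{..<m}. c k t = 0"
    by (intro eventually_ball_finite) auto
  moreover have "\<forall>\<^sub>F t in at_top. c m t \<noteq> 0" using dichotomy[OF c[OF m(1)]] m by blast
  ultimately have "\<forall>\<^sub>F t in at_top. t \<ge> 1 \<and> (\<forall>k\<in>{..<m}. c k t = 0) \<and> c m t \<noteq> 0 \<and>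
      (\<Sum>k\<le>d. c k t * g t ^ k) = 0"
    using eq eventually_ge_at_top[of 1] by eventually_elim auto
  then obtain T where T: "\<And>t. t \<ge> T \<Longrightarrow> t \<ge> 1 \<and> (\<forall>k\<in>{..<m}. c k t = 0) \<and> c m t \<noteq> 0 \<and>
      (\<Sum>k\<le>d. c k t * g t ^ k) = 0"
    by (auto simp: eventually_at_top_linorder)
  from contra obtain t1 where t1: "t1 \<ge> T" "g t1 = 0"
    by (auto simp: eventually_at_top_linorder)
  from contra obtain t2 where t2: "t2 \<ge> t1" "g t2 \<noteq> 0"
    by (auto simp: eventually_at_top_linorder)
  \<comment> \<open>Zeros and nonzeros of \<open>g\<close> both occur beyond \<open>T\<close>. The
    last zero \<open>z\<close> before \<open>t2\<close> is a limit of times at which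
    \<open>g\<close> does not vanish, and at those times a power of \<open>g\<close> may be
    cancelled.\<close>
  define Z where "Z = {t \<in> {t1..t2}. g t = 0}"
  have cont12: "continuous_on {t1..t2} g"
    using T[OF t1(1)] by (intro continuous_on_subset[OF g]) auto
  have "closed Z" unfolding Z_def
    by (intro continuous_closed_preimage_constant cont12) auto
  moreover have "Z \<noteq> {}" "bdd_above Z" using t1 t2 by (auto simp: Z_def intro!: bdd_aboveI[of _ t2])
  ultimately have "Sup Z \<in> Z" by (rule closed_contains_Sup[rotated 2])
  define z where "z = Sup Z"
  have z: "t1 \<le> z" "z < t2" "g z = 0"
    using \<open>Sup Z \<in> Z\<close> t2 by (auto simp: Z_def z_def order.order_iff_strict)
  have gnz: "g t \<noteq> 0" if "t \<in> {z<..t2}" for t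
  proof
    assume "g t = 0"
    then have "t \<in> Z" using that z by (auto simp: Z_def)
    then have "t \<le> z" unfolding z_def using \<open>bdd_above Z\<close> by (rule cSup_upper)
    then show False using that by simp
  qed
  define h where "h = (\<lambda>t. \<Sum>k\<in>{m..d}. c k t * g t ^ (k - m))"
  have h0: "h t = 0" if "t \<in> {z<..t2}" for t
  proof -
    have t: "t \<ge> T" using that z t1 by auto
    have "(\<Sum>k\<le>d. c k t * g t ^ k) = (\<Sum>k\<in>{m..d}. c k t * g t ^ k)"
      using T[OF t] m by (intro sum.mono_neutral_right) auto
    also have "\<dots> = g t ^ m * h t"
      unfolding h_def sum_distrib_left
      by (intro sum.cong) (auto simp: power_add[symmetric] mult_ac)
    finally show ?thesis using T[OF t] gnz[OF that] by auto
  qed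
  \<comment> \<open>Continuity carries \<open>h = 0\<close> over to \<open>z\<close>. There
    \<open>g z = 0\<close> kills every term except the one with exponent zero, which is
    \<open>c m z\<close>.\<close>
  have "continuous_on {z..t2} h" unfolding h_def
    using T[OF t1(1)] z
    by (intro continuous_intros continuous_on_subset[OF cont] c continuous_on_subset[OF g]) auto
  moreover have cl: "closure {z<..t2} = {z..t2}" using z by simp
  ultimately have "h z = 0"
    using continuous_constant_on_closure[of "{z<..t2}" h 0 z] h0 z by auto
  moreover have "h z = c m z"
  proof -
    have "h z = (\<Sum>k\<in>{m..d}. if k = m then c m z else 0)"
      unfolding h_def using z by (intro sum.cong) auto
    also have "\<dots> = c m z" using m by simp
    finally show ?thesis .
  qed
  ultimately show False using T[of z] z t1 by auto
qed

end

section \<open>Finite sums of real exponentials\<close>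

definition exp_sums :: "(real \<Rightarrow> real) set" where
  "exp_sums = {f. \<exists>S a. finite S \<and> (\<forall>t. f t = (\<Sum>c\<in>S. a c * exp (c * t)))}"

lemma exp_sums_monomial: "(\<lambda>t. b * exp (c * t)) \<in> exp_sums"
  unfolding exp_sums_def by (intro CollectI exI[of _ "{c}"] exI[of _ "\<lambda>_. b"]) auto

lemma exp_sums_add:
  assumes "f \<in> exp_sums" "g \<in> exp_sums"
  shows "(\<lambda>t. f t + g t) \<in> exp_sums"
proof -
  from assms obtain S a S' a' where *: "finite S" "\<And>t. f t = (\<Sum>c\<in>S. a c * exp (c * t))"
     "finite S'" "\<And>t. g t = (\<Sum>c\<in>S'. a' c * exp (c * t))"
    unfolding exp_sums_def by blast
  define b where "b = (\<lambda>c. (if c \<in> S then a c else 0) + (if c \<in> S' then a' c else 0))"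
  have "f t + g t = (\<Sum>c\<in>S\<union>S'. b c * exp (c * t))" for t
  proof -
    have "f t = (\<Sum>c\<in>S\<union>S'. (if c \<in> S then a c else 0) * exp (c * t))"
      unfolding * using * by (intro sum.mono_neutral_cong_left) auto
    moreover have "g t = (\<Sum>c\<in>S\<union>S'. (if c \<in> S' then a' c else 0) * exp (c * t))"
      unfolding * using * by (intro sum.mono_neutral_cong_left) auto
    ultimately show ?thesis by (simp add: b_def distrib_right sum.distrib)
  qed
  then show ?thesis unfolding exp_sums_def using * by blast
qed

lemma exp_sums_sum: "(\<And>k. k \<in> K \<Longrightarrow> f k \<in> exp_sums) \<Longrightarrow> (\<lambda>t. \<Sum>k\<in>K. f k t) \<in> exp_sums"
  using exp_sums_monomial[of 0 0]
  by (induction K rule: infinite_finite_induct) (auto intro: exp_sums_add)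

lemma exp_sums_mult:
  assumes "f \<in> exp_sums" "g \<in> exp_sums"
  shows "(\<lambda>t. f t * g t) \<in> exp_sums"
proof -
  from assms obtain S a S' a' where *: "\<And>t. f t = (\<Sum>c\<in>S. a c * exp (c * t))"
     "\<And>t. g t = (\<Sum>c\<in>S'. a' c * exp (c * t))"
    unfolding exp_sums_def by blast
  have "(\<lambda>t. \<Sum>c\<in>S. \<Sum>d\<in>S'. (a c * a' d) * exp ((c + d) * t)) \<in> exp_sums"
    by (intro exp_sums_sum exp_sums_monomial)
  also have "(\<lambda>t. \<Sum>c\<in>S. \<Sum>d\<in>S'. (a c * a' d) * exp ((c + d) * t)) = (\<lambda>t. f t * g t)"
    unfolding * sum_product
    by (intro ext sum.cong refl) (simp add: distrib_left exp_add mult_ac)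
  finally show ?thesis .
qed

text \<open>Indexing by the exponents themselves merges equal ones. Once zero coefficients are
  discarded, division by the exponential with the largest exponent leaves a limit, the leading
  coefficient, which is nonzero; so the sum is eventually nonzero unless it vanishes
  identically.\<close>

lemma hardy_ring_exp_sums: "hardy_ring exp_sums"
proof
  fix c :: real show "(\<lambda>_. c) \<in> exp_sums" using exp_sums_monomial[of c 0] by simp
next
  fix f assume "f \<in> exp_sums"
  then obtain S a where f: "finite S" "\<And>t. f t = (\<Sum>c\<in>S. a c * exp (c * t))"
    unfolding exp_sums_def by blast
  have "f = (\<lambda>t. \<Sum>c\<in>S. a c * exp (c * t))" using f by auto
  then show "continuous_on {1..} f" by (auto intro!: continuous_intros)
  define S' where "S' = {c \<in> S. a c \<noteq> 0}"
  have f': "f t = (\<Sum>c\<in>S'. a c * exp (c * t))" "finite S'" for t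
    unfolding f S'_def using f by (auto intro!: sum.mono_neutral_right)
  show "(\<forall>\<^sub>F t in at_top. f t = 0) \<or> (\<forall>\<^sub>F t in at_top. f t \<noteq> 0)"
  proof (cases "S' = {}")
    case True
    then show ?thesis using f' by simp
  next
    case False
    define m where "m = Max S'"
    have m: "m \<in> S'" "\<And>c. c \<in> S' \<Longrightarrow> c \<le> m" using f' False by (auto simp: m_def)
    have lim: "((\<lambda>t. a c * exp ((c - m) * t)) \<longlongrightarrow> (if c = m then a m else 0)) at_top" if "c \<in> S'" for c
    proof (cases "c = m")
      case False
      then have "c - m < 0" using m(2)[OF that] by simp
      then have "((\<lambda>t. a c * exp ((c - m) * t)) \<longlongrightarrow> a c * 0) at_top"
        by (intro tendsto_mult tendsto_const filterlim_compose[OF exp_at_bot]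
            filterlim_tendsto_neg_mult_at_bot[OF tendsto_const] filterlim_ident)
      with False show ?thesis by simp
    qed simp
    have "((\<lambda>t. \<Sum>c\<in>S'. a c * exp ((c - m) * t)) \<longlongrightarrow> (\<Sum>c\<in>S'. if c = m then a m else 0)) at_top"
      by (intro tendsto_sum lim)
    also have "(\<Sum>c\<in>S'. if c = m then a m else 0) = a m" using m f' by simp
    finally have "\<forall>\<^sub>F t in at_top. (\<Sum>c\<in>S'. a c * exp ((c - m) * t)) \<noteq> 0"
      using m by (intro tendsto_imp_eventually_ne) (auto simp: S'_def)
    moreover have "f t = exp (m * t) * (\<Sum>c\<in>S'. a c * exp ((c - m) * t))" for t
      unfolding f' sum_distrib_left
      by (intro sum.cong refl) (simp add: left_diff_distrib exp_diff)
    ultimately show ?thesis by simp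
  qed
qed (auto intro: exp_sums_add exp_sums_mult)

text \<open>The functions by which some matrix over \<open>R\<close> acts on the fixed vector \<open>u\<close>. This is a ring
  containing the eigenvalue belonging to \<open>u\<close>, and its elements are algebraic over \<open>R\<close> because their
  powers act on the finite-dimensional space of \<open>u\<close>.\<close>

definition eigen_ring :: "(real \<Rightarrow> real) set \<Rightarrow> nat set \<Rightarrow> (nat \<Rightarrow> real \<Rightarrow> real) \<Rightarrow> (real \<Rightarrow> real) set" where
  "eigen_ring R F u = {g. continuous_on {1..} g \<and> (\<exists>M. (\<forall>i j. M i j \<in> R) \<and>
     (\<forall>t\<ge>1. \<forall>j\<in>F. (\<Sum>i\<in>F. u i t * M i j t) = g t * u j t))}"

lemma eigen_ringI:
  assumes "continuous_on {1..} g" "\<And>i j. M i j \<in> R"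
    "\<And>t j. t \<ge> 1 \<Longrightarrow> j \<in> F \<Longrightarrow> (\<Sum>i\<in>F. u i t * M i j t) = g t * u j t"
  shows "g \<in> eigen_ring R F u"
  unfolding eigen_ring_def mem_Collect_eq
  using assms by (intro conjI exI[of _ M] allI impI ballI)

lemma eigen_ringE:
  assumes "g \<in> eigen_ring R F u"
  obtains M where "continuous_on {1..} g" "\<And>i j. M i j \<in> R"
    "\<And>t j. t \<ge> 1 \<Longrightarrow> j \<in> F \<Longrightarrow> (\<Sum>i\<in>F. u i t * M i j t) = g t * u j t"
proof -
  from assms obtain M where *: "continuous_on {1..} g" "\<forall>i j. M i j \<in> R"
    "\<forall>t\<ge>1. \<forall>j\<in>F. (\<Sum>i\<in>F. u i t * M i j t) = g t * u j t"
    unfolding eigen_ring_def mem_Collect_eq by (elim conjE exE)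
  show thesis by (rule that[of M]) (use * in simp_all)
qed

text \<open>If \<open>u M = f u\<close> and \<open>u N = g u\<close>, then
  \<open>u (M + N) = (f + g) u\<close> and \<open>u M N = f g u\<close>, so the ring operations come
  from matrices over \<open>R\<close>. The dichotomy is inherited because each element satisfies a
  polynomial relation over \<open>R\<close>, to which \<open>algebraic_dichotomy\<close> applies;
  the continuity demanded in \<open>eigen_ring\<close> serves that step.\<close>

lemma (in hardy_ring) hardy_ring_eigen_ring:
  assumes F: "finite F" "a \<in> F" and u: "\<And>i t. i \<in> F \<Longrightarrow> t \<ge> 1 \<Longrightarrow> u i t > 0"
  shows "hardy_ring (eigen_ring R F u)" and "R \<subseteq> eigen_ring R F u"
proof -
  show sub: "R \<subseteq> eigen_ring R F u"
  proof
    fix f assume f: "f \<in> R"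
    define M where "M = (\<lambda>(i::nat) j t. if i = j then f t else 0 :: real)"
    have "M i j \<in> R" for i j :: nat
    proof (cases "i = j")
      case True
      then have "M i j = f" by (simp add: M_def)
      then show ?thesis using f by simp
    next
      case False
      then have "M i j = (\<lambda>_. 0)" by (simp add: M_def)
      then show ?thesis using const by simp
    qed
    moreover have "(\<Sum>i\<in>F. u i t * M i j t) = f t * u j t" if "j \<in> F" for j t
    proof -
      have "(\<Sum>i\<in>F. u i t * M i j t) = (\<Sum>i\<in>F. if i = j then f t * u j t else 0)"
        by (intro sum.cong) (auto simp: M_def)
      then show ?thesis using F that by simp
    qed
    ultimately show "f \<in> eigen_ring R F u" 
      using cont[OF f] by (intro eigen_ringI[where M = M])
  qed
  show "hardy_ring (eigen_ring R F u)"
  proof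
    fix c show "(\<lambda>_. c) \<in> eigen_ring R F u" using sub const by blast
  next
    fix f g assume "f \<in> eigen_ring R F u" "g \<in> eigen_ring R F u"
    from \<open>f \<in> eigen_ring R F u\<close> obtain M where M: "continuous_on {1..} f" "\<And>i j. M i j \<in> R"
      "\<And>t j. t \<ge> 1 \<Longrightarrow> j \<in> F \<Longrightarrow> (\<Sum>i\<in>F. u i t * M i j t) = f t * u j t"
      by (elim eigen_ringE) blast
    from \<open>g \<in> eigen_ring R F u\<close> obtain N where N: "continuous_on {1..} g" "\<And>i j. N i j \<in> R"
      "\<And>t j. t \<ge> 1 \<Longrightarrow> j \<in> F \<Longrightarrow> (\<Sum>i\<in>F. u i t * N i j t) = g t * u j t"
      by (elim eigen_ringE) blast
    have "(\<Sum>i\<in>F. u i t * (M i j t + N i j t)) = (f t + g t) * u j t" if "t \<ge> 1" "j \<in> F" for t j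
      using M(3)[OF that] N(3)[OF that] by (simp add: distrib_left distrib_right sum.distrib)
    then show "(\<lambda>t. f t + g t) \<in> eigen_ring R F u"

      by (intro eigen_ringI[where M = "\<lambda>i j t. M i j t + N i j t"] continuous_intros add M N) auto
    have "(\<Sum>i\<in>F. u i t * (\<Sum>k\<in>F. M i k t * N k j t)) = (f t * g t) * u j t" if "t \<ge> 1" "j \<in> F" for t j
    proof -
      have "(\<Sum>i\<in>F. u i t * (\<Sum>k\<in>F. M i k t * N k j t)) = (\<Sum>k\<in>F. (\<Sum>i\<in>F. u i t * M i k t) * N k j t)"
        unfolding sum_distrib_left sum_distrib_right by (subst sum.swap) (simp add: mult_ac)
      also have "\<dots> = (\<Sum>k\<in>F. f t * (u k t * N k j t))"
        using M that by (intro sum.cong) auto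
      also have "\<dots> = f t * (g t * u j t)" unfolding sum_distrib_left[symmetric] using N that by simp
      finally show ?thesis by simp
    qed
    then show "(\<lambda>t. f t * g t) \<in> eigen_ring R F u"

      by (intro eigen_ringI[where M = "\<lambda>i j t. \<Sum>k\<in>F. M i k t * N k j t"]
          continuous_intros sum mult M N) auto
  next
    fix f assume "f \<in> eigen_ring R F u" then show "continuous_on {1..} f" by (simp add: eigen_ring_def)
  next
    fix g assume "g \<in> eigen_ring R F u"
    then obtain M where *: "continuous_on {1..} g" "\<And>i j. M i j \<in> R"
      "\<And>t j. t \<ge> 1 \<Longrightarrow> j \<in> F \<Longrightarrow> (\<Sum>i\<in>F. u i t * M i j t) = g t * u j t"
      by (elim eigen_ringE) blast
    \<comment> \<open>The columns \<open>M^k e_a\<close>. Pairing with \<open>u\<close> gives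
      \<open>g^k * u a\<close>, and \<open>card F + 1\<close> of these columns are linearly
      dependent, which is the required relation for \<open>g\<close>; the positive factor
      \<open>u a\<close> cancels.\<close>
    define x where "x = rec_nat (\<lambda>i t. if i = a then 1 else 0 :: real)
      (\<lambda>_ y i t. \<Sum>j\<in>F. M i j t * y j t)"
    have x0: "x 0 = (\<lambda>i t. if i = a then 1 else 0)" and
      xS: "\<And>k. x (Suc k) = (\<lambda>i t. \<Sum>j\<in>F. M i j t * x k j t)"
      by (simp_all add: x_def)
    have xR: "x k i \<in> R" for k i
    proof (induction k arbitrary: i)
      case 0 then show ?case using const[of 0] const[of 1] by (cases "i = a") (auto simp: x0)
    next
      case (Suc k) then show ?case unfolding xS by (intro sum mult *)
    qed
    have ux: "(\<Sum>i\<in>F. u i t * x k i t) = g t ^ k * u a t" if t: "t \<ge> 1" for k t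
    proof (induction k)
      case 0
      have "(\<Sum>i\<in>F. u i t * x 0 i t) = (\<Sum>i\<in>F. if i = a then u a t else 0)"
        by (intro sum.cong) (auto simp: x0)
      then show ?case using F by simp
    next
      case (Suc k)
      have "(\<Sum>i\<in>F. u i t * x (Suc k) i t) = (\<Sum>j\<in>F. (\<Sum>i\<in>F. u i t * M i j t) * x k j t)"
        unfolding sum_distrib_left sum_distrib_right xS by (subst sum.swap) (simp add: mult_ac)
      also have "\<dots> = (\<Sum>j\<in>F. g t * (u j t * x k j t))" using * t by (intro sum.cong) auto
      also have "\<dots> = g t ^ Suc k * u a t" unfolding sum_distrib_left[symmetric] Suc by simp
      finally show ?case .
    qed
    obtain c where c: "\<forall>k\<in>{..card F}. c k \<in> R" "\<exists>k\<in>{..card F}. \<not> (\<forall>\<^sub>F t in at_top. c k t = 0)"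
       "\<forall>i\<in>F. \<forall>\<^sub>F t in at_top. (\<Sum>k\<in>{..card F}. c k t * x k i t) = 0"
      using linear_dependence[OF F(1), of "{..card F}" x] xR by auto
    have "\<forall>\<^sub>F t in at_top. \<forall>i\<in>F. (\<Sum>k\<in>{..card F}. c k t * x k i t) = 0"
      using c(3) F(1) by (intro eventually_ball_finite) auto
    then have "\<forall>\<^sub>F t in at_top. (\<Sum>k\<le>card F. c k t * g t ^ k) = 0"
      using eventually_ge_at_top[of "1::real"]
    proof eventually_elim
      case (elim t)
      have "(\<Sum>k\<le>card F. c k t * g t ^ k) * u a t = (\<Sum>k\<le>card F. c k t * (\<Sum>i\<in>F. u i t * x k i t))"
        unfolding sum_distrib_right by (intro sum.cong) (auto simp: ux[OF elim(2)])
      also have "\<dots> = (\<Sum>i\<in>F. u i t * (\<Sum>k\<le>card F. c k t * x k i t))"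
        unfolding sum_distrib_left by (subst sum.swap) (simp add: mult_ac)
      also have "\<dots> = 0" using elim by simp
      finally show ?case using u[OF F(2) elim(2)] by simp
    qed
    then show "(\<forall>\<^sub>F t in at_top. g t = 0) \<or> (\<forall>\<^sub>F t in at_top. g t \<noteq> 0)"
      using algebraic_dichotomy[OF *(1), of "card F" c] c by auto
  qed
qed

section \<open>Germs at infinity of quotients\<close>

definition germ_fractions :: "(real \<Rightarrow> real) set \<Rightarrow> (real \<Rightarrow> real) set" where
  "germ_fractions R = {f. \<exists>g\<in>R. \<exists>h\<in>R. \<forall>\<^sub>F t in at_top. h t \<noteq> 0 \<and> f t = g t / h t}"

context hardy_ring
begin

lemma germ_fractionsI: "g \<in> R \<Longrightarrow> h \<in> R \<Longrightarrow> \<forall>\<^sub>F t in at_top. h t \<noteq> 0 \<and> f t = g t / h t \<Longrightarrow> f \<in> germ_fractions R"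
  unfolding germ_fractions_def by blast

lemma in_germ_fractions: "f \<in> R \<Longrightarrow> f \<in> germ_fractions R"
  by (rule germ_fractionsI[OF _ const[of 1]]) auto

lemma germ_fractions_add:
  assumes "f \<in> germ_fractions R" "f' \<in> germ_fractions R"
  shows "(\<lambda>t. f t + f' t) \<in> germ_fractions R"
proof -
  from assms obtain g h g' h' where *: "g \<in> R" "h \<in> R" "g' \<in> R" "h' \<in> R"
    "\<forall>\<^sub>F t in at_top. h t \<noteq> 0 \<and> f t = g t / h t" "\<forall>\<^sub>F t in at_top. h' t \<noteq> 0 \<and> f' t = g' t / h' t"
    unfolding germ_fractions_def by blast
  show ?thesis
  proof (rule germ_fractionsI)
    show "(\<lambda>t. g t * h' t + g' t * h t) \<in> R" "(\<lambda>t. h t * h' t) \<in> R" by (intro add mult *)+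
    show "\<forall>\<^sub>F t in at_top. h t * h' t \<noteq> 0 \<and> f t + f' t = (g t * h' t + g' t * h t) / (h t * h' t)"
      using *(5,6) by eventually_elim (simp add: field_simps)
  qed
qed

lemma germ_fractions_mult:
  assumes "f \<in> germ_fractions R" "f' \<in> germ_fractions R"
  shows "(\<lambda>t. f t * f' t) \<in> germ_fractions R"
proof -
  from assms obtain g h g' h' where *: "g \<in> R" "h \<in> R" "g' \<in> R" "h' \<in> R"
    "\<forall>\<^sub>F t in at_top. h t \<noteq> 0 \<and> f t = g t / h t" "\<forall>\<^sub>F t in at_top. h' t \<noteq> 0 \<and> f' t = g' t / h' t"
    unfolding germ_fractions_def by blast
  show ?thesis
  proof (rule germ_fractionsI)
    show "(\<lambda>t. g t * g' t) \<in> R" "(\<lambda>t. h t * h' t) \<in> R" by (intro add mult *)+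
    show "\<forall>\<^sub>F t in at_top. h t * h' t \<noteq> 0 \<and> f t * f' t = (g t * g' t) / (h t * h' t)"
      using *(5,6) by eventually_elim (simp add: field_simps)
  qed
qed

text \<open>A function that vanishes eventually is its own inverse under the convention
  \<open>inverse 0 = 0\<close>, so the quotients form a field up to eventual equality and no side
  condition on \<open>f\<close> arises.\<close>

lemma germ_fractions_inverse:
  assumes "f \<in> germ_fractions R"
  shows "(\<lambda>t. inverse (f t)) \<in> germ_fractions R"
proof -
  from assms obtain g h where *: "g \<in> R" "h \<in> R"
    "\<forall>\<^sub>F t in at_top. h t \<noteq> 0 \<and> f t = g t / h t"
    unfolding germ_fractions_def by blast
  from dichotomy[OF *(1)] show ?thesis
  proof
    assume "\<forall>\<^sub>F t in at_top. g t = 0"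
    with *(3) have "\<forall>\<^sub>F t in at_top. h t \<noteq> 0 \<and> inverse (f t) = 0 / h t" by eventually_elim simp
    then show ?thesis by (intro germ_fractionsI[OF const[of 0] *(2)])
  next
    assume "\<forall>\<^sub>F t in at_top. g t \<noteq> 0"
    with *(3) have "\<forall>\<^sub>F t in at_top. g t \<noteq> 0 \<and> inverse (f t) = h t / g t" by eventually_elim simp
    then show ?thesis by (intro germ_fractionsI[OF *(2,1)])
  qed
qed

lemma germ_fractions_divide:
  "f \<in> germ_fractions R \<Longrightarrow> f' \<in> germ_fractions R \<Longrightarrow> (\<lambda>t. f t / f' t) \<in> germ_fractions R"
  using germ_fractions_mult[OF _ germ_fractions_inverse, of f f'] by (simp add: divide_inverse)

lemma germ_fractions_diff:
  "f \<in> germ_fractions R \<Longrightarrow> f' \<in> germ_fractions R \<Longrightarrow> (\<lambda>t. f t - f' t) \<in> germ_fractions R"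
  using germ_fractions_add[OF _ germ_fractions_mult[OF in_germ_fractions[OF const[of "-1"]]], of f f'] by simp

lemma germ_fractions_sum:
  "(\<And>k. k \<in> K \<Longrightarrow> f k \<in> germ_fractions R) \<Longrightarrow> (\<lambda>t. \<Sum>k\<in>K. f k t) \<in> germ_fractions R"
  by (induction K rule: infinite_finite_induct)
     (auto intro: in_germ_fractions const germ_fractions_add)

lemma germ_fractions_cong:
  assumes "f \<in> germ_fractions R" "\<forall>\<^sub>F t in at_top. f t = f' t"
  shows "f' \<in> germ_fractions R"
proof -
  from assms obtain g h where *: "g \<in> R" "h \<in> R" "\<forall>\<^sub>F t in at_top. h t \<noteq> 0 \<and> f t = g t / h t"
    unfolding germ_fractions_def by blast
  show ?thesis
    by (rule germ_fractionsI[OF *(1,2)], use *(3) assms(2) in eventually_elim) auto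
qed

text \<open>Beyond the point where numerator and denominator have stopped vanishing, the quotient is
  continuous without zeros, so the intermediate value theorem fixes its sign.\<close>

lemma germ_fractions_trichotomy:
  assumes "f \<in> germ_fractions R"
  shows "(\<forall>\<^sub>F t in at_top. f t = 0) \<or> (\<forall>\<^sub>F t in at_top. f t > 0) \<or> (\<forall>\<^sub>F t in at_top. f t < 0)"
proof -
  from assms obtain g h where *: "g \<in> R" "h \<in> R" "\<forall>\<^sub>F t in at_top. h t \<noteq> 0 \<and> f t = g t / h t"
    unfolding germ_fractions_def by blast
  from dichotomy[OF *(1)] show ?thesis
  proof
    assume "\<forall>\<^sub>F t in at_top. g t = 0"
    with *(3) have "\<forall>\<^sub>F t in at_top. f t = 0" by eventually_elim simp
    then show ?thesis by simp
  next
    assume "\<forall>\<^sub>F t in at_top. g t \<noteq> 0"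
    with *(3) eventually_ge_at_top[of 1]
    have "\<forall>\<^sub>F t in at_top. t \<ge> 1 \<and> h t \<noteq> 0 \<and> f t = g t / h t \<and> g t \<noteq> 0" by eventually_elim simp
    then obtain T where T: "\<And>t. t \<ge> T \<Longrightarrow> t \<ge> 1 \<and> h t \<noteq> 0 \<and> f t = g t / h t \<and> g t \<noteq> 0"
      by (auto simp: eventually_at_top_linorder)
    have "continuous_on {T..} (\<lambda>t. g t / h t)"
      using T by (intro continuous_intros continuous_on_subset[OF cont] *) auto
    moreover have "\<forall>t\<in>{T..}. g t / h t = f t" using T by auto
    ultimately have cf: "continuous_on {T..} f" 
      using continuous_on_cong[of "{T..}" "{T..}" "\<lambda>t. g t / h t" f] by simp
    have nz: "f t \<noteq> 0" if "t \<ge> T" for t using T[OF that] by auto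
    have same: "f t > 0 \<longleftrightarrow> f T > 0" if t: "t \<ge> T" for t
    proof (rule ccontr)
      assume neq: "\<not> ?thesis"
      have "continuous_on {T..t} f" using cf by (rule continuous_on_subset) auto
      then have "\<exists>x\<ge>T. x \<le> t \<and> f x = 0"
        using neq nz[OF t] nz[of T] t IVT'[of f T 0 t] IVT2'[of f t 0 T]
        by (cases "f T > 0") (auto simp: not_less)
      then show False using nz by auto
    qed
    show ?thesis
    proof (cases "f T > 0")
      case True
      then have "f t > 0" if "t \<ge> T" for t using same[OF that] by blast
      then have "\<forall>\<^sub>F t in at_top. f t > 0" by (auto simp: eventually_at_top_linorder)
      then show ?thesis by simp
    next
      case False
      then have "f t < 0" if "t \<ge> T" for t using same[OF that] nz[OF that] by linarith
      then have "\<forall>\<^sub>F t in at_top. f t < 0" by (auto simp: eventually_at_top_linorder)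
      then show ?thesis by simp
    qed
  qed
qed

text \<open>Trichotomy applied to \<open>f - c\<close> puts \<open>f\<close> eventually on one side
  of every constant \<open>c\<close>, or makes it equal to \<open>c\<close>. A bounded
  \<open>f\<close> therefore converges to the supremum of the constants that it eventually
  exceeds.\<close>

lemma germ_fractions_convergent:
  assumes f: "f \<in> germ_fractions R" and bd: "\<forall>\<^sub>F t in at_top. \<bar>f t\<bar> \<le> B"
  shows "\<exists>L. (f \<longlongrightarrow> L) at_top"
proof -
  have tri: "(\<forall>\<^sub>F t in at_top. f t = c) \<or> (\<forall>\<^sub>F t in at_top. f t > c) \<or> (\<forall>\<^sub>F t in at_top. f t < c)" for c
    using germ_fractions_trichotomy[OF germ_fractions_diff[OF f in_germ_fractions[OF const[of c]]]]
    by simp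
  define C where "C = {c. \<forall>\<^sub>F t in at_top. f t > c}"
  have "- B - 1 \<in> C" unfolding C_def using bd by (auto elim!: eventually_mono)
  have ub: "c \<le> B" if "c \<in> C" for c
  proof (rule ccontr)
    assume "\<not> c \<le> B"
    have "\<forall>\<^sub>F t::real in at_top. False"
      using bd that[unfolded C_def mem_Collect_eq] by eventually_elim (use \<open>\<not> c \<le> B\<close> in auto)
    then show False by simp
  qed
  then have bdd: "bdd_above C" by (rule bdd_aboveI)
  have "(f \<longlongrightarrow> Sup C) at_top"
  proof (rule order_tendstoI)
    fix a assume "a < Sup C"
    then obtain c where c: "c \<in> C" "a < c" using less_cSup_iff[OF _ bdd] \<open>- B - 1 \<in> C\<close> by blast
    then show "\<forall>\<^sub>F t in at_top. a < f t" by (auto simp: C_def elim: eventually_mono)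
  next
    fix a assume a: "Sup C < a"
    define b where "b = (Sup C + a) / 2"
    have "b \<notin> C" using cSup_upper[OF _ bdd, of b] a by (auto simp: b_def)
    then have "(\<forall>\<^sub>F t in at_top. f t = b) \<or> (\<forall>\<^sub>F t in at_top. f t < b)"
      using tri[of b] by (auto simp: C_def)
    moreover have "b < a" using a by (simp add: b_def)
    ultimately show "\<forall>\<^sub>F t in at_top. f t < a" by (auto elim: eventually_mono)
  qed
  then show ?thesis ..
qed

end

section \<open>Perron vectors of finite nonnegative matrices\<close>

lemma finite_pointwise_convergent_subseq:
  fixes x :: "nat \<Rightarrow> 'a \<Rightarrow> real"
  assumes "finite F" "\<And>n i. i \<in> F \<Longrightarrow> x n i \<in> {0..1}"
  shows "\<exists>r l. strict_mono (r :: nat \<Rightarrow> nat) \<and> (\<forall>i\<in>F. (\<lambda>n. x (r n) i) \<longlonglongrightarrow> l i)"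
  using assms
proof (induction F rule: finite_induct)
  case empty
  have "strict_mono (id :: nat \<Rightarrow> nat)" by (simp add: strict_mono_def)
  then show ?case by blast
next
  case (insert a F)
  then obtain r l where r: "strict_mono (r :: nat \<Rightarrow> nat)" "\<forall>i\<in>F. (\<lambda>n. x (r n) i) \<longlonglongrightarrow> l i" by auto
  have "compact {0..1::real}" by simp
  then obtain l' s where s: "strict_mono (s :: nat \<Rightarrow> nat)" "((\<lambda>n. x (r n) a) \<circ> s) \<longlonglongrightarrow> l'"
    using insert.prems[of a] unfolding compact_def by (metis insertI1)
  have "(\<lambda>n. x ((r \<circ> s) n) i) \<longlonglongrightarrow> (l(a := l')) i" if "i \<in> insert a F" for i
  proof (cases "i = a")
    case True
    then show ?thesis using s by (simp add: o_def)
  next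
    case False
    then have "(\<lambda>n. x (r n) i) \<longlonglongrightarrow> l i" using r that by auto
    from LIMSEQ_subseq_LIMSEQ[OF this s(1)] False show ?thesis by (simp add: o_def)
  qed
  moreover have "strict_mono (r \<circ> s)" using r s by (simp add: strict_mono_o)
  ultimately show ?case by blast
qed

definition edges_in :: "nat set \<Rightarrow> (nat \<Rightarrow> nat \<Rightarrow> bool) \<Rightarrow> (nat \<times> nat) set" where
  "edges_in F A = {(i, j). i \<in> F \<and> j \<in> F \<and> A i j}"

text \<open>The transitive rather than the reflexive closure: even a single state needs a cycle
  inside \<open>F\<close>, which is what forces a positive eigenvalue.\<close>

definition strongly_connected :: "nat set \<Rightarrow> (nat \<Rightarrow> nat \<Rightarrow> bool) \<Rightarrow> bool" where
  "strongly_connected F A \<longleftrightarrow> (\<forall>i\<in>F. \<forall>j\<in>F. (i, j) \<in> (edges_in F A)\<^sup>+)"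

lemma edges_in_converse: "edges_in F (\<lambda>i j. A j i) = (edges_in F A)\<inverse>"
  by (auto simp: edges_in_def)

lemma strongly_connected_converse:
  "strongly_connected F (\<lambda>i j. A j i) \<longleftrightarrow> strongly_connected F A"
  unfolding strongly_connected_def edges_in_converse[of F A] trancl_converse converse_iff by blast

lemma edges_in_mono: "F \<subseteq> G \<Longrightarrow> edges_in F A \<subseteq> edges_in G A"
  by (auto simp: edges_in_def)

text \<open>No nonempty set of states that misses \<open>a\<close> is closed. Strong connectivity is
  used in this form because it passes to the smaller systems obtained by eliminating states.\<close>

lemma strongly_connected_leak:
  assumes "strongly_connected F A" "a \<in> F" "S \<subseteq> F - {a}" "S \<noteq> {}"
  shows "\<exists>i\<in>S. \<exists>j\<in>F - S. A i j"
proof (rule ccontr)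
  assume no: "\<not> ?thesis"
  obtain i where i: "i \<in> S" using assms by auto
  then have "(i, a) \<in> (edges_in F A)\<^sup>+" using assms by (auto simp: strongly_connected_def)
  then have "a \<in> S"
  proof (induction rule: trancl_induct)
    case (base y) then show ?case using i no by (auto simp: edges_in_def)
  next
    case (step y z) then show ?case using no by (auto simp: edges_in_def)
  qed
  with assms show False by auto
qed

text \<open>Collatz-Wielandt characterisation: \<open>l\<close> is the largest \<rho> that admits a
  normalised nonnegative \<open>v\<close> with \<open>\<rho> v <= W v\<close>, attained by
  compactness. If the inequality were strict anywhere, a power of \<open>I + W\<close> would make it
  strict everywhere and \<open>l\<close> could be increased.\<close>

lemma perron_right:
  assumes F: "finite F" "F \<noteq> {}"
    and nonneg: "\<And>i j. W i j \<ge> (0::real)"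
    and conn: "strongly_connected F (\<lambda>i j. W i j > 0)"
  shows "\<exists>l v. l > 0 \<and> (\<forall>i\<in>F. v i > 0) \<and> (\<forall>i\<in>F. (\<Sum>j\<in>F. W i j * v j) = l * v i)"
proof -
  define adm where "adm = (\<lambda>\<rho> v. (\<forall>i\<in>F. 0 \<le> v i) \<and> (\<Sum>i\<in>F. v i) = 1 \<and>
    (\<forall>i\<in>F. \<rho> * v i \<le> (\<Sum>j\<in>F. W i j * v j)))"
  have adm_le1: "v i \<in> {0..1}" if "adm \<rho> v" "i \<in> F" for \<rho> v i
    using that member_le_sum[of i F v] F by (auto simp: adm_def)
  define D where "D = {\<rho>. \<exists>v. adm \<rho> v}"
  obtain a where a: "a \<in> F" using F by auto
  have "adm 0 (\<lambda>i. if i = a then 1 else 0)"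
    unfolding adm_def using F a nonneg by (auto intro!: sum_nonneg)
  then have D0: "0 \<in> D" by (auto simp: D_def)
  have bdd: "\<rho> \<le> (\<Sum>i\<in>F. \<Sum>j\<in>F. W i j)" if \<rho>D: "\<rho> \<in> D" for \<rho>
  proof -
    obtain v where v: "adm \<rho> v" using \<rho>D by (auto simp: D_def)
    have "\<rho> = (\<Sum>i\<in>F. \<rho> * v i)" using v by (simp add: adm_def sum_distrib_left[symmetric])
    also have "\<dots> \<le> (\<Sum>i\<in>F. \<Sum>j\<in>F. W i j * v j)" using v by (intro sum_mono) (auto simp: adm_def)
    also have "\<dots> \<le> (\<Sum>i\<in>F. \<Sum>j\<in>F. W i j * 1)"
      using adm_le1[OF v] by (intro sum_mono mult_left_mono nonneg) auto
    finally show ?thesis by simp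
  qed
  then have bddD: "bdd_above D" by (rule bdd_aboveI)
  define l where "l = Sup D"
  have "\<exists>\<rho>\<in>D. l + -inverse (real (Suc n)) < \<rho>" for n
    using less_cSup_iff[OF _ bddD, of "l + -inverse (real (Suc n))"] D0 by (auto simp: l_def)
  then obtain \<rho> where \<rho>: "\<And>n. \<rho> n \<in> D" "\<And>n. l + -inverse (real (Suc n)) < \<rho> n" by metis
  have "\<rho> n \<le> l" for n using cSup_upper[OF \<rho>(1) bddD] by (simp add: l_def)
  then have \<rho>lim: "\<rho> \<longlonglongrightarrow> l"
    by (intro tendsto_sandwich[OF _ _ LIMSEQ_inverse_real_of_nat_add_minus[of l] tendsto_const[of l]]
        eventuallyI less_imp_le[OF \<rho>(2)])
  from \<rho>(1) obtain x where x: "\<And>n. adm (\<rho> n) (x n)" unfolding D_def mem_Collect_eq by metis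
  obtain r v where r: "strict_mono (r::nat \<Rightarrow> nat)" "\<And>i. i \<in> F \<Longrightarrow> (\<lambda>n. x (r n) i) \<longlonglongrightarrow> v i"
    using finite_pointwise_convergent_subseq[OF F(1), of x] adm_le1[OF x] by blast
  have adml: "adm l v" unfolding adm_def
  proof (intro conjI ballI)
    fix i assume i: "i \<in> F"
    show "0 \<le> v i" using x i by (intro LIMSEQ_le_const[OF r(2)[OF i]]) (auto simp: adm_def)
    have "(\<lambda>n. \<rho> (r n) * x (r n) i) \<longlonglongrightarrow> l * v i"
      using LIMSEQ_subseq_LIMSEQ[OF \<rho>lim r(1)] by (intro tendsto_mult r i) (simp add: o_def)
    moreover have "(\<lambda>n. \<Sum>j\<in>F. W i j * x (r n) j) \<longlonglongrightarrow> (\<Sum>j\<in>F. W i j * v j)"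
      by (intro tendsto_intros r)
    ultimately show "l * v i \<le> (\<Sum>j\<in>F. W i j * v j)"
      by (rule LIMSEQ_le) (use x i in \<open>auto simp: adm_def\<close>)
  next
    have "(\<lambda>n. \<Sum>i\<in>F. x (r n) i) \<longlonglongrightarrow> (\<Sum>i\<in>F. v i)" by (intro tendsto_sum r)
    moreover have "(\<lambda>n. \<Sum>i\<in>F. x (r n) i) = (\<lambda>n. 1)" using x by (auto simp: adm_def)
    ultimately show "(\<Sum>i\<in>F. v i) = 1" by (metis LIMSEQ_unique tendsto_const)
  qed
  \<comment> \<open>\<open>T = I + W\<close> commutes with \<open>W\<close>, so the defect of
    \<open>T^n v\<close> is \<open>T^n z\<close>; the identity part keeps the positivity already
    gained while \<open>W\<close> spreads it along the edges.\<close>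
  define T where "T = (\<lambda>y i. y i + (\<Sum>j\<in>F. W i j * y j))"
  define z where "z = (\<lambda>i. (\<Sum>j\<in>F. W i j * v j) - l * v i)"
  have z0: "z i \<ge> 0" if "i \<in> F" for i using adml that by (simp add: z_def adm_def)
  have v0: "v i \<ge> 0" if "i \<in> F" for i using adml that by (simp add: adm_def)
  have Tnn: "(T ^^ n) y i \<ge> 0" if "\<And>i. i \<in> F \<Longrightarrow> y i \<ge> 0" "i \<in> F" for n y i
    using that(2)
  proof (induction n arbitrary: i)
    case (Suc n) then show ?case using nonneg by (auto simp: T_def intro!: add_nonneg_nonneg sum_nonneg)
  qed (use that in auto)
  have Tz0: "(T ^^ n) z i \<ge> 0" if "i \<in> F" for n i
    using Tnn[where y = z and i = i and n = n] z0 that by simp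
  have Tz: "(\<Sum>j\<in>F. W i j * (T ^^ n) v j) - l * (T ^^ n) v i = (T ^^ n) z i" for n i
  proof (induction n arbitrary: i)
    case (Suc n)
    have "(T ^^ Suc n) z i = (T ^^ n) z i + (\<Sum>j\<in>F. W i j * (T ^^ n) z j)" by (simp add: T_def)
    also have "\<dots> = (\<Sum>j\<in>F. W i j * (T ^^ n) v j) - l * (T ^^ n) v i +
        (\<Sum>j\<in>F. W i j * ((\<Sum>k\<in>F. W j k * (T ^^ n) v k) - l * (T ^^ n) v j))"
      unfolding Suc by simp
    also have "\<dots> = (\<Sum>j\<in>F. W i j * (T ^^ Suc n) v j) - l * (T ^^ Suc n) v i"
      by (simp add: T_def algebra_simps sum.distrib sum_subtractf sum_distrib_left)
    finally show ?case ..
  qed (simp add: z_def)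
  have z_eq: "z k = 0" if "k \<in> F" for k
  proof (rule ccontr)
    assume "z k \<noteq> 0"
    then have zk: "z k > 0" using z0[OF that] by simp
    have "\<forall>\<^sub>F n in sequentially. (T ^^ n) z i > 0" if i: "i \<in> F" for i
    proof -
      have "(i, k) \<in> (edges_in F (\<lambda>i j. W i j > 0))\<^sup>*"
        using conn i \<open>k \<in> F\<close> by (auto simp: strongly_connected_def intro: trancl_into_rtrancl)
      then have "i \<in> F \<Longrightarrow> \<forall>\<^sub>F n in sequentially. (T ^^ n) z i > 0"
      proof (induction rule: converse_rtrancl_induct)
        case base
        have "(T ^^ n) z k > 0" for n
          by (induction n) (use zk that nonneg Tz0 in
              \<open>auto simp: T_def intro!: add_pos_nonneg sum_nonneg mult_nonneg_nonneg\<close>)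
        then show ?case by simp
      next
        case (step i j)
        then have ij: "i \<in> F" "j \<in> F" "W i j > 0" by (auto simp: edges_in_def)
        have "(T ^^ Suc n) z i > 0" if "(T ^^ n) z j > 0" for n
        proof -
          have "0 < W i j * (T ^^ n) z j" using ij that by simp
          also have "\<dots> \<le> (\<Sum>j\<in>F. W i j * (T ^^ n) z j)"
            using F ij nonneg Tz0 by (intro member_le_sum) auto
          finally show ?thesis using Tz0[where i = i and n = n] ij by (simp add: T_def)
        qed
        moreover have "\<forall>\<^sub>F n in sequentially. (T ^^ n) z j > 0" using step ij by simp
        ultimately have "\<forall>\<^sub>F n in sequentially. (T ^^ Suc n) z i > 0"
          by (auto elim: eventually_mono)
        then show ?case by (subst eventually_sequentially_Suc[symmetric])
      qed
      then show ?thesis using i by simp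
    qed
    then have "\<forall>\<^sub>F n in sequentially. \<forall>i\<in>F. (T ^^ n) z i > 0"
      using F by (simp add: eventually_ball_finite)
    then obtain n where n: "\<And>i. i \<in> F \<Longrightarrow> (T ^^ n) z i > 0"
      unfolding eventually_sequentially by auto
    define y where "y = (T ^^ n) v"
    define m where "m = Min ((T ^^ n) z ` F)"
    have m: "m > 0" "\<And>i. i \<in> F \<Longrightarrow> m \<le> (T ^^ n) z i" using F n by (auto simp: m_def)
    have y0: "y i \<ge> 0" if "i \<in> F" for i unfolding y_def using Tnn[where y = v and i = i and n = n] v0 that by simp
    have yz: "(\<Sum>j\<in>F. W i j * y j) = l * y i + (T ^^ n) z i" for i
      using Tz[of i n] by (simp add: y_def)
    define s where "s = (\<Sum>i\<in>F. y i)"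
    have "s \<noteq> 0"
    proof
      assume "s = 0"
      then have "\<forall>i\<in>F. y i = 0" unfolding s_def using F y0 by (simp add: sum_nonneg_eq_0_iff)
      then show False using yz[of a] a n[OF a] by simp
    qed
    then have s: "s > 0" using sum_nonneg[of F y] y0 by (simp add: s_def order.order_iff_strict)
    \<comment> \<open>Every entry of \<open>y\<close> is at most its total \<open>s\<close>, so a
      defect of at least \<open>m\<close> pays for raising the eigenvalue by
      \<open>m / s\<close>.\<close>
    have "adm (l + m / s) (\<lambda>i. y i / s)" unfolding adm_def
    proof (intro conjI ballI)
      show "(\<Sum>i\<in>F. y i / s) = 1" using s by (simp add: sum_divide_distrib[symmetric] s_def[symmetric])
      fix i assume i: "i \<in> F"
      show "0 \<le> y i / s" using y0[OF i] s by simp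
      have "y i \<le> s" unfolding s_def using F i y0 by (intro member_le_sum) auto
      then have "m / s * y i \<le> m" using m s by (simp add: field_simps mult_left_mono)
      then have "(l + m / s) * y i \<le> (\<Sum>j\<in>F. W i j * y j)" using yz[of i] m(2)[OF i] by (simp add: distrib_right)
      then have "(l + m / s) * y i / s \<le> (\<Sum>j\<in>F. W i j * y j) / s" using s by (simp add: divide_right_mono)
      then show "(l + m / s) * (y i / s) \<le> (\<Sum>j\<in>F. W i j * (y j / s))"
        by (simp add: sum_divide_distrib)
    qed
    then have "l + m / s \<in> D" unfolding D_def by blast
    then have "l + m / s \<le> l" unfolding l_def by (rule cSup_upper[OF _ bddD])
    then show False using m s by (simp add: field_simps)
  qed
  have eq: "(\<Sum>j\<in>F. W i j * v j) = l * v i" if "i \<in> F" for i using z_eq[OF that] by (simp add: z_def)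
  have l0: "l \<ge> 0" using cSup_upper[OF D0 bddD] by (simp add: l_def)
  have pos_step: "l * v i > 0" if "i \<in> F" "j \<in> F" "W i j > 0" "v j > 0" for i j
  proof -
    have "0 < W i j * v j" using that by simp
    also have "\<dots> \<le> (\<Sum>j\<in>F. W i j * v j)" using F that v0 nonneg by (intro member_le_sum) auto
    finally show ?thesis using eq that by simp
  qed
  have "\<exists>k\<in>F. v k \<noteq> 0" using adml by (rule contrapos_pp) (simp add: adm_def)
  then obtain k where k: "k \<in> F" "v k > 0" using v0 by (metis order.order_iff_strict)
  \<comment> \<open>Positivity of the product \<open>l * v i\<close> is propagated backwards along
    edges from one positive entry; it yields \<open>l > 0\<close> and \<open>v i > 0\<close>
    together.\<close>
  have lv: "l * v i > 0" if "i \<in> F" for i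
  proof -
    have "(i, k) \<in> (edges_in F (\<lambda>i j. W i j > 0))\<^sup>+" using conn k that by (auto simp: strongly_connected_def)
    then show ?thesis
    proof (induction rule: converse_trancl_induct)
      case (base y) then show ?case using pos_step k by (auto simp: edges_in_def)
    next
      case (step y z)
      then have "v z > 0" using l0 by (auto simp: zero_less_mult_iff)
      then show ?case using step pos_step[of y z] by (auto simp: edges_in_def)
    qed
  qed
  have "l > 0 \<and> v i > 0" if "i \<in> F" for i using lv[OF that] l0 by (auto simp: zero_less_mult_iff)
  then show ?thesis using eq a by blast
qed

text \<open>The left and the right Perron value come from separate applications; evaluating
  \<open>u W v\<close> in two ways identifies them.\<close>

lemma perron:
  assumes F: "finite F" "F \<noteq> {}"
    and nonneg: "\<And>i j. W i j \<ge> (0::real)"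
    and conn: "strongly_connected F (\<lambda>i j. W i j > 0)"
  shows "\<exists>l u v. l > 0 \<and> (\<forall>i\<in>F. u i > 0) \<and> (\<forall>i\<in>F. v i > 0) \<and>
    (\<forall>i\<in>F. (\<Sum>j\<in>F. W i j * v j) = l * v i) \<and> (\<forall>j\<in>F. (\<Sum>i\<in>F. u i * W i j) = l * u j)"
proof -
  obtain l v where v: "l > 0" "\<forall>i\<in>F. v i > 0" "\<forall>i\<in>F. (\<Sum>j\<in>F. W i j * v j) = l * v i"
    using perron_right[OF assms] by auto
  have "strongly_connected F (\<lambda>i j. W j i > 0)"
    using conn strongly_connected_converse[of F "\<lambda>i j. W i j > 0"] by simp
  then obtain l' u where u: "\<forall>i\<in>F. u i > 0" "\<forall>i\<in>F. (\<Sum>j\<in>F. W j i * u j) = l' * u i"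
    using perron_right[OF F, of "\<lambda>i j. W j i"] nonneg by auto
  have "l * (\<Sum>i\<in>F. u i * v i) = (\<Sum>i\<in>F. u i * (\<Sum>j\<in>F. W i j * v j))"
    using v by (simp add: sum_distrib_left mult_ac)
  also have "\<dots> = (\<Sum>j\<in>F. (\<Sum>i\<in>F. W i j * u i) * v j)"
    unfolding sum_distrib_left sum_distrib_right by (subst sum.swap) (simp add: mult_ac)
  also have "\<dots> = l' * (\<Sum>i\<in>F. u i * v i)"
    using u by (simp add: sum_distrib_left mult_ac)
  finally have "l = l'" using sum_pos[OF F, of "\<lambda>i. u i * v i"] u v by auto
  then show ?thesis using u v by (intro exI[of _ l] exI[of _ u] exI[of _ v]) (auto simp: mult.commute)
qed


text \<open>Eliminating a state \<open>k \<noteq> a\<close> replaces \<open>W i j\<close> by \<open>W i j + W i k * W k j / (lam - W k k)\<close>, which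
  is again nonnegative with entries in the field, so the number of states can be reduced to one.\<close>

lemma (in hardy_ring) eigenvector_ratio_germ:
  assumes "finite (F :: nat set)" "a \<in> F" "i \<in> F"
    and "\<And>i j. (\<lambda>t. W i j t) \<in> germ_fractions R" "lam \<in> germ_fractions R"
    and "\<And>i t. i \<in> F \<Longrightarrow> t \<ge> 1 \<Longrightarrow> v i t > 0"
    and "\<And>i t. i \<in> F - {a} \<Longrightarrow> t \<ge> 1 \<Longrightarrow> (\<Sum>j\<in>F. W i j t * v j t) = lam t * v i t"
    and "\<And>i j t. i \<in> F \<Longrightarrow> j \<in> F \<Longrightarrow> t \<ge> 1 \<Longrightarrow> W i j t \<ge> 0"
    and "\<And>i j t. i \<in> F \<Longrightarrow> j \<in> F \<Longrightarrow> t \<ge> 1 \<Longrightarrow> W i j t > 0 \<longleftrightarrow> E i j"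
    and "\<And>S. S \<subseteq> F - {a} \<Longrightarrow> S \<noteq> {} \<Longrightarrow> \<exists>i\<in>S. \<exists>j\<in>F - S. E i j"
  shows "(\<lambda>t. v i t / v a t) \<in> germ_fractions R"
  using assms
proof (induction "card F" arbitrary: F W E i rule: less_induct)
  case less
  note fin = less.prems(1) and a = less.prems(2) and WR = less.prems(4) and lamR = less.prems(5)
    and vpos = less.prems(6) and eq = less.prems(7) and nonneg = less.prems(8)
    and pos = less.prems(9) and leak = less.prems(10)
  have aa: "(\<lambda>t. v a t / v a t) \<in> germ_fractions R"
  proof (rule germ_fractions_cong[OF in_germ_fractions[OF const[of 1]]])
    show "\<forall>\<^sub>F t in at_top. 1 = v a t / v a t"
      using eventually_ge_at_top[of 1] by eventually_elim (use vpos[OF a] in force)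
  qed
  show ?case
  proof (cases "F = {a}")
    case True
    then show ?thesis using aa less.prems by simp
  next
    case False
    then obtain k where k: "k \<in> F" "k \<noteq> a" using a by auto
    define F' where "F' = F - {k}"
    have F': "finite F'" "a \<in> F'" "card F' < card F" "F = insert k F'" "k \<notin> F'"
      using fin a k card_Diff1_less[OF fin k(1)] by (auto simp: F'_def simp del: card_Diff_insert card_Diff_singleton)
    have sumF: "(\<Sum>j\<in>F. f j) = f k + (\<Sum>j\<in>F'. f j)" for f :: "nat \<Rightarrow> real" using F' by simp
    \<comment> \<open>The state \<open>k\<close> leads out of \<open>{k}\<close>, so in its equation
      \<open>W k k * v k\<close> is strictly below \<open>lam * v k\<close>; the denominator created
      by the elimination is positive.\<close>
    have gap: "lam t - W k k t > 0" if t: "t \<ge> 1" for t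
    proof -
      obtain j where j: "j \<in> F'" "E k j" using leak[of "{k}"] k by (auto simp: F'_def)
      have "0 < W k j t * v j t" using j F' pos[of k j t] vpos[of j t] t by simp
      also have "\<dots> \<le> (\<Sum>j\<in>F'. W k j t * v j t)"
        using j F' t by (intro member_le_sum) (auto intro!: mult_nonneg_nonneg nonneg less_imp_le[OF vpos])
      finally have "0 < (lam t - W k k t) * v k t"
        using eq[of k t] k t by (simp add: sumF left_diff_distrib)
      then show ?thesis using vpos[OF k(1) t] by (simp add: zero_less_mult_iff)
    qed
    have vk: "v k t = (\<Sum>j\<in>F'. W k j t / (lam t - W k k t) * v j t)" if t: "t \<ge> 1" for t
    proof -
      have "(lam t - W k k t) * v k t = (\<Sum>j\<in>F'. W k j t * v j t)"
        using eq[of k t] k t by (simp add: sumF left_diff_distrib)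
      then show ?thesis using gap[OF t] by (simp add: sum_divide_distrib[symmetric] field_simps)
    qed
    define W' where "W' = (\<lambda>i j t. W i j t + W i k t * (W k j t / (lam t - W k k t)))"
    \<comment> \<open>The pattern of positive entries is the same for all \<open>t >= 1\<close>, so
      it is carried along as one graph: a path \<open>i, k, j\<close> becomes an edge.\<close>
    define E' where "E' = (\<lambda>i j. E i j \<or> (E i k \<and> E k j))"
    have W'R: "(\<lambda>t. W' i j t) \<in> germ_fractions R" for i j
      unfolding W'_def by (intro germ_fractions_add germ_fractions_mult germ_fractions_divide germ_fractions_diff WR lamR)
    have extra: "W i k t * (W k j t / (lam t - W k k t)) \<ge> 0"
      "W i k t * (W k j t / (lam t - W k k t)) > 0 \<longleftrightarrow> E i k \<and> E k j" if "i \<in> F'" "j \<in> F'" "t \<ge> 1" for i j t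
      using that F' gap[of t] nonneg[of i k t] nonneg[of k j t] pos[of i k t] pos[of k j t]
      by (auto simp: zero_less_mult_iff zero_less_divide_iff)
    have IH: "(\<lambda>t. v i t / v a t) \<in> germ_fractions R" if i: "i \<in> F'" for i
    proof (rule less.hyps[OF F'(3,1,2) i W'R lamR])
      show "v i t > 0" if "i \<in> F'" "t \<ge> 1" for i t using vpos that F' by simp
      show "(\<Sum>j\<in>F'. W' i j t * v j t) = lam t * v i t" if "i \<in> F' - {a}" "t \<ge> 1" for i t
      proof -
        have "(\<Sum>j\<in>F'. W' i j t * v j t) = (\<Sum>j\<in>F'. W i j t * v j t) +
            W i k t * (\<Sum>j\<in>F'. W k j t / (lam t - W k k t) * v j t)"
          by (simp add: W'_def distrib_left distrib_right sum.distrib sum_distrib_left sum_divide_distrib mult_ac)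
        also have "\<dots> = (\<Sum>j\<in>F. W i j t * v j t)" by (simp add: sumF vk[OF that(2)])
        finally show ?thesis using eq[of i t] that F' by simp
      qed
      show "W' i j t \<ge> 0" if "i \<in> F'" "j \<in> F'" "t \<ge> 1" for i j t
        using extra(1)[OF that] nonneg[of i j t] that F' by (simp add: W'_def)
      show "W' i j t > 0 \<longleftrightarrow> E' i j" if "i \<in> F'" "j \<in> F'" "t \<ge> 1" for i j t
        using extra[OF that] nonneg[of i j t] pos[of i j t] that F' unfolding W'_def E'_def
        by (smt (verit) insertCI)
      show "\<exists>i\<in>S. \<exists>j\<in>F' - S. E' i j" if S: "S \<subseteq> F' - {a}" "S \<noteq> {}" for S
      proof -
        obtain i j where ij: "i \<in> S" "j \<in> F - S" "E i j" using leak[of S] S F' by blast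
        \<comment> \<open>If the exit found from \<open>S\<close> ends in \<open>k\<close>, an exit
          of \<open>insert k S\<close> completes the argument: it starts in \<open>S\<close>, or it
          starts in \<open>k\<close> and extends the former to a path through
          \<open>k\<close>.\<close>
        obtain i' j' where ij': "i' \<in> insert k S" "j' \<in> F - insert k S" "E i' j'"
          using leak[of "insert k S"] S F' k by blast
        show ?thesis
        proof (cases "j = k")
          case False
          then show ?thesis using ij F' unfolding E'_def by blast
        next
          case True
          then show ?thesis using ij ij' F' unfolding E'_def by blast
        qed
      qed
    qed
    show ?thesis
    proof (cases "i = k")
      case False
      then show ?thesis using IH less.prems(3) F' by auto
    next
      case True
      have "(\<lambda>t. \<Sum>j\<in>F'. W k j t / (lam t - W k k t) * (v j t / v a t)) \<in> germ_fractions R"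
        by (intro germ_fractions_sum germ_fractions_mult germ_fractions_divide germ_fractions_diff WR lamR IH)
      then show ?thesis
      proof (rule germ_fractions_cong)
        show "\<forall>\<^sub>F t in at_top. (\<Sum>j\<in>F'. W k j t / (lam t - W k k t) * (v j t / v a t)) = v i t / v a t"
          using eventually_ge_at_top[of 1]
          by eventually_elim (simp add: True vk sum_divide_distrib)
      qed
    qed
  qed
qed

section \<open>Perron data of the transfer matrices as functions of the inverse temperature\<close>

definition transfer_weight :: "(nat \<Rightarrow> nat \<Rightarrow> bool) \<Rightarrow> (nat \<Rightarrow> nat \<Rightarrow> real) \<Rightarrow> real \<Rightarrow> nat \<Rightarrow> nat \<Rightarrow> real" where
  "transfer_weight A \<psi> t i j = (if A i j then exp (t * \<psi> i j) else 0)"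

lemma transfer_weight_nonneg: "transfer_weight A \<psi> t i j \<ge> 0"
  and transfer_weight_pos_iff: "transfer_weight A \<psi> t i j > 0 \<longleftrightarrow> A i j"
  by (auto simp: transfer_weight_def)

lemma transfer_weight_exp_sums: "(\<lambda>t. transfer_weight A \<psi> t i j) \<in> exp_sums"
  using exp_sums_monomial[of 1 "\<psi> i j"] exp_sums_monomial[of 0 0]
  by (cases "A i j") (simp_all add: transfer_weight_def mult.commute)

definition perron_data :: "(nat \<Rightarrow> nat \<Rightarrow> real) \<Rightarrow> nat set \<Rightarrow> real \<Rightarrow> (nat \<Rightarrow> real) \<Rightarrow> (nat \<Rightarrow> real) \<Rightarrow> bool" where
  "perron_data W F l u v \<longleftrightarrow> l > 0 \<and> (\<forall>i\<in>F. u i > 0) \<and> (\<forall>i\<in>F. v i > 0) \<and>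
    (\<forall>i\<in>F. (\<Sum>j\<in>F. W i j * v j) = l * v i) \<and> (\<forall>j\<in>F. (\<Sum>i\<in>F. u i * W i j) = l * u j)"

text \<open>Pair the left eigenvector of one matrix with the right eigenvector of the other:
  \<open>l * (u . v') = u W v'\<close>, which is at most
  \<open>K * u W' v' = K * l' * (u . v')\<close>.\<close>

lemma perron_data_compare:
  assumes F: "finite F" "F \<noteq> {}"
    and "perron_data W F l u v" "perron_data W' F l' u' v'"
    and le: "\<And>i j. i \<in> F \<Longrightarrow> j \<in> F \<Longrightarrow> W i j \<le> K * W' i j"
  shows "l \<le> K * l'"
proof -
  have pos: "\<And>i. i \<in> F \<Longrightarrow> u i > 0" "\<And>i. i \<in> F \<Longrightarrow> v' i > 0"
    and eqs: "\<And>j. j \<in> F \<Longrightarrow> (\<Sum>i\<in>F. u i * W i j) = l * u j"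
      "\<And>i. i \<in> F \<Longrightarrow> (\<Sum>j\<in>F. W' i j * v' j) = l' * v' i"
    using assms by (auto simp: perron_data_def)
  have "l * (\<Sum>j\<in>F. u j * v' j) = (\<Sum>j\<in>F. (\<Sum>i\<in>F. u i * W i j) * v' j)"
    by (simp add: eqs sum_distrib_left mult_ac)
  also have "\<dots> = (\<Sum>i\<in>F. \<Sum>j\<in>F. u i * W i j * v' j)"
    unfolding sum_distrib_right by (rule sum.swap)
  also have "\<dots> \<le> (\<Sum>i\<in>F. \<Sum>j\<in>F. u i * (K * W' i j) * v' j)"
    using pos le by (intro sum_mono mult_right_mono mult_left_mono) (auto intro: less_imp_le)
  also have "\<dots> = (\<Sum>i\<in>F. K * u i * (\<Sum>j\<in>F. W' i j * v' j))"
    by (simp add: sum_distrib_left mult_ac)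
  also have "\<dots> = (\<Sum>i\<in>F. K * u i * (l' * v' i))"
    by (simp add: eqs)
  also have "\<dots> = K * l' * (\<Sum>j\<in>F. u j * v' j)"
    by (simp add: sum_distrib_left mult_ac)
  finally show ?thesis using sum_pos[OF F, of "\<lambda>i. u i * v' i"] pos by simp
qed

text \<open>Between \<open>s\<close> and \<open>t\<close> every entry changes by a factor of at most
  \<open>exp (\<bar>t - s\<bar> * B)\<close>, hence so does the Perron value. Continuity is what
  admits it to \<open>eigen_ring\<close>.\<close>

lemma perron_value_continuous:
  assumes F: "finite F" "F \<noteq> {}"
    and data: "\<And>t. t \<ge> 1 \<Longrightarrow> perron_data (transfer_weight A \<psi> t) F (l t) (u t) (v t)"
  shows "continuous_on {1..} l"
proof -
  define B where "B = (\<Sum>i\<in>F. \<Sum>j\<in>F. \<bar>\<psi> i j\<bar>)"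
  have B: "\<bar>\<psi> i j\<bar> \<le> B" if "i \<in> F" "j \<in> F" for i j
  proof -
    have "\<bar>\<psi> i j\<bar> \<le> (\<Sum>j\<in>F. \<bar>\<psi> i j\<bar>)" using F that by (intro member_le_sum) auto
    also have "\<dots> \<le> B" unfolding B_def
      using F that by (intro member_le_sum[of i F "\<lambda>i. \<Sum>j\<in>F. \<bar>\<psi> i j\<bar>"]) (auto intro: sum_nonneg)
    finally show ?thesis .
  qed
  have comp: "l t \<le> exp (\<bar>t - s\<bar> * B) * l s" if "t \<ge> 1" "s \<ge> 1" for s t
  proof (rule perron_data_compare[OF F data[OF that(1)] data[OF that(2)]])
    fix i j assume "i \<in> F" "j \<in> F"
    have "(t - s) * \<psi> i j \<le> \<bar>t - s\<bar> * \<bar>\<psi> i j\<bar>" by (simp add: abs_mult[symmetric])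
    also have "\<dots> \<le> \<bar>t - s\<bar> * B" using B \<open>i \<in> F\<close> \<open>j \<in> F\<close> by (intro mult_left_mono) auto
    finally have "t * \<psi> i j \<le> \<bar>t - s\<bar> * B + s * \<psi> i j" by (simp add: left_diff_distrib)
    then show "transfer_weight A \<psi> t i j \<le> exp (\<bar>t - s\<bar> * B) * transfer_weight A \<psi> s i j"
      by (simp add: transfer_weight_def exp_add[symmetric])
  qed
  show ?thesis unfolding continuous_on_def
  proof
    fix s :: real assume s: "s \<in> {1..}"
    show "(l \<longlongrightarrow> l s) (at s within {1..})"
    proof (rule tendsto_sandwich)
      show "\<forall>\<^sub>F t in at s within {1..}. l t \<le> exp (\<bar>t - s\<bar> * B) * l s"
        using comp s by (auto simp: eventually_at_filter)
      show "\<forall>\<^sub>F t in at s within {1..}. exp (- (\<bar>t - s\<bar> * B)) * l s \<le> l t"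
      proof -
        have "exp (- (\<bar>t - s\<bar> * B)) * l s \<le> l t" if "t \<ge> 1" for t
          using comp[of s t] that s by (simp add: exp_minus abs_minus_commute field_simps)
        then show ?thesis by (auto simp: eventually_at_filter)
      qed
      show "((\<lambda>t. exp (\<bar>t - s\<bar> * B) * l s) \<longlongrightarrow> l s) (at s within {1..})"
        by (rule tendsto_eq_rhs, (rule tendsto_intros)+) simp
      show "((\<lambda>t. exp (- (\<bar>t - s\<bar> * B)) * l s) \<longlongrightarrow> l s) (at s within {1..})"
        by (rule tendsto_eq_rhs, (rule tendsto_intros)+) simp
    qed
  qed
qed

text \<open>The quotient is unchanged when \<open>u\<close> or \<open>v\<close> is rescaled, so it
  can be written with ratios to one reference state, and these lie in the fraction field of a ring
  containing \<open>l\<close>. It is at most one because the flow along an edge is at most the mass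
  \<open>u i * v i\<close> of its source. Dividing by the mass of \<open>G\<close> rather than of
  \<open>F\<close> prepares the comparison with a system that is controlled only on
  \<open>G\<close>.\<close>

lemma perron_edge_ratio_convergent:
  assumes F: "finite F" and conn: "strongly_connected F A"
    and data: "\<And>t. t \<ge> 1 \<Longrightarrow> perron_data (transfer_weight A \<psi> t) F (l t) (u t) (v t)"
    and G: "G \<subseteq> F" "i \<in> G" "j \<in> G"
  shows "\<exists>L. ((\<lambda>t. u t i * transfer_weight A \<psi> t i j * v t j / l t / (\<Sum>k\<in>G. u t k * v t k)) \<longlongrightarrow> L) at_top"
    and "\<And>t. t \<ge> 1 \<Longrightarrow> u t i * transfer_weight A \<psi> t i j * v t j / l t / (\<Sum>k\<in>G. u t k * v t k) \<in> {0..1}"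
proof -
  let ?W = "\<lambda>i j t. transfer_weight A \<psi> t i j"
  define a where "a = i"
  have a: "a \<in> F" using G by (auto simp: a_def)
  have Fne: "F \<noteq> {}" using a by auto
  have d: "l t > 0" "\<And>i. i \<in> F \<Longrightarrow> u t i > 0" "\<And>i. i \<in> F \<Longrightarrow> v t i > 0"
    "\<And>i. i \<in> F \<Longrightarrow> (\<Sum>j\<in>F. ?W i j t * v t j) = l t * v t i"
    "\<And>j. j \<in> F \<Longrightarrow> (\<Sum>i\<in>F. u t i * ?W i j t) = l t * u t j" if "t \<ge> 1" for t
    using data[OF that] by (auto simp: perron_data_def)
  let ?R = "eigen_ring exp_sums F (\<lambda>i t. u t i)"
  interpret E: hardy_ring exp_sums by (rule hardy_ring_exp_sums)
  interpret H: hardy_ring ?R by (rule E.hardy_ring_eigen_ring[OF F a]) (use d in auto)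
  have sub: "exp_sums \<subseteq> ?R" by (rule E.hardy_ring_eigen_ring[OF F a]) (use d in auto)
  have WR: "?W i j \<in> germ_fractions ?R" for i j
    using transfer_weight_exp_sums[of A \<psi> i j] sub by (intro H.in_germ_fractions) auto
  have "l \<in> ?R"
    by (rule eigen_ringI[where M = ?W])
       (use perron_value_continuous[OF F Fne data] d transfer_weight_exp_sums in auto)
  then have lR: "l \<in> germ_fractions ?R" by (rule H.in_germ_fractions)
  have vR: "(\<lambda>t. v t i / v t a) \<in> germ_fractions ?R" if "i \<in> F" for i
  proof (rule H.eigenvector_ratio_germ[OF F a that WR lR, where E = A and v = "\<lambda>i t. v t i"])
    show "v t i > 0" if "i \<in> F" "t \<ge> 1" for i t using d(3) that by blast
    show "(\<Sum>j\<in>F. ?W i j t * v t j) = l t * v t i" if "i \<in> F - {a}" "t \<ge> 1" for i t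
      using d(4) that by blast
  qed (rule transfer_weight_nonneg transfer_weight_pos_iff strongly_connected_leak[OF conn a]; assumption)+
  have conn': "strongly_connected F (\<lambda>i j. A j i)" using conn strongly_connected_converse[of F A] by blast
  have uR: "(\<lambda>t. u t i / u t a) \<in> germ_fractions ?R" if "i \<in> F" for i
  proof (rule H.eigenvector_ratio_germ[OF F a that, where E = "\<lambda>i j. A j i" and v = "\<lambda>i t. u t i"
          and W = "\<lambda>i j. ?W j i" and lam = l])
    show "u t i > 0" if "i \<in> F" "t \<ge> 1" for i t using d(2) that by blast
    show "(\<Sum>j\<in>F. ?W j i t * u t j) = l t * u t i" if "i \<in> F - {a}" "t \<ge> 1" for i t
      using d(5)[of t i] that by (simp add: mult.commute[of "transfer_weight A \<psi> t _ _"])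
  qed (rule transfer_weight_nonneg transfer_weight_pos_iff strongly_connected_leak[OF conn' a] WR lR; assumption)+
  let ?f = "\<lambda>t. u t i * ?W i j t * v t j / l t / (\<Sum>k\<in>G. u t k * v t k)"
  have finG: "finite G" using F G finite_subset by auto
  have "(\<lambda>t. (u t i / u t a) * ?W i j t * (v t j / v t a) / l t /
      (\<Sum>k\<in>G. (u t k / u t a) * (v t k / v t a))) \<in> germ_fractions ?R"
    using G by (intro H.germ_fractions_divide H.germ_fractions_mult H.germ_fractions_sum uR vR WR lR) auto
  then have fR: "?f \<in> germ_fractions ?R"
  proof (rule H.germ_fractions_cong)
    show "\<forall>\<^sub>F t in at_top. (u t i / u t a) * ?W i j t * (v t j / v t a) / l t /
      (\<Sum>k\<in>G. (u t k / u t a) * (v t k / v t a)) = ?f t"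
      using eventually_ge_at_top[of 1]
    proof eventually_elim
      case (elim t)
      have "(\<Sum>k\<in>G. (u t k / u t a) * (v t k / v t a)) = (\<Sum>k\<in>G. u t k * v t k) / (u t a * v t a)"
        by (simp add: sum_divide_distrib)
      then show ?case using d(2,3)[OF elim a] by simp
    qed
  qed
  show bd: "?f t \<in> {0..1}" if t: "t \<ge> 1" for t
  proof -
    have iF: "i \<in> F" "j \<in> F" using G by auto
    have nn: "0 \<le> u t k" "0 \<le> v t k" if "k \<in> F" for k
      using d(2,3)[OF t that] by simp_all
    have nn': "0 \<le> u t k" "0 \<le> v t k" if "k \<in> G" for k using nn G that by auto
    have "?W i j t * v t j \<le> (\<Sum>j\<in>F. ?W i j t * v t j)"
      using F iF by (intro member_le_sum mult_nonneg_nonneg transfer_weight_nonneg nn) auto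
    then have "u t i * (?W i j t * v t j) \<le> u t i * (l t * v t i)"
      using d(2)[OF t iF(1)] d(4)[OF t iF(1)] by (intro mult_left_mono) auto
    then have "u t i * ?W i j t * v t j / l t \<le> u t i * v t i"
      using d(1)[OF t] by (simp add: field_simps)
    also have "\<dots> \<le> (\<Sum>k\<in>G. u t k * v t k)"
      using finG G by (intro member_le_sum mult_nonneg_nonneg nn') auto
    finally have le: "u t i * ?W i j t * v t j / l t \<le> (\<Sum>k\<in>G. u t k * v t k)" .
    have "0 < (\<Sum>k\<in>G. u t k * v t k)" using finG G d(2,3)[OF t] by (intro sum_pos mult_pos_pos) auto
    moreover have "0 \<le> u t i * ?W i j t * v t j / l t"
      using d(1)[OF t] by (intro divide_nonneg_nonneg mult_nonneg_nonneg transfer_weight_nonneg nn iF) simp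
    moreover have "x / s \<in> {0..1}" if "0 \<le> x" "x \<le> s" "0 < s" for x s :: real using that by simp
    ultimately show ?thesis using le by blast
  qed
  have "\<forall>\<^sub>F t in at_top. \<bar>?f t\<bar> \<le> 1"
    using eventually_ge_at_top[of 1]
  proof eventually_elim
    case (elim t)
    have "\<bar>x\<bar> \<le> 1" if "x \<in> {0..1}" for x :: real using that by simp
    then show ?case using bd[OF elim] by blast
  qed
  then show "\<exists>L. (?f \<longlongrightarrow> L) at_top" by (rule H.germ_fractions_convergent[OF fR])
qed

section \<open>Superharmonic functions of a stationary chain\<close>

lemma ennreal_add_mult:
  "0 \<le> a \<Longrightarrow> 0 \<le> m \<Longrightarrow> 0 \<le> b \<Longrightarrow> ennreal a + ennreal m * ennreal b = ennreal (a + m * b)"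
  by (simp add: ennreal_mult)

locale stationary_pairs =
  fixes q :: "(nat \<times> nat) pmf"
  assumes stationary: "map_pmf snd q = map_pmf fst q"
begin

abbreviation marg :: "nat pmf" where "marg \<equiv> map_pmf fst q"

lemma integrable_bounded:
  assumes "\<And>x. \<bar>f x\<bar> \<le> (B::real)" shows "integrable (measure_pmf q) f"
  by (rule measure_pmf.integrable_const_bound[of _ B]) (use assms in auto)

lemma expectation_fst_snd: "measure_pmf.expectation q (\<lambda>x. f (snd x)) = measure_pmf.expectation q (\<lambda>x. f (fst x) :: real)"
  using integral_map_pmf[of snd q f] integral_map_pmf[of fst q f] by (simp add: stationary)

text \<open>The contributions of the possible first coordinates add up to the whole expectation;
  dominated convergence passes from finitely many of them to all.\<close>

lemma expectation_nonneg_by_fst: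
  fixes g :: "nat \<times> nat \<Rightarrow> real"
  assumes bd: "\<And>x. \<bar>g x\<bar> \<le> B"
    and nonneg: "\<And>i. measure_pmf.expectation q (\<lambda>x. indicator {i} (fst x) * g x) \<ge> 0"
  shows "measure_pmf.expectation q g \<ge> 0"
proof -
  have "0 \<le> B" using bd[of "(0, 0)"] by linarith
  have le: "\<bar>indicator S (fst x) * g x\<bar> \<le> B" for S x
    using bd[of x] \<open>0 \<le> B\<close> by (auto simp: indicator_def)
  have "(\<lambda>n. measure_pmf.expectation q (\<lambda>x. indicator {..<n} (fst x) * g x)) \<longlonglongrightarrow> measure_pmf.expectation q g"
  proof (rule integral_dominated_convergence[where w = "\<lambda>_. B"])
    show "AE x in measure_pmf q. (\<lambda>n. indicator {..<n} (fst x) * g x) \<longlonglongrightarrow> g x"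
    proof (rule AE_I2, rule tendsto_eventually)
      fix x show "\<forall>\<^sub>F n in sequentially. indicator {..<n} (fst x) * g x = g x"
        using eventually_gt_at_top[of "fst x"] by eventually_elim simp
    qed
  qed (use le in auto)
  moreover have "measure_pmf.expectation q (\<lambda>x. indicator {..<n} (fst x) * g x) \<ge> 0" for n :: nat
  proof -
    have "indicator {..<n} (fst x) * g x = (\<Sum>i<n. indicator {i} (fst x) * g x)" for x
      unfolding sum_distrib_right[symmetric] by (cases "fst x < n") (auto simp: indicator_def)
    then have "measure_pmf.expectation q (\<lambda>x. indicator {..<n} (fst x) * g x) =
        measure_pmf.expectation q (\<lambda>x. \<Sum>i<n. indicator {i} (fst x) * g x)"
      by (rule arg_cong[OF ext])
    also have "\<dots> = (\<Sum>i<n. measure_pmf.expectation q (\<lambda>x. indicator {i} (fst x) * g x))"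
      by (intro Bochner_Integration.integral_sum integrable_bounded[of _ B] le)
    finally show ?thesis by (simp add: sum_nonneg nonneg)
  qed
  ultimately show ?thesis by (intro LIMSEQ_le_const) auto
qed

lemma expectation_fst_eq: "measure_pmf.expectation q (\<lambda>x. indicator {i} (fst x)) = pmf marg i"
  using integral_map_pmf[of fst q "indicator {i} :: nat \<Rightarrow> real"]
  by (simp add: measure_pmf_single)

text \<open>Let \<open>X\<close> and \<open>Y\<close> be \<open>h\<close> at the first and at the
  second state. Stationarity gives \<open>E (Y - X)^2 = 2 E (X (X - Y))\<close>, and
  \<open>X = 0\<close> off \<open>D\<close>. On \<open>D\<close> the drift \<open>X - Y\<close> has
  nonnegative conditional mean, so replacing the weight \<open>X <= 1\<close> by one only increases
  the value; then \<open>E (X - Y) = 0\<close> leaves the integral of \<open>Y\<close> over the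
  complement of \<open>D\<close>, which is at most its mass. The second claim keeps the drift at a
  single state instead.\<close>

lemma superharmonic_energy:
  fixes h :: "nat \<Rightarrow> real"
  assumes h: "\<And>i. 0 \<le> h i" "\<And>i. h i \<le> 1" "\<And>i. i \<notin> D \<Longrightarrow> h i = 0"
    and super: "\<And>i. i \<in> D \<Longrightarrow>
      measure_pmf.expectation q (\<lambda>x. indicator {i} (fst x) * h (snd x)) \<le> pmf marg i * h i"
  shows "pmf q (i, j) * (h j - h i)\<^sup>2 \<le> 2 * measure marg (- D)"
    and "i \<in> D \<Longrightarrow> pmf marg i * h i -
      measure_pmf.expectation q (\<lambda>x. indicator {i} (fst x) * h (snd x)) \<le> measure marg (- D)"
proof -
  let ?E = "measure_pmf.expectation q"
  define X where "X = (\<lambda>x::nat\<times>nat. h (fst x))"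
  define Y where "Y = (\<lambda>x::nat\<times>nat. h (snd x))"
  have XY: "0 \<le> X x" "X x \<le> 1" "0 \<le> Y x" "Y x \<le> 1" for x using h by (auto simp: X_def Y_def)
  have diff1: "\<bar>X x - Y x\<bar> \<le> 1" for x using XY[of x] by linarith
  have prod1: "\<bar>a * b\<bar> \<le> 1" if "\<bar>a\<bar> \<le> 1" "\<bar>b\<bar> \<le> 1" for a b :: real
    using mult_mono[of "\<bar>a\<bar>" 1 "\<bar>b\<bar>" 1] that by (simp add: abs_mult)
  have ind1: "\<bar>indicator S (a::nat) :: real\<bar> \<le> 1" for S a by (simp add: indicator_def)
  note int = integrable_bounded[of _ 1]
  have iX: "integrable q X" and iY: "integrable q Y" and iXX: "integrable q (\<lambda>x. X x * X x)"
    and iYY: "integrable q (\<lambda>x. Y x * Y x)" and iXY: "integrable q (\<lambda>x. X x * Y x)"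
    using XY by (auto intro!: int prod1)
  have iI: "integrable q (\<lambda>x. indicator S (fst x) * X x)" "integrable q (\<lambda>x. indicator S (fst x) * Y x)" for S
    using XY by (auto intro!: int prod1 ind1)
  have gap: "?E (\<lambda>x. indicator {i} (fst x) * (X x - Y x)) =
      pmf marg i * h i - ?E (\<lambda>x. indicator {i} (fst x) * h (snd x))" for i
  proof -
    have "?E (\<lambda>x. indicator {i} (fst x) * (X x - Y x)) =
       ?E (\<lambda>x. indicator {i} (fst x) * X x) - ?E (\<lambda>x. indicator {i} (fst x) * Y x)"
      by (simp add: right_diff_distrib iI)
    also have "?E (\<lambda>x. indicator {i} (fst x) * X x) = ?E (\<lambda>x. indicator {i} (fst x) * h i)"
      by (intro Bochner_Integration.integral_cong) (auto simp: X_def indicator_def)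
    finally show ?thesis by (simp add: expectation_fst_eq Y_def)
  qed
  have restr: "?E (\<lambda>x. indicator D (fst x) * (X x - Y x)) \<le> measure marg (- D)"
  proof -
    have "?E (\<lambda>x. indicator D (fst x) * (X x - Y x)) = ?E (\<lambda>x. (X x - Y x) + indicator (- D) (fst x) * Y x)"
      by (intro Bochner_Integration.integral_cong) (auto simp: X_def indicator_def h(3))
    also have "\<dots> = ?E X - ?E Y + ?E (\<lambda>x. indicator (- D) (fst x) * Y x)"
      by (subst Bochner_Integration.integral_add) (auto simp: iX iY iI)
    also have "?E Y = ?E X" unfolding X_def Y_def by (rule expectation_fst_snd)
    also have "?E (\<lambda>x. indicator (- D) (fst x) * Y x) \<le> ?E (\<lambda>x. indicator (- D) (fst x))"
    proof (rule integral_mono)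
      show "integrable q (\<lambda>x. indicator (- D) (fst x) :: real)" by (intro int ind1)
      show "integrable q (\<lambda>x. indicator (- D) (fst x) * Y x)" by (rule iI)
      show "indicator (- D) (fst x) * Y x \<le> indicator (- D) (fst x)" for x
        using XY[of x] by (simp add: indicator_def)
    qed
    also have "?E (\<lambda>x. indicator (- D) (fst x)) = measure marg (- D)"
      using integral_map_pmf[of fst q "indicator (- D) :: nat \<Rightarrow> real"] by simp
    finally show ?thesis by simp
  qed
  have weighted: "0 \<le> ?E (\<lambda>x. w (fst x) * (indicator D (fst x) * (X x - Y x)))"
    if w: "\<And>i. 0 \<le> w i" "\<And>i. w i \<le> 1" for w
  proof (rule expectation_nonneg_by_fst[of _ 1])
    show "\<bar>w (fst x) * (indicator D (fst x) * (X x - Y x))\<bar> \<le> 1" for x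
      using w by (intro prod1 ind1 diff1) auto
    fix k
    have "?E (\<lambda>x. indicator {k} (fst x) * (w (fst x) * (indicator D (fst x) * (X x - Y x)))) =
      ?E (\<lambda>x. (w k * indicator D k) * (indicator {k} (fst x) * (X x - Y x)))"
      by (intro Bochner_Integration.integral_cong) (auto simp: indicator_def)
    also have "\<dots> = (w k * indicator D k) * ?E (\<lambda>x. indicator {k} (fst x) * (X x - Y x))" by simp
    also have "\<dots> \<ge> 0" using super[of k] w by (cases "k \<in> D") (auto simp: gap)
    finally show "0 \<le> ?E (\<lambda>x. indicator {k} (fst x) * (w (fst x) * (indicator D (fst x) * (X x - Y x))))" .
  qed
  \<comment> \<open>Used with \<open>w = 1 - h\<close>, which leaves half of the energy, and with
    \<open>w\<close> the indicator of the complement of \<open>{i}\<close>, which leaves the drift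
    at \<open>i\<close>.\<close>
  have split: "?E (\<lambda>x. (1 - w (fst x)) * (indicator D (fst x) * (X x - Y x))) \<le> measure marg (- D)"
    if w: "\<And>i. 0 \<le> w i" "\<And>i. w i \<le> 1" for w
  proof -
    have "integrable q (\<lambda>x. indicator D (fst x) * (X x - Y x))" by (intro int prod1 ind1 diff1)
    moreover have "integrable q (\<lambda>x. w (fst x) * (indicator D (fst x) * (X x - Y x)))"
      using w by (intro int prod1 ind1 diff1) auto
    ultimately have "?E (\<lambda>x. (1 - w (fst x)) * (indicator D (fst x) * (X x - Y x))) =
      ?E (\<lambda>x. indicator D (fst x) * (X x - Y x)) - ?E (\<lambda>x. w (fst x) * (indicator D (fst x) * (X x - Y x)))"
      by (simp add: left_diff_distrib[of 1])
    then show ?thesis using weighted[of w, OF w] restr by linarith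
  qed
  have "(\<lambda>x. (Y x - X x)\<^sup>2) = (\<lambda>x. (Y x * Y x + X x * X x) - 2 * (X x * Y x))"
    by (auto simp: power2_eq_square algebra_simps)
  then have "?E (\<lambda>x. (Y x - X x)\<^sup>2) = ?E (\<lambda>x. Y x * Y x) + ?E (\<lambda>x. X x * X x) - 2 * ?E (\<lambda>x. X x * Y x)"
    by (simp add: iXX iYY iXY)
  also have "?E (\<lambda>x. Y x * Y x) = ?E (\<lambda>x. X x * X x)"
    unfolding X_def Y_def by (rule expectation_fst_snd)
  also have "?E (\<lambda>x. X x * X x) + ?E (\<lambda>x. X x * X x) - 2 * ?E (\<lambda>x. X x * Y x) =
      2 * ?E (\<lambda>x. (1 - (1 - h (fst x))) * (indicator D (fst x) * (X x - Y x)))"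
  proof -
    have "?E (\<lambda>x. (1 - (1 - h (fst x))) * (indicator D (fst x) * (X x - Y x))) = ?E (\<lambda>x. X x * X x - X x * Y x)"
      by (intro Bochner_Integration.integral_cong) (auto simp: X_def indicator_def h(3) right_diff_distrib)
    then show ?thesis by (simp add: iXX iXY)
  qed
  also have "\<dots> \<le> 2 * measure marg (- D)" using split[of "\<lambda>i. 1 - h i"] h by simp
  finally have energy: "?E (\<lambda>x. (Y x - X x)\<^sup>2) \<le> 2 * measure marg (- D)" .
  have "pmf q (i, j) * (h j - h i)\<^sup>2 = ?E (\<lambda>x. (h j - h i)\<^sup>2 * indicator {(i, j)} x)"
    by (simp add: measure_pmf_single)
  also have "\<dots> \<le> ?E (\<lambda>x. (Y x - X x)\<^sup>2)"
  proof (rule integral_mono)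
    show "integrable q (\<lambda>x. (Y x - X x)\<^sup>2)"
      unfolding power2_eq_square using diff1 by (intro int prod1) (auto simp: abs_minus_commute)
    show "integrable q (\<lambda>x. (h j - h i)\<^sup>2 * indicator {(i, j)} x :: real)"
      by (intro integrable_bounded[of _ "(h j - h i)\<^sup>2"]) (auto simp: indicator_def)
    show "(h j - h i)\<^sup>2 * indicator {(i, j)} x \<le> (Y x - X x)\<^sup>2" for x
      by (auto simp: indicator_def X_def Y_def)
  qed
  finally show "pmf q (i, j) * (h j - h i)\<^sup>2 \<le> 2 * measure marg (- D)" using energy by simp
  assume i: "i \<in> D"
  have "?E (\<lambda>x. indicator {i} (fst x) * (X x - Y x)) =
     ?E (\<lambda>x. (1 - (1 - indicator {i} (fst x))) * (indicator D (fst x) * (X x - Y x)))"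
    using i by (intro Bochner_Integration.integral_cong) (auto simp: indicator_def)
  also have "\<dots> \<le> measure marg (- D)" by (rule split[of "\<lambda>k. 1 - indicator {i} k"]) (auto simp: indicator_def)
  finally show "pmf marg i * h i - ?E (\<lambda>x. indicator {i} (fst x) * h (snd x)) \<le> measure marg (- D)"
    by (simp add: gap)
qed

lemma expectation_fst_nn:
  assumes h: "\<And>i. 0 \<le> h i" "\<And>i. h i \<le> (1::real)"
  shows "ennreal (measure_pmf.expectation q (\<lambda>x. indicator {i} (fst x) * h (snd x))) =
    (\<integral>\<^sup>+ j. ennreal (pmf q (i, j) * h j) \<partial>count_space UNIV)"
proof -
  have "ennreal (measure_pmf.expectation q (\<lambda>x. indicator {i} (fst x) * h (snd x))) =
    (\<integral>\<^sup>+ x. ennreal (indicator {i} (fst x) * h (snd x)) \<partial>measure_pmf q)"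
    using h by (intro nn_integral_eq_integral[symmetric] integrable_bounded[of _ 1]) (auto simp: indicator_def)
  also have "\<dots> = (\<integral>\<^sup>+ x. ennreal (pmf q x) * ennreal (indicator {i} (fst x) * h (snd x)) \<partial>count_space UNIV)"
    by (rule nn_integral_measure_pmf)
  also have "\<dots> = (\<integral>\<^sup>+ a. \<integral>\<^sup>+ j. ennreal (pmf q (a, j)) * ennreal (indicator {i} a * h j) \<partial>count_space UNIV \<partial>count_space UNIV)"
    by (subst nn_integral_fst_count_space[symmetric]) simp
  also have "\<dots> = (\<integral>\<^sup>+ a. (\<integral>\<^sup>+ j. ennreal (pmf q (a, j) * h j) \<partial>count_space UNIV) * indicator {i} a \<partial>count_space UNIV)"
    by (intro nn_integral_cong) (auto simp: indicator_def ennreal_mult' h)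
  also have "\<dots> = (\<integral>\<^sup>+ j. ennreal (pmf q (i, j) * h j) \<partial>count_space UNIV)"
    by (subst nn_integral_indicator_singleton) auto
  finally show ?thesis .
qed

end

text \<open>The pair law of the chain with transition probabilities
  \<open>W i j * v j / (l * v i)\<close> and stationary law \<open>u i * v i\<close>. Both
  eigenvector equations are implicit: summing \<open>pmf_q\<close> over \<open>j\<close> or, by
  stationarity, over \<open>i\<close> must give the marginal.\<close>

locale eigen_flow = stationary_pairs q for q +
  fixes W :: "nat \<Rightarrow> nat \<Rightarrow> real" and l :: real and u v :: "nat \<Rightarrow> real"
  assumes W: "\<And>i j. W i j \<ge> 0" and l: "l > 0" and u: "\<And>i. u i > 0" and v: "\<And>i. v i > 0"
    and pmf_q: "\<And>i j. pmf q (i, j) = u i * W i j * v j / l"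
    and pmf_marg: "\<And>i. pmf (map_pmf fst q) i = u i * v i"
begin

lemma nonneg: "0 \<le> u i" "0 \<le> v i" "0 \<le> l"
  using u[of i] v[of i] l by simp_all

lemma marg_sum: "(\<integral>\<^sup>+ j. ennreal (pmf q (i, j)) \<partial>count_space UNIV) = ennreal (pmf marg i)"
  using expectation_fst_nn[of "\<lambda>_. 1" i] by (simp add: expectation_fst_eq)

lemma right_eigen: "(\<integral>\<^sup>+ j. ennreal (W i j * v j) \<partial>count_space UNIV) = ennreal (l * v i)"
proof -
  have "(\<integral>\<^sup>+ j. ennreal (W i j * v j) \<partial>count_space UNIV) =
      (\<integral>\<^sup>+ j. ennreal (l / u i) * ennreal (pmf q (i, j)) \<partial>count_space UNIV)"
    using u[of i] l by (intro nn_integral_cong) (simp add: pmf_q ennreal_mult'[symmetric])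
  also have "\<dots> = ennreal (l / u i) * ennreal (pmf marg i)"
    by (subst nn_integral_cmult) (auto simp: marg_sum)
  also have "\<dots> = ennreal (l * v i)"
    using u[of i] l v[of i] by (simp add: pmf_marg ennreal_mult'[symmetric])
  finally show ?thesis .
qed

text \<open>Division by \<open>v\<close> turns a vector with \<open>W y <= l y\<close> on
  \<open>D\<close> into a function \<open>y / v\<close> that is superharmonic there and bounded by
  one. The second claim measures the drop at a state where even \<open>W y <= c y\<close> holds; it
  is the source of the bound on the eigenvalue defect.\<close>

lemma superharmonic_energy_weights:
  assumes y: "\<And>i. 0 \<le> y i" "\<And>i. y i \<le> v i" "\<And>i. i \<notin> D \<Longrightarrow> y i = 0"
    and super: "\<And>i. i \<in> D \<Longrightarrow> (\<integral>\<^sup>+ j. ennreal (W i j * y j) \<partial>count_space UNIV) \<le> ennreal (l * y i)"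
  shows "pmf q (i, j) * (y j / v j - y i / v i)\<^sup>2 \<le> 2 * measure marg (- D)"
    and "i \<in> D \<Longrightarrow> (\<integral>\<^sup>+ j. ennreal (W i j * y j) \<partial>count_space UNIV) \<le> ennreal (c * y i) \<Longrightarrow> 0 \<le> c \<Longrightarrow>
      u i * y i * (1 - c / l) \<le> measure marg (- D)"
proof -
  define h where "h = (\<lambda>i. y i / v i)"
  have h: "0 \<le> h i" "h i \<le> 1" "i \<notin> D \<Longrightarrow> h i = 0" for i
    using y[of i] v[of i] by (auto simp: h_def)
  have E: "ennreal (measure_pmf.expectation q (\<lambda>x. indicator {i} (fst x) * h (snd x))) =
     ennreal (u i / l) * (\<integral>\<^sup>+ j. ennreal (W i j * y j) \<partial>count_space UNIV)" for i
  proof -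
    have "ennreal (measure_pmf.expectation q (\<lambda>x. indicator {i} (fst x) * h (snd x))) =
      (\<integral>\<^sup>+ j. ennreal (pmf q (i, j) * h j) \<partial>count_space UNIV)" using h by (intro expectation_fst_nn)
    also have "\<dots> = (\<integral>\<^sup>+ j. ennreal (u i / l) * ennreal (W i j * y j) \<partial>count_space UNIV)"
    proof (intro nn_integral_cong)
      fix j
      have "pmf q (i, j) * h j = u i / l * (W i j * y j)" using v[of j] by (simp add: pmf_q h_def)
      then show "ennreal (pmf q (i, j) * h j) = ennreal (u i / l) * ennreal (W i j * y j)"
        using u[of i] l by (simp add: ennreal_mult'[symmetric])
    qed
    also have "\<dots> = ennreal (u i / l) * (\<integral>\<^sup>+ j. ennreal (W i j * y j) \<partial>count_space UNIV)"
      by (rule nn_integral_cmult) simp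
    finally show ?thesis .
  qed
  have bound: "measure_pmf.expectation q (\<lambda>x. indicator {i} (fst x) * h (snd x)) \<le> u i * y i * (c / l)"
    if "(\<integral>\<^sup>+ j. ennreal (W i j * y j) \<partial>count_space UNIV) \<le> ennreal (c * y i)" "0 \<le> c" for i c
  proof -
    have "ennreal (measure_pmf.expectation q (\<lambda>x. indicator {i} (fst x) * h (snd x))) \<le>
       ennreal (u i / l) * ennreal (c * y i)" unfolding E using that by (intro mult_left_mono) auto
    also have "\<dots> = ennreal (u i * y i * (c / l))" using u[of i] l y(1)[of i] that(2)
      by (subst ennreal_mult[symmetric]) (auto simp: mult_ac)
    finally show ?thesis using that y nonneg by (subst (asm) ennreal_le_iff) (auto intro!: mult_nonneg_nonneg divide_nonneg_nonneg)
  qed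
  have ph: "pmf marg i * h i = u i * y i" for i using v[of i] by (simp add: pmf_marg h_def)
  have super': "measure_pmf.expectation q (\<lambda>x. indicator {i} (fst x) * h (snd x)) \<le> pmf marg i * h i" if "i \<in> D" for i
    using bound[OF super[OF that]] l by (simp add: ph)
  show "pmf q (i, j) * (y j / v j - y i / v i)\<^sup>2 \<le> 2 * measure marg (- D)"
    using superharmonic_energy(1)[OF h super'] unfolding h_def by blast
  assume *: "i \<in> D" "(\<integral>\<^sup>+ j. ennreal (W i j * y j) \<partial>count_space UNIV) \<le> ennreal (c * y i)" "0 \<le> c"
  have "u i * y i * (1 - c / l) = pmf marg i * h i - u i * y i * (c / l)" by (simp add: ph right_diff_distrib)
  also have "\<dots> \<le> pmf marg i * h i - measure_pmf.expectation q (\<lambda>x. indicator {i} (fst x) * h (snd x))"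
    using bound[OF *(2,3)] by simp
  also have "\<dots> \<le> measure marg (- D)" using superharmonic_energy(2)[OF h super'] *(1) by blast
  finally show "u i * y i * (1 - c / l) \<le> measure marg (- D)" .
qed

text \<open>With \<open>D\<close> the set of all states the energy is zero, so \<open>y / v\<close>
  is constant along edges. This turns comparison vectors into pointwise bounds on
  \<open>v\<close>.\<close>

lemma superharmonic_eq:
  assumes irred: "\<And>i j. (i, j) \<in> (edges_in UNIV (\<lambda>i j. W i j > 0))\<^sup>*"
    and y: "\<And>i. 0 \<le> y i" "\<And>i. y i \<le> v i" "y a = v a"
    and super: "\<And>i. (\<integral>\<^sup>+ j. ennreal (W i j * y j) \<partial>count_space UNIV) \<le> ennreal (l * y i)"
  shows "y k = v k"
proof -
  have *: "pmf q (i, j) * (y j / v j - y i / v i)\<^sup>2 \<le> 0" for i j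
    using superharmonic_energy_weights(1)[of y UNIV i j] y super by simp
  have step: "y j / v j = y i / v i" if "W i j > 0" for i j
  proof -
    have "pmf q (i, j) > 0" using that u[of i] v[of j] l by (simp add: pmf_q)
    then have "(y j / v j - y i / v i)\<^sup>2 \<le> 0" using *[of i j] by (simp add: mult_le_0_iff)
    then show ?thesis by simp
  qed
  have "(a, k) \<in> (edges_in UNIV (\<lambda>i j. W i j > 0))\<^sup>*" by (rule irred)
  then have "y k / v k = y a / v a"
    by induction (auto simp: edges_in_def step)
  then show ?thesis using y(3) v[of a] v[of k] by (simp add: field_simps)
qed

text \<open>Cut \<open>v\<close> off at a multiple of \<open>s\<close> outside \<open>F\<close>. If
  the multiple is large enough, the cut vector is still superharmonic, and as it agrees with
  \<open>v\<close> on \<open>F\<close> it is \<open>v\<close> itself: the cut removed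
  nothing.\<close>

lemma right_eigen_tail:
  assumes irred: "\<And>i j. (i, j) \<in> (edges_in UNIV (\<lambda>i j. W i j > 0))\<^sup>*"
    and F: "finite F" "F \<noteq> {}" "k \<notin> F"
    and s: "\<And>i. s i \<ge> 0" "\<And>i j. W i j \<le> s i"
    and out: "(\<integral>\<^sup>+ i. ennreal (s i) * indicator (- F) i \<partial>count_space UNIV) \<le> ennreal (l / 2)"
  shows "v k \<le> s k * (2 * (\<Sum>i\<in>F. v i) / l)"
proof -
  \<comment> \<open>The solution of \<open>(\<Sum>i\<in>F. v i) + m * (l / 2) = l * m\<close>. Up to
    the factor \<open>s i\<close>, the states of \<open>F\<close> contribute the first term to a row
    sum and the others at most half of \<open>l * m\<close>.\<close>
  define m where "m = 2 * (\<Sum>i\<in>F. v i) / l"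
  have m: "m > 0" unfolding m_def using F l v by (intro divide_pos_pos mult_pos_pos sum_pos) auto
  define y where "y = (\<lambda>i. if i \<in> F then v i else min (v i) (m * s i))"
  have y: "0 \<le> y i" "y i \<le> v i" for i using m s v[of i] by (auto simp: y_def)
  have "(\<integral>\<^sup>+ j. ennreal (W i j * y j) \<partial>count_space UNIV) \<le> ennreal (l * y i)" for i
  proof -
    have le1: "(\<integral>\<^sup>+ j. ennreal (W i j * y j) \<partial>count_space UNIV) \<le> ennreal (l * v i)"
      unfolding right_eigen[symmetric] using W y by (intro nn_integral_mono ennreal_leI mult_left_mono) auto
    have "(\<integral>\<^sup>+ j. ennreal (W i j * y j) \<partial>count_space UNIV) \<le>
      (\<integral>\<^sup>+ j. ennreal (s i) * (ennreal (v j) * indicator F j + ennreal m * (ennreal (s j) * indicator (- F) j)) \<partial>count_space UNIV)"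
    proof (intro nn_integral_mono)
      fix j
      have "ennreal (W i j * y j) \<le> ennreal (s i) * ennreal (y j)"
        using s W y by (subst ennreal_mult[symmetric]) (auto intro!: ennreal_leI mult_right_mono)
      also have "ennreal (y j) \<le> ennreal (v j) * indicator F j + ennreal m * (ennreal (s j) * indicator (- F) j)"
        using m s by (auto simp: y_def indicator_def ennreal_mult[symmetric] intro!: ennreal_leI)
      finally show "ennreal (W i j * y j) \<le> ennreal (s i) * (ennreal (v j) * indicator F j + ennreal m * (ennreal (s j) * indicator (- F) j))"
        by (simp add: mult_left_mono)
    qed
    also have "\<dots> = ennreal (s i) * ((\<integral>\<^sup>+ j. ennreal (v j) * indicator F j \<partial>count_space UNIV) +
       ennreal m * (\<integral>\<^sup>+ j. ennreal (s j) * indicator (- F) j \<partial>count_space UNIV))"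
      by (subst nn_integral_cmult, simp, subst nn_integral_add, simp, simp, subst nn_integral_cmult) auto
    also have "(\<integral>\<^sup>+ j. ennreal (v j) * indicator F j \<partial>count_space UNIV) = ennreal (\<Sum>i\<in>F. v i)"
      using F v by (subst nn_integral_count_space_indicator[symmetric])
        (auto simp: nn_integral_count_space_finite nonneg intro!: sum_ennreal)
    also have "ennreal (s i) * (ennreal (\<Sum>i\<in>F. v i) +
       ennreal m * (\<integral>\<^sup>+ j. ennreal (s j) * indicator (- F) j \<partial>count_space UNIV)) \<le>
       ennreal (s i) * (ennreal (\<Sum>i\<in>F. v i) + ennreal m * ennreal (l / 2))"
      using out by (intro mult_left_mono add_left_mono) auto
    also have "\<dots> = ennreal (s i * ((\<Sum>i\<in>F. v i) + m * (l / 2)))"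
      using s m l by (subst ennreal_add_mult) (auto intro!: sum_nonneg simp: nonneg ennreal_mult')
    also have "s i * ((\<Sum>i\<in>F. v i) + m * (l / 2)) = l * (m * s i)" using l by (simp add: m_def field_simps)
    finally have "(\<integral>\<^sup>+ j. ennreal (W i j * y j) \<partial>count_space UNIV) \<le> ennreal (l * (m * s i))" .
    with le1 show ?thesis by (auto simp: y_def min_def)
  qed
  moreover obtain a where "a \<in> F" using F by auto
  ultimately have "y k = v k" using superharmonic_eq[OF irred y, of a k] by (auto simp: y_def)
  then show ?thesis using F(3) by (simp add: y_def m_def mult.commute)
qed

text \<open>Time reversal: the reversed pair law belongs to the transposed matrix with the two
  eigenvectors exchanged, so every statement about \<open>v\<close> has a counterpart for
  \<open>u\<close>.\<close>

lemma swap_eigen_flow: "eigen_flow (map_pmf prod.swap q) (\<lambda>i j. W j i) l v u"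
proof
  show "map_pmf snd (map_pmf prod.swap q) = map_pmf fst (map_pmf prod.swap q)"
    by (simp add: pmf.map_comp o_def stationary)
  show "pmf (map_pmf prod.swap q) (i, j) = v i * W j i * u j / l" for i j
    using pmf_map_inj'[of prod.swap q "(j, i)"] by (simp add: pmf_q mult_ac)
  show "pmf (map_pmf fst (map_pmf prod.swap q)) i = v i * u i" for i
    using pmf_marg[of i] by (simp add: pmf.map_comp o_def stationary mult.commute)
qed (use W l u v in auto)

lemma marg_swap: "map_pmf fst (map_pmf prod.swap q) = marg"
  by (simp add: pmf.map_comp o_def stationary)

text \<open>As for \<open>v\<close>, but the cut is at a constant: \<open>s\<close> bounds the rows
  of \<open>W\<close>, and in the transposed equation the factor \<open>s j\<close> belongs to the
  summation index instead of the fixed state.\<close>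

lemma left_eigen_tail:
  assumes irred: "\<And>i j. (i, j) \<in> (edges_in UNIV (\<lambda>i j. W i j > 0))\<^sup>*"
    and F: "finite F" "F \<noteq> {}" "k \<notin> F"
    and s: "\<And>i. s i \<ge> 0" "\<And>i j. W i j \<le> s i"
    and out: "(\<integral>\<^sup>+ i. ennreal (s i) * indicator (- F) i \<partial>count_space UNIV) \<le> ennreal (l / 2)"
  shows "u k \<le> 2 * (\<Sum>i\<in>F. s i * u i) / l"
proof -
  interpret T: eigen_flow "map_pmf prod.swap q" "\<lambda>i j. W j i" l v u by (rule swap_eigen_flow)
  have irred': "(i, j) \<in> (edges_in UNIV (\<lambda>i j. W j i > 0))\<^sup>*" for i j
    unfolding edges_in_converse[of UNIV "\<lambda>i j. W i j > 0"] rtrancl_converse using irred by simp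
  define m where "m = 2 * (\<Sum>i\<in>F. s i * u i) / l"
  have m: "m \<ge> 0" unfolding m_def by (intro divide_nonneg_nonneg sum_nonneg mult_nonneg_nonneg nonneg s) auto
  define y where "y = (\<lambda>i. if i \<in> F then u i else min (u i) m)"
  have y: "0 \<le> y i" "y i \<le> u i" for i using m u[of i] by (auto simp: y_def)
  have "(\<integral>\<^sup>+ j. ennreal (W j i * y j) \<partial>count_space UNIV) \<le> ennreal (l * y i)" for i
  proof -
    have le1: "(\<integral>\<^sup>+ j. ennreal (W j i * y j) \<partial>count_space UNIV) \<le> ennreal (l * u i)"
      unfolding T.right_eigen[symmetric] using W y by (intro nn_integral_mono ennreal_leI mult_left_mono) auto
    have "(\<integral>\<^sup>+ j. ennreal (W j i * y j) \<partial>count_space UNIV) \<le>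
      (\<integral>\<^sup>+ j. ennreal (s j * u j) * indicator F j + ennreal m * (ennreal (s j) * indicator (- F) j) \<partial>count_space UNIV)"
    proof (intro nn_integral_mono)
      fix j
      have "ennreal (W j i * y j) \<le> ennreal (s j * y j)"
        using s W y by (intro ennreal_leI mult_right_mono) auto
      also have "\<dots> \<le> ennreal (s j * u j) * indicator F j + ennreal m * (ennreal (s j) * indicator (- F) j)"
        using m s by (auto simp: y_def indicator_def ennreal_mult[symmetric] mult.commute[of m]
            intro!: ennreal_leI mult_left_mono)
      finally show "ennreal (W j i * y j) \<le> ennreal (s j * u j) * indicator F j + ennreal m * (ennreal (s j) * indicator (- F) j)" .
    qed
    also have "\<dots> = (\<integral>\<^sup>+ j. ennreal (s j * u j) * indicator F j \<partial>count_space UNIV) +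
       ennreal m * (\<integral>\<^sup>+ j. ennreal (s j) * indicator (- F) j \<partial>count_space UNIV)"
      by (subst nn_integral_add, simp, simp, subst nn_integral_cmult) auto
    also have "(\<integral>\<^sup>+ j. ennreal (s j * u j) * indicator F j \<partial>count_space UNIV) = ennreal (\<Sum>i\<in>F. s i * u i)"
      using F u s by (subst nn_integral_count_space_indicator[symmetric])
        (auto simp: nn_integral_count_space_finite nonneg intro!: sum_ennreal)
    also have "ennreal (\<Sum>i\<in>F. s i * u i) +
       ennreal m * (\<integral>\<^sup>+ j. ennreal (s j) * indicator (- F) j \<partial>count_space UNIV) \<le>
       ennreal (\<Sum>i\<in>F. s i * u i) + ennreal m * ennreal (l / 2)"
      using out by (intro mult_left_mono add_left_mono) auto
    also have "\<dots> = ennreal ((\<Sum>i\<in>F. s i * u i) + m * (l / 2))"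
      using s m l by (intro ennreal_add_mult sum_nonneg) (auto simp: nonneg)
    also have "(\<Sum>i\<in>F. s i * u i) + m * (l / 2) = l * m" using l by (simp add: m_def field_simps)
    finally have "(\<integral>\<^sup>+ j. ennreal (W j i * y j) \<partial>count_space UNIV) \<le> ennreal (l * m)" .
    with le1 show ?thesis by (auto simp: y_def min_def)
  qed
  moreover obtain a where "a \<in> F" using F by auto
  ultimately have "y k = u k" using T.superharmonic_eq[OF irred' y, of a k] by (auto simp: y_def)
  then show ?thesis using F(3) by (simp add: y_def m_def)
qed

text \<open>On \<open>G\<close> the full left eigenvector satisfies \<open>u W <= l u\<close>, since
  the omitted states contribute nonnegative terms; pairing with \<open>v'\<close> gives the
  comparison.\<close>

lemma sub_eigenvalue_le:
  assumes G: "finite G" "G \<noteq> {}" and v': "\<And>i. i \<in> G \<Longrightarrow> v' i > 0" "\<And>i. i \<in> G \<Longrightarrow> (\<Sum>j\<in>G. W i j * v' j) = l' * v' i"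
  shows "l' \<le> l"
proof -
  interpret T: eigen_flow "map_pmf prod.swap q" "\<lambda>i j. W j i" l v u by (rule swap_eigen_flow)
  have col: "(\<Sum>i\<in>G. u i * W i j) \<le> l * u j" for j
  proof -
    have "ennreal (\<Sum>i\<in>G. u i * W i j) = (\<integral>\<^sup>+ i. ennreal (W i j * u i) * indicator G i \<partial>count_space UNIV)"
      using G u W by (subst nn_integral_count_space_indicator[symmetric])
        (auto simp: nn_integral_count_space_finite nonneg mult.commute intro!: sum_ennreal[symmetric])
    also have "\<dots> \<le> (\<integral>\<^sup>+ i. ennreal (W i j * u i) \<partial>count_space UNIV)"
      by (intro nn_integral_mono) (auto simp: indicator_def)
    also have "\<dots> = ennreal (l * u j)" by (rule T.right_eigen)
    finally show ?thesis using l u[of j] by (subst (asm) ennreal_le_iff) auto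
  qed
  have "l' * (\<Sum>i\<in>G. u i * v' i) = (\<Sum>i\<in>G. u i * (\<Sum>j\<in>G. W i j * v' j))"
    using v'(2) by (simp add: sum_distrib_left mult_ac)
  also have "\<dots> = (\<Sum>j\<in>G. (\<Sum>i\<in>G. u i * W i j) * v' j)"
    unfolding sum_distrib_left sum_distrib_right by (subst sum.swap) (simp add: mult_ac)
  also have "\<dots> \<le> (\<Sum>j\<in>G. (l * u j) * v' j)"
    using col v'(1) by (intro sum_mono mult_right_mono) (auto intro: less_imp_le)
  also have "\<dots> = l * (\<Sum>i\<in>G. u i * v' i)" by (simp add: sum_distrib_left mult_ac)
  finally show ?thesis using sum_pos[OF G, of "\<lambda>i. u i * v' i"] u v'(1) by simp
qed

text \<open>The truncated eigenvector, cut off at the full one, is superharmonic up to the flow through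
  the complement of \<open>G\<close>.\<close>

lemma truncation_compare:
  assumes G: "finite G" "i0 \<in> G"
    and v': "\<And>i. i \<in> G \<Longrightarrow> v' i > 0" "\<And>i. i \<in> G \<Longrightarrow> (\<Sum>j\<in>G. W i j * v' j) = l' * v' i" and l': "l' > 0"
  defines "h \<equiv> \<lambda>i. min 1 ((v i0 / v' i0) * v' i / v i)"
  shows "i \<in> G \<Longrightarrow> j \<in> G \<Longrightarrow> pmf q (i, j) * (h j - h i)\<^sup>2 \<le> 2 * measure marg (- G)"
    and "pmf marg i0 * (1 - l' / l) \<le> measure marg (- G)"
proof -
  \<comment> \<open>The normalisation that makes the two eigenvectors agree at
    \<open>i0\<close>.\<close>
  define \<kappa> where "\<kappa> = v i0 / v' i0"
  have \<kappa>: "\<kappa> > 0" using v v' G by (simp add: \<kappa>_def)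
  have le: "l' \<le> l" using sub_eigenvalue_le[OF G(1) _ v'] G by auto
  define y where "y = (\<lambda>i. if i \<in> G then min (v i) (\<kappa> * v' i) else 0)"
  have y: "0 \<le> y i" "y i \<le> v i" "i \<notin> G \<Longrightarrow> y i = 0" for i
    using v[of i] v'(1)[of i] \<kappa> by (auto simp: y_def)
  have le2: "(\<integral>\<^sup>+ j. ennreal (W i j * y j) \<partial>count_space UNIV) \<le> ennreal (l' * (\<kappa> * v' i))" if i: "i \<in> G" for i
  proof -
    have "(\<integral>\<^sup>+ j. ennreal (W i j * y j) \<partial>count_space UNIV) \<le>
       (\<integral>\<^sup>+ j. ennreal (W i j * (\<kappa> * v' j)) * indicator G j \<partial>count_space UNIV)"
      using W by (intro nn_integral_mono) (auto simp: y_def indicator_def intro!: ennreal_leI mult_left_mono)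
    also have "\<dots> = ennreal (\<Sum>j\<in>G. W i j * (\<kappa> * v' j))"
      using G v' W \<kappa> by (subst nn_integral_count_space_indicator[symmetric])
        (auto simp: nn_integral_count_space_finite less_imp_le intro!: sum_ennreal)
    also have "(\<Sum>j\<in>G. W i j * (\<kappa> * v' j)) = \<kappa> * (\<Sum>j\<in>G. W i j * v' j)"
      by (simp add: sum_distrib_left mult_ac)
    also have "\<dots> = l' * (\<kappa> * v' i)" using v'(2)[OF i] by simp
    finally show ?thesis .
  qed
  have super: "(\<integral>\<^sup>+ j. ennreal (W i j * y j) \<partial>count_space UNIV) \<le> ennreal (l * y i)" if i: "i \<in> G" for i
  proof -
    have le1: "(\<integral>\<^sup>+ j. ennreal (W i j * y j) \<partial>count_space UNIV) \<le> ennreal (l * v i)"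
      unfolding right_eigen[symmetric] using W y by (intro nn_integral_mono ennreal_leI mult_left_mono) auto
    have "l' * (\<kappa> * v' i) \<le> l * (\<kappa> * v' i)" using le \<kappa> v'(1)[OF i] by (intro mult_right_mono) auto
    then have "(\<integral>\<^sup>+ j. ennreal (W i j * y j) \<partial>count_space UNIV) \<le> ennreal (l * (\<kappa> * v' i))"
      using le2[OF i] by (auto intro: order_trans ennreal_leI)
    with le1 i show ?thesis by (auto simp: y_def min_def)
  qed
  have hy: "h i = y i / v i" if "i \<in> G" for i
    using that v[of i] by (auto simp: h_def y_def \<kappa>_def[symmetric] min_def field_simps)
  show "pmf q (i, j) * (h j - h i)\<^sup>2 \<le> 2 * measure marg (- G)" if "i \<in> G" "j \<in> G"
    using superharmonic_energy_weights(1)[OF y super] that by (simp add: hy)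
  \<comment> \<open>As the vectors agree at \<open>i0\<close>, the cut vector satisfies there the
    inequality with the smaller value \<open>l'\<close>; the drop at \<open>i0\<close> therefore
    bounds the eigenvalue defect.\<close>
  have yi0: "y i0 = v i0" "\<kappa> * v' i0 = v i0" using G v'(1)[OF G(2)] by (auto simp: y_def \<kappa>_def)
  have "u i0 * y i0 * (1 - l' / l) \<le> measure marg (- G)"
    using superharmonic_energy_weights(2)[OF y super, where i = i0 and c = l'] le2[OF G(2)] G l' by (simp add: yi0)
  then show "pmf marg i0 * (1 - l' / l) \<le> measure marg (- G)" by (simp add: yi0 pmf_marg)
qed

end

section \<open>Truncation to a finite subsystem\<close>

text \<open>Reachability inside \<open>V\<close>, from \<open>i\<close> and to \<open>j\<close>, is
  recorded for every vertex, so that sets belonging to closed paths through a common state can be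
  united to a strongly connected set.\<close>

lemma irreducible_path_set:
  assumes "(i, j) \<in> (edges_in UNIV A)\<^sup>+"
  shows "\<exists>V. finite V \<and> (i, j) \<in> (edges_in V A)\<^sup>+ \<and>
    (\<forall>w\<in>V. (i, w) \<in> (edges_in V A)\<^sup>* \<and> (w, j) \<in> (edges_in V A)\<^sup>*)"
  using assms
proof (induction rule: trancl_induct)
  case (base y)
  then have "(i, y) \<in> edges_in {i, y} A" by (simp add: edges_in_def)
  then show ?case by (intro exI[of _ "{i, y}"]) auto
next
  case (step y z)
  then obtain V where V: "finite V" "(i, y) \<in> (edges_in V A)\<^sup>+"
    "\<forall>w\<in>V. (i, w) \<in> (edges_in V A)\<^sup>* \<and> (w, y) \<in> (edges_in V A)\<^sup>*" by auto
  define V' where "V' = insert z V"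
  have sub: "edges_in V A \<subseteq> edges_in V' A" by (intro edges_in_mono) (auto simp: V'_def)
  have "y \<in> V" using V(2) by (auto simp: edges_in_def elim: tranclE)
  then have yz: "(y, z) \<in> edges_in V' A" using step(2) by (auto simp: edges_in_def V'_def)
  have iz: "(i, z) \<in> (edges_in V' A)\<^sup>+" using trancl_mono[OF V(2) sub] yz by (rule trancl_into_trancl)
  have "(i, w) \<in> (edges_in V' A)\<^sup>* \<and> (w, z) \<in> (edges_in V' A)\<^sup>*" if "w \<in> V'" for w
  proof (cases "w = z")
    case True then show ?thesis using iz by (simp add: trancl_into_rtrancl)
  next
    case False
    then have "w \<in> V" using that by (simp add: V'_def)
    then show ?thesis using V(3) rtrancl_mono[OF sub] yz by (meson in_mono rtrancl.rtrancl_into_rtrancl)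
  qed
  then show ?case using iz V(1) by (intro exI[of _ V']) (auto simp: V'_def)
qed

text \<open>For each state of \<open>S\<close> take a closed path through it and the base state
  \<open>0\<close>; the base state links all of them.\<close>

lemma finite_strongly_connected_superset:
  assumes irred: "\<And>i j. (i, j) \<in> (edges_in UNIV A)\<^sup>+" and S: "finite S"
  shows "\<exists>G. finite G \<and> S \<subseteq> G \<and> strongly_connected G A"
proof -
  define a where "a = (0::nat)"
  have "\<exists>C. finite C \<and> i \<in> C \<and> (a, a) \<in> (edges_in C A)\<^sup>+ \<and>
    (\<forall>w\<in>C. (a, w) \<in> (edges_in C A)\<^sup>* \<and> (w, a) \<in> (edges_in C A)\<^sup>*)" for i
  proof -
    obtain V where V: "finite V" "(a, i) \<in> (edges_in V A)\<^sup>+"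
      "\<forall>w\<in>V. (a, w) \<in> (edges_in V A)\<^sup>* \<and> (w, i) \<in> (edges_in V A)\<^sup>*"
      using irreducible_path_set[OF irred] by blast
    obtain V' where V': "finite V'" "(i, a) \<in> (edges_in V' A)\<^sup>+"
      "\<forall>w\<in>V'. (i, w) \<in> (edges_in V' A)\<^sup>* \<and> (w, a) \<in> (edges_in V' A)\<^sup>*"
      using irreducible_path_set[OF irred] by blast
    let ?C = "V \<union> V'"
    have sub: "edges_in V A \<subseteq> edges_in ?C A" "edges_in V' A \<subseteq> edges_in ?C A"
      by (intro edges_in_mono; simp)+
    have 1: "(a, i) \<in> (edges_in ?C A)\<^sup>+" "(i, a) \<in> (edges_in ?C A)\<^sup>+"
      using trancl_mono[OF V(2) sub(1)] trancl_mono[OF V'(2) sub(2)] by auto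
    have "i \<in> ?C" using V(2) by (auto simp: edges_in_def elim: tranclE)
    moreover have "(a, w) \<in> (edges_in ?C A)\<^sup>* \<and> (w, a) \<in> (edges_in ?C A)\<^sup>*" if "w \<in> ?C" for w
    proof (cases "w \<in> V")
      case True
      then have "(a, w) \<in> (edges_in ?C A)\<^sup>*" "(w, i) \<in> (edges_in ?C A)\<^sup>*"
        using V(3) rtrancl_mono[OF sub(1)] by blast+
      then show ?thesis using rtrancl_trans[OF _ trancl_into_rtrancl[OF 1(2)]] by blast
    next
      case False
      then have "(i, w) \<in> (edges_in ?C A)\<^sup>*" "(w, a) \<in> (edges_in ?C A)\<^sup>*"
        using that V'(3) rtrancl_mono[OF sub(2)] by blast+
      then show ?thesis using rtrancl_trans[OF trancl_into_rtrancl[OF 1(1)]] by blast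
    qed
    moreover have "(a, a) \<in> (edges_in ?C A)\<^sup>+" using 1 by (rule trancl_trans)
    ultimately show ?thesis using V(1) V'(1) by (intro exI[of _ ?C]) auto
  qed
  then obtain C where C: "\<And>i. finite (C i)" "\<And>i. i \<in> C i" "\<And>i. (a, a) \<in> (edges_in (C i) A)\<^sup>+"
    "\<And>i w. w \<in> C i \<Longrightarrow> (a, w) \<in> (edges_in (C i) A)\<^sup>* \<and> (w, a) \<in> (edges_in (C i) A)\<^sup>*" by metis
  define G where "G = (\<Union>i\<in>S. C i)"
  have mono: "edges_in (C i) A \<subseteq> edges_in G A" if "i \<in> S" for i
    using that by (intro edges_in_mono) (auto simp: G_def)
  have "(w, w') \<in> (edges_in G A)\<^sup>+" if w: "w \<in> G" "w' \<in> G" for w w'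
  proof -
    obtain i i' where i: "i \<in> S" "w \<in> C i" "i' \<in> S" "w' \<in> C i'" using w by (auto simp: G_def)
    have "(w, a) \<in> (edges_in G A)\<^sup>*" using C(4)[OF i(2)] rtrancl_mono[OF mono[OF i(1)]] by blast
    moreover have "(a, a) \<in> (edges_in G A)\<^sup>+" using trancl_mono[OF C(3) mono[OF i(1)]] .
    moreover have "(a, w') \<in> (edges_in G A)\<^sup>*" using C(4)[OF i(4)] rtrancl_mono[OF mono[OF i(3)]] by blast
    ultimately show ?thesis by (meson rtrancl_trancl_trancl trancl_rtrancl_trancl)
  qed
  then have "strongly_connected G A" by (auto simp: strongly_connected_def)
  moreover have "finite G" "S \<subseteq> G" using S C(1,2) by (auto simp: G_def)
  ultimately show ?thesis by blast
qed

section \<open>Functions of at most exponential growth\<close>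

definition exp_bounded :: "(real \<Rightarrow> real) \<Rightarrow> bool" where
  "exp_bounded f \<longleftrightarrow> (\<exists>c. \<forall>\<^sub>F t in at_top. 0 \<le> f t \<and> f t \<le> exp (c * t))"

lemma exp_bounded_exp: "exp_bounded (\<lambda>t. exp (c * t))"
  unfolding exp_bounded_def by (intro exI[of _ c]) simp

lemma exp_bounded_mono:
  assumes "exp_bounded f" and g: "\<forall>\<^sub>F t in at_top. 0 \<le> g t \<and> g t \<le> f t"
  shows "exp_bounded g"
proof -
  from assms obtain c where "\<forall>\<^sub>F t in at_top. 0 \<le> f t \<and> f t \<le> exp (c * t)"
    unfolding exp_bounded_def by blast
  with g have "\<forall>\<^sub>F t in at_top. 0 \<le> g t \<and> g t \<le> exp (c * t)" by eventually_elim auto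
  then show ?thesis unfolding exp_bounded_def by blast
qed

lemma exp_bounded_const: "0 \<le> K \<Longrightarrow> exp_bounded (\<lambda>_. K)"
proof (rule exp_bounded_mono[OF exp_bounded_exp[of 1]])
  assume "0 \<le> K"
  show "\<forall>\<^sub>F t in at_top. 0 \<le> K \<and> K \<le> exp (1 * t)"
    using eventually_ge_at_top[of K]
  proof eventually_elim
    case (elim t)
    then have "K \<le> exp t" using exp_ge_add_one_self[of t] by linarith
    then show ?case using \<open>0 \<le> K\<close> by simp
  qed
qed

lemma exp_bounded_mult:
  assumes "exp_bounded f" "exp_bounded g" shows "exp_bounded (\<lambda>t. f t * g t)"
proof -
  from assms obtain c d where "\<forall>\<^sub>F t in at_top. 0 \<le> f t \<and> f t \<le> exp (c * t)"
    "\<forall>\<^sub>F t in at_top. 0 \<le> g t \<and> g t \<le> exp (d * t)" unfolding exp_bounded_def by blast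
  then have "\<forall>\<^sub>F t in at_top. 0 \<le> f t * g t \<and> f t * g t \<le> exp ((c + d) * t)"
    by eventually_elim (auto simp: distrib_right exp_add intro!: mult_mono)
  then show ?thesis unfolding exp_bounded_def by blast
qed

lemma exp_bounded_add:
  assumes "exp_bounded f" "exp_bounded g" shows "exp_bounded (\<lambda>t. f t + g t)"
proof -
  from assms obtain c d where *: "\<forall>\<^sub>F t in at_top. 0 \<le> f t \<and> f t \<le> exp (c * t)"
    "\<forall>\<^sub>F t in at_top. 0 \<le> g t \<and> g t \<le> exp (d * t)" unfolding exp_bounded_def by blast
  have b: "exp_bounded (\<lambda>t. 2 * exp (max c d * t))"
    by (intro exp_bounded_mult exp_bounded_const exp_bounded_exp) simp
  have "\<forall>\<^sub>F t in at_top. 0 \<le> f t + g t \<and> f t + g t \<le> 2 * exp (max c d * t)"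
    using * eventually_ge_at_top[of 0]
  proof eventually_elim
    case (elim t)
    have "exp (c * t) \<le> exp (max c d * t)" "exp (d * t) \<le> exp (max c d * t)"
      using elim(3) by (auto intro!: mult_right_mono)
    then show ?case using elim by linarith
  qed
  then show ?thesis by (rule exp_bounded_mono[OF b])
qed

lemma exp_bounded_sum: "(\<And>k. k \<in> K \<Longrightarrow> exp_bounded (f k)) \<Longrightarrow> exp_bounded (\<lambda>t. \<Sum>k\<in>K. f k t)"
  by (induction K rule: infinite_finite_induct) (auto intro: exp_bounded_add exp_bounded_const)

lemma exp_bounded_uniform:
  assumes "finite K" "\<And>k. k \<in> K \<Longrightarrow> exp_bounded (f k)"
  shows "\<exists>c. \<forall>k\<in>K. \<forall>\<^sub>F t in at_top. f k t \<le> exp (c * t)"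
proof -
  have "\<exists>c. \<forall>\<^sub>F t in at_top. 0 \<le> f k t \<and> f k t \<le> exp (c * t)" if "k \<in> K" for k
    using assms(2)[OF that] by (simp add: exp_bounded_def)
  then obtain c where c: "\<And>k. k \<in> K \<Longrightarrow> \<forall>\<^sub>F t in at_top. 0 \<le> f k t \<and> f k t \<le> exp (c k * t)" by metis
  define C where "C = (\<Sum>k\<in>K. \<bar>c k\<bar>)"
  have C: "c k \<le> C" if "k \<in> K" for k
    using member_le_sum[of k K "\<lambda>k. \<bar>c k\<bar>"] that assms(1) unfolding C_def by auto
  have "\<forall>\<^sub>F t in at_top. f k t \<le> exp (C * t)" if "k \<in> K" for k
    using c[OF that] eventually_ge_at_top[of 0]
  proof eventually_elim
    case (elim t)
    have "exp (c k * t) \<le> exp (C * t)" using C[OF that] elim by (simp add: mult_right_mono)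
    then show ?case using elim by linarith
  qed
  then show ?thesis by blast
qed

lemma exp_decay: "c > 0 \<Longrightarrow> ((\<lambda>t::real. K * exp (- c * t)) \<longlongrightarrow> 0) at_top"
proof -
  assume "c > 0"
  then have "((\<lambda>t::real. K * exp (- c * t)) \<longlongrightarrow> K * 0) at_top"
    by (intro tendsto_mult tendsto_const filterlim_compose[OF exp_at_bot]
        filterlim_tendsto_neg_mult_at_bot[OF tendsto_const] filterlim_ident) simp
  then show ?thesis by simp
qed

text \<open>By \<open>truncation_compare\<close> the cut ratio changes along an edge by at most the
  square root of twice the mass outside \<open>H\<close> over the mass of the edge, which tends to
  zero. Finitely many steps lead from \<open>i0\<close>, where the value is one, to
  \<open>j\<close>. Because of the cut, this only excludes that the ratio itself stays below
  one.\<close>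

lemma ratio_min_tendsto_1:
  fixes v v' :: "real \<Rightarrow> nat \<Rightarrow> real"
  assumes flow: "\<And>t. t \<ge> 1 \<Longrightarrow> eigen_flow (q t) (W t) (l t) (u t) (v t)"
    and H: "finite H" "G \<subseteq> H" "i0 \<in> G"
    and path: "(i0, j) \<in> (edges_in G A)\<^sup>*"
    and v': "\<And>t i. t \<ge> 1 \<Longrightarrow> i \<in> H \<Longrightarrow> v' t i > 0"
      "\<And>t i. t \<ge> 1 \<Longrightarrow> i \<in> H \<Longrightarrow> (\<Sum>j\<in>H. W t i j * v' t j) = l' t * v' t i"
      "\<And>t. t \<ge> 1 \<Longrightarrow> l' t > 0"
    and small: "\<And>i j. (i, j) \<in> edges_in G A \<Longrightarrow>
      ((\<lambda>t. measure (map_pmf fst (q t)) (- H) / pmf (q t) (i, j)) \<longlongrightarrow> 0) at_top"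
      "\<And>i j t. (i, j) \<in> edges_in G A \<Longrightarrow> t \<ge> 1 \<Longrightarrow> pmf (q t) (i, j) > 0"
  shows "((\<lambda>t. min 1 ((v t i0 / v' t i0) * v' t j / v t j)) \<longlongrightarrow> 1) at_top"
  using path
proof (induction rule: rtrancl_induct)
  case base
  have "\<forall>\<^sub>F t in at_top. 1 = min 1 ((v t i0 / v' t i0) * v' t i0 / v t i0)"
    using eventually_ge_at_top[of 1]
  proof eventually_elim
    case (elim t)
    interpret eigen_flow "q t" "W t" "l t" "u t" "v t" using flow elim by simp
    show ?case using v[of i0] v'(1)[OF elim, of i0] H by auto
  qed
  then show ?case by (rule Lim_transform_eventually[OF tendsto_const])
next
  case (step i j)
  let ?h = "\<lambda>t j. min 1 ((v t i0 / v' t i0) * v' t j / v t j)"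
  have ij: "i \<in> H" "j \<in> H" using step(2) H by (auto simp: edges_in_def)
  have "((\<lambda>t. sqrt (2 * (measure (map_pmf fst (q t)) (- H) / pmf (q t) (i, j)))) \<longlongrightarrow> sqrt (2 * 0)) at_top"
    by (intro tendsto_intros small step)
  then have lim: "((\<lambda>t. sqrt (2 * (measure (map_pmf fst (q t)) (- H) / pmf (q t) (i, j)))) \<longlongrightarrow> 0) at_top" by simp
  have "((\<lambda>t. ?h t j - ?h t i) \<longlongrightarrow> 0) at_top"
  proof (rule Lim_null_comparison[OF _ lim])
    show "\<forall>\<^sub>F t in at_top. norm (?h t j - ?h t i) \<le> sqrt (2 * (measure (map_pmf fst (q t)) (- H) / pmf (q t) (i, j)))"
      using eventually_ge_at_top[of 1]
    proof eventually_elim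
      case (elim t)
      interpret eigen_flow "q t" "W t" "l t" "u t" "v t" using flow elim by simp
      have "i0 \<in> H" using H by auto
      have "pmf (q t) (i, j) * (?h t j - ?h t i)\<^sup>2 \<le> 2 * measure (map_pmf fst (q t)) (- H)"
        by (rule truncation_compare(1)[OF H(1) \<open>i0 \<in> H\<close> v'(1)[OF elim] v'(2)[OF elim] v'(3)[OF elim] ij])
      then have "(?h t j - ?h t i)\<^sup>2 \<le> 2 * (measure (map_pmf fst (q t)) (- H) / pmf (q t) (i, j))"
        using small(2)[OF step(2) elim] by (simp add: field_simps)
      then show ?case by (simp add: real_le_rsqrt)
    qed
  qed
  from tendsto_add[OF this step(3)] show ?case by simp
qed

text \<open>Exchanging \<open>i\<close> and \<open>j\<close> inverts the ratio, so the two one-sided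
  results together control it: \<open>min 1 x / min 1 (1 / x) = x\<close>.\<close>

lemma ratio_tendsto_1:
  fixes v v' :: "real \<Rightarrow> nat \<Rightarrow> real"
  assumes flow: "\<And>t. t \<ge> 1 \<Longrightarrow> eigen_flow (q t) (W t) (l t) (u t) (v t)"
    and H: "finite H" "G \<subseteq> H" "i \<in> G" "j \<in> G"
    and conn: "strongly_connected G A"
    and v': "\<And>t i. t \<ge> 1 \<Longrightarrow> i \<in> H \<Longrightarrow> v' t i > 0"
      "\<And>t i. t \<ge> 1 \<Longrightarrow> i \<in> H \<Longrightarrow> (\<Sum>j\<in>H. W t i j * v' t j) = l' t * v' t i"
      "\<And>t. t \<ge> 1 \<Longrightarrow> l' t > 0"
    and small: "\<And>i j. (i, j) \<in> edges_in G A \<Longrightarrow>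
      ((\<lambda>t. measure (map_pmf fst (q t)) (- H) / pmf (q t) (i, j)) \<longlongrightarrow> 0) at_top"
      "\<And>i j t. (i, j) \<in> edges_in G A \<Longrightarrow> t \<ge> 1 \<Longrightarrow> pmf (q t) (i, j) > 0"
  shows "((\<lambda>t. (v t i / v' t i) * (v' t j / v t j)) \<longlongrightarrow> 1) at_top"
proof -
  have path: "(i, j) \<in> (edges_in G A)\<^sup>*" "(j, i) \<in> (edges_in G A)\<^sup>*"
    using conn H by (auto simp: strongly_connected_def intro: trancl_into_rtrancl)
  have iH: "i \<in> H" "j \<in> H" using H by auto
  note L1 = ratio_min_tendsto_1[OF flow H(1,2,3) path(1) v' small]
  note L2 = ratio_min_tendsto_1[OF flow H(1,2,4) path(2) v' small]
  have L: "((\<lambda>t. min 1 ((v t i / v' t i) * v' t j / v t j) / min 1 ((v t j / v' t j) * v' t i / v t i)) \<longlongrightarrow> 1 / 1) at_top"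
    by (rule tendsto_divide[OF L1 L2]) auto
  have ev: "\<forall>\<^sub>F t in at_top. min 1 ((v t i / v' t i) * v' t j / v t j) / min 1 ((v t j / v' t j) * v' t i / v t i) =
      (v t i / v' t i) * (v' t j / v t j)"
    using eventually_ge_at_top[of 1]
  proof eventually_elim
    case (elim t)
    interpret eigen_flow "q t" "W t" "l t" "u t" "v t" using flow elim by simp
    define x where "x = (v t i / v' t i) * v' t j / v t j"
    have x: "x > 0" "(v t j / v' t j) * v' t i / v t i = 1 / x"
      using v[of i] v[of j] v'(1)[OF elim iH(1)] v'(1)[OF elim iH(2)] by (simp_all add: x_def mult_ac)
    have "min 1 x / min 1 (1 / x) = x" using x(1) by (auto simp: min_def field_simps)
    then show ?case using x by (simp add: x_def)
  qed
  from Lim_transform_eventually[OF L ev] show ?thesis by simp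
qed

section \<open>Exponential rates for states, edges and tails, and the limit of the pair laws\<close>

locale transfer_family =
  fixes A :: "nat \<Rightarrow> nat \<Rightarrow> bool" and \<psi> :: "nat \<Rightarrow> nat \<Rightarrow> real" and s :: "nat \<Rightarrow> real" and c0 :: real
    and q :: "real \<Rightarrow> (nat \<times> nat) pmf" and l :: "real \<Rightarrow> real" and u v :: "real \<Rightarrow> nat \<Rightarrow> real"
  assumes irred: "\<And>i j. (i, j) \<in> (edges_in UNIV A)\<^sup>+"
    and psi_le: "\<And>i j. A i j \<Longrightarrow> \<psi> i j \<le> s i"
    and summable_s: "summable (\<lambda>i. exp (s i))"
    and flow: "\<And>t. t \<ge> 1 \<Longrightarrow> eigen_flow (q t) (transfer_weight A \<psi> t) (l t) (u t) (v t)"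
    and l_le: "\<And>t. t \<ge> 1 \<Longrightarrow> l t \<le> exp (c0 * t)"
begin

abbreviation marginal where "marginal t \<equiv> map_pmf fst (q t)"

lemma pos: "t \<ge> 1 \<Longrightarrow> u t i > 0" "t \<ge> 1 \<Longrightarrow> v t i > 0" "t \<ge> 1 \<Longrightarrow> l t > 0"
  using flow[of t] by (auto simp: eigen_flow_def eigen_flow_axioms_def)

lemma pmf_q: "t \<ge> 1 \<Longrightarrow> pmf (q t) (i, j) = u t i * transfer_weight A \<psi> t i j * v t j / l t"
  and pmf_marg: "t \<ge> 1 \<Longrightarrow> pmf (marginal t) i = u t i * v t i"
  using flow[of t] by (auto simp: eigen_flow_def eigen_flow_axioms_def)

lemma pmf_q_pos: "t \<ge> 1 \<Longrightarrow> A i j \<Longrightarrow> pmf (q t) (i, j) > 0"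
  using pos[of t] by (simp add: pmf_q transfer_weight_def)

lemma pmf_q_le_fst: "pmf (q t) (i, j) \<le> pmf (marginal t) i"
  unfolding pmf.rep_eq[of "q t"] pmf_map
  by (auto intro!: measure_pmf.finite_measure_mono)

lemma pmf_q_le_snd: "t \<ge> 1 \<Longrightarrow> pmf (q t) (i, j) \<le> pmf (marginal t) j"
proof -
  assume "t \<ge> 1"
  then interpret eigen_flow "q t" "transfer_weight A \<psi> t" "l t" "u t" "v t" by (rule flow)
  show ?thesis unfolding stationary[symmetric] pmf.rep_eq[of "q t"] pmf_map
    by (auto intro!: measure_pmf.finite_measure_mono)
qed

lemma exp_bounded_l: "exp_bounded l"
  unfolding exp_bounded_def
  by (rule exI[of _ c0], rule eventually_mono[OF eventually_ge_at_top[of 1]])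
    (use l_le pos in \<open>auto intro: less_imp_le\<close>)

lemma exp_bounded_inverse_weight: "A i j \<Longrightarrow> exp_bounded (\<lambda>t. 1 / transfer_weight A \<psi> t i j)"
  using exp_bounded_exp[of "- \<psi> i j"] by (simp add: transfer_weight_def exp_minus field_simps)

text \<open>The mass of an edge is at most the mass of either endpoint. After a common factor is
  cancelled this is a one-step Harnack inequality: for \<open>v\<close> the target is controlled by
  the source, for \<open>u\<close> the source by the target.\<close>

lemma eigen_step:
  assumes "A i j" "t \<ge> 1"
  shows "v t j / v t i \<le> l t * (1 / transfer_weight A \<psi> t i j)"
    and "u t i / u t j \<le> l t * (1 / transfer_weight A \<psi> t i j)"
proof -
  let ?w = "transfer_weight A \<psi> t i j"
  have w: "?w > 0" using assms by (simp add: transfer_weight_def)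
  note p = pos(1)[OF assms(2)] pos(2)[OF assms(2)] pos(3)[OF assms(2)]
  have "u t i * (?w * v t j) \<le> u t i * (l t * v t i)"
    using pmf_q_le_fst[of t i j] p(3) assms by (simp add: pmf_q pmf_marg field_simps)
  then have "?w * v t j \<le> l t * v t i" using p(1)[of i] by simp
  then show "v t j / v t i \<le> l t * (1 / ?w)" using w p(2)[of i] by (simp add: field_simps)
  have "(u t i * ?w) * v t j \<le> (l t * u t j) * v t j"
    using pmf_q_le_snd[of t i j] p(3) assms by (simp add: pmf_q pmf_marg field_simps)
  then have "u t i * ?w \<le> l t * u t j" using p(2)[of j] by simp
  then show "u t i / u t j \<le> l t * (1 / ?w)" using w p(1)[of j] by (simp add: field_simps)
qed

text \<open>Irreducibility joins any two states by a path, and the bounds of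
  \<open>eigen_step\<close> multiply along it.\<close>

lemma exp_bounded_ratio: "exp_bounded (\<lambda>t. v t j / v t i)" "exp_bounded (\<lambda>t. u t i / u t j)"
proof -
  have "(i, j) \<in> (edges_in UNIV A)\<^sup>*" using irred by (rule trancl_into_rtrancl)
  then have "exp_bounded (\<lambda>t. v t j / v t i) \<and> exp_bounded (\<lambda>t. u t i / u t j)"
  proof (induction rule: rtrancl_induct)
    case base
    have "\<forall>\<^sub>F t in at_top. 0 \<le> v t i / v t i \<and> v t i / v t i \<le> 1"
      "\<forall>\<^sub>F t in at_top. 0 \<le> u t i / u t i \<and> u t i / u t i \<le> 1"
      by (auto simp: divide_self_if)
    then show ?case using exp_bounded_mono[OF exp_bounded_const[of 1]] by simp
  next
    case (step y z)
    then have A: "A y z" by (simp add: edges_in_def)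
    have b: "exp_bounded (\<lambda>t. l t * (1 / transfer_weight A \<psi> t y z))"
      by (intro exp_bounded_mult exp_bounded_l exp_bounded_inverse_weight A)
    have bv: "exp_bounded (\<lambda>t. v t y / v t i * (l t * (1 / transfer_weight A \<psi> t y z)))"
     and bu: "exp_bounded (\<lambda>t. u t i / u t y * (l t * (1 / transfer_weight A \<psi> t y z)))"
      using exp_bounded_mult[OF conjunct1[OF step.IH] b] exp_bounded_mult[OF conjunct2[OF step.IH] b] .
    have "\<forall>\<^sub>F t in at_top. (0 \<le> v t z / v t i \<and> v t z / v t i \<le> v t y / v t i * (l t * (1 / transfer_weight A \<psi> t y z))) \<and>
      (0 \<le> u t i / u t z \<and> u t i / u t z \<le> u t i / u t y * (l t * (1 / transfer_weight A \<psi> t y z)))"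
      using eventually_ge_at_top[of 1]
    proof eventually_elim
      case (elim t)
      note p = pos(1)[OF elim] pos(2)[OF elim]
      have "v t z / v t i = v t y / v t i * (v t z / v t y)" "u t i / u t z = u t i / u t y * (u t y / u t z)"
        using p(1)[of y] p(2)[of y] by auto
      moreover have "v t y / v t i * (v t z / v t y) \<le> v t y / v t i * (l t * (1 / transfer_weight A \<psi> t y z))"
        using p(2)[of y] p(2)[of i] by (intro mult_left_mono eigen_step A elim) simp
      moreover have "u t i / u t y * (u t y / u t z) \<le> u t i / u t y * (l t * (1 / transfer_weight A \<psi> t y z))"
        using p(1)[of y] p(1)[of i] by (intro mult_left_mono eigen_step A elim) simp
      ultimately show ?case using p(1)[of i] p(1)[of z] p(2)[of i] p(2)[of z] by simp
    qed
    then show ?case using exp_bounded_mono[OF bv] exp_bounded_mono[OF bu] by (simp add: eventually_conj_iff)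
  qed
  then show "exp_bounded (\<lambda>t. v t j / v t i)" "exp_bounded (\<lambda>t. u t i / u t j)" by auto
qed

lemma exp_bounded_inverse_l: "exp_bounded (\<lambda>t. 1 / l t)"
proof -
  obtain b where A: "A 0 b" using irred[of 0 0] by (auto simp: edges_in_def elim: converse_tranclE)
  have "exp_bounded (\<lambda>t. v t 0 / v t b * (1 / transfer_weight A \<psi> t 0 b))"
    by (intro exp_bounded_mult exp_bounded_ratio exp_bounded_inverse_weight A)
  then show ?thesis
  proof (rule exp_bounded_mono)
    show "\<forall>\<^sub>F t in at_top. 0 \<le> 1 / l t \<and> 1 / l t \<le> v t 0 / v t b * (1 / transfer_weight A \<psi> t 0 b)"
      using eventually_ge_at_top[of 1]
    proof eventually_elim
      case (elim t)
      show ?case using eigen_step(1)[OF A elim] pos(2)[OF elim, of 0] pos(2)[OF elim, of b] pos(3)[OF elim] A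
        by (simp add: field_simps transfer_weight_def)
    qed
  qed
qed

text \<open>Outside a finite set \<open>s i <= - (M + 1)\<close>. One of the \<open>t\<close> copies
  of \<open>s i\<close> in the exponent is kept for summability, the other \<open>t - 1\<close>
  supply the decay, and the additional unit in \<open>M + 1\<close> absorbs the constants.\<close>

lemma weight_tail:
  "\<exists>S0. finite S0 \<and> (\<forall>S. S0 \<subseteq> S \<longrightarrow> (\<forall>\<^sub>F t in at_top.
    (\<integral>\<^sup>+ i. ennreal (exp (t * s i)) * indicator (- S) i \<partial>count_space UNIV) \<le> ennreal (exp (- M * t))))"
proof -
  define S0 where "S0 = {i. \<not> exp (s i) < exp (- (M + 1))}"
  have "(\<lambda>i. exp (s i)) \<longlonglongrightarrow> 0" by (rule summable_LIMSEQ_zero[OF summable_s])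
  then have "\<forall>\<^sub>F i in sequentially. exp (s i) < exp (- (M + 1))" by (rule order_tendstoD) simp
  then have "finite S0" by (simp add: S0_def eventually_cofinite cofinite_eq_sequentially[symmetric])
  moreover have "\<forall>\<^sub>F t in at_top.
    (\<integral>\<^sup>+ i. ennreal (exp (t * s i)) * indicator (- S) i \<partial>count_space UNIV) \<le> ennreal (exp (- M * t))" if S: "S0 \<subseteq> S" for S
  proof -
    define Z where "Z = (\<Sum>i. exp (s i))"
    have Z0: "0 \<le> Z" unfolding Z_def by (intro suminf_nonneg summable_s) simp
    have Z: "(\<integral>\<^sup>+ i. ennreal (exp (s i)) \<partial>count_space UNIV) = ennreal Z"
      unfolding nn_integral_count_space_nat Z_def by (intro suminf_ennreal2 summable_s) simp
    have "((\<lambda>t::real. (exp (M + 1) * Z) * exp (- 1 * t)) \<longlongrightarrow> 0) at_top" by (intro exp_decay) simp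
    then have "\<forall>\<^sub>F t::real in at_top. (exp (M + 1) * Z) * exp (- 1 * t) < 1" by (rule order_tendstoD) simp
    then show ?thesis using eventually_ge_at_top[of 1]
    proof eventually_elim
      case (elim t)
      have "(\<integral>\<^sup>+ i. ennreal (exp (t * s i)) * indicator (- S) i \<partial>count_space UNIV) \<le>
        (\<integral>\<^sup>+ i. ennreal (exp (- (t - 1) * (M + 1))) * ennreal (exp (s i)) \<partial>count_space UNIV)"
      proof (intro nn_integral_mono)
        fix i
        show "ennreal (exp (t * s i)) * indicator (- S) i \<le> ennreal (exp (- (t - 1) * (M + 1))) * ennreal (exp (s i))"
        proof (cases "i \<in> S")
          case False
          then have "i \<notin> S0" using S by auto
          then have "s i \<le> - (M + 1)" by (simp add: S0_def)
          then have "(t - 1) * s i \<le> (t - 1) * - (M + 1)" using elim(2) by (intro mult_left_mono) auto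
          then have "t * s i \<le> - (t - 1) * (M + 1) + s i" by (simp add: algebra_simps)
          then have "exp (t * s i) \<le> exp (- (t - 1) * (M + 1)) * exp (s i)" by (simp add: exp_add[symmetric])
          then show ?thesis using False by (simp add: ennreal_mult[symmetric] ennreal_leI)
        qed simp
      qed
      also have "\<dots> = ennreal (exp (- (t - 1) * (M + 1)) * Z)"
        by (subst nn_integral_cmult) (auto simp: Z ennreal_mult Z0)
      also have "\<dots> \<le> ennreal (exp (- M * t))"
      proof (rule ennreal_leI)
        have "- (t - 1) * (M + 1) = - M * t + (M + 1 + - 1 * t)" by (simp add: algebra_simps)
        then have "exp (- (t - 1) * (M + 1)) * Z = exp (- M * t) * ((exp (M + 1) * Z) * exp (- 1 * t))"
          by (simp only: exp_add mult_ac)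
        also have "\<dots> \<le> exp (- M * t) * 1" using elim by (intro mult_left_mono) auto
        finally show "exp (- (t - 1) * (M + 1)) * Z \<le> exp (- M * t)" by simp
      qed
      finally show ?case .
    qed
  qed
  ultimately show ?thesis by blast
qed

text \<open>The product of the tail bounds for \<open>v\<close> and \<open>u\<close>. Everything is
  measured relative to state \<open>0\<close>, because no lower bound on the mass of that state is
  available yet.\<close>

lemma marginal_tail_base:
  "\<exists>F0 c. finite F0 \<and> (\<forall>\<^sub>F t in at_top. \<forall>k. k \<notin> F0 \<longrightarrow>
     pmf (marginal t) k \<le> exp (c * t) * exp (t * s k) * pmf (marginal t) 0)"
proof -
  obtain c1 where c1: "\<forall>\<^sub>F t in at_top. 1 / l t \<le> exp (c1 * t)"
    using exp_bounded_inverse_l by (auto simp: exp_bounded_def eventually_conj_iff)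
  \<comment> \<open>The rate \<open>c1 + 1\<close> exceeds the possible decay rate of
    \<open>l\<close> by one; the surplus factor \<open>exp (- t)\<close> eventually provides the
    \<open>1 / 2\<close> demanded by the tail lemmas.\<close>
  obtain S0 where S0: "finite S0" "\<And>S. S0 \<subseteq> S \<Longrightarrow> \<forall>\<^sub>F t in at_top.
    (\<integral>\<^sup>+ i. ennreal (exp (t * s i)) * indicator (- S) i \<partial>count_space UNIV) \<le> ennreal (exp (- (c1 + 1) * t))"
    using weight_tail[of "c1 + 1"] by blast
  define F0 where "F0 = insert 0 S0"
  have F0: "finite F0" "F0 \<noteq> {}" using S0 by (auto simp: F0_def)
  have "((\<lambda>t::real. 2 * exp (- 1 * t)) \<longlongrightarrow> 0) at_top" by (intro exp_decay) simp
  then have "\<forall>\<^sub>F t::real in at_top. 2 * exp (- 1 * t) < 1" by (rule order_tendstoD) simp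
  then have out: "\<forall>\<^sub>F t in at_top.
    (\<integral>\<^sup>+ i. ennreal (exp (t * s i)) * indicator (- F0) i \<partial>count_space UNIV) \<le> ennreal (l t / 2)"
    using c1 S0(2)[of F0, OF subset_insertI[of S0 0, folded F0_def]] eventually_ge_at_top[of 1]
  proof eventually_elim
    case (elim t)
    have "exp (- (c1 * t)) \<le> l t" using elim(2) pos(3)[OF elim(4)] by (simp add: exp_minus field_simps)
    then have "exp (- (c1 * t)) * exp (- 1 * t) \<le> l t * (1 / 2)"
      using elim(1) pos(3)[OF elim(4)] by (intro mult_mono) auto
    moreover have "- (c1 + 1) * t = - (c1 * t) + - 1 * t" by (simp add: algebra_simps)
    ultimately have "exp (- (c1 + 1) * t) \<le> l t / 2" by (simp only: exp_add)
    then show ?case by (rule order_trans[OF elim(3) ennreal_leI])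
  qed
  \<comment> \<open>The product of the two bounds, divided by the entries at state \<open>0\<close>
    to make it independent of scaling. Apart from explicit exponentials only ratios and powers of
    \<open>1 / l\<close> remain, all of them exponentially bounded.\<close>
  define f where "f = (\<lambda>t. 4 * (\<Sum>i\<in>F0. exp (s i * t) * (u t i / u t 0)) * (\<Sum>i\<in>F0. v t i / v t 0) * (1 / l t * (1 / l t)))"
  have "exp_bounded f" unfolding f_def
    by (intro exp_bounded_mult exp_bounded_sum exp_bounded_const exp_bounded_exp exp_bounded_ratio
        exp_bounded_inverse_l) simp
  then obtain c where c: "\<forall>\<^sub>F t in at_top. 0 \<le> f t \<and> f t \<le> exp (c * t)" by (auto simp: exp_bounded_def)
  have "\<forall>\<^sub>F t in at_top. \<forall>k. k \<notin> F0 \<longrightarrow> pmf (marginal t) k \<le> exp (c * t) * exp (t * s k) * pmf (marginal t) 0"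
    using c out eventually_ge_at_top[of 1]
  proof eventually_elim
    case (elim t)
    interpret eigen_flow "q t" "transfer_weight A \<psi> t" "l t" "u t" "v t" by (rule flow[OF elim(3)])
    have irred': "(i, j) \<in> (edges_in UNIV (\<lambda>i j. transfer_weight A \<psi> t i j > 0))\<^sup>*" for i j
      using irred[of i j] by (simp add: transfer_weight_pos_iff trancl_into_rtrancl)
    have le_s: "transfer_weight A \<psi> t i j \<le> exp (t * s i)" for i j
      using psi_le[of i j] elim(3) by (auto simp: transfer_weight_def)
    show ?case
    proof (intro allI impI)
      fix k assume k: "k \<notin> F0"
      have vk: "v t k \<le> exp (t * s k) * (2 * (\<Sum>i\<in>F0. v t i) / l t)"
        by (rule right_eigen_tail[OF irred' F0 k _ le_s elim(2)]) simp
      have uk: "u t k \<le> 2 * (\<Sum>i\<in>F0. exp (t * s i) * u t i) / l t"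
        by (rule left_eigen_tail[OF irred' F0 k _ le_s elim(2)]) simp
      have "u t k * v t k \<le> (2 * (\<Sum>i\<in>F0. exp (t * s i) * u t i) / l t) * (exp (t * s k) * (2 * (\<Sum>i\<in>F0. v t i) / l t))"
        by (rule mult_mono[OF uk vk order_trans[OF nonneg(1) uk] nonneg(2)])
      also have "\<dots> = f t * exp (t * s k) * (u t 0 * v t 0)"
        using u[of 0] v[of 0] by (simp add: f_def sum_divide_distrib[symmetric] mult.commute[of t])
      also have "\<dots> \<le> exp (c * t) * exp (t * s k) * (u t 0 * v t 0)"
        using elim(1) nonneg by (intro mult_right_mono) auto
      finally show "pmf (marginal t) k \<le> exp (c * t) * exp (t * s k) * pmf (marginal t) 0"
        by (simp add: pmf_marg)
    qed
  qed
  then show ?thesis using F0 by blast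
qed

lemma marginal_tail_measure:
  assumes "\<And>k. k \<notin> F0 \<Longrightarrow> pmf (p :: nat pmf) k \<le> K * exp (t * s k)" "F0 \<subseteq> S" "0 \<le> K" "0 \<le> m"
    "(\<integral>\<^sup>+ i. ennreal (exp (t * s i)) * indicator (- S) i \<partial>count_space UNIV) \<le> ennreal m"
  shows "measure p (- S) \<le> K * m"
proof -
  have "ennreal (measure p (- S)) = (\<integral>\<^sup>+ i. ennreal (pmf p i) * indicator (- S) i \<partial>count_space UNIV)"
    by (simp add: measure_pmf.emeasure_eq_measure[symmetric] nn_integral_measure_pmf[symmetric]
        nn_integral_indicator[symmetric] del: nn_integral_indicator)
  also have "\<dots> \<le> (\<integral>\<^sup>+ i. ennreal K * (ennreal (exp (t * s i)) * indicator (- S) i) \<partial>count_space UNIV)"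
    using assms(1-3) by (intro nn_integral_mono) (auto simp: indicator_def ennreal_mult[symmetric] intro!: ennreal_leI)
  also have "\<dots> = ennreal K * (\<integral>\<^sup>+ i. ennreal (exp (t * s i)) * indicator (- S) i \<partial>count_space UNIV)"
    by (rule nn_integral_cmult) simp
  also have "\<dots> \<le> ennreal K * ennreal m" using assms by (intro mult_left_mono) auto
  also have "\<dots> = ennreal (K * m)" using assms by (simp add: ennreal_mult)
  finally show ?thesis using assms by (subst (asm) ennreal_le_iff) auto
qed

text \<open>The growth \<open>exp (c * t)\<close> of the prefactor is fixed before the finite set is
  chosen, so a larger set outweighs it and leaves any prescribed rate \<open>M\<close>.\<close>

lemma marginal_tail:
  "\<exists>S0. finite S0 \<and> (\<forall>S. S0 \<subseteq> S \<longrightarrow> (\<forall>\<^sub>F t in at_top. measure (marginal t) (- S) \<le> exp (- M * t)))"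
proof -
  obtain F0 c where F0: "finite F0" and c: "\<forall>\<^sub>F t in at_top. \<forall>k. k \<notin> F0 \<longrightarrow>
     pmf (marginal t) k \<le> exp (c * t) * exp (t * s k) * pmf (marginal t) 0" using marginal_tail_base by blast
  obtain S0 where S0: "finite S0" "\<And>S. S0 \<subseteq> S \<Longrightarrow> \<forall>\<^sub>F t in at_top.
    (\<integral>\<^sup>+ i. ennreal (exp (t * s i)) * indicator (- S) i \<partial>count_space UNIV) \<le> ennreal (exp (- (M + c) * t))"
    using weight_tail[of "M + c"] by blast
  have "\<forall>\<^sub>F t in at_top. measure (marginal t) (- S) \<le> exp (- M * t)" if S: "F0 \<union> S0 \<subseteq> S" for S
    using c S0(2)[OF order_trans[OF Un_upper2 S]]
  proof eventually_elim
    case (elim t)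
    have "measure (marginal t) (- S) \<le> exp (c * t) * exp (- (M + c) * t)"
    proof (rule marginal_tail_measure[of F0])
      fix k assume "k \<notin> F0"
      then have "pmf (marginal t) k \<le> exp (c * t) * exp (t * s k) * pmf (marginal t) 0" using elim by blast
      also have "\<dots> \<le> exp (c * t) * exp (t * s k) * 1" by (intro mult_left_mono pmf_le_1) simp
      finally show "pmf (marginal t) k \<le> exp (c * t) * exp (t * s k)" by simp
    qed (use S elim in auto)
    also have "\<dots> = exp (- M * t)" by (simp add: exp_add[symmetric] algebra_simps)
    finally show ?case .
  qed
  then show ?thesis using F0 S0(1) by (intro exI[of _ "F0 \<union> S0"]) auto
qed

text \<open>Total mass one is the mass of finitely many states, each exponentially comparable with
  state \<open>0\<close>, plus a tail that is also bounded by a multiple of the mass of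
  \<open>0\<close>; hence that mass cannot decay faster than exponentially.\<close>

lemma exp_bounded_inverse_marg: "exp_bounded (\<lambda>t. 1 / pmf (marginal t) 0)"
proof -
  obtain F0 c where F0: "finite F0" and c: "\<forall>\<^sub>F t in at_top. \<forall>k. k \<notin> F0 \<longrightarrow>
     pmf (marginal t) k \<le> exp (c * t) * exp (t * s k) * pmf (marginal t) 0" using marginal_tail_base by blast
  obtain S0 where S0: "finite S0" "\<And>S. S0 \<subseteq> S \<Longrightarrow> \<forall>\<^sub>F t in at_top.
    (\<integral>\<^sup>+ i. ennreal (exp (t * s i)) * indicator (- S) i \<partial>count_space UNIV) \<le> ennreal (exp (- 0 * t))"
    using weight_tail[of 0] by blast
  define S where "S = F0 \<union> S0"
  have S: "finite S" "F0 \<subseteq> S" "S0 \<subseteq> S" using F0 S0 by (auto simp: S_def)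
  have b: "exp_bounded (\<lambda>t. (\<Sum>k\<in>S. u t k / u t 0 * (v t k / v t 0)) + exp (c * t))"
    by (intro exp_bounded_add exp_bounded_sum exp_bounded_mult exp_bounded_ratio exp_bounded_exp)
  show ?thesis
  proof (rule exp_bounded_mono[OF b])
    show "\<forall>\<^sub>F t in at_top. 0 \<le> 1 / pmf (marginal t) 0 \<and>
      1 / pmf (marginal t) 0 \<le> (\<Sum>k\<in>S. u t k / u t 0 * (v t k / v t 0)) + exp (c * t)"
      using c S0(2)[OF S(3)] eventually_ge_at_top[of 1]
    proof eventually_elim
      case (elim t)
      have p0: "pmf (marginal t) 0 > 0" using pos[OF elim(3)] by (simp add: pmf_marg[OF elim(3)])
      have "measure (marginal t) (- S) \<le> (exp (c * t) * pmf (marginal t) 0) * 1"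
        by (rule marginal_tail_measure[of F0]) (use S elim in \<open>auto simp: mult_ac\<close>)
      moreover have "measure (marginal t) (- S) = 1 - measure (marginal t) S"
        using measure_pmf.prob_compl[of S "marginal t"] by (simp add: Compl_eq_Diff_UNIV)
      moreover have "measure (marginal t) S = (\<Sum>k\<in>S. pmf (marginal t) k)"
        using S by (intro measure_measure_pmf_finite)
      ultimately have "1 \<le> (\<Sum>k\<in>S. pmf (marginal t) k) + exp (c * t) * pmf (marginal t) 0" by linarith
      then have "1 / pmf (marginal t) 0 \<le> ((\<Sum>k\<in>S. pmf (marginal t) k) + exp (c * t) * pmf (marginal t) 0) / pmf (marginal t) 0"
        using p0 by (intro divide_right_mono) auto
      also have "\<dots> = (\<Sum>k\<in>S. pmf (marginal t) k / pmf (marginal t) 0) + exp (c * t)"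
        using p0 by (simp add: add_divide_distrib sum_divide_distrib)
      finally show ?case using p0 by (simp add: pmf_marg[OF elim(3)])
    qed
  qed
qed

lemma exp_bounded_inverse_edge: "A i j \<Longrightarrow> exp_bounded (\<lambda>t. 1 / pmf (q t) (i, j))"
proof -
  assume A: "A i j"
  have b: "exp_bounded (\<lambda>t. l t * (1 / transfer_weight A \<psi> t i j) * (u t 0 / u t i) * (v t 0 / v t j) * (1 / pmf (marginal t) 0))"
    by (intro exp_bounded_mult exp_bounded_l exp_bounded_inverse_weight exp_bounded_ratio exp_bounded_inverse_marg A)
  show ?thesis
  proof (rule exp_bounded_mono[OF b], rule eventually_mono[OF eventually_ge_at_top[of 1]])
    fix t :: real assume t: "t \<ge> 1"
    show "0 \<le> 1 / pmf (q t) (i, j) \<and> 1 / pmf (q t) (i, j) \<le>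
      l t * (1 / transfer_weight A \<psi> t i j) * (u t 0 / u t i) * (v t 0 / v t j) * (1 / pmf (marginal t) 0)"
      using pos(1)[OF t, of 0] pos(2)[OF t, of 0] pos(1)[OF t, of i] pos(2)[OF t, of j] pos(3)[OF t] A
      by (simp add: pmf_q[OF t] pmf_marg[OF t] transfer_weight_def mult_ac)
  qed
qed

text \<open>The mass of an edge of \<open>G\<close> is the convergent quotient of the finite system
  \<open>H\<close> times correction factors that tend to one: the quotient of the eigenvalues, the
  eigenvector ratios at both ends, and the mass of \<open>G\<close> in these coordinates.\<close>

theorem pair_limit:
  "\<exists>G p. finite G \<and> (\<forall>i j. ((\<lambda>t. pmf (q t) (i, j)) \<longlongrightarrow> p i j) at_top) \<and>
     (\<forall>i j. p i j \<noteq> 0 \<longrightarrow> i \<in> G \<and> j \<in> G) \<and> ((\<lambda>t. measure (marginal t) (- G)) \<longlongrightarrow> 0) at_top"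
proof -
  obtain S1 where S1: "finite S1" "\<And>S. S1 \<subseteq> S \<Longrightarrow> \<forall>\<^sub>F t in at_top. measure (marginal t) (- S) \<le> exp (- 1 * t)"
    using marginal_tail[of 1] by blast
  obtain G where G: "finite G" "insert 0 S1 \<subseteq> G" "strongly_connected G A"
    using finite_strongly_connected_superset[OF irred, of "insert 0 S1"] S1 by auto
  have G0: "0 \<in> G" using G by auto
  have decay: "((\<lambda>t::real. exp (- 1 * t)) \<longlongrightarrow> 0) at_top" using exp_decay[of 1 1] by simp
  have tailG: "((\<lambda>t. measure (marginal t) (- G)) \<longlongrightarrow> 0) at_top"
    by (rule Lim_null_comparison[OF _ decay], rule eventually_mono[OF S1(2)[of G]]) (use G in auto)
  have finE: "finite (edges_in G A)" by (rule finite_subset[of _ "G \<times> G"]) (use G in \<open>auto simp: edges_in_def\<close>)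
  obtain c where c: "\<forall>e\<in>edges_in G A. \<forall>\<^sub>F t in at_top. 1 / pmf (q t) e \<le> exp (c * t)"
    using exp_bounded_uniform[OF finE, of "\<lambda>e t. 1 / pmf (q t) e"] exp_bounded_inverse_edge
    by (auto simp: edges_in_def)
  \<comment> \<open>The rate \<open>c + 1\<close> for the complement of \<open>H\<close> leaves a
    quotient of order \<open>exp (- t)\<close> against each edge of \<open>G\<close>.\<close>
  obtain S2 where S2: "finite S2" "\<And>S. S2 \<subseteq> S \<Longrightarrow> \<forall>\<^sub>F t in at_top. measure (marginal t) (- S) \<le> exp (- (c + 1) * t)"
    using marginal_tail[of "c + 1"] by blast
  obtain H where H: "finite H" "G \<union> S2 \<subseteq> H" "strongly_connected H A"
    using finite_strongly_connected_superset[OF irred, of "G \<union> S2"] S2 G by auto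
  have GH: "G \<subseteq> H" "H \<noteq> {}" using H G0 by auto
  have small: "((\<lambda>t. measure (marginal t) (- H) / pmf (q t) (i, j)) \<longlongrightarrow> 0) at_top" if "(i, j) \<in> edges_in G A" for i j
  proof (rule Lim_null_comparison[OF _ decay])
    show "\<forall>\<^sub>F t in at_top. norm (measure (marginal t) (- H) / pmf (q t) (i, j)) \<le> exp (- 1 * t)"
      using bspec[OF c that] S2(2)[OF order_trans[OF Un_upper2 H(2)]]
    proof eventually_elim
      case (elim t)
      have "measure (marginal t) (- H) / pmf (q t) (i, j) \<le> exp (- (c + 1) * t) * exp (c * t)"
        using elim mult_mono[OF elim(2,1)] by simp
      also have "\<dots> = exp (- 1 * t)" by (simp add: exp_add[symmetric] algebra_simps)
      finally show ?case by simp
    qed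
  qed
  have qpos: "pmf (q t) (i, j) > 0" if "(i, j) \<in> edges_in G A" "t \<ge> 1" for i j t
    using that pmf_q_pos by (auto simp: edges_in_def)
  have "\<exists>l' u' v'. perron_data (transfer_weight A \<psi> t) H l' u' v'" for t
    unfolding perron_data_def
    using perron[OF H(1) GH(2), of "transfer_weight A \<psi> t"] H(3)
    by (simp add: transfer_weight_nonneg transfer_weight_pos_iff)
  then obtain l' u' v' where data: "\<And>t. perron_data (transfer_weight A \<psi> t) H (l' t) (u' t) (v' t)" by metis
  then have d: "l' t > 0" "\<And>i. i \<in> H \<Longrightarrow> u' t i > 0" "\<And>i. i \<in> H \<Longrightarrow> v' t i > 0"
    "\<And>i. i \<in> H \<Longrightarrow> (\<Sum>j\<in>H. transfer_weight A \<psi> t i j * v' t j) = l' t * v' t i"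
    "\<And>j. j \<in> H \<Longrightarrow> (\<Sum>i\<in>H. u' t i * transfer_weight A \<psi> t i j) = l' t * u' t j" for t
    by (auto simp: perron_data_def)
  \<comment> \<open>Ratios of truncated to full eigenvectors, normalised at state \<open>0\<close>:
    \<open>B\<close> for the right ones and \<open>C\<close> for the left ones.\<close>
  define B where "B = (\<lambda>k t. (v t 0 / v' t 0) * (v' t k / v t k))"
  define C where "C = (\<lambda>k t. (u t 0 / u' t 0) * (u' t k / u t k))"
  have B: "(B k \<longlongrightarrow> 1) at_top" if "k \<in> G" for k
    unfolding B_def
    by (rule ratio_tendsto_1[OF flow H(1) GH(1) G0 that G(3) d(3,4,1) small qpos])
  have conv: "edges_in G (\<lambda>i j. A j i) = (edges_in G A)\<inverse>" by (rule edges_in_converse)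
  have C: "(C k \<longlongrightarrow> 1) at_top" if "k \<in> G" for k
    unfolding C_def
  proof (rule ratio_tendsto_1[where q = "\<lambda>t. map_pmf prod.swap (q t)" and u = v and l = l and
        W = "\<lambda>t i j. transfer_weight A \<psi> t j i" and A = "\<lambda>i j. A j i" and l' = l', OF _ H(1) GH(1) G0 that])
    show "eigen_flow (map_pmf prod.swap (q t)) (\<lambda>i j. transfer_weight A \<psi> t j i) (l t) (v t) (u t)" if "t \<ge> 1" for t
      by (rule eigen_flow.swap_eigen_flow[OF flow[OF that]])
    show "strongly_connected G (\<lambda>i j. A j i)" using G(3) strongly_connected_converse[of G A] by blast
    show "(\<Sum>j\<in>H. transfer_weight A \<psi> t j i * u' t j) = l' t * u' t i" if "i \<in> H" for t i
      using d(5)[OF that, of t] by (simp add: mult.commute)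
    have sw: "pmf (map_pmf prod.swap (q t)) (i, j) = pmf (q t) (j, i)" for t i j
      using pmf_map_inj'[of prod.swap "q t" "(j, i)"] by simp
    show "pmf (map_pmf prod.swap (q t)) (i, j) > 0" if "(i, j) \<in> edges_in G (\<lambda>i j. A j i)" "t \<ge> 1" for i j t
      using qpos[of j i t] that by (simp add: sw conv)
    show "((\<lambda>t. measure (map_pmf fst (map_pmf prod.swap (q t))) (- H) / pmf (map_pmf prod.swap (q t)) (i, j)) \<longlongrightarrow> 0) at_top"
      if "(i, j) \<in> edges_in G (\<lambda>i j. A j i)" for i j
    proof -
      have "(j, i) \<in> edges_in G A" using that by (simp add: conv)
      from small[OF this] show ?thesis
      proof (rule Lim_transform_eventually)
        show "\<forall>\<^sub>F t in at_top. measure (marginal t) (- H) / pmf (q t) (j, i) =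
          measure (map_pmf fst (map_pmf prod.swap (q t))) (- H) / pmf (map_pmf prod.swap (q t)) (i, j)"
          using eventually_ge_at_top[of 1]
          by eventually_elim (simp only: sw eigen_flow.marg_swap[OF flow])
      qed
    qed
  qed (use d in auto)
  \<comment> \<open>The eigenvalue defect is at most the mass outside \<open>H\<close> divided by
    the mass of state \<open>0\<close>, and the latter is at least the mass of any edge leaving
    \<open>0\<close>.\<close>
  have lratio: "((\<lambda>t. l' t / l t) \<longlongrightarrow> 1) at_top"
  proof -
    have "(0, 0) \<in> (edges_in G A)\<^sup>+" using G(3) G0 by (auto simp: strongly_connected_def)
    then obtain b where b: "(0, b) \<in> edges_in G A" by (auto elim: converse_tranclE)
    have "((\<lambda>t. 1 - l' t / l t) \<longlongrightarrow> 0) at_top"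
    proof (rule Lim_null_comparison[OF _ small[OF b]], rule eventually_mono[OF eventually_ge_at_top[of 1]])
      fix t :: real assume t: "t \<ge> 1"
      interpret eigen_flow "q t" "transfer_weight A \<psi> t" "l t" "u t" "v t" by (rule flow[OF t])
      have "0 \<in> H" using G0 GH by auto
      have le: "l' t \<le> l t" using sub_eigenvalue_le[OF H(1) GH(2) d(3,4)] by simp
      then have nn: "0 \<le> 1 - l' t / l t" using l by (simp add: field_simps)
      have "pmf (q t) (0, b) * (1 - l' t / l t) \<le> pmf (marginal t) 0 * (1 - l' t / l t)"
        using nn by (intro mult_right_mono pmf_q_le_fst)
      also have "\<dots> \<le> measure (marginal t) (- H)"
        by (rule truncation_compare(2)[OF H(1) \<open>0 \<in> H\<close> d(3,4,1)])
      finally have "1 - l' t / l t \<le> measure (marginal t) (- H) / pmf (q t) (0, b)"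
        using qpos[OF b t] by (simp add: field_simps)
      then show "norm (1 - l' t / l t) \<le> measure (marginal t) (- H) / pmf (q t) (0, b)" using nn by simp
    qed
    from tendsto_diff[OF tendsto_const[of 1] this] show ?thesis by simp
  qed
  \<comment> \<open>In the limit \<open>G\<close> has full mass and all factors
    \<open>C k t * B k t\<close> are one. So the truncated mass of \<open>G\<close>, scaled such
    that both systems agree at \<open>0\<close>, tends to one.\<close>
  have total: "((\<lambda>t. \<Sum>k\<in>G. pmf (marginal t) k * (C k t * B k t)) \<longlongrightarrow> 1) at_top"
  proof -
    have "((\<lambda>t. (1 - measure (marginal t) (- G)) + (\<Sum>k\<in>G. pmf (marginal t) k * (C k t * B k t - 1))) \<longlongrightarrow> (1 - 0) + (\<Sum>k\<in>G. 0)) at_top"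
    proof (intro tendsto_add tendsto_diff tendsto_const tailG tendsto_sum)
      fix k assume k: "k \<in> G"
      have "((\<lambda>t. C k t * B k t - 1) \<longlongrightarrow> 1 * 1 - 1) at_top" by (intro tendsto_intros B C k)
      then have "((\<lambda>t. C k t * B k t - 1) \<longlongrightarrow> 0) at_top" by simp
      then show "((\<lambda>t. pmf (marginal t) k * (C k t * B k t - 1)) \<longlongrightarrow> 0) at_top"
        by (rule Lim_null_comparison[OF _ tendsto_norm_zero, rotated])
          (auto simp: abs_mult intro!: eventuallyI mult_left_le_one_le pmf_le_1)
    qed
    moreover have "(1 - measure (marginal t) (- G)) + (\<Sum>k\<in>G. pmf (marginal t) k * (C k t * B k t - 1)) =
        (\<Sum>k\<in>G. pmf (marginal t) k * (C k t * B k t))" for t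
    proof -
      have "1 - measure (marginal t) (- G) = (\<Sum>k\<in>G. pmf (marginal t) k)"
        using measure_pmf.prob_compl[of G "marginal t"] measure_measure_pmf_finite[OF G(1), of "marginal t"]
        by (simp add: Compl_eq_Diff_UNIV)
      then show ?thesis by (simp add: right_diff_distrib sum_subtractf)
    qed
    ultimately show ?thesis by simp
  qed
  have "\<exists>L. ((\<lambda>t. pmf (q t) (i, j)) \<longlongrightarrow> L) at_top" if ij: "i \<in> G" "j \<in> G" for i j
  proof -
    let ?R = "\<lambda>t. u' t i * transfer_weight A \<psi> t i j * v' t j / l' t / (\<Sum>k\<in>G. u' t k * v' t k)"
    obtain L where L: "(?R \<longlongrightarrow> L) at_top"
      using perron_edge_ratio_convergent(1)[OF H(1,3) data GH(1) ij] by blast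
    have "((\<lambda>t. ?R t * (l' t / l t) * (\<Sum>k\<in>G. pmf (marginal t) k * (C k t * B k t)) / (C i t * B j t)) \<longlongrightarrow> L * 1 * 1 / (1 * 1)) at_top"
      by (intro tendsto_intros L lratio total C B ij) simp
    moreover have "\<forall>\<^sub>F t in at_top. ?R t * (l' t / l t) * (\<Sum>k\<in>G. pmf (marginal t) k * (C k t * B k t)) / (C i t * B j t) = pmf (q t) (i, j)"
      using eventually_ge_at_top[of 1]
    proof eventually_elim
      case (elim t)
      interpret eigen_flow "q t" "transfer_weight A \<psi> t" "l t" "u t" "v t" by (rule flow[OF elim])
      have HG: "k \<in> H" if "k \<in> G" for k using that GH by auto
      define \<kappa> where "\<kappa> = (u t 0 / u' t 0) * (v t 0 / v' t 0)"
      have \<kappa>: "\<kappa> > 0" unfolding \<kappa>_def using u v d(2)[OF HG[OF G0], of t] d(3)[OF HG[OF G0], of t] by simp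
      have sum: "(\<Sum>k\<in>G. pmf (marginal t) k * (C k t * B k t)) = \<kappa> * (\<Sum>k\<in>G. u' t k * v' t k)"
        unfolding sum_distrib_left
      proof (intro sum.cong refl)
        fix k assume "k \<in> G"
        show "pmf (marginal t) k * (C k t * B k t) = \<kappa> * (u' t k * v' t k)"
          using u[of k] v[of k] by (simp add: pmf_marg C_def B_def \<kappa>_def)
      qed
      have CB: "C i t * B j t = \<kappa> * (u' t i * v' t j) / (u t i * v t j)"
        by (simp add: C_def B_def \<kappa>_def mult_ac)
      define X where "X = (\<Sum>k\<in>G. u' t k * v' t k)"
      have X: "X > 0" unfolding X_def using G G0 d(2,3) HG by (intro sum_pos mult_pos_pos) auto
      have p: "u' t i > 0" "v' t j > 0" "l' t > 0" using d HG ij by auto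
      show ?case unfolding sum CB X_def[symmetric] pmf_q
        using X p \<kappa> u[of i] v[of j] l by (simp add: field_simps)
    qed
    ultimately show ?thesis by (auto cong: tendsto_cong)
  qed
  then obtain p where p: "\<And>i j. i \<in> G \<Longrightarrow> j \<in> G \<Longrightarrow> ((\<lambda>t. pmf (q t) (i, j)) \<longlongrightarrow> p i j) at_top" by metis
  have outside: "((\<lambda>t. pmf (q t) (i, j)) \<longlongrightarrow> 0) at_top" if "\<not> (i \<in> G \<and> j \<in> G)" for i j
  proof (rule Lim_null_comparison[OF _ tailG], rule eventually_mono[OF eventually_ge_at_top[of 1]])
    fix t :: real assume t: "t \<ge> 1"
    have single: "pmf (marginal t) k \<le> measure (marginal t) (- G)" if "k \<notin> G" for k
      unfolding pmf.rep_eq using that by (intro measure_pmf.finite_measure_mono) auto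
    show "norm (pmf (q t) (i, j)) \<le> measure (marginal t) (- G)"
      using that single[of i] single[of j] pmf_q_le_fst[of t i j] pmf_q_le_snd[OF t, of i j] by auto
  qed
  show ?thesis
    by (rule exI[of _ G], rule exI[of _ "\<lambda>i j. if i \<in> G \<and> j \<in> G then p i j else 0"])
       (use G(1) p outside tailG in auto)
qed

end

section \<open>Entropy of labels and of finite partitions\<close>

definition level_prob :: "'a measure \<Rightarrow> ('a \<Rightarrow> 'c) \<Rightarrow> 'c \<Rightarrow> real" where
  "level_prob M X c = measure M (X -` {c} \<inter> space M)"

definition label_entropy :: "'a measure \<Rightarrow> ('a \<Rightarrow> 'c) \<Rightarrow> real" where
  "label_entropy M X = - (\<Sum>c\<in>X ` space M. level_prob M X c * ln (level_prob M X c))"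

lemma measurable_finite_range:
  assumes "finite (f ` space M)" "\<And>c. f -` {c} \<inter> space M \<in> sets M"
  shows "f \<in> measurable M (count_space UNIV)"
proof (rule measurableI)
  fix B
  have "f -` B \<inter> space M = (\<Union>c\<in>B \<inter> f ` space M. f -` {c} \<inter> space M)" by auto
  also have "\<dots> \<in> sets M" using assms by (intro sets.finite_UN) auto
  finally show "f -` B \<inter> space M \<in> sets M" .
qed simp

context prob_space
begin

lemma level_sum_expectation:
  assumes X: "X \<in> measurable M (count_space UNIV)" and fin: "finite (X ` space M)"
  shows "integrable M (\<lambda>x. g (X x) :: real)"
    and "expectation (\<lambda>x. g (X x)) = (\<Sum>c\<in>X ` space M. g c * level_prob M X c)"
proof -
  have meas: "X -` {c} \<inter> space M \<in> events" for c using X by (auto intro: measurable_sets)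
  have eq: "g (X x) = (\<Sum>c\<in>X ` space M. g c * indicator (X -` {c} \<inter> space M) x)" if "x \<in> space M" for x
  proof -
    have "(\<Sum>c\<in>X ` space M. g c * indicator (X -` {c} \<inter> space M) x) = (\<Sum>c\<in>X ` space M. if c = X x then g c else 0)"
      using that by (intro sum.cong) (auto simp: indicator_def)
    then show ?thesis using that fin by simp
  qed
  have int: "integrable M (\<lambda>x. \<Sum>c\<in>X ` space M. g c * indicator (X -` {c} \<inter> space M) x)"
    using meas by (intro Bochner_Integration.integrable_sum integrable_mult_right integrable_real_indicator)
      (auto simp: emeasure_eq_measure)
  then show "integrable M (\<lambda>x. g (X x))" using eq by (subst Bochner_Integration.integrable_cong[OF refl eq])
  have "expectation (\<lambda>x. g (X x)) = expectation (\<lambda>x. \<Sum>c\<in>X ` space M. g c * indicator (X -` {c} \<inter> space M) x)"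
    by (intro Bochner_Integration.integral_cong refl eq)
  also have "\<dots> = (\<Sum>c\<in>X ` space M. expectation (\<lambda>x. g c * indicator (X -` {c} \<inter> space M) x))"
    using meas by (intro Bochner_Integration.integral_sum integrable_mult_right integrable_real_indicator)
      (auto simp: emeasure_eq_measure)
  also have "\<dots> = (\<Sum>c\<in>X ` space M. g c * level_prob M X c)"
    using meas by (simp add: level_prob_def)
  finally show "expectation (\<lambda>x. g (X x)) = (\<Sum>c\<in>X ` space M. g c * level_prob M X c)" .
qed

lemma AE_level_prob_pos:
  assumes X: "X \<in> measurable M (count_space UNIV)" and fin: "finite (X ` space M)"
  shows "AE x in M. level_prob M X (X x) > 0"
proof (rule AE_I')
  define C where "C = {c \<in> X ` space M. level_prob M X c = 0}"
  have "X -` {c} \<inter> space M \<in> null_sets M" if "c \<in> C" for c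
    using that X by (auto simp: C_def level_prob_def null_sets_def emeasure_eq_measure intro: measurable_sets)
  then show "(\<Union>c\<in>C. X -` {c} \<inter> space M) \<in> null_sets M"
    using fin by (intro null_sets_UN') (auto simp: C_def intro: countable_finite)
  show "{x \<in> space M. \<not> level_prob M X (X x) > 0} \<subseteq> (\<Union>c\<in>C. X -` {c} \<inter> space M)"
    by (auto simp: C_def level_prob_def zero_less_measure_iff)
qed

lemma label_entropy_expectation:
  assumes X: "X \<in> measurable M (count_space UNIV)" and fin: "finite (X ` space M)"
  shows "label_entropy M X = expectation (\<lambda>x. - ln (level_prob M X (X x)))"
  using level_sum_expectation(2)[OF X fin, of "\<lambda>c. - ln (level_prob M X c)"]
  by (simp add: label_entropy_def sum_negf mult.commute)

lemma level_prob_le_1: "level_prob M X c \<le> 1"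
  by (simp add: level_prob_def)

lemma label_entropy_nonneg: "0 \<le> label_entropy M X"
proof -
  have "level_prob M X c * ln (level_prob M X c) \<le> 0" for c
    using level_prob_le_1[of X c] by (cases "level_prob M X c = 0")
      (auto simp: level_prob_def mult_le_0_iff zero_less_measure_iff)
  then show ?thesis unfolding label_entropy_def by (simp add: sum_nonpos)
qed

lemma sum_level_prob:
  assumes X: "X \<in> measurable M (count_space UNIV)" and fin: "finite (X ` space M)"
  shows "(\<Sum>c\<in>X ` space M. level_prob M X c) = 1"
  using level_sum_expectation(2)[OF X fin, of "\<lambda>_. 1"] by (simp add: prob_space)

text \<open>Cross entropy bounds entropy, here with side information: \<rho> is a subprobability on
  pairs of a label and a value of \<open>Z\<close>, and the entropy of \<open>Z\<close> itself need
  not be finite. By \<open>ln R <= R - 1\<close>, where \<open>R\<close> is \<rho> over the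
  probability of the label, it is enough that \<open>R\<close> has mean at most one; this holds
  because a pair is at most as likely as its label.\<close>

lemma gibbs_inequality:
  fixes X :: "'a \<Rightarrow> 'c" and Z :: "'a \<Rightarrow> 'z::countable" and \<rho> :: "'c \<Rightarrow> 'z \<Rightarrow> real"
  assumes X: "X \<in> measurable M (count_space UNIV)" and fin: "finite (X ` space M)"
    and Z: "Z \<in> measurable M (count_space UNIV)"
    and nonneg: "\<And>c z. 0 \<le> \<rho> c z"
    and total: "(\<integral>\<^sup>+ z. (\<Sum>c\<in>X ` space M. ennreal (\<rho> c z)) \<partial>count_space UNIV) \<le> 1"
    and pos: "AE x in M. \<rho> (X x) (Z x) > 0"
    and int: "integrable M (\<lambda>x. - ln (\<rho> (X x) (Z x)))"
  shows "label_entropy M X \<le> expectation (\<lambda>x. - ln (\<rho> (X x) (Z x)))"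
proof -
  note Z[measurable]
  have meas[measurable]: "X -` {c} \<inter> space M \<in> events" for c using X by (auto intro: measurable_sets)
  let ?p = "\<lambda>x. level_prob M X (X x)"
  define R where "R = (\<lambda>x. \<rho> (X x) (Z x) / ?p x)"
  have Req: "R x = (\<Sum>c\<in>X ` space M. \<rho> c (Z x) / level_prob M X c * indicator (X -` {c} \<inter> space M) x)"
    if "x \<in> space M" for x
  proof -
    have "(\<Sum>c\<in>X ` space M. \<rho> c (Z x) / level_prob M X c * indicator (X -` {c} \<inter> space M) x) =
        (\<Sum>c\<in>X ` space M. if c = X x then \<rho> c (Z x) / level_prob M X c else 0)"
      using that by (intro sum.cong) (auto simp: indicator_def)
    then show ?thesis using that fin by (simp add: R_def)
  qed
  have Rmeas: "R \<in> borel_measurable M"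
    by (subst measurable_cong[OF Req]) auto
  have R0: "0 \<le> R x" for x using nonneg by (simp add: R_def level_prob_def)
  have part: "(\<integral>\<^sup>+ x. ennreal (\<rho> c (Z x) / level_prob M X c * indicator (X -` {c} \<inter> space M) x) \<partial>M) \<le>
      (\<integral>\<^sup>+ z. ennreal (\<rho> c z) \<partial>count_space UNIV)" for c
  proof -
    let ?f = "\<lambda>z. ennreal (\<rho> c z / level_prob M X c)"
    interpret P: pair_sigma_finite "count_space (UNIV :: 'z set)" M
      by (intro pair_sigma_finite.intro sigma_finite_measure_count_space sigma_finite_measure_axioms)
    have "(\<integral>\<^sup>+ x. ennreal (\<rho> c (Z x) / level_prob M X c * indicator (X -` {c} \<inter> space M) x) \<partial>M) =
      (\<integral>\<^sup>+ x. (\<integral>\<^sup>+ z. ?f z * indicator (X -` {c} \<inter> Z -` {z} \<inter> space M) x \<partial>count_space UNIV) \<partial>M)"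
    proof (intro nn_integral_cong)
      fix x assume x: "x \<in> space M"
      have "(\<integral>\<^sup>+ z. ?f z * indicator (X -` {c} \<inter> Z -` {z} \<inter> space M) x \<partial>count_space UNIV) =
        (\<integral>\<^sup>+ z. (?f z * indicator (X -` {c} \<inter> space M) x) * indicator {Z x} z \<partial>count_space UNIV)"
        using x by (intro nn_integral_cong) (auto simp: indicator_def)
      also have "\<dots> = ?f (Z x) * indicator (X -` {c} \<inter> space M) x"
        by (subst nn_integral_indicator_singleton) auto
      finally show "ennreal (\<rho> c (Z x) / level_prob M X c * indicator (X -` {c} \<inter> space M) x) =
        (\<integral>\<^sup>+ z. ?f z * indicator (X -` {c} \<inter> Z -` {z} \<inter> space M) x \<partial>count_space UNIV)"
        by (simp add: indicator_def)
    qed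
    also have "\<dots> = (\<integral>\<^sup>+ z. (\<integral>\<^sup>+ x. ?f z * indicator (X -` {c} \<inter> Z -` {z} \<inter> space M) x \<partial>M) \<partial>count_space UNIV)"
    proof (rule P.Fubini')
      have "X -` {c} \<inter> Z -` {z} \<inter> space M = (X -` {c} \<inter> space M) \<inter> (Z -` {z} \<inter> space M)" for z by auto
      then have [measurable]: "X -` {c} \<inter> Z -` {z} \<inter> space M \<in> events" for z
        using Z by (auto intro!: sets.Int measurable_sets)
      show "(\<lambda>(z, x). ?f z * indicator (X -` {c} \<inter> Z -` {z} \<inter> space M) x) \<in>
        borel_measurable (count_space UNIV \<Otimes>\<^sub>M M)"
        by (rule measurable_pair_measure_countable1) auto
    qed
    also have "\<dots> \<le> (\<integral>\<^sup>+ z. ennreal (\<rho> c z) \<partial>count_space UNIV)"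
    proof (intro nn_integral_mono)
      fix z
      have "X -` {c} \<inter> Z -` {z} \<inter> space M = (X -` {c} \<inter> space M) \<inter> (Z -` {z} \<inter> space M)" by auto
      then have m: "X -` {c} \<inter> Z -` {z} \<inter> space M \<in> events"
        using Z by (auto intro!: sets.Int measurable_sets)
      have "(\<integral>\<^sup>+ x. ?f z * indicator (X -` {c} \<inter> Z -` {z} \<inter> space M) x \<partial>M) =
         ?f z * ennreal (prob (X -` {c} \<inter> Z -` {z} \<inter> space M))"
        using m by (simp add: nn_integral_cmult_indicator emeasure_eq_measure)
      also have "\<dots> \<le> ?f z * ennreal (level_prob M X c)"
        unfolding level_prob_def using meas
        by (intro mult_left_mono ennreal_leI finite_measure_mono) auto
      also have "\<dots> \<le> ennreal (\<rho> c z)"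
        using nonneg[of c z] measure_nonneg[of M "X -` {c} \<inter> space M"]
        by (cases "level_prob M X c = 0") (auto simp: ennreal_mult'[symmetric] level_prob_def ennreal_mult[symmetric])
      finally show "(\<integral>\<^sup>+ x. ?f z * indicator (X -` {c} \<inter> Z -` {z} \<inter> space M) x \<partial>M) \<le> ennreal (\<rho> c z)" .
    qed
    finally show ?thesis .
  qed
  have "(\<integral>\<^sup>+ x. ennreal (R x) \<partial>M) = (\<integral>\<^sup>+ x. (\<Sum>c\<in>X ` space M.
      ennreal (\<rho> c (Z x) / level_prob M X c * indicator (X -` {c} \<inter> space M) x)) \<partial>M)"
    using nonneg by (intro nn_integral_cong, subst Req) (auto intro!: sum_ennreal[symmetric] mult_nonneg_nonneg divide_nonneg_nonneg simp: level_prob_def)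
  also have "\<dots> = (\<Sum>c\<in>X ` space M. \<integral>\<^sup>+ x. ennreal (\<rho> c (Z x) / level_prob M X c * indicator (X -` {c} \<inter> space M) x) \<partial>M)"
    by (rule nn_integral_sum) auto
  also have "\<dots> \<le> (\<Sum>c\<in>X ` space M. \<integral>\<^sup>+ z. ennreal (\<rho> c z) \<partial>count_space UNIV)"
    by (intro sum_mono part)
  also have "\<dots> = (\<integral>\<^sup>+ z. (\<Sum>c\<in>X ` space M. ennreal (\<rho> c z)) \<partial>count_space UNIV)"
    by (rule nn_integral_sum[symmetric]) auto
  finally have R1: "(\<integral>\<^sup>+ x. ennreal (R x) \<partial>M) \<le> 1" using total by simp
  have Rint: "integrable M R"
    using R1 R0 Rmeas by (intro integrableI_nonneg) (auto intro: le_less_trans)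
  have ER: "expectation R \<le> 1"
    using nn_integral_eq_integral[OF Rint] R0 R1 by (auto simp: ennreal_le_1)
  have intp: "integrable M (\<lambda>x. - ln (?p x))" using level_sum_expectation(1)[OF X fin] .
  have "label_entropy M X - expectation (\<lambda>x. - ln (\<rho> (X x) (Z x))) =
      expectation (\<lambda>x. - ln (?p x) - - ln (\<rho> (X x) (Z x)))"
    unfolding label_entropy_expectation[OF X fin]
    by (rule Bochner_Integration.integral_diff[OF intp int, symmetric])
  also have "\<dots> \<le> expectation (\<lambda>x. R x - 1)"
  proof (rule integral_mono_AE)
    show "integrable M (\<lambda>x. - ln (?p x) - - ln (\<rho> (X x) (Z x)))"
      using intp int by (rule Bochner_Integration.integrable_diff)
    show "integrable M (\<lambda>x. R x - 1)" using Rint by simp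
    show "AE x in M. - ln (?p x) - - ln (\<rho> (X x) (Z x)) \<le> R x - 1"
      using pos AE_level_prob_pos[OF X fin]
    proof eventually_elim
      case (elim x)
      then have "ln (R x) = ln (\<rho> (X x) (Z x)) - ln (?p x)" by (simp add: R_def ln_div)
      moreover have "ln (R x) \<le> R x - 1" using elim by (intro ln_le_minus_one) (simp add: R_def)
      ultimately show ?case by simp
    qed
  qed
  also have "\<dots> = expectation R - 1" using Rint by (simp add: prob_space)
  finally show ?thesis using ER by simp
qed

end

text \<open>Fekete's argument: division with remainder by \<open>m\<close> bounds the quotients by
  \<open>a m / m\<close> plus a bounded remainder over \<open>n\<close>, while every quotient is at
  least the infimum.\<close>

lemma subadditive_limit:
  fixes a :: "nat \<Rightarrow> real"
  assumes sub: "\<And>m n. a (m + n) \<le> a m + a n" and nonneg: "\<And>n. 0 \<le> a n"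
  shows "convergent (\<lambda>n. a (Suc n) / real (Suc n))"
proof -
  define L where "L = (INF n. a (Suc n) / real (Suc n))"
  have bdd: "bdd_below (range (\<lambda>n. a (Suc n) / real (Suc n)))"
    by (rule bdd_belowI[of _ 0]) (auto simp: nonneg)
  have L_le: "L \<le> a (Suc n) / real (Suc n)" for n unfolding L_def by (rule cINF_lower[OF bdd]) simp
  have mult: "a (q * m + r) \<le> real q * a m + a r" for q m r
  proof (induction q)
    case (Suc q)
    have "a (Suc q * m + r) = a (m + (q * m + r))" by (simp add: add_ac)
    also have "\<dots> \<le> a m + a (q * m + r)" by (rule sub)
    finally show ?case using Suc by (simp add: algebra_simps)
  qed simp
  have "(\<lambda>n. a (Suc n) / real (Suc n)) \<longlonglongrightarrow> L"
  proof (rule order_tendstoI)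
    fix b assume "b < L"
    then show "\<forall>\<^sub>F n in sequentially. b < a (Suc n) / real (Suc n)"
      by (intro always_eventually allI less_le_trans[OF _ L_le])
  next
    fix b assume "L < b"
    then obtain k where k: "a (Suc k) / real (Suc k) < b"
      unfolding L_def using cINF_less_iff[OF _ bdd] by auto
    define m where "m = Suc k"
    define C where "C = Max (a ` {..<m})"
    have C: "a r \<le> C" if "r < m" for r unfolding C_def using that by (intro Max_ge) auto
    have "(\<lambda>n. a m / real m + C / real (Suc n)) \<longlonglongrightarrow> a m / real m + 0"
      by (intro tendsto_add tendsto_const LIMSEQ_Suc[OF lim_const_over_n])
    then have "\<forall>\<^sub>F n in sequentially. a m / real m + C / real (Suc n) < b"
      by (rule order_tendstoD) (use k in \<open>simp add: m_def\<close>)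
    then show "\<forall>\<^sub>F n in sequentially. a (Suc n) / real (Suc n) < b"
    proof eventually_elim
      case (elim n)
      define q where "q = Suc n div m"
      define r where "r = Suc n mod m"
      have n: "Suc n = q * m + r" "r < m"
        unfolding q_def r_def by (simp, simp add: m_def)
      have "a (Suc n) \<le> real q * a m + C" using mult[of q m r] C[OF n(2)] n by simp
      also have "real q * a m = (real q * real m) * (a m / real m)" by (simp add: m_def)
      also have "\<dots> \<le> real (Suc n) * (a m / real m)"
      proof (rule mult_right_mono)
        show "real q * real m \<le> real (Suc n)" using n(1) by (metis le_add1 of_nat_le_iff of_nat_mult)
        show "0 \<le> a m / real m" using nonneg by simp
      qed
      finally have "a (Suc n) / real (Suc n) \<le> (real (Suc n) * (a m / real m) + C) / real (Suc n)"
        by (intro divide_right_mono) auto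
      also have "\<dots> = a m / real m + C / real (Suc n)" by (simp add: add_divide_distrib)
      finally show ?case using elim by simp
    qed
  qed
  then show ?thesis by (auto simp: convergent_def)
qed

section \<open>Itineraries of a measure preserving map\<close>

locale measure_preserving = prob_space M for M :: "'a measure" +
  fixes T :: "'a \<Rightarrow> 'a"
  assumes T_meas: "T \<in> measurable M M" and T_distr: "distr M M T = M"
begin

lemma T_iter_meas: "(T ^^ k) \<in> measurable M M"
proof (induction k)
  case (Suc k) then show ?case using measurable_comp[OF Suc T_meas] by (simp add: comp_def)
qed simp

lemma T_iter_space: "x \<in> space M \<Longrightarrow> (T ^^ k) x \<in> space M"
  using T_iter_meas[of k] by (rule measurable_space)

lemma T_iter_distr: "distr M M (T ^^ k) = M"
proof (induction k)
  case (Suc k)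
  have "distr M M (T ^^ Suc k) = distr (distr M M (T ^^ k)) M T"
    by (simp add: distr_distr[OF T_meas T_iter_meas] comp_def)
  then show ?case using Suc T_distr by (simp add: comp_def)
qed (simp add: distr_id)

lemma expectation_T_iter:
  assumes "f \<in> borel_measurable M"
  shows "expectation (\<lambda>x. f ((T ^^ k) x)) = expectation (f :: 'a \<Rightarrow> real)"
  using integral_distr[OF T_iter_meas[of k] assms] by (simp add: T_iter_distr)

lemma integrable_T_iter:
  assumes "integrable M (f :: 'a \<Rightarrow> real)"
  shows "integrable M (\<lambda>x. f ((T ^^ k) x))"
  using integrable_distr[OF T_iter_meas[of k], of f] assms by (simp add: T_iter_distr)

lemma prob_T_iter:
  assumes "B \<in> events" shows "prob ((T ^^ k) -` B \<inter> space M) = prob B"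
  using measure_distr[OF T_iter_meas[of k] assms] by (simp add: T_iter_distr)

definition itinerary :: "('a \<Rightarrow> 'b) \<Rightarrow> nat \<Rightarrow> 'a \<Rightarrow> 'b list" where
  "itinerary b n x = map (\<lambda>k. b ((T ^^ k) x)) [0..<n]"

lemma length_itinerary [simp]: "length (itinerary b n x) = n"
  by (simp add: itinerary_def)

lemma itinerary_nth: "k < n \<Longrightarrow> itinerary b n x ! k = b ((T ^^ k) x)"
  by (simp add: itinerary_def)

lemma itinerary_eq_iff: "itinerary b n x = c \<longleftrightarrow> length c = n \<and> (\<forall>k<n. b ((T ^^ k) x) = c ! k)"
  by (auto simp: list_eq_iff_nth_eq itinerary_nth)

lemma take_itinerary: "take m (itinerary b (m + n) x) = itinerary b m x"
  by (rule nth_equalityI) (auto simp: itinerary_nth)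

lemma drop_itinerary: "drop m (itinerary b (m + n) x) = itinerary b n ((T ^^ m) x)"
  by (rule nth_equalityI) (auto simp: itinerary_nth funpow_add add.commute[of m])

lemma itinerary_measurable:
  assumes b: "b \<in> measurable M (count_space UNIV)" and fin: "finite (b ` space M)"
  shows "itinerary b n \<in> measurable M (count_space UNIV)" "finite (itinerary b n ` space M)"
proof -
  have "itinerary b n ` space M \<subseteq> {c. set c \<subseteq> b ` space M \<and> length c = n}"
    using T_iter_space by (auto simp: itinerary_def)
  then show fin': "finite (itinerary b n ` space M)"
    using finite_lists_length_eq[OF fin] by (rule finite_subset)
  have "itinerary b n -` {c} \<inter> space M \<in> events" for c
  proof (cases "length c = n")
    case True
    have "b -` {c ! k} \<inter> space M \<in> events" for k using b by (auto intro: measurable_sets)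
    then have *: "(T ^^ k) -` (b -` {c ! k} \<inter> space M) \<inter> space M \<in> events" for k
      by (rule measurable_sets[OF T_iter_meas])
    have "itinerary b n -` {c} \<inter> space M =
        (if n = 0 then space M else (\<Inter>k<n. (T ^^ k) -` (b -` {c ! k} \<inter> space M) \<inter> space M))"
      using True T_iter_space by (auto simp: itinerary_eq_iff)
    also have "\<dots> \<in> events"
    proof (cases "n = 0")
      case False
      have "(\<Inter>k<n. (T ^^ k) -` (b -` {c ! k} \<inter> space M) \<inter> space M) \<in> events"
        by (rule sets.finite_INT[OF _ _ *]) (use False in auto)
      with False show ?thesis by (simp only: if_False)
    qed simp
    finally show ?thesis .
  next
    case False
    then have "itinerary b n -` {c} \<inter> space M = {}" by (auto simp: itinerary_eq_iff)
    then show ?thesis by simp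
  qed
  then show "itinerary b n \<in> measurable M (count_space UNIV)" by (rule measurable_finite_range[OF fin'])
qed

text \<open>Gibbs inequality for the model in which the first \<open>m\<close> and the last
  \<open>n\<close> labels are independent, each block with its true law; the side information is
  trivial. Invariance makes the second block cost as much as an initial one.\<close>

lemma label_entropy_itinerary_subadditive:
  assumes b: "b \<in> measurable M (count_space UNIV)" and fin: "finite (b ` space M)"
  shows "label_entropy M (itinerary b (m + n)) \<le> label_entropy M (itinerary b m) + label_entropy M (itinerary b n)"
proof -
  note I = itinerary_measurable[OF b fin]
  let ?P = "\<lambda>n. level_prob M (itinerary b n)"
  define \<rho> where "\<rho> = (\<lambda>c (_::unit). ?P m (take m c) * ?P n (drop m c))"
  have \<rho>eq: "\<rho> (itinerary b (m + n) x) z = ?P m (itinerary b m x) * ?P n (itinerary b n ((T ^^ m) x))" for x z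
    by (simp add: \<rho>_def take_itinerary drop_itinerary)
  have AEpos: "AE x in M. ?P m (itinerary b m x) > 0 \<and> ?P n (itinerary b n ((T ^^ m) x)) > 0"
  proof -
    have "AE x in distr M M (T ^^ m). ?P n (itinerary b n x) > 0"
      unfolding T_iter_distr by (rule AE_level_prob_pos[OF I])
    then have "AE x in M. ?P n (itinerary b n ((T ^^ m) x)) > 0"
      by (rule AE_distrD[OF T_iter_meas])
    with AE_level_prob_pos[OF I, of m] show ?thesis by eventually_elim simp
  qed
  have i1: "integrable M (\<lambda>x. - ln (?P k (itinerary b k x)))" for k
    using level_sum_expectation(1)[OF I, of "\<lambda>c. - ln (?P k c)" k] .
  have i2: "integrable M (\<lambda>x. - ln (?P n (itinerary b n ((T ^^ m) x))))"
    by (rule integrable_T_iter[OF i1])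
  have AEeq: "AE x in M. - ln (\<rho> (itinerary b (m + n) x) ()) =
     - ln (?P m (itinerary b m x)) + - ln (?P n (itinerary b n ((T ^^ m) x)))"
    using AEpos by eventually_elim (auto simp: \<rho>eq ln_mult)
  have meas: "(\<lambda>x. - ln (\<rho> (itinerary b (m + n) x) ())) \<in> borel_measurable M"
    using level_sum_expectation(1)[OF I, of "\<lambda>c. - ln (\<rho> c ())" "m + n"] by auto
  have "label_entropy M (itinerary b (m + n)) \<le> expectation (\<lambda>x. - ln (\<rho> (itinerary b (m + n) x) ()))"
  proof (rule gibbs_inequality[OF I, of "\<lambda>_. ()"])
    show "0 \<le> \<rho> c z" for c z by (simp add: \<rho>_def level_prob_def)
    let ?X = "\<lambda>n. itinerary b n ` space M"
    have inj: "inj_on (\<lambda>c. (take m c, drop m c)) (?X (m + n))"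
      by (rule inj_onI) (metis append_take_drop_id prod.inject)
    have "(\<Sum>c\<in>?X (m + n). \<rho> c ()) = (\<Sum>p\<in>(\<lambda>c. (take m c, drop m c)) ` ?X (m + n). ?P m (fst p) * ?P n (snd p))"
      by (subst sum.reindex[OF inj]) (simp add: \<rho>_def)
    also have "\<dots> \<le> (\<Sum>p\<in>?X m \<times> ?X n. ?P m (fst p) * ?P n (snd p))"
      using I(2) T_iter_space by (intro sum_mono2) (auto simp: level_prob_def take_itinerary drop_itinerary)
    also have "\<dots> = (\<Sum>c\<in>?X m. ?P m c) * (\<Sum>c\<in>?X n. ?P n c)"
      by (simp add: sum_product sum.cartesian_product case_prod_beta)
    also have "\<dots> = 1" by (simp add: sum_level_prob[OF I])
    finally have "(\<Sum>c\<in>?X (m + n). \<rho> c ()) \<le> 1" .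
    then have "(\<Sum>c\<in>?X (m + n). ennreal (\<rho> c ())) \<le> 1"
      by (subst sum_ennreal) (auto simp: \<rho>_def level_prob_def ennreal_le_1)
    then show "(\<integral>\<^sup>+ z. (\<Sum>c\<in>?X (m + n). ennreal (\<rho> c z)) \<partial>count_space UNIV) \<le> 1"
      by (simp add: nn_integral_count_space_finite UNIV_unit)
    show "AE x in M. \<rho> (itinerary b (m + n) x) () > 0"
      using AEpos by eventually_elim (simp add: \<rho>eq)
    show "integrable M (\<lambda>x. - ln (\<rho> (itinerary b (m + n) x) ()))"
      using level_sum_expectation(1)[OF I, of "\<lambda>c. - ln (\<rho> c ())" "m + n"] .
  qed auto
  also have "\<dots> = expectation (\<lambda>x. - ln (?P m (itinerary b m x)) + - ln (?P n (itinerary b n ((T ^^ m) x))))"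
    using AEeq meas i1[of m] i2 by (intro integral_cong_AE) auto
  also have "\<dots> = expectation (\<lambda>x. - ln (?P m (itinerary b m x))) + expectation (\<lambda>x. - ln (?P n (itinerary b n ((T ^^ m) x))))"
    by (rule Bochner_Integration.integral_add[OF i1 i2])
  also have "expectation (\<lambda>x. - ln (?P n (itinerary b n ((T ^^ m) x)))) = expectation (\<lambda>x. - ln (?P n (itinerary b n x)))"
    using i1[of n] by (intro expectation_T_iter) auto
  finally show ?thesis unfolding label_entropy_expectation[OF I] .
qed

definition cell :: "'a set set \<Rightarrow> 'a \<Rightarrow> 'a set" where
  "cell P x = (THE B. B \<in> P \<and> x \<in> B)"

lemma cell:
  assumes P: "fin_partition M P" and x: "x \<in> space M"
  shows "cell P x \<in> P" "x \<in> cell P x" "B \<in> P \<Longrightarrow> x \<in> B \<Longrightarrow> cell P x = B"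
proof -
  have eq: "cell P x = B" if "B \<in> P" "x \<in> B" for B
    unfolding cell_def
  proof (intro the_equality)
    fix C assume "C \<in> P \<and> x \<in> C"
    then show "C = B" using that P unfolding fin_partition_def disjoint_def by blast
  qed (use that in simp)
  moreover obtain B0 where B: "B0 \<in> P" "x \<in> B0" using P x by (auto simp: fin_partition_def)
  ultimately show "cell P x \<in> P" "x \<in> cell P x" "B \<in> P \<Longrightarrow> x \<in> B \<Longrightarrow> cell P x = B" by auto
qed

lemma cell_measurable:
  assumes P: "fin_partition M P"
  shows "cell P \<in> measurable M (count_space UNIV)" "finite (cell P ` space M)"
proof -
  show fin: "finite (cell P ` space M)"
    by (rule finite_subset[of _ P]) (use P cell(1)[OF P] in \<open>auto simp: fin_partition_def\<close>)
  have "cell P -` {B} \<inter> space M \<in> events" for B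
  proof (cases "B \<in> P")
    case True
    then have "B \<subseteq> space M" using P by (auto simp: fin_partition_def)
    then have "cell P -` {B} \<inter> space M = B" using cell[OF P] True by blast
    then show ?thesis using True P by (auto simp: fin_partition_def)
  next
    case False
    then have "cell P -` {B} \<inter> space M = {}" using cell(1)[OF P] by auto
    then show ?thesis by simp
  qed
  then show "cell P \<in> measurable M (count_space UNIV)" by (rule measurable_finite_range[OF fin])
qed

text \<open>Atoms of the join are the sets of points with a common itinerary. As
  \<open>iter_join\<close> discards the empty set, they correspond bijectively to the itineraries
  that occur, so both entropies sum the same terms.\<close>

lemma part_entropy_iter_join:
  assumes P: "fin_partition M P"
  shows "part_entropy M (iter_join M T P n) = label_entropy M (itinerary (cell P) n)"
proof -
  let ?X = "itinerary (cell P) n"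
  let ?atom = "\<lambda>c. ?X -` {c} \<inter> space M"
  have atom_eq: "(\<Inter>i<n. (T ^^ i) -` f i) \<inter> space M = ?atom (map f [0..<n])" if f: "\<forall>i<n. f i \<in> P" for f
  proof (intro set_eqI iffI)
    fix x assume x: "x \<in> (\<Inter>i<n. (T ^^ i) -` f i) \<inter> space M"
    then have "cell P ((T ^^ k) x) = f k" if "k < n" for k
      using that f by (intro cell(3)[OF P]) (auto intro: T_iter_space)
    with x show "x \<in> ?atom (map f [0..<n])" by (auto simp: itinerary_eq_iff)
  next
    fix x assume x: "x \<in> ?atom (map f [0..<n])"
    then have "(T ^^ k) x \<in> f k" if "k < n" for k
      using cell(2)[OF P T_iter_space, of x k] that by (auto simp: itinerary_eq_iff)
    with x show "x \<in> (\<Inter>i<n. (T ^^ i) -` f i) \<inter> space M" by auto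
  qed
  have join: "iter_join M T P n = ?atom ` (?X ` space M)"
  proof (intro set_eqI iffI)
    fix S assume "S \<in> iter_join M T P n"
    then obtain f where f: "\<forall>i<n. f i \<in> P" "S = (\<Inter>i<n. (T ^^ i) -` f i) \<inter> space M" "S \<noteq> {}"
      by (auto simp: iter_join_def)
    then have S: "S = ?atom (map f [0..<n])" by (simp add: atom_eq)
    with f(3) obtain x where "x \<in> space M" "?X x = map f [0..<n]" by auto
    then show "S \<in> ?atom ` (?X ` space M)" unfolding S by (metis imageI)
  next
    fix S assume "S \<in> ?atom ` (?X ` space M)"
    then obtain x where x: "x \<in> space M" "S = ?atom (?X x)" by auto
    define f where "f = (\<lambda>i. cell P ((T ^^ i) x))"
    have fP: "\<forall>i<n. f i \<in> P" using cell(1)[OF P T_iter_space[OF x(1)]] by (simp add: f_def)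
    have "?X x = map f [0..<n]" by (simp add: itinerary_def f_def)
    then have S: "S = (\<Inter>i<n. (T ^^ i) -` f i) \<inter> space M" using atom_eq[OF fP] x(2) by simp
    moreover have "S \<noteq> {}" using x by auto
    ultimately show "S \<in> iter_join M T P n" unfolding iter_join_def using fP by blast
  qed
  have "inj_on ?atom (?X ` space M)"
    by (rule inj_onI) (auto simp: set_eq_iff)
  then show ?thesis
    unfolding part_entropy_def join label_entropy_def level_prob_def by (subst sum.reindex) auto
qed

lemma entropy_wrt_limit:
  assumes P: "fin_partition M P"
  shows "(\<lambda>n. label_entropy M (itinerary (cell P) (Suc n)) / real (Suc n)) \<longlonglongrightarrow> entropy_wrt M T P"
proof -
  have "convergent (\<lambda>n. label_entropy M (itinerary (cell P) (Suc n)) / real (Suc n))"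
    by (intro subadditive_limit label_entropy_itinerary_subadditive cell_measurable P label_entropy_nonneg)
  then show ?thesis unfolding entropy_wrt_def part_entropy_iter_join[OF P]
    by (simp add: convergent_LIMSEQ_iff)
qed

lemma entropy_wrt_nonneg: "fin_partition M P \<Longrightarrow> 0 \<le> entropy_wrt M T P"
  by (rule LIMSEQ_le_const[OF entropy_wrt_limit]) (auto simp: label_entropy_nonneg)

lemma metric_entropy_nonneg: "0 \<le> metric_entropy M T"
proof -
  have P: "fin_partition M {space M}" by (auto simp: fin_partition_def disjoint_def)
  have "0 \<le> ereal (entropy_wrt M T {space M})" using entropy_wrt_nonneg[OF P] by simp
  also have "\<dots> \<le> metric_entropy M T" unfolding metric_entropy_def using P by (intro SUP_upper) auto
  finally show ?thesis .
qed

end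

section \<open>Entropy bounds by models on words\<close>

definition word :: "nat \<Rightarrow> (nat \<Rightarrow> nat) \<Rightarrow> nat list" where
  "word n x = map x [0..<n]"

lemma length_word [simp]: "length (word n x) = n"
  by (simp add: word_def)

lemma word_nth: "k < n \<Longrightarrow> word n x ! k = x k"
  by (simp add: word_def)

lemma word_Suc: "word (Suc n) x = word n x @ [x n]"
  by (simp add: word_def)

lemma take_word: "k \<le> n \<Longrightarrow> take k (word n x) = word k x"
  by (simp add: word_def take_map)

lemma word_eq_iff: "word n x = w \<longleftrightarrow> length w = n \<and> (\<forall>k<n. x k = w ! k)"
  by (auto simp: list_eq_iff_nth_eq word_nth)

lemma shift_iter: "(shift ^^ k) x = (\<lambda>i. x (i + k))"
  by (induction k) (auto simp: shift_def)

lemma drop_word: "drop k (word (k + n) x) = word n ((shift ^^ k) x)"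
  by (rule nth_equalityI) (auto simp: word_nth shift_iter add.commute)

lemma sets_borel_sequences:
  "sets (borel :: (nat \<Rightarrow> nat) measure) = sigma_sets UNIV {{x. x i \<in> S} |i S. True}"
proof -
  have "sets (borel :: (nat \<Rightarrow> nat) measure) = sets (Pi\<^sub>M UNIV (\<lambda>i::nat. borel :: nat measure))"
    by (rule sets_PiM_equal_borel[symmetric])
  also have "\<dots> = sigma_sets UNIV {{x. x i \<in> S} |i S. True}"
    unfolding sets_PiM_single by (simp add: sets_borel_eq_count_space PiE_UNIV_domain)
  finally show ?thesis .
qed

lemma sum_lessThan_add: "(\<Sum>k<a + b. f k) = (\<Sum>k<a. f k) + (\<Sum>k<b. f (a + k) :: real)" for a b :: nat
  by (induction b) (auto simp: add_ac)

locale shift_measure =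
  fixes A :: "nat \<Rightarrow> nat \<Rightarrow> bool" and M :: "(nat \<Rightarrow> nat) measure"
  assumes inv: "inv_prob A M"

sublocale shift_measure \<subseteq> measure_preserving M shift
  using inv by (auto simp: inv_prob_def measure_preserving_def measure_preserving_axioms_def)

context shift_measure
begin

lemma space_M: "space M = CMS A" and sets_M: "sets M = sets (restrict_space borel (CMS A))"
  using inv by (auto simp: inv_prob_def)

lemma coordinate_measurable [measurable]: "(\<lambda>x. x i) \<in> measurable M (count_space UNIV)"
proof -
  have "(\<lambda>x::nat \<Rightarrow> nat. x i) \<in> borel_measurable borel"
    by (intro borel_measurable_continuous_onI) simp
  then have "(\<lambda>x::nat \<Rightarrow> nat. x i) \<in> borel_measurable (restrict_space borel (CMS A))"
    by (rule measurable_restrict_space1)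
  then show ?thesis
    by (simp add: measurable_cong_sets[OF sets_M refl] measurable_cong_sets[OF refl sets_borel_eq_count_space])
qed

lemma word_measurable [measurable]: "word n \<in> measurable M (count_space UNIV)"
proof -
  have "word n -` {w} \<inter> space M = {x \<in> space M. length w = n \<and> (\<forall>k<n. x k = w ! k)}" for w
    by (auto simp: word_eq_iff word_nth)
  moreover have "{x \<in> space M. length w = n \<and> (\<forall>k<n. x k = w ! k)} \<in> events" for w by measurable
  ultimately show ?thesis by (simp add: measurable_count_space_eq2_countable)
qed

lemma word_function_measurable: "(\<lambda>x. f (word n x)) \<in> measurable M (count_space UNIV)"
  by (rule measurable_compose[OF word_measurable]) simp

lemma events_eq: "events = {CMS A \<inter> B |B. B \<in> sets borel}"
  by (auto simp: sets_M sets_restrict_space)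

text \<open>The sets that can be approximated by a test on finitely many coordinates include the
  generators and are closed under complements and countable unions.\<close>

lemma cylinder_approx:
  assumes "B \<in> events" "\<epsilon> > 0"
  shows "\<exists>m \<beta>. prob {x \<in> space M. (x \<in> B) \<noteq> \<beta> (word m x)} < \<epsilon>"
proof -
  have meas: "{x \<in> space M. (x \<in> B') \<noteq> \<beta> (word m x)} \<in> events" if "B' \<in> sets borel" for B' m and \<beta> :: "nat list \<Rightarrow> bool"
  proof -
    have "CMS A \<inter> B' \<in> events" using that by (auto simp: events_eq)
    moreover have "{x \<in> space M. \<beta> (word m x)} \<in> events"
      using word_function_measurable[of \<beta> m] by (simp add: pred_def)
    moreover have "{x \<in> space M. (x \<in> B') \<noteq> \<beta> (word m x)} =
      ((CMS A \<inter> B') - {x \<in> space M. \<beta> (word m x)}) \<union> ({x \<in> space M. \<beta> (word m x)} - (CMS A \<inter> B'))"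
      by (auto simp: space_M)
    ultimately show ?thesis by auto
  qed
  have "\<exists>m \<beta>. prob {x \<in> space M. (x \<in> B') \<noteq> \<beta> (word m x)} < \<epsilon>"
    if "B' \<in> sets borel" "\<epsilon> > 0" for B' \<epsilon>
    using that(1)[unfolded sets_borel_sequences] that(2)
  proof (induction B' arbitrary: \<epsilon> rule: sigma_sets.induct)
    case (Basic a)
    then obtain i S where a: "a = {x. x i \<in> S}" by auto
    have eq: "{x \<in> space M. (x \<in> a) \<noteq> (word (Suc i) x ! i \<in> S)} = {}" by (auto simp: a word_nth)
    have "prob {x \<in> space M. (x \<in> a) \<noteq> (word (Suc i) x ! i \<in> S)} < \<epsilon>"
      unfolding eq using Basic by simp
    then show ?case by (intro exI[of _ "Suc i"] exI[of _ "\<lambda>w. w ! i \<in> S"])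
  next
    case Empty
    have "prob {x \<in> space M. (x \<in> {}) \<noteq> False} < \<epsilon>" using Empty by simp
    then show ?case by (intro exI[of _ 0] exI[of _ "\<lambda>_. False"])
  next
    case (Compl a)
    then obtain m \<beta> where "prob {x \<in> space M. (x \<in> a) \<noteq> \<beta> (word m x)} < \<epsilon>" by blast
    then have "prob {x \<in> space M. (x \<in> UNIV - a) \<noteq> (\<not> \<beta> (word m x))} < \<epsilon>" by simp
    then show ?case by (intro exI[of _ m] exI[of _ "\<lambda>w. \<not> \<beta> w"])
  next
    case (Union a)
    have aB: "a n \<in> sets borel" for n using Union(1) by (simp add: sets_borel_sequences)
    define U where "U = (\<lambda>N. CMS A \<inter> (\<Union>n<N. a n))"
    have Uev: "U N \<in> events" for N
      unfolding U_def events_eq by (intro CollectI exI[of _ "\<Union>n<N. a n"] conjI refl sets.finite_UN) (auto intro: aB)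
    have "incseq U" by (fastforce simp: incseq_def U_def)
    then have "(\<lambda>N. prob (U N)) \<longlonglongrightarrow> prob (\<Union>N. U N)"
      using Uev by (intro finite_Lim_measure_incseq) auto
    moreover have Uall: "(\<Union>N. U N) = CMS A \<inter> (\<Union>n. a n)" by (auto simp: U_def)
    ultimately have "(\<lambda>N. prob (U N)) \<longlonglongrightarrow> prob (CMS A \<inter> (\<Union>n. a n))" by simp
    then have "\<forall>\<^sub>F N in sequentially. prob (CMS A \<inter> (\<Union>n. a n)) - \<epsilon> / 2 < prob (U N)"
      by (rule order_tendstoD) (use Union in simp)
    \<comment> \<open>Half of the error is spent on cutting the union at \<open>N\<close>; the other
      half is shared by the \<open>N\<close> sets that remain.\<close>
    then obtain N where N: "prob (CMS A \<inter> (\<Union>n. a n)) - \<epsilon> / 2 < prob (U N)"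
      by (auto simp: eventually_sequentially)
    have "\<forall>n. \<exists>p. prob {x \<in> space M. (x \<in> a n) \<noteq> snd p (word (fst p) x)} < \<epsilon> / (2 * (real N + 1))"
    proof
      fix n
      obtain m \<beta> where "prob {x \<in> space M. (x \<in> a n) \<noteq> \<beta> (word m x)} < \<epsilon> / (2 * (real N + 1))"
        using Union.IH[of "\<epsilon> / (2 * (real N + 1))" n] Union.prems by auto
      then have "prob {x \<in> space M. (x \<in> a n) \<noteq> snd (m, \<beta>) (word (fst (m, \<beta>)) x)} < \<epsilon> / (2 * (real N + 1))" by simp
      then show "\<exists>p. prob {x \<in> space M. (x \<in> a n) \<noteq> snd p (word (fst p) x)} < \<epsilon> / (2 * (real N + 1))" by blast
    qed
    from choice[OF this] obtain f where
      f: "\<forall>n. prob {x \<in> space M. (x \<in> a n) \<noteq> snd (f n) (word (fst (f n)) x)} < \<epsilon> / (2 * (real N + 1))" by blast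
    define m where "m = (\<lambda>n. fst (f n))"
    define \<beta> where "\<beta> = (\<lambda>n. snd (f n))"
    have m: "prob {x \<in> space M. (x \<in> a n) \<noteq> \<beta> n (word (m n) x)} < \<epsilon> / (2 * (real N + 1))" for n
      using f by (simp add: m_def \<beta>_def)
    define K where "K = (\<Sum>n<N. m n)"
    have K: "m n \<le> K" if "n < N" for n unfolding K_def using that by (intro member_le_sum) auto
    define \<gamma> where "\<gamma> = (\<lambda>w. \<exists>n<N. \<beta> n (take (m n) w))"
    define D where "D = CMS A \<inter> (\<Union>n. a n) - U N"
    define E where "E = (\<lambda>n. {x \<in> space M. (x \<in> a n) \<noteq> \<beta> n (word (m n) x)})"
    have all: "CMS A \<inter> (\<Union>n. a n) \<in> events"
      unfolding events_eq by (intro CollectI exI[of _ "\<Union>n. a n"] conjI refl sets.countable_UN) (auto intro: aB)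
    have D: "D \<in> events" "prob D < \<epsilon> / 2"
    proof -
      show "D \<in> events" unfolding D_def using all Uev by auto
      have "prob D = prob (CMS A \<inter> (\<Union>n. a n)) - prob (U N)"
        unfolding D_def by (rule finite_measure_Diff[OF all Uev]) (auto simp: U_def)
      then show "prob D < \<epsilon> / 2" using N by simp
    qed
    have E: "E n \<in> events" for n unfolding E_def by (rule meas[OF aB])
    have "{x \<in> space M. (x \<in> (\<Union>n. a n)) \<noteq> \<gamma> (word K x)} \<subseteq> D \<union> (\<Union>n<N. E n)"
    proof
      fix x assume x: "x \<in> {x \<in> space M. (x \<in> (\<Union>n. a n)) \<noteq> \<gamma> (word K x)}"
      show "x \<in> D \<union> (\<Union>n<N. E n)"
      proof (rule ccontr)
        assume no: "x \<notin> D \<union> (\<Union>n<N. E n)"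
        then have "(x \<in> a n) = \<beta> n (word (m n) x)" if "n < N" for n using that x by (auto simp: E_def)
        then have "\<gamma> (word K x) \<longleftrightarrow> (\<exists>n<N. x \<in> a n)" unfolding \<gamma>_def using K by (auto simp: take_word)
        moreover have "x \<in> (\<Union>n. a n) \<longleftrightarrow> (\<exists>n<N. x \<in> a n)" using no x by (auto simp: D_def U_def space_M)
        ultimately show False using x by auto
      qed
    qed
    then have "prob {x \<in> space M. (x \<in> (\<Union>n. a n)) \<noteq> \<gamma> (word K x)} \<le> prob (D \<union> (\<Union>n<N. E n))"
      using D E by (intro finite_measure_mono) auto
    also have "\<dots> \<le> prob D + prob (\<Union>n<N. E n)" using D E by (intro measure_Un_le) auto
    also have "prob (\<Union>n<N. E n) \<le> (\<Sum>n<N. prob (E n))" using E by (intro finite_measure_subadditive_finite) auto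
    also have "\<dots> \<le> (\<Sum>n<N. \<epsilon> / (2 * (real N + 1)))"
      unfolding E_def by (rule sum_mono) (rule less_imp_le[OF m])
    also have "\<dots> \<le> \<epsilon> / 2" using Union.prems by (simp add: field_simps)
    finally have "prob {x \<in> space M. (x \<in> (\<Union>n. a n)) \<noteq> \<gamma> (word K x)} < \<epsilon>" using D by simp
    then show ?case by blast
  qed
  moreover obtain B' where B': "B = CMS A \<inter> B'" "B' \<in> sets borel" using assms by (auto simp: events_eq)
  ultimately obtain m \<beta> where "prob {x \<in> space M. (x \<in> B') \<noteq> \<beta> (word m x)} < \<epsilon>" using assms by blast
  moreover have "{x \<in> space M. (x \<in> B) \<noteq> \<beta> (word m x)} = {x \<in> space M. (x \<in> B') \<noteq> \<beta> (word m x)}"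
    by (auto simp: B' space_M)
  ultimately show ?thesis by metis
qed

text \<open>Each cell is approximated by a test on a word. Off the exceptional events exactly one
  test accepts, that of the true cell, so the choice made by \<open>SOME\<close> is determined
  there.\<close>

lemma partition_approx:
  assumes P: "fin_partition M P" and "\<epsilon> > 0"
  shows "\<exists>m \<beta>. prob {x \<in> space M. cell P x \<noteq> \<beta> (word m x)} < \<epsilon>"
proof -
  have fin: "finite P" and ev: "\<And>B. B \<in> P \<Longrightarrow> B \<in> events" using P by (auto simp: fin_partition_def)
  have "\<forall>B\<in>P. \<exists>p. prob {x \<in> space M. (x \<in> B) \<noteq> snd p (word (fst p) x)} < \<epsilon> / (real (card P) + 1)"
  proof
    fix B assume "B \<in> P"
    from cylinder_approx[OF ev[OF this], of "\<epsilon> / (real (card P) + 1)"] assms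
    obtain m \<beta> where "prob {x \<in> space M. (x \<in> B) \<noteq> \<beta> (word m x)} < \<epsilon> / (real (card P) + 1)" by auto
    then have "prob {x \<in> space M. (x \<in> B) \<noteq> snd (m, \<beta>) (word (fst (m, \<beta>)) x)} < \<epsilon> / (real (card P) + 1)" by simp
    then show "\<exists>p. prob {x \<in> space M. (x \<in> B) \<noteq> snd p (word (fst p) x)} < \<epsilon> / (real (card P) + 1)" by blast
  qed
  from bchoice[OF this] obtain f where
    f: "\<forall>B\<in>P. prob {x \<in> space M. (x \<in> B) \<noteq> snd (f B) (word (fst (f B)) x)} < \<epsilon> / (real (card P) + 1)" by blast
  define m where "m = (\<lambda>B. fst (f B))"
  define \<beta> where "\<beta> = (\<lambda>B. snd (f B))"
  have m: "prob {x \<in> space M. (x \<in> B) \<noteq> \<beta> B (word (m B) x)} < \<epsilon> / (real (card P) + 1)" if "B \<in> P" for B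
    using f that by (simp add: m_def \<beta>_def)
  define K where "K = (\<Sum>B\<in>P. m B)"
  have K: "m B \<le> K" if "B \<in> P" for B unfolding K_def using that fin by (intro member_le_sum) auto
  define \<gamma> where "\<gamma> = (\<lambda>w. SOME B. B \<in> P \<and> \<beta> B (take (m B) w))"
  define E where "E = (\<lambda>B. {x \<in> space M. (x \<in> B) \<noteq> \<beta> B (word (m B) x)})"
  have E: "E B \<in> events" if "B \<in> P" for B
  proof -
    have "{x \<in> space M. \<beta> B (word (m B) x)} \<in> events"
      using word_function_measurable[of "\<beta> B" "m B"] by (simp add: pred_def)
    moreover have "E B = (B - {x \<in> space M. \<beta> B (word (m B) x)}) \<union> ({x \<in> space M. \<beta> B (word (m B) x)} - B)"
      unfolding E_def using sets.sets_into_space[OF ev[OF that]] by auto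
    ultimately show ?thesis using ev[OF that] by auto
  qed
  have "{x \<in> space M. cell P x \<noteq> \<gamma> (word K x)} \<subseteq> (\<Union>B\<in>P. E B)"
  proof
    fix x assume x: "x \<in> {x \<in> space M. cell P x \<noteq> \<gamma> (word K x)}"
    then have xM: "x \<in> space M" by simp
    show "x \<in> (\<Union>B\<in>P. E B)"
    proof (rule ccontr)
      assume no: "x \<notin> (\<Union>B\<in>P. E B)"
      then have *: "\<beta> B (take (m B) (word K x)) \<longleftrightarrow> x \<in> B" if "B \<in> P" for B
        using that xM K by (auto simp: E_def take_word)
      have "\<gamma> (word K x) = cell P x" unfolding \<gamma>_def
      proof (rule some_equality)
        show "cell P x \<in> P \<and> \<beta> (cell P x) (take (m (cell P x)) (word K x))"
          using *[OF cell(1)[OF P xM]] cell(1,2)[OF P xM] by blast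
        show "B = cell P x" if "B \<in> P \<and> \<beta> B (take (m B) (word K x))" for B
          using *[of B] cell(3)[OF P xM, of B] that by blast
      qed
      then show False using x by simp
    qed
  qed
  then have "prob {x \<in> space M. cell P x \<noteq> \<gamma> (word K x)} \<le> prob (\<Union>B\<in>P. E B)"
    using E fin by (intro finite_measure_mono) auto
  also have "\<dots> \<le> (\<Sum>B\<in>P. prob (E B))" using E fin by (intro finite_measure_subadditive_finite) auto
  also have "\<dots> \<le> (\<Sum>B\<in>P. \<epsilon> / (real (card P) + 1))"
  proof (rule sum_mono)
    fix B assume "B \<in> P"
    from m[OF this] show "prob (E B) \<le> \<epsilon> / (real (card P) + 1)" unfolding E_def by (rule less_imp_le)
  qed
  also have "\<dots> < \<epsilon>"
  proof -
    have "real (card P) * \<epsilon> < \<epsilon> * (real (card P) + 1)" using assms(2) by (simp add: algebra_simps)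
    then have "real (card P) * \<epsilon> / (real (card P) + 1) < \<epsilon>" by (simp add: pos_divide_less_eq)
    then show ?thesis by simp
  qed
  finally show ?thesis by blast
qed

end

text \<open>The probability of a word under a model that predicts each letter from the whole
  past.\<close>

definition seq_weight :: "(nat list \<Rightarrow> nat \<Rightarrow> real) \<Rightarrow> nat list \<Rightarrow> real" where
  "seq_weight G zs = (\<Prod>k<length zs. G (take k zs) (zs ! k))"

lemma seq_weight_append: "seq_weight G (zs @ [y]) = seq_weight G zs * G zs y"
  by (simp add: seq_weight_def nth_append)

lemma seq_weight_total:
  assumes G: "\<And>zs y. 0 \<le> G zs y" "\<And>zs. (\<integral>\<^sup>+ y. ennreal (G zs y) \<partial>count_space UNIV) \<le> 1"
  shows "(\<integral>\<^sup>+ zs. ennreal (seq_weight G zs) \<partial>count_space {zs. length zs = K}) \<le> 1"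
proof (induction K)
  case 0
  have "{zs :: nat list. length zs = 0} = {[]}" by auto
  then show ?case by (simp add: nn_integral_count_space_finite seq_weight_def)
next
  case (Suc K)
  let ?S = "{zs :: nat list. length zs = K}"
  have nn: "0 \<le> seq_weight G zs" for zs by (simp add: seq_weight_def prod_nonneg G)
  have bij: "bij_betw (\<lambda>(zs, y). zs @ [y]) (?S \<times> UNIV) {zs. length zs = Suc K}"
  proof (rule bij_betw_imageI)
    show "(\<lambda>(zs, y). zs @ [y]) ` (?S \<times> UNIV) = {zs. length zs = Suc K}"
    proof (intro set_eqI iffI)
      fix zs :: "nat list" assume "zs \<in> {zs. length zs = Suc K}"
      then have "zs = butlast zs @ [last zs]" "length (butlast zs) = K" by (auto intro: append_butlast_last_id[symmetric])
      then show "zs \<in> (\<lambda>(zs, y). zs @ [y]) ` (?S \<times> UNIV)" by (metis (mono_tags, lifting) SigmaI UNIV_I case_prod_conv image_eqI mem_Collect_eq)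
    qed auto
  qed (auto simp: inj_on_def)
  have "(\<integral>\<^sup>+ zs. ennreal (seq_weight G zs) \<partial>count_space {zs. length zs = Suc K}) =
      (\<integral>\<^sup>+ p. ennreal (seq_weight G (fst p @ [snd p])) \<partial>count_space (?S \<times> UNIV))"
    by (subst nn_integral_bij_count_space[OF bij, symmetric]) (simp add: case_prod_beta)
  also have "\<dots> = (\<integral>\<^sup>+ p. ennreal (seq_weight G (fst p) * G (fst p) (snd p)) * indicator ?S (fst p) \<partial>count_space UNIV)"
    by (subst nn_integral_count_space_indicator) (auto simp: seq_weight_append indicator_def intro!: nn_integral_cong)
  also have "\<dots> = (\<integral>\<^sup>+ zs. \<integral>\<^sup>+ y. ennreal (seq_weight G zs * G zs y) * indicator ?S zs \<partial>count_space UNIV \<partial>count_space UNIV)"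
    by (subst nn_integral_fst_count_space[symmetric]) simp
  also have "\<dots> \<le> (\<integral>\<^sup>+ zs. ennreal (seq_weight G zs) * indicator ?S zs \<partial>count_space UNIV)"
  proof (intro nn_integral_mono)
    fix zs
    have "(\<integral>\<^sup>+ y. ennreal (seq_weight G zs * G zs y) * indicator ?S zs \<partial>count_space UNIV) =
      (\<integral>\<^sup>+ y. (ennreal (seq_weight G zs) * indicator ?S zs) * ennreal (G zs y) \<partial>count_space UNIV)"
      by (intro nn_integral_cong) (simp add: ennreal_mult nn G mult_ac)
    also have "\<dots> = (ennreal (seq_weight G zs) * indicator ?S zs) * (\<integral>\<^sup>+ y. ennreal (G zs y) \<partial>count_space UNIV)"
      by (rule nn_integral_cmult) simp
    also have "\<dots> \<le> (ennreal (seq_weight G zs) * indicator ?S zs) * 1" by (intro mult_left_mono G) simp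
    finally show "(\<integral>\<^sup>+ y. ennreal (seq_weight G zs * G zs y) * indicator ?S zs \<partial>count_space UNIV) \<le>
      ennreal (seq_weight G zs) * indicator ?S zs" by simp
  qed
  also have "\<dots> = (\<integral>\<^sup>+ zs. ennreal (seq_weight G zs) \<partial>count_space ?S)"
    by (rule nn_integral_count_space_indicator[symmetric]) simp
  finally show ?case using Suc by (rule order_trans)
qed

lemma sum_lists_prod:
  fixes e :: "nat \<Rightarrow> 'b \<Rightarrow> real"
  assumes "finite P"
  shows "(\<Sum>c | set c \<subseteq> P \<and> length c = N. \<Prod>k<N. e k (c ! k)) = (\<Prod>k<N. \<Sum>B\<in>P. e k B)"
proof (induction N arbitrary: e)
  case 0
  have "{c. set c \<subseteq> P \<and> length c = 0} = {[]}" by auto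
  then show ?case by simp
next
  case (Suc N)
  let ?L = "\<lambda>N. {c. set c \<subseteq> P \<and> length c = N}"
  have "(\<Sum>c\<in>?L (Suc N). \<Prod>k<Suc N. e k (c ! k)) = (\<Sum>p\<in>?L N \<times> P. \<Prod>k<Suc N. e k ((snd p # fst p) ! k))"
    unfolding lists_length_Suc_eq by (subst sum.reindex) (auto simp: inj_on_def case_prod_beta)
  also have "\<dots> = (\<Sum>p\<in>?L N \<times> P. e 0 (snd p) * (\<Prod>k<N. e (Suc k) (fst p ! k)))"
    by (simp only: prod.lessThan_Suc_shift nth_Cons_0 nth_Cons_Suc)
  also have "\<dots> = (\<Sum>c\<in>?L N. \<Sum>B\<in>P. e 0 B * (\<Prod>k<N. e (Suc k) (c ! k)))"
    by (subst sum.cartesian_product) (simp add: case_prod_beta)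
  also have "\<dots> = (\<Sum>B\<in>P. e 0 B) * (\<Sum>c\<in>?L N. \<Prod>k<N. e (Suc k) (c ! k))"
    by (simp add: sum_distrib_left sum_distrib_right sum_product)
  also have "\<dots> = (\<Prod>k<Suc N. \<Sum>B\<in>P. e k B)"
    unfolding Suc.IH[of "\<lambda>k. e (Suc k)"] by (simp only: prod.lessThan_Suc_shift)
  finally show ?case .
qed

context shift_measure
begin

text \<open>Encode a long word with the predictor \<open>g\<close>, then the cells visited by a
  finite partition given the word. A cell need not be determined by finitely many coordinates, so it
  is guessed from \<open>m\<close> letters with rare errors, and correcting these costs little. The
  auxiliary law \<open>r\<close> serves only the first \<open>n0\<close> letters, for which
  \<open>g\<close> lacks its context.\<close>

theorem metric_entropy_le_model:
  assumes g: "\<And>w y. 0 \<le> g w y" "\<And>w. (\<integral>\<^sup>+ y. ennreal (g w y) \<partial>count_space UNIV) \<le> 1"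
    and gpos: "\<And>x. x \<in> space M \<Longrightarrow> 0 < g (word n0 x) (x n0)"
    and gint: "integrable M (\<lambda>x. - ln (g (word n0 x) (x n0)))"
    and r: "\<And>y. 0 < r y" "(\<integral>\<^sup>+ y. ennreal (r y) \<partial>count_space UNIV) \<le> 1"
    and rint: "integrable M (\<lambda>x. - ln (r (x 0)))"
  shows "metric_entropy M shift \<le> ereal (expectation (\<lambda>x. - ln (g (word n0 x) (x n0))))"
  unfolding metric_entropy_def
proof (rule SUP_least)
  fix P assume "P \<in> {P. fin_partition M P}"
  then have P: "fin_partition M P" by simp
  define \<Gamma> where "\<Gamma> = expectation (\<lambda>x. - ln (g (word n0 x) (x n0)))"
  define \<Lambda> where "\<Lambda> = expectation (\<lambda>x. - ln (r (x 0)))"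
  have "entropy_wrt M shift P \<le> \<Gamma> + \<delta>" if \<delta>: "\<delta> > 0" for \<delta>
  proof -
    have finP: "finite P" using P by (simp add: fin_partition_def)
    obtain x0 where "x0 \<in> space M" using not_empty by auto
    then have "P \<noteq> {}" using P by (auto simp: fin_partition_def)
    then have cP: "real (card P) \<ge> 1" using finP by (simp add: Suc_leI card_gt_0_iff)
    \<comment> \<open>Chosen such that \<open>- ln (1 - \<epsilon>) = \<delta> / 4\<close>, which
      bounds the cost of confirming a correct guess.\<close>
    define \<epsilon> where "\<epsilon> = 1 - exp (- \<delta> / 4)"
    have \<epsilon>: "0 < \<epsilon>" "\<epsilon> < 1" using \<delta> by (auto simp: \<epsilon>_def)
    define L where "L = - ln (\<epsilon> / card P)"
    have ec: "0 < \<epsilon> / card P" "\<epsilon> / card P \<le> 1" using \<epsilon> cP by (auto simp: field_simps)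
    have L: "L \<ge> 0" unfolding L_def using ec by simp
    have "\<delta> / (4 * (L + 1)) > 0" using \<delta> L by simp
    \<comment> \<open>A wrong guess costs at most \<open>L\<close> more than a correct one is
      allowed to, so this probability of error keeps the expected extra cost below
      \<open>\<delta> / 4\<close>.\<close>
    from partition_approx[OF P this] obtain m \<beta> where
      err: "prob {x \<in> space M. cell P x \<noteq> \<beta> (word m x)} < \<delta> / (4 * (L + 1))" by blast
    \<comment> \<open>A noisy channel: \<open>e B B'\<close> is the weight of the true cell
      \<open>B\<close> given the guess \<open>B'\<close>. The uniform part
      \<open>\<epsilon> / card P\<close> keeps it positive, and its sum over \<open>B\<close> is at
      most one.\<close>
    define e where "e = (\<lambda>B B' :: (nat \<Rightarrow> nat) set. (if B = B' then 1 - \<epsilon> else 0) + \<epsilon> / card P)"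
    have e: "0 < e B B'" "e B B' \<le> 1" for B B'
    proof -
      have "\<epsilon> / card P \<le> \<epsilon> / 1" using \<epsilon> cP by (intro divide_left_mono) auto
      then show "0 < e B B'" "e B B' \<le> 1" using \<epsilon> ec by (auto simp: e_def)
    qed
    have esum: "(\<Sum>B\<in>P. e B B') \<le> 1" for B'
    proof -
      have "(\<Sum>B\<in>P. e B B') = (if B' \<in> P then 1 - \<epsilon> else 0) + \<epsilon>"
        using finP cP \<open>P \<noteq> {}\<close> by (simp add: e_def sum.distrib)
      then show ?thesis using \<epsilon> by auto
    qed
    have eln: "- ln (e B B') \<le> \<delta> / 4 + (if B = B' then 0 else L)" for B B'
    proof (cases "B = B'")
      case True
      have "ln (1 - \<epsilon>) \<le> ln (e B B')" using True \<epsilon> ec e by (subst ln_le_cancel_iff) (auto simp: e_def)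
      then show ?thesis using True by (simp add: \<epsilon>_def)
    next
      case False
      then show ?thesis using \<delta> by (simp add: e_def L_def)
    qed
    let ?E = "\<lambda>x. - ln (e (cell P x) (\<beta> (word m x)))"
    have Emeas: "?E \<in> borel_measurable M"
    proof (rule measurable_compose_countable[OF _ word_measurable[of m]])
      fix w show "(\<lambda>x. - ln (e (cell P x) (\<beta> w))) \<in> borel_measurable M"
        by (rule measurable_compose[OF cell_measurable(1)[OF P]]) simp
    qed
    have Eint: "integrable M ?E"
    proof (rule integrable_const_bound[OF _ Emeas, of "\<delta> / 4 + L"], rule AE_I2)
      fix x
      show "norm (?E x) \<le> \<delta> / 4 + L"
        using eln[of "cell P x" "\<beta> (word m x)"] e[of "cell P x" "\<beta> (word m x)"] L by (auto split: if_splits)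
    qed
    define \<theta> where "\<theta> = expectation ?E"
    have bad: "{x \<in> space M. cell P x \<noteq> \<beta> (word m x)} \<in> events"
    proof -
      have "Measurable.pred M (\<lambda>x. cell P x \<noteq> \<beta> (word m x))"
        by (rule measurable_compose_countable[OF _ word_measurable[of m]])
           (rule measurable_compose[OF cell_measurable(1)[OF P]], simp)
      then show ?thesis by (simp add: pred_def)
    qed
    have \<theta>: "\<theta> \<le> \<delta> / 2"
    proof -
      have "\<theta> \<le> expectation (\<lambda>x. \<delta> / 4 + L * indicator {x \<in> space M. cell P x \<noteq> \<beta> (word m x)} x)"
        unfolding \<theta>_def
      proof (rule integral_mono[OF Eint])
        show "integrable M (\<lambda>x. \<delta> / 4 + L * indicator {x \<in> space M. cell P x \<noteq> \<beta> (word m x)} x)"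
          using bad by (intro Bochner_Integration.integrable_add integrable_mult_right integrable_real_indicator)
            (auto simp: emeasure_eq_measure)
        show "?E x \<le> \<delta> / 4 + L * indicator {x \<in> space M. cell P x \<noteq> \<beta> (word m x)} x" if "x \<in> space M" for x
          using eln[of "cell P x" "\<beta> (word m x)"] that by (simp add: indicator_def split: if_splits)
      qed
      also have "\<dots> = \<delta> / 4 + L * prob {x \<in> space M. cell P x \<noteq> \<beta> (word m x)}"
        using bad by (subst Bochner_Integration.integral_add) (auto simp: prob_space emeasure_eq_measure)
      also have "L * prob {x \<in> space M. cell P x \<noteq> \<beta> (word m x)} \<le> L * (\<delta> / (4 * (L + 1)))"
        using err L by (intro mult_left_mono) auto
      also have "\<dots> \<le> \<delta> / 4" using L \<delta> by (simp add: field_simps)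
      finally show ?thesis by simp
    qed
    \<comment> \<open>The predictor for a whole word: \<open>r\<close> while the past is shorter
      than \<open>n0\<close>, afterwards \<open>g\<close> on the last \<open>n0\<close>
      letters.\<close>
    define G where "G = (\<lambda>zs y. if length zs < n0 then r y else g (drop (length zs - n0) zs) y)"
    have G: "0 \<le> G zs y" "(\<integral>\<^sup>+ y. ennreal (G zs y) \<partial>count_space UNIV) \<le> 1" for zs y
      by (cases "length zs < n0"; simp add: G_def g r less_imp_le)+
    have Gword: "- ln (G (word k x) (x k)) = (if k < n0 then - ln (r ((shift ^^ k) x 0))
      else (\<lambda>x. - ln (g (word n0 x) (x n0))) ((shift ^^ (k - n0)) x))" for k x
    proof (cases "k < n0")
      case True
      then show ?thesis by (simp add: G_def shift_iter)
    next
      case False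
      then obtain j where j: "k = j + n0" by (metis add.commute le_add_diff_inverse not_less)
      have "(shift ^^ j) x n0 = x k" by (simp add: shift_iter j add.commute)
      then show ?thesis by (simp add: G_def j drop_word)
    qed
    have Gpos: "0 < G (word k x) (x k)" if "x \<in> space M" for k x
    proof (cases "k < n0")
      case True
      then show ?thesis by (simp add: G_def r(1))
    next
      case False
      then obtain j where j: "k = j + n0" by (metis add.commute le_add_diff_inverse not_less)
      have "(shift ^^ j) x n0 = x k" by (simp add: shift_iter j add.commute)
      then show ?thesis using gpos[OF T_iter_space[OF that], of j] by (simp add: G_def j drop_word)
    qed
    have Gint: "integrable M (\<lambda>x. - ln (G (word k x) (x k)))" for k
      unfolding Gword using integrable_T_iter[OF rint, of k] integrable_T_iter[OF gint, of "k - n0"]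
      by (cases "k < n0") auto
    have Gexp: "expectation (\<lambda>x. - ln (G (word k x) (x k))) = (if k < n0 then \<Lambda> else \<Gamma>)" for k
      unfolding Gword \<Lambda>_def \<Gamma>_def
      using expectation_T_iter[of "\<lambda>x. - ln (r (x 0))" k] rint gint
        expectation_T_iter[of "\<lambda>x. - ln (g (word n0 x) (x n0))" "k - n0"]
      by (cases "k < n0") auto
    have bound: "label_entropy M (itinerary (cell P) N) \<le>
        (real n0 * \<Lambda> + real (N + m) * \<Gamma>) + real N * \<theta>" for N
    proof -
      \<comment> \<open>The guess for the cell at time \<open>k < N\<close> reads \<open>m\<close>
        letters from position \<open>k\<close> on, so it stays within \<open>N + m\<close> letters;
        another \<open>n0\<close> are added, so that exactly \<open>N + m\<close> letters are
        charged to \<open>g\<close>.\<close>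
      define K where "K = n0 + (N + m)"
      define \<rho> where "\<rho> = (\<lambda>c zs. if length zs = K then
          seq_weight G zs * (\<Prod>k<N. e (c ! k) (\<beta> (take m (drop k zs)))) else 0)"
      have sw: "0 \<le> seq_weight G zs" for zs by (simp add: seq_weight_def prod_nonneg G)
      have pe: "0 \<le> (\<Prod>k<N. e (c ! k) (f k))" for c f by (simp add: prod_nonneg e less_imp_le)
      have tk: "take m (drop k (word K x)) = word m ((shift ^^ k) x)" if "k < N" for k x
      proof -
        have "drop k (word (k + (K - k)) x) = word (K - k) ((shift ^^ k) x)" by (rule drop_word)
        moreover have "k + (K - k) = K" "m \<le> K - k" using that by (auto simp: K_def)
        ultimately show ?thesis by (simp add: take_word)
      qed
      have \<rho>word: "\<rho> (itinerary (cell P) N x) (word K x) =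
          (\<Prod>k<K. G (word k x) (x k)) * (\<Prod>k<N. e (cell P ((shift ^^ k) x)) (\<beta> (word m ((shift ^^ k) x))))" for x
        by (simp add: \<rho>_def seq_weight_def take_word word_nth itinerary_nth tk)
      have \<rho>pos: "0 < \<rho> (itinerary (cell P) N x) (word K x)" if "x \<in> space M" for x
        unfolding \<rho>word using Gpos[OF that] e by (intro mult_pos_pos prod_pos) auto
      have \<rho>ln: "- ln (\<rho> (itinerary (cell P) N x) (word K x)) =
          (\<Sum>k<K. - ln (G (word k x) (x k))) + (\<Sum>k<N. ?E ((shift ^^ k) x))" if "x \<in> space M" for x
      proof -
        let ?p = "\<Prod>k<K. G (word k x) (x k)"
        let ?p' = "\<Prod>k<N. e (cell P ((shift ^^ k) x)) (\<beta> (word m ((shift ^^ k) x)))"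
        have "?p > 0" "?p' > 0" using Gpos[OF that] e by (auto intro!: prod_pos)
        then have "ln (?p * ?p') = ln ?p + ln ?p'" by (rule ln_mult_pos)
        moreover have "ln ?p = (\<Sum>k<K. ln (G (word k x) (x k)))"
          by (intro ln_prod finite_lessThan) (use less_imp_neq[OF Gpos[OF that]] in metis)
        moreover have "ln ?p' = (\<Sum>k<N. ln (e (cell P ((shift ^^ k) x)) (\<beta> (word m ((shift ^^ k) x)))))"
          by (intro ln_prod finite_lessThan) (use less_imp_neq[OF e(1)] in metis)
        ultimately show ?thesis unfolding \<rho>word by (simp add: sum_negf)
      qed
      have i1: "integrable M (\<lambda>x. \<Sum>k<K. - ln (G (word k x) (x k)))" by (intro Bochner_Integration.integrable_sum Gint)
      have i2: "integrable M (\<lambda>x. \<Sum>k<N. ?E ((shift ^^ k) x))"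
        by (intro Bochner_Integration.integrable_sum integrable_T_iter[OF Eint])
      have int: "integrable M (\<lambda>x. - ln (\<rho> (itinerary (cell P) N x) (word K x)))"
        by (subst Bochner_Integration.integrable_cong[OF refl \<rho>ln]) (auto intro: Bochner_Integration.integrable_add i1 i2)
      have "label_entropy M (itinerary (cell P) N) \<le> expectation (\<lambda>x. - ln (\<rho> (itinerary (cell P) N x) (word K x)))"
      proof (rule gibbs_inequality[OF itinerary_measurable[OF cell_measurable[OF P]] word_measurable])
        show "0 \<le> \<rho> c z" for c z unfolding \<rho>_def using sw pe by auto
        show "AE x in M. 0 < \<rho> (itinerary (cell P) N x) (word K x)" using \<rho>pos by (intro AE_I2)
        show "integrable M (\<lambda>x. - ln (\<rho> (itinerary (cell P) N x) (word K x)))" by (rule int)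
        let ?X = "itinerary (cell P) N ` space M"
        have sub: "?X \<subseteq> {c. set c \<subseteq> P \<and> length c = N}"
          using cell(1)[OF P T_iter_space] by (auto simp: itinerary_def)
        have le: "(\<Sum>c\<in>?X. ennreal (\<rho> c zs)) \<le> ennreal (seq_weight G zs) * indicator {zs. length zs = K} zs" for zs
        proof (cases "length zs = K")
          case True
          let ?b = "\<lambda>k. \<beta> (take m (drop k zs))"
          have "(\<Sum>c\<in>?X. \<rho> c zs) = seq_weight G zs * (\<Sum>c\<in>?X. \<Prod>k<N. e (c ! k) (?b k))"
            using True by (simp add: \<rho>_def sum_distrib_left)
          also have "\<dots> \<le> seq_weight G zs * (\<Sum>c | set c \<subseteq> P \<and> length c = N. \<Prod>k<N. e (c ! k) (?b k))"
            using sw pe sub finite_lists_length_eq[OF finP] by (intro mult_left_mono sum_mono2) auto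
          also have "(\<Sum>c | set c \<subseteq> P \<and> length c = N. \<Prod>k<N. e (c ! k) (?b k)) = (\<Prod>k<N. \<Sum>B\<in>P. e B (?b k))"
            by (rule sum_lists_prod[OF finP, where N = N and e = "\<lambda>k B. e B (?b k)"])
          also have "\<dots> \<le> 1" using esum less_imp_le[OF e(1)] by (intro prod_le_1) (auto intro!: sum_nonneg)
          finally have "(\<Sum>c\<in>?X. \<rho> c zs) \<le> seq_weight G zs" using sw[of zs] by (simp add: mult_left_mono)
          moreover have "(\<Sum>c\<in>?X. ennreal (\<rho> c zs)) = ennreal (\<Sum>c\<in>?X. \<rho> c zs)"
            using sw pe by (intro sum_ennreal) (auto simp: \<rho>_def)
          ultimately show ?thesis using True by (simp add: ennreal_leI)
        next
          case False
          then show ?thesis by (simp add: \<rho>_def)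
        qed
        have "(\<integral>\<^sup>+ zs. (\<Sum>c\<in>?X. ennreal (\<rho> c zs)) \<partial>count_space UNIV) \<le>
          (\<integral>\<^sup>+ zs. ennreal (seq_weight G zs) * indicator {zs. length zs = K} zs \<partial>count_space UNIV)"
          by (intro nn_integral_mono le)
        also have "\<dots> = (\<integral>\<^sup>+ zs. ennreal (seq_weight G zs) \<partial>count_space {zs. length zs = K})"
          by (rule nn_integral_count_space_indicator[symmetric]) simp
        also have "\<dots> \<le> 1" by (rule seq_weight_total[OF G])
        finally show "(\<integral>\<^sup>+ zs. (\<Sum>c\<in>?X. ennreal (\<rho> c zs)) \<partial>count_space UNIV) \<le> 1" .
      qed
      also have "\<dots> = expectation (\<lambda>x. (\<Sum>k<K. - ln (G (word k x) (x k))) + (\<Sum>k<N. ?E ((shift ^^ k) x)))"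
        by (intro Bochner_Integration.integral_cong refl \<rho>ln)
      also have "\<dots> = expectation (\<lambda>x. \<Sum>k<K. - ln (G (word k x) (x k))) + expectation (\<lambda>x. \<Sum>k<N. ?E ((shift ^^ k) x))"
        by (rule Bochner_Integration.integral_add[OF i1 i2])
      also have "expectation (\<lambda>x. \<Sum>k<K. - ln (G (word k x) (x k))) = (\<Sum>k<K. if k < n0 then \<Lambda> else \<Gamma>)"
        by (subst Bochner_Integration.integral_sum[OF Gint]) (simp only: Gexp)
      also have "\<dots> = real n0 * \<Lambda> + real (N + m) * \<Gamma>"
        unfolding K_def sum_lessThan_add by (simp add: distrib_right)
      also have "expectation (\<lambda>x. \<Sum>k<N. ?E ((shift ^^ k) x)) = (\<Sum>k<N. expectation (\<lambda>x. ?E ((shift ^^ k) x)))"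
        by (rule Bochner_Integration.integral_sum[OF integrable_T_iter[OF Eint]])
      also have "\<dots> = real N * \<theta>"
        unfolding \<theta>_def expectation_T_iter[OF Emeas] by simp
      finally show ?thesis .
    qed
    \<comment> \<open>The overhead of \<open>n0\<close> initial letters and \<open>m\<close> extra
      ones is constant and disappears after division by the length.\<close>
    have "(\<lambda>n. (real n0 * \<Lambda> + real m * \<Gamma>) / real (Suc n) + (\<Gamma> + \<theta>)) \<longlonglongrightarrow> 0 + (\<Gamma> + \<theta>)"
      by (intro tendsto_add tendsto_const LIMSEQ_Suc[OF lim_const_over_n])
    then have "(\<lambda>n. (real n0 * \<Lambda> + real m * \<Gamma>) / real (Suc n) + (\<Gamma> + \<theta>)) \<longlonglongrightarrow> \<Gamma> + \<theta>" by simp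
    moreover have "label_entropy M (itinerary (cell P) (Suc n)) / real (Suc n) \<le>
      (real n0 * \<Lambda> + real m * \<Gamma>) / real (Suc n) + (\<Gamma> + \<theta>)" for n
    proof -
      have "label_entropy M (itinerary (cell P) (Suc n)) / real (Suc n) \<le>
        ((real n0 * \<Lambda> + real (Suc n + m) * \<Gamma>) + real (Suc n) * \<theta>) / real (Suc n)"
        by (intro divide_right_mono bound) simp
      also have "(real n0 * \<Lambda> + real (Suc n + m) * \<Gamma>) + real (Suc n) * \<theta> =
        (real n0 * \<Lambda> + real m * \<Gamma>) + real (Suc n) * (\<Gamma> + \<theta>)" by (simp add: algebra_simps)
      also have "\<dots> / real (Suc n) = (real n0 * \<Lambda> + real m * \<Gamma>) / real (Suc n) + (\<Gamma> + \<theta>)"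
        by (simp add: add_divide_distrib del: of_nat_Suc)
      finally show ?thesis .
    qed
    ultimately have "entropy_wrt M shift P \<le> \<Gamma> + \<theta>"
      by (intro LIMSEQ_le[OF entropy_wrt_limit[OF P]]) auto
    then show ?thesis using \<theta> \<delta> by simp
  qed
  then have "entropy_wrt M shift P \<le> \<Gamma>" by (rule field_le_epsilon)
  then show "ereal (entropy_wrt M shift P) \<le> ereal (expectation (\<lambda>x. - ln (g (word n0 x) (x n0))))"
    by (simp add: \<Gamma>_def)
qed

lemma word_event [measurable]: "{x \<in> space M. word n x = w} \<in> events"
proof -
  have "word n -` {w} \<inter> space M \<in> events" by (rule measurable_sets[OF word_measurable]) simp
  also have "word n -` {w} \<inter> space M = {x \<in> space M. word n x = w}" by auto
  finally show ?thesis .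
qed

text \<open>If the measure were not Markov at a context \<open>w\<close>, tilting the model at \<open>w\<close> towards the
  conditional frequency of \<open>y\<close> would give a strictly better entropy bound.\<close>

theorem markov_of_maximal_entropy:
  assumes Q: "\<And>i j. 0 \<le> Q i j" "\<And>i. (\<integral>\<^sup>+ j. ennreal (Q i j) \<partial>count_space UNIV) \<le> 1"
    and Qpos: "\<And>x. x \<in> space M \<Longrightarrow> 0 < Q (x 0) (x 1)"
    and Qint: "integrable M (\<lambda>x. - ln (Q (x 0) (x 1)))"
    and r: "\<And>y. 0 < r y" "(\<integral>\<^sup>+ y. ennreal (r y) \<partial>count_space UNIV) \<le> 1"
    and rint: "integrable M (\<lambda>x. - ln (r (x 0)))"
    and max: "ereal (expectation (\<lambda>x. - ln (Q (x 0) (x 1)))) \<le> metric_entropy M shift"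
    and w: "w \<noteq> []"
  shows "prob {x \<in> space M. word (Suc (length w)) x = w @ [y]} =
    prob {x \<in> space M. word (length w) x = w} * Q (last w) y"
proof (rule ccontr)
  assume neq: "\<not> ?thesis"
  define n0 where "n0 = length w"
  have n0: "n0 > 0" using w by (simp add: n0_def)
  define b where "b = Q (last w) y"
  define S where "S = (\<integral>\<^sup>+ z. ennreal (Q (last w) z) * indicator (- {y}) z \<partial>count_space UNIV)"
  have bS: "ennreal b + S \<le> 1"
  proof -
    have "ennreal b + S = (\<integral>\<^sup>+ z. ennreal (Q (last w) z) * indicator {y} z \<partial>count_space UNIV) + S"
      by (subst nn_integral_indicator_singleton) (auto simp: b_def)
    also have "\<dots> = (\<integral>\<^sup>+ z. ennreal (Q (last w) z) * indicator {y} z + ennreal (Q (last w) z) * indicator (- {y}) z \<partial>count_space UNIV)"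
      unfolding S_def by (subst nn_integral_add) auto
    also have "\<dots> = (\<integral>\<^sup>+ z. ennreal (Q (last w) z) \<partial>count_space UNIV)"
      by (intro nn_integral_cong) (auto simp: indicator_def)
    finally show ?thesis using Q(2)[of "last w"] by simp
  qed
  have "S \<le> ennreal b + S" by (rule add_increasing) auto
  then have "S \<le> 1" using bS by (rule order_trans)
  then obtain s where s: "S = ennreal s" "0 \<le> s" by (cases S) (auto simp: top_unique)
  have b: "0 \<le> b" "b + s \<le> 1" using bS Q(1) s by (auto simp: b_def ennreal_plus[symmetric] ennreal_le_1 simp del: ennreal_plus)
  define mw where "mw = prob {x \<in> space M. word n0 x = w}"
  define c where "c = prob {x \<in> space M. word (Suc n0) x = w @ [y]}"
  have cm: "c \<noteq> mw * b" using neq by (simp add: c_def mw_def b_def n0_def)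
  \<comment> \<open>The expected gain in code length when, after the context \<open>w\<close>, the
    weight of \<open>y\<close> is multiplied by \<open>1 + a * (1 - b)\<close> and every other
    weight by \<open>1 - a * b\<close>. The factors are balanced: averaged with the weights
    \<open>b\<close> and \<open>1 - b\<close> they give one.\<close>
  define F where "F = (\<lambda>a. c * ln (1 + a * (1 - b)) + (mw - c) * ln (1 - a * b))"
  have F0: "F 0 = 0" by (simp add: F_def)
  \<comment> \<open>The derivative at zero is the deviation from the Markov property at
    \<open>w\<close> and \<open>y\<close>. As it is nonzero, a small \<open>a\<close> of the same
    sign makes the gain positive.\<close>
  have "DERIV F 0 :> c * (1 - b) + (mw - c) * (- b)"
    unfolding F_def by (auto intro!: derivative_eq_intros)
  moreover have "c * (1 - b) + (mw - c) * (- b) = c - mw * b" by (simp add: algebra_simps)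
  ultimately have dF: "DERIV F 0 :> c - mw * b" by simp
  obtain a where a: "\<bar>a\<bar> < 1" "0 < F a"
  proof (cases "c - mw * b > 0")
    case True
    from DERIV_pos_inc_right[OF dF True] obtain d where d: "d > 0" "\<forall>h>0. h < d \<longrightarrow> F 0 < F (0 + h)" by blast
    have "0 < F (min d 1 / 2)" using d(1) spec[OF d(2), of "min d 1 / 2"] F0 by auto
    then show thesis using d(1) by (intro that[of "min d 1 / 2"]) auto
  next
    case False
    then have "c - mw * b < 0" using cm by simp
    from DERIV_neg_dec_left[OF dF this] obtain d where d: "d > 0" "\<forall>h>0. h < d \<longrightarrow> F 0 < F (0 - h)" by blast
    have "0 < F (- (min d 1 / 2))" using d(1) spec[OF d(2), of "min d 1 / 2"] F0 by auto
    then show thesis using d(1) by (intro that[of "- (min d 1 / 2)"]) auto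
  qed
  define \<kappa>1 where "\<kappa>1 = 1 + a * (1 - b)"
  define \<kappa>2 where "\<kappa>2 = 1 - a * b"
  have b1: "b \<le> 1" using b s by simp
  have "\<bar>a * (1 - b)\<bar> < 1" "\<bar>a * b\<bar> < 1"
    using a(1) b(1) b1 mult_left_le[of "1 - b" "\<bar>a\<bar>"] mult_left_le[of b "\<bar>a\<bar>"] by (auto simp: abs_mult)
  then have \<kappa>: "0 < \<kappa>1" "0 < \<kappa>2" by (auto simp: \<kappa>1_def \<kappa>2_def)
  define \<tau> where "\<tau> = (\<lambda>ctx z. if ctx = w then (if z = y then \<kappa>1 else \<kappa>2) else 1 :: real)"
  have \<tau>: "0 < \<tau> ctx z" for ctx z using \<kappa> by (auto simp: \<tau>_def)
  define g where "g = (\<lambda>ctx z. Q (last ctx) z * \<tau> ctx z)"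
  have g0: "0 \<le> g ctx z" for ctx z using Q(1) \<tau>[of ctx z] by (simp add: g_def)
  have g1: "(\<integral>\<^sup>+ z. ennreal (g ctx z) \<partial>count_space UNIV) \<le> 1" for ctx
  proof (cases "ctx = w")
    case True
    have "(\<integral>\<^sup>+ z. ennreal (g ctx z) \<partial>count_space UNIV) =
      (\<integral>\<^sup>+ z. ennreal (b * \<kappa>1) * indicator {y} z + ennreal \<kappa>2 * (ennreal (Q (last w) z) * indicator (- {y}) z) \<partial>count_space UNIV)"
      using True \<kappa> Q(1) by (intro nn_integral_cong)
        (auto simp: g_def \<tau>_def b_def indicator_def ennreal_mult[symmetric] mult.commute)
    also have "\<dots> = (\<integral>\<^sup>+ z. ennreal (b * \<kappa>1) * indicator {y} z \<partial>count_space UNIV) + ennreal \<kappa>2 * S"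
      unfolding S_def by (subst nn_integral_add, simp, simp, subst nn_integral_cmult) auto
    also have "(\<integral>\<^sup>+ z. ennreal (b * \<kappa>1) * indicator {y} z \<partial>count_space UNIV) = ennreal (b * \<kappa>1)"
      by (subst nn_integral_indicator_singleton) auto
    also have "ennreal (b * \<kappa>1) + ennreal \<kappa>2 * S = ennreal (b * \<kappa>1 + \<kappa>2 * s)"
      using b \<kappa> s by (simp add: ennreal_mult)
    also have "\<dots> \<le> ennreal 1"
    proof (rule ennreal_leI)
      have "\<kappa>2 * s \<le> \<kappa>2 * (1 - b)" using b \<kappa> by (intro mult_left_mono) auto
      then have "b * \<kappa>1 + \<kappa>2 * s \<le> b * \<kappa>1 + \<kappa>2 * (1 - b)" by simp
      also have "\<dots> = 1" by (simp add: \<kappa>1_def \<kappa>2_def algebra_simps)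
      finally show "b * \<kappa>1 + \<kappa>2 * s \<le> 1" .
    qed
    finally show ?thesis by simp
  next
    case False
    then show ?thesis using Q(2)[of "last ctx"] by (simp add: g_def \<tau>_def)
  qed
  have last_word: "last (word n0 x) = x (n0 - 1)" for x
    using n0 by (simp add: last_conv_nth word_nth word_def)
  have Qsh: "Q (x (n0 - 1)) (x n0) = Q ((shift ^^ (n0 - 1)) x 0) ((shift ^^ (n0 - 1)) x 1)" for x
    using n0 by (simp add: shift_iter)
  have Qp: "0 < Q (x (n0 - 1)) (x n0)" if "x \<in> space M" for x
    unfolding Qsh by (rule Qpos[OF T_iter_space[OF that]])
  have gp: "0 < g (word n0 x) (x n0)" if "x \<in> space M" for x
    unfolding g_def last_word using Qp[OF that] \<tau> by simp
  let ?I = "\<lambda>x. indicator {x \<in> space M. word (Suc n0) x = w @ [y]} x :: real"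
  let ?J = "\<lambda>x. indicator {x \<in> space M. word n0 x = w} x :: real"
  have gln: "- ln (g (word n0 x) (x n0)) =
      - ln (Q (x (n0 - 1)) (x n0)) - (ln \<kappa>1 * ?I x + ln \<kappa>2 * (?J x - ?I x))" if "x \<in> space M" for x
  proof -
    have "ln (g (word n0 x) (x n0)) = ln (Q (x (n0 - 1)) (x n0)) + ln (\<tau> (word n0 x) (x n0))"
      unfolding g_def last_word using Qp[OF that] \<tau> by (intro ln_mult_pos) auto
    moreover have "ln (\<tau> (word n0 x) (x n0)) = ln \<kappa>1 * ?I x + ln \<kappa>2 * (?J x - ?I x)"
      using that by (auto simp: \<tau>_def indicator_def word_Suc)
    ultimately show ?thesis by simp
  qed
  have iI: "integrable M ?I" and iJ: "integrable M ?J"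
    by (intro integrable_real_indicator; simp add: word_event emeasure_eq_measure)+
  have iQ: "integrable M (\<lambda>x. - ln (Q (x (n0 - 1)) (x n0)))"
    unfolding Qsh by (rule integrable_T_iter[OF Qint])
  have iR: "integrable M (\<lambda>x. ln \<kappa>1 * ?I x + ln \<kappa>2 * (?J x - ?I x))" using iI iJ by auto
  have gint: "integrable M (\<lambda>x. - ln (g (word n0 x) (x n0)))"
    by (rule Bochner_Integration.integrable_cong[THEN iffD2, OF refl gln Bochner_Integration.integrable_diff[OF iQ iR]])
  have "metric_entropy M shift \<le> ereal (expectation (\<lambda>x. - ln (g (word n0 x) (x n0))))"
    by (rule metric_entropy_le_model[OF g0 g1 gp gint r rint])
  also have "expectation (\<lambda>x. - ln (g (word n0 x) (x n0))) =
      expectation (\<lambda>x. - ln (Q (x (n0 - 1)) (x n0)) - (ln \<kappa>1 * ?I x + ln \<kappa>2 * (?J x - ?I x)))"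
    by (rule Bochner_Integration.integral_cong[OF refl gln])
  also have "\<dots> = expectation (\<lambda>x. - ln (Q (x (n0 - 1)) (x n0))) - expectation (\<lambda>x. ln \<kappa>1 * ?I x + ln \<kappa>2 * (?J x - ?I x))"
    by (rule Bochner_Integration.integral_diff[OF iQ iR])
  also have "expectation (\<lambda>x. ln \<kappa>1 * ?I x + ln \<kappa>2 * (?J x - ?I x)) = F a"
  proof -
    have "expectation (\<lambda>x. ln \<kappa>1 * ?I x + ln \<kappa>2 * (?J x - ?I x)) = ln \<kappa>1 * expectation ?I + ln \<kappa>2 * (expectation ?J - expectation ?I)"
      using iI iJ by (subst Bochner_Integration.integral_add) auto
    moreover have "expectation ?I = c" "expectation ?J = mw" by (auto simp: c_def mw_def word_event Int_absorb2)
    ultimately show ?thesis by (simp add: F_def \<kappa>1_def \<kappa>2_def mult.commute)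
  qed
  also have "expectation (\<lambda>x. - ln (Q (x (n0 - 1)) (x n0))) = expectation (\<lambda>x. - ln (Q (x 0) (x 1)))"
    unfolding Qsh using Qint by (intro expectation_T_iter) auto
  finally have "ereal (expectation (\<lambda>x. - ln (Q (x 0) (x 1)))) \<le> ereal (expectation (\<lambda>x. - ln (Q (x 0) (x 1))) - F a)"
    using max by (rule order_trans[rotated])
  then show False using a(2) by simp
qed

end

section \<open>Markov measures on finitely many states\<close>

lemma cylinder_borel: "{x. word n x = w} \<in> sets borel"
proof -
  have "{x :: nat \<Rightarrow> nat. x i \<in> S} \<in> sets borel" for i S
    unfolding sets_borel_sequences by (intro sigma_sets.Basic) blast
  from this[of _ "{_}"] have *: "{x :: nat \<Rightarrow> nat. x i = a} \<in> sets borel" for i a by simp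
  have "{x. word n x = w} = (if length w = n then (\<Inter>k. {x. k < n \<longrightarrow> x k = w ! k}) else {})"
    by (auto simp: word_eq_iff)
  moreover have "{x. k < n \<longrightarrow> x k = w ! k} \<in> sets borel" for k
    using *[of k "w ! k"] by (cases "k < n") auto
  ultimately show ?thesis by (auto intro!: sets.countable_INT'')
qed

lemma coordinate_borel: "{x :: nat \<Rightarrow> nat. x i \<in> S} \<in> sets borel"
  unfolding sets_borel_sequences by (intro sigma_sets.Basic) blast

lemma CMS_borel: "CMS A \<in> sets borel"
proof -
  have "CMS A = (\<Inter>k. \<Union>i. {x. x k \<in> {i}} \<inter> {x. x (Suc k) \<in> {j. A i j}})"
    by (auto simp: CMS_def)
  also have "\<dots> \<in> sets borel"
    by (intro sets.countable_INT'' sets.countable_UN'' sets.Int coordinate_borel) auto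
  finally show ?thesis .
qed

lemma measure_eq_by_words:
  fixes M N :: "(nat \<Rightarrow> nat) measure"
  assumes M: "prob_space M" "sets M = sets borel" and N: "prob_space N" "sets N = sets borel"
    and eq: "\<And>n w. measure M {x. word n x = w} = measure N {x. word n x = w}"
  shows "M = N"
proof (rule measure_eqI_generator_eq[where A = "\<lambda>_. UNIV" and \<Omega> = UNIV])
  interpret M: prob_space M by fact
  interpret N: prob_space N by fact
  \<comment> \<open>The empty set is added because cylinders over incompatible words are disjoint;
    without it the family would not be closed under intersections.\<close>
  let ?E = "insert {} (range (\<lambda>(n, w). {x. word n x = w}))"
  show "Int_stable ?E"
  proof (rule Int_stableI)
    fix a b assume ab: "a \<in> ?E" "b \<in> ?E"
    have Int: "{x. word n x = w} \<inter> {x. word m x = w'} \<in> ?E" for n w m w'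
    proof (cases "\<exists>x. word n x = w \<and> word m x = w'")
      case True
      then obtain x where x: "word n x = w" "word m x = w'" by blast
      have "{x. word n x = w} \<inter> {x. word m x = w'} = {y. word (max n m) y = word (max n m) x}"
        using x by (auto simp: word_eq_iff word_nth less_max_iff_disj)
      then show ?thesis by (auto simp: image_iff)
    next
      case False
      then have "{x. word n x = w} \<inter> {x. word m x = w'} = {}" by auto
      then show ?thesis by simp
    qed
    show "a \<inter> b \<in> ?E"
    proof (cases "a = {} \<or> b = {}")
      case False
      then obtain n w m w' where "a = {x. word n x = w}" "b = {x. word m x = w'}" using ab by auto
      then show ?thesis using Int[of n w m w'] by simp
    qed auto
  qed
  have gen: "sets borel = sigma_sets UNIV ?E"
  proof
    have "{x :: nat \<Rightarrow> nat. x i \<in> S} \<in> sigma_sets UNIV ?E" for i S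
    proof -
      have "{x. x i \<in> S} = (\<Union>w\<in>{w. length w = Suc i \<and> w ! i \<in> S}. {x. word (Suc i) x = w})"
        by (auto simp: word_nth)
      also have "\<dots> \<in> sigma_sets UNIV ?E"
        by (intro sigma_sets_UNION countable_subset[OF subset_UNIV countableI_type]) (auto intro!: sigma_sets.Basic)
      finally show ?thesis .
    qed
    then show "sets borel \<subseteq> sigma_sets UNIV ?E"
      unfolding sets_borel_sequences by (intro sigma_sets_mono) blast
    show "sigma_sets UNIV ?E \<subseteq> sets borel"
      using cylinder_borel by (intro sets.sigma_sets_subset'[of _ borel, simplified]) auto
  qed
  show "sets M = sigma_sets UNIV ?E" "sets N = sigma_sets UNIV ?E" using M N gen by auto
  show "emeasure M X = emeasure N X" if "X \<in> ?E" for X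
    using that eq by (auto simp: M.emeasure_eq_measure N.emeasure_eq_measure)
  show "emeasure M UNIV \<noteq> \<infinity>" by simp
  show "range (\<lambda>_::nat. UNIV :: (nat \<Rightarrow> nat) set) \<subseteq> ?E"
  proof -
    have "(UNIV :: (nat \<Rightarrow> nat) set) = {x. word 0 x = []}" by (auto simp: word_def)
    then show ?thesis by (auto simp: image_iff)
  qed
qed auto

text \<open>A Markov chain with finitely many relevant states, driven by independent random maps:
  the state at time \<open>k + 1\<close> is the value of the \<open>(k + 1)\<close>-st map at the state at time \<open>k\<close>.\<close>

fun driven_path :: "(nat \<Rightarrow> nat \<Rightarrow> nat) \<Rightarrow> nat \<Rightarrow> nat" where
  "driven_path \<omega> 0 = \<omega> 0 0"
| "driven_path \<omega> (Suc k) = \<omega> (Suc k) (driven_path \<omega> k)"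

text \<open>Independence of the maps factorises the probability of a word: once the word is
  prescribed, the condition at time \<open>k + 1\<close> concerns only the map of that time, at the
  point \<open>w ! k\<close>. Outside \<open>F\<close> the kernel is the default value
  \<open>0\<close> of \<open>Pi_pmf\<close>, so a product over the finite set \<open>F\<close>
  describes a whole random map.\<close>

lemma markov_chain_measure:
  fixes \<pi> :: "nat pmf" and K :: "nat \<Rightarrow> nat pmf"
  assumes F: "finite F" and K: "\<And>i. i \<notin> F \<Longrightarrow> K i = return_pmf 0"
  shows "\<exists>N. prob_space N \<and> sets N = sets (borel :: (nat \<Rightarrow> nat) measure) \<and>
    (\<forall>n w. length w = Suc n \<longrightarrow> measure N {x. word (Suc n) x = w} =
       pmf \<pi> (w ! 0) * (\<Prod>k<n. pmf (K (w ! k)) (w ! Suc k)))"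
proof -
  \<comment> \<open>The map at time \<open>0\<close> is constant with law \<pi>; evaluating it at
    the dummy argument \<open>0\<close> gives the initial state.\<close>
  define L where "L = (\<lambda>n. case n of 0 \<Rightarrow> map_pmf (\<lambda>i (_::nat). i) \<pi> | Suc _ \<Rightarrow> Pi_pmf F 0 K)"
  interpret product_prob_space "\<lambda>n. measure_pmf (L n)" UNIV
    by unfold_locales
  let ?P = "Pi\<^sub>M UNIV (\<lambda>n. measure_pmf (L n))"
  define box where "box = (\<lambda>(w::nat list) k. {f :: nat \<Rightarrow> nat. (if k = 0 then f 0 else f (w ! (k - 1))) = w ! k})"
  have path_iff: "word (Suc n) (driven_path \<omega>) = w \<longleftrightarrow> length w = Suc n \<and> (\<forall>k\<le>n. \<omega> k \<in> box w k)" for n w \<omega>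
  proof -
    have "(\<forall>k\<le>m. driven_path \<omega> k = w ! k) \<longleftrightarrow> (\<forall>k\<le>m. \<omega> k \<in> box w k)" for m
    proof (induction m)
      case (Suc m)
      have all_Suc: "(\<forall>k\<le>Suc m. P k) \<longleftrightarrow> (\<forall>k\<le>m. P k) \<and> P (Suc m)" for P by (auto simp: le_Suc_eq)
      show ?case unfolding all_Suc Suc.IH[symmetric] by (auto simp: box_def)
    qed (simp add: box_def)
    then show ?thesis by (simp add: word_eq_iff less_Suc_eq_le)
  qed
  have prob_box: "measure ?P {\<omega>. word (Suc n) (driven_path \<omega>) = w} =
       pmf \<pi> (w ! 0) * (\<Prod>k<n. pmf (K (w ! k)) (w ! Suc k))"
    and meas_box: "{\<omega>. word (Suc n) (driven_path \<omega>) = w} \<in> sets ?P" if len: "length w = Suc n" for n w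
  proof -
    have eq: "{\<omega>. word (Suc n) (driven_path \<omega>) = w} =
      prod_emb UNIV (\<lambda>n. measure_pmf (L n)) {..n} (Pi\<^sub>E {..n} (box w))"
      unfolding path_iff using len by (auto simp: prod_emb_def PiE_iff space_PiM)
    show "{\<omega>. word (Suc n) (driven_path \<omega>) = w} \<in> sets ?P"
      unfolding eq by (intro sets_PiM_I) auto
    have first: "measure (L 0) (box w 0) = pmf \<pi> (w ! 0)"
      by (simp add: L_def box_def vimage_def measure_pmf_single[symmetric])
    have later: "measure (L (Suc k)) (box w (Suc k)) = pmf (K (w ! k)) (w ! Suc k)" for k
    proof -
      have "box w (Suc k) = (\<lambda>f. f (w ! k)) -` {w ! Suc k}" by (auto simp: box_def)
      then have "measure (L (Suc k)) (box w (Suc k)) = pmf (map_pmf (\<lambda>f. f (w ! k)) (Pi_pmf F 0 K)) (w ! Suc k)"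
        by (simp add: L_def pmf_map)
      also have "map_pmf (\<lambda>f. f (w ! k)) (Pi_pmf F 0 K) = K (w ! k)"
        using K[of "w ! k"] by (simp add: Pi_pmf_component[OF F])
      finally show ?thesis .
    qed
    have "measure ?P {\<omega>. word (Suc n) (driven_path \<omega>) = w} = (\<Prod>k\<in>{..n}. measure (L k) (box w k))"
      unfolding eq by (rule measure_PiM_emb) auto
    also have "\<dots> = measure (L 0) (box w 0) * (\<Prod>k<n. measure (L (Suc k)) (box w (Suc k)))"
      unfolding lessThan_Suc_atMost[symmetric] by (rule prod.lessThan_Suc_shift)
    finally show "measure ?P {\<omega>. word (Suc n) (driven_path \<omega>) = w} =
       pmf \<pi> (w ! 0) * (\<Prod>k<n. pmf (K (w ! k)) (w ! Suc k))" by (simp only: first later)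
  qed
  have meas: "driven_path \<in> measurable ?P borel"
  proof (rule measurable_sigma_sets[where \<Omega> = UNIV])
    show "sets borel = sigma_sets UNIV {{x :: nat \<Rightarrow> nat. x i \<in> S} |i S. True}" by (rule sets_borel_sequences)
    fix B :: "(nat \<Rightarrow> nat) set" assume "B \<in> {{x. x i \<in> S} |i S. True}"
    then obtain i S where "B = {x. x i \<in> S}" by auto
    then have "driven_path -` B \<inter> space ?P =
      (\<Union>w\<in>{w. length w = Suc i \<and> w ! i \<in> S}. {\<omega>. word (Suc i) (driven_path \<omega>) = w})"
      by (auto simp: space_PiM word_nth)
    also have "\<dots> \<in> sets ?P"
      by (intro sets.countable_UN' countable_subset[OF subset_UNIV countableI_type]) (auto intro!: meas_box)
    finally show "driven_path -` B \<inter> space ?P \<in> sets ?P" .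
  qed auto
  show ?thesis
  proof (intro exI[of _ "distr ?P borel driven_path"] conjI allI impI)
    show "prob_space (distr ?P borel driven_path)" by (rule prob_space_distr[OF meas])
    fix n and w :: "nat list" assume len: "length w = Suc n"
    have "measure (distr ?P borel driven_path) {x. word (Suc n) x = w} =
      measure ?P (driven_path -` {x. word (Suc n) x = w} \<inter> space ?P)"
      by (rule measure_distr[OF meas cylinder_borel])
    also have "driven_path -` {x. word (Suc n) x = w} \<inter> space ?P = {\<omega>. word (Suc n) (driven_path \<omega>) = w}"
      by (auto simp: space_PiM)
    finally show "measure (distr ?P borel driven_path) {x. word (Suc n) x = w} =
       pmf \<pi> (w ! 0) * (\<Prod>k<n. pmf (K (w ! k)) (w ! Suc k))" using prob_box[OF len] by simp
  qed simp
qed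

lemma word_shift: "word (Suc n) x = x 0 # word n (shift x)"
  by (rule nth_equalityI) (auto simp: word_nth shift_def nth_Cons split: nat.split)

lemma shift_borel: "shift \<in> measurable borel borel"
proof (rule measurable_sigma_sets[where \<Omega> = UNIV])
  show "sets borel = sigma_sets UNIV {{x :: nat \<Rightarrow> nat. x i \<in> S} |i S. True}" by (rule sets_borel_sequences)
  fix B :: "(nat \<Rightarrow> nat) set" assume "B \<in> {{x. x i \<in> S} |i S. True}"
  then obtain i S where "B = {x. x i \<in> S}" by auto
  then have "shift -` B \<inter> space borel = {x. x (Suc i) \<in> S}" by (auto simp: shift_def)
  then show "shift -` B \<inter> space borel \<in> sets borel" by (simp add: coordinate_borel)
qed auto

text \<open>Normalised rows of \<open>p\<close> are the transition probabilities, and equality of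
  row and column sums is stationarity. The chain is built on all sequences and then restricted to
  \<open>CMS A\<close>, which has full measure because forbidden pairs have weight zero. The Markov
  property is stated in product form, so states of mass zero require no exception.\<close>

lemma finite_markov_measure:
  fixes p :: "nat \<Rightarrow> nat \<Rightarrow> real"
  assumes F: "finite F" and p0: "\<And>i j. 0 \<le> p i j" and psupp: "\<And>i j. p i j \<noteq> 0 \<Longrightarrow> i \<in> F \<and> j \<in> F \<and> A i j"
    and total: "(\<Sum>i\<in>F. \<Sum>j\<in>F. p i j) = 1"
    and balance: "\<And>i. (\<Sum>j\<in>F. p i j) = (\<Sum>j\<in>F. p j i)"
  shows "\<exists>N. inv_prob A N \<and>
    (\<forall>i. measure N {x \<in> space N. word 1 x = [i]} = (\<Sum>j\<in>F. p i j)) \<and>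
    (\<forall>w y. w \<noteq> [] \<longrightarrow> measure N {x \<in> space N. word (Suc (length w)) x = w @ [y]} * (\<Sum>j\<in>F. p (last w) j) =
       measure N {x \<in> space N. word (length w) x = w} * p (last w) y)"
proof -
  define \<pi> where "\<pi> = (\<lambda>i. \<Sum>j\<in>F. p i j)"
  have \<pi>0: "0 \<le> \<pi> i" for i unfolding \<pi>_def by (intro sum_nonneg p0)
  have \<pi>F: "\<pi> i = 0" if "i \<notin> F" for i unfolding \<pi>_def using psupp that by (intro sum.neutral) blast
  have nnF: "(\<integral>\<^sup>+ i. ennreal (f i) \<partial>count_space UNIV) = ennreal (\<Sum>i\<in>F. f i)"
    if "\<And>i. 0 \<le> f i" "\<And>i. i \<notin> F \<Longrightarrow> f i = 0" for f :: "nat \<Rightarrow> real"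
  proof -
    have "(\<integral>\<^sup>+ i. ennreal (f i) \<partial>count_space UNIV) = (\<integral>\<^sup>+ i. ennreal (f i) \<partial>count_space F)"
      using that(2) by (intro nn_integral_count_space_eq) auto
    then show ?thesis using F that by (simp add: nn_integral_count_space_finite)
  qed
  have total\<pi>: "(\<Sum>i\<in>F. \<pi> i) = 1" using total by (simp add: \<pi>_def)
  define start where "start = embed_pmf \<pi>"
  have pmfstart: "pmf start i = \<pi> i" for i
    unfolding start_def using nnF[OF \<pi>0 \<pi>F] total\<pi> by (intro pmf_embed_pmf[OF \<pi>0]) simp
  \<comment> \<open>Rows of mass zero cannot be normalised; the point mass at \<open>0\<close>
    replaces them and is the default expected by \<open>markov_chain_measure\<close>.\<close>
  define K where "K = (\<lambda>i. if \<pi> i = 0 then return_pmf 0 else embed_pmf (\<lambda>j. p i j / \<pi> i))"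
  have pmfK: "pmf (K i) j = p i j / \<pi> i" if "\<pi> i \<noteq> 0" for i j
  proof -
    have *: "0 \<le> p i j / \<pi> i" "j \<notin> F \<Longrightarrow> p i j / \<pi> i = 0" for j using p0 \<pi>0 psupp[of i j] by auto
    have "(\<Sum>j\<in>F. p i j / \<pi> i) = 1" using that by (simp add: sum_divide_distrib[symmetric] \<pi>_def)
    then have "pmf (embed_pmf (\<lambda>j. p i j / \<pi> i)) j = p i j / \<pi> i"
      using nnF[OF *] by (intro pmf_embed_pmf *) simp
    then show ?thesis using that by (simp add: K_def)
  qed
  have step: "\<pi> i * pmf (K i) j = p i j" for i j
  proof (cases "\<pi> i = 0")
    case True
    have "p i j = 0"
    proof (cases "j \<in> F")
      case jF: True
      then show ?thesis using True F p0 sum_nonneg_eq_0_iff[of F "p i"] by (simp add: \<pi>_def)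
    next
      case False
      then show ?thesis using psupp by blast
    qed
    then show ?thesis using True by simp
  qed (simp add: pmfK)
  have K0: "K i = return_pmf 0" if "i \<notin> F" for i using \<pi>F[OF that] by (simp add: K_def)
  obtain N0 where N0: "prob_space N0" "sets N0 = sets (borel :: (nat \<Rightarrow> nat) measure)" and
    N0w: "\<And>n w. length w = Suc n \<Longrightarrow> measure N0 {x. word (Suc n) x = w} = pmf start (w ! 0) * (\<Prod>k<n. pmf (K (w ! k)) (w ! Suc k))"
    using markov_chain_measure[OF F, of K start] K0 by blast
  interpret N0: prob_space N0 by fact
  have spN0: "space N0 = UNIV" using sets_eq_imp_space_eq[OF N0(2)] by simp
  have cyl: "{x. word n x = w} \<in> sets N0" for n w using cylinder_borel N0(2) by simp
  have shN0: "shift \<in> measurable N0 N0" using shift_borel by (simp add: measurable_cong_sets[OF N0(2) N0(2)])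
  have inv: "distr N0 N0 shift = N0"
  proof (rule measure_eq_by_words)
    show "prob_space (distr N0 N0 shift)" by (rule N0.prob_space_distr[OF shN0])
    fix n w
    have "measure (distr N0 N0 shift) {x. word n x = w} = measure N0 (shift -` {x. word n x = w} \<inter> space N0)"
      by (rule measure_distr[OF shN0 cyl])
    also have "shift -` {x. word n x = w} \<inter> space N0 = (\<Union>i. {x. word (Suc n) x = i # w})"
      by (auto simp: spN0 word_shift)
    also have "measure N0 (\<Union>i. {x. word (Suc n) x = i # w}) = measure N0 {x. word n x = w}"
    proof (cases "length w = n")
      case False
      then have "{x. word (Suc n) x = i # w} = {}" "{x. word n x = w} = {}" for i by (auto simp: word_eq_iff)
      then show ?thesis by simp
    next
      case len: True
      have "(\<lambda>i. measure N0 {x. word (Suc n) x = i # w}) sums measure N0 (\<Union>i. {x. word (Suc n) x = i # w})"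
        using cyl by (intro N0.finite_measure_UNION) (auto simp: disjoint_family_on_def)
      moreover have "(\<lambda>i. measure N0 {x. word (Suc n) x = i # w}) sums measure N0 {x. word n x = w}"
      proof (cases n)
        case 0
        then have "measure N0 {x. word (Suc n) x = i # w} = \<pi> i" for i using N0w[of "i # w" n] len by (simp add: pmfstart)
        moreover have "\<pi> sums (\<Sum>i\<in>F. \<pi> i)" using F \<pi>F by (intro sums_finite) auto
        moreover have "{x. word n x = w} = space N0" using 0 len by (auto simp: spN0 word_def)
        ultimately show ?thesis using total N0.prob_space by (simp add: \<pi>_def)
      next
        case (Suc m)
        define R where "R = (\<Prod>k<m. pmf (K (w ! k)) (w ! Suc k))"
        have "measure N0 {x. word (Suc n) x = i # w} = p i (w ! 0) * R" for i
          using N0w[of "i # w" n] len Suc by (simp only: prod.lessThan_Suc_shift R_def) (simp add: pmfstart step mult.assoc[symmetric])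
        moreover have "(\<lambda>i. p i (w ! 0) * R) sums (\<Sum>i\<in>F. p i (w ! 0) * R)"
          using F psupp by (intro sums_finite) auto
        moreover have "(\<Sum>i\<in>F. p i (w ! 0) * R) = \<pi> (w ! 0) * R"
          unfolding sum_distrib_right[symmetric] \<pi>_def balance ..
        moreover have "measure N0 {x. word n x = w} = \<pi> (w ! 0) * R"
          using N0w[of w m] len Suc by (simp add: pmfstart R_def)
        ultimately show ?thesis by simp
      qed
      ultimately show ?thesis by (rule sums_unique2)
    qed
    finally show "measure (distr N0 N0 shift) {x. word n x = w} = measure N0 {x. word n x = w}" .
  qed (use N0 in auto)
  interpret T: measure_preserving N0 shift
    by (intro measure_preserving.intro measure_preserving_axioms.intro N0(1) shN0 inv)
  have pair: "measure N0 {x. x k = i \<and> x (Suc k) = j} = p i j" for i j k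
  proof -
    have "measure N0 {x. x k = i \<and> x (Suc k) = j} = measure N0 ((shift ^^ k) -` {x. word (Suc 1) x = [i, j]} \<inter> space N0)"
      by (rule arg_cong[where f = "measure N0"]) (auto simp: spN0 word_eq_iff shift_iter less_Suc_eq)
    also have "\<dots> = measure N0 {x. word (Suc 1) x = [i, j]}" by (rule T.prob_T_iter[OF cyl])
    also have "\<dots> = p i j" by (subst N0w) (auto simp: pmfstart step)
    finally show ?thesis .
  qed
  have pairset: "{x. x k = i \<and> x (Suc k) = j} \<in> sets N0" for k i j
    using sets.Int[OF coordinate_borel[of k "{i}"] coordinate_borel[of "Suc k" "{j}"]] N0(2) by (simp add: Int_def)
  have "AE x in N0. x \<in> CMS A"
  proof -
    have "AE x in N0. \<forall>k i j. \<not> A i j \<longrightarrow> \<not> (x k = i \<and> x (Suc k) = j)"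
      unfolding AE_all_countable
    proof (intro allI impI)
      fix k i j
      show "AE x in N0. \<not> A i j \<longrightarrow> \<not> (x k = i \<and> x (Suc k) = j)"
      proof (cases "A i j")
        case False
        then have "measure N0 {x. x k = i \<and> x (Suc k) = j} = 0" using pair psupp by metis
        then have "{x. x k = i \<and> x (Suc k) = j} \<in> null_sets N0"
          using pairset by (simp add: null_sets_def N0.emeasure_eq_measure)
        then show ?thesis by (rule AE_I') auto
      qed simp
    qed
    then show ?thesis by eventually_elim (auto simp: CMS_def)
  qed
  note AE_CMS = this
  define N where "N = restrict_space N0 (CMS A)"
  have CN0: "CMS A \<in> sets N0" using CMS_borel N0(2) by simp
  have spN: "space N = CMS A" by (simp add: N_def space_restrict_space spN0)
  have setsN: "sets N = sets (restrict_space borel (CMS A))"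
    unfolding N_def by (simp add: sets_restrict_space N0(2))
  have emN: "emeasure N B = emeasure N0 B" if "B \<in> sets N" for B
    using that CN0 spN unfolding N_def by (subst emeasure_restrict_space) (auto simp: sets_restrict_space)
  have emCMS: "emeasure N0 (CMS A \<inter> B) = emeasure N0 B" if "B \<in> sets N0" for B
    using AE_CMS that CN0 by (intro emeasure_eq_AE) (auto elim: eventually_mono)
  have "emeasure N0 (CMS A) = 1" using emCMS[of UNIV] N0.emeasure_space_1 spN0 sets.top[of N0] by simp
  then have probN: "prob_space N"
    using emN[of "CMS A"] sets.top[of N] by (intro prob_spaceI) (simp add: spN)
  have shCMS: "shift x \<in> CMS A" if "x \<in> CMS A" for x using that by (auto simp: CMS_def shift_def)
  have shN: "shift \<in> measurable N N"
    unfolding N_def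
    by (rule measurable_restrict_space2)
      (auto simp: space_restrict_space shCMS intro: measurable_restrict_space1[OF shN0])
  have "distr N N shift = N"
  proof (rule measure_eqI)
    fix B assume "B \<in> sets (distr N N shift)"
    then have B: "B \<in> sets N" by simp
    then have BN0: "B \<in> sets N0" "B \<subseteq> CMS A" unfolding N_def using CN0 by (auto simp: sets_restrict_space)
    have s: "shift -` B \<inter> space N \<in> sets N" by (rule measurable_sets[OF shN B])
    have sN0: "shift -` B \<in> sets N0" using measurable_sets[OF shN0 BN0(1)] by (simp add: spN0)
    have "emeasure (distr N N shift) B = emeasure N0 (CMS A \<inter> shift -` B)"
      using emeasure_distr[OF shN B] emN[OF s] by (simp add: spN Int_commute)
    also have "\<dots> = emeasure N0 (shift -` B)" by (rule emCMS[OF sN0])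
    also have "\<dots> = emeasure (distr N0 N0 shift) B" using emeasure_distr[OF shN0 BN0(1)] by (simp add: spN0)
    also have "\<dots> = emeasure N B" using emN[OF B] by (simp add: inv)
    finally show "emeasure (distr N N shift) B = emeasure N B" .
  qed simp
  then have "inv_prob A N" unfolding inv_prob_def using probN spN setsN shN by simp
  have wordN: "measure N {x \<in> space N. word n x = w} = measure N0 {x. word n x = w}" for n w
  proof -
    have eq: "{x \<in> space N. word n x = w} = CMS A \<inter> {x. word n x = w}" by (auto simp: spN)
    moreover have "CMS A \<inter> {x. word n x = w} \<in> sets N"
      unfolding setsN by (auto simp: sets_restrict_space intro: cylinder_borel)
    ultimately show ?thesis unfolding measure_def using emN emCMS[OF cyl] by simp
  qed
  have "measure N {x \<in> space N. word (Suc (length w)) x = w @ [y]} * \<pi> (last w) =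
       measure N {x \<in> space N. word (length w) x = w} * p (last w) y" if w: "w \<noteq> []" for w y
  proof -
    obtain n where n: "length w = Suc n" using w by (cases w) auto
    have lw: "last w = w ! n" using w n by (simp add: last_conv_nth)
    define R where "R = (\<Prod>k<n. pmf (K (w ! k)) (w ! Suc k))"
    have "measure N0 {x. word (Suc (length w)) x = w @ [y]} = pmf start (w ! 0) * (R * pmf (K (w ! n)) y)"
      unfolding n using n by (subst N0w) (auto simp: nth_append R_def)
    moreover have "measure N0 {x. word (length w) x = w} = pmf start (w ! 0) * R"
      unfolding n using N0w[OF n] by (simp add: R_def)
    moreover have "pmf (K (w ! n)) y * \<pi> (w ! n) = p (w ! n) y" using step[of "w ! n" y] by (simp add: mult.commute)
    ultimately show ?thesis unfolding wordN lw by simp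
  qed
  moreover have "measure N {x \<in> space N. word 1 x = [i]} = \<pi> i" for i
    unfolding wordN using N0w[of "[i]" 0] by (simp add: pmfstart)
  ultimately show ?thesis using \<open>inv_prob A N\<close> unfolding \<pi>_def by blast
qed

section \<open>State partitions and coboundaries under an invariant measure\<close>

context shift_measure
begin

lemma word_1_iff: "word 1 x = [i] \<longleftrightarrow> x 0 = i"
  by (auto simp: word_eq_iff)

lemma prob_coordinate: "prob {x \<in> space M. x k = i} = prob {x \<in> space M. x 0 = i}"
proof -
  have "{x \<in> space M. x k = i} = (shift ^^ k) -` {x \<in> space M. x 0 = i} \<inter> space M"
    using T_iter_space by (auto simp: shift_iter)
  then show ?thesis using prob_T_iter[of "{x \<in> space M. x 0 = i}" k] by simp
qed

lemma AE_coordinates: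
  assumes "\<And>i. i \<notin> G \<Longrightarrow> prob {x \<in> space M. x 0 = i} = 0"
  shows "AE x in M. \<forall>k. x k \<in> G"
proof -
  have "AE x in M. \<forall>k i. i \<notin> G \<longrightarrow> x k \<noteq> i"
    unfolding AE_all_countable
  proof (intro allI impI)
    fix k i
    show "AE x in M. i \<notin> G \<longrightarrow> x k \<noteq> i"
    proof (cases "i \<in> G")
      case False
      then have "prob {x \<in> space M. x k = i} = 0" using assms[OF False] prob_coordinate[of k i] by simp
      then have "{x \<in> space M. x k = i} \<in> null_sets M"
        by (simp add: null_sets_def emeasure_eq_measure)
      then show ?thesis by (rule AE_I') auto
    qed simp
  qed
  then show ?thesis by eventually_elim auto
qed

lemma pair_function_measurable [measurable]: "(\<lambda>x. f (x i) (x j) :: real) \<in> borel_measurable M"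
  by measurable

lemma integrable_finite_coordinates:
  fixes f :: "nat \<Rightarrow> nat \<Rightarrow> real"
  assumes G: "finite G" and AE: "AE x in M. \<forall>k. x k \<in> G"
  shows "integrable M (\<lambda>x. f (x i) (x j))"
proof (rule integrable_const_bound)
  show "AE x in M. norm (f (x i) (x j)) \<le> (\<Sum>a\<in>G. \<Sum>b\<in>G. \<bar>f a b\<bar>)"
    using AE
  proof eventually_elim
    case (elim x)
    have "\<bar>f (x i) (x j)\<bar> \<le> (\<Sum>b\<in>G. \<bar>f (x i) b\<bar>)" using G elim by (intro member_le_sum) auto
    also have "\<dots> \<le> (\<Sum>a\<in>G. \<Sum>b\<in>G. \<bar>f a b\<bar>)"
      using G elim by (intro member_le_sum[of "x i" G "\<lambda>a. \<Sum>b\<in>G. \<bar>f a b\<bar>"]) (auto intro: sum_nonneg)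
    finally show ?case by simp
  qed
qed measurable

lemma expectation_pair_shift:
  "expectation (\<lambda>x. f (x k) (x (Suc k))) = expectation (\<lambda>x. f (x 0) (x 1) :: real)"
  using expectation_T_iter[of "\<lambda>x. f (x 0) (x 1)" k] by (simp add: shift_iter)

lemma state_partition:
  assumes "finite G"
  defines "P \<equiv> (\<lambda>i. {x \<in> space M. x 0 = i}) ` G \<union> {{x \<in> space M. x 0 \<notin> G}}"
  shows "fin_partition M P"
    and "\<And>x. x \<in> space M \<Longrightarrow> x 0 \<in> G \<Longrightarrow> cell P x = {y \<in> space M. y 0 = x 0}"
proof -
  define \<kappa> where "\<kappa> = (\<lambda>i. if i \<in> G then Some i else None)"
  define S where "S = (\<lambda>c. {x \<in> space M. \<kappa> (x 0) = c})"
  have S: "S (Some i) = {x \<in> space M. x 0 = i}" if "i \<in> G" for i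
    using that by (auto simp: S_def \<kappa>_def)
  have "S None = {x \<in> space M. x 0 \<notin> G}" by (auto simp: S_def \<kappa>_def)
  then have P_eq: "P = S ` insert None (Some ` G)" using S by (auto simp: P_def image_iff)
  show P: "fin_partition M P"
    unfolding fin_partition_def
  proof (intro conjI)
    show "finite P" using assms(1) by (simp add: P_eq)
    have "S c \<in> events" for c unfolding S_def by measurable
    then show "P \<subseteq> events" by (auto simp: P_eq)
    show "\<Union> P = space M" by (auto simp: P_eq S_def \<kappa>_def)
    show "disjoint P"
    proof (rule disjointI)
      fix a b assume "a \<in> P" "b \<in> P" "a \<noteq> b"
      then obtain c d where "a = S c" "b = S d" "c \<noteq> d" by (auto simp: P_eq)
      then show "a \<inter> b = {}" by (auto simp: S_def)
    qed
  qed
  show "cell P x = {y \<in> space M. y 0 = x 0}" if "x \<in> space M" "x 0 \<in> G" for x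
    using that by (intro cell(3)[OF P]) (auto simp: P_def)
qed

text \<open>For a point that never leaves \<open>G\<close> the visited cells reveal every letter,
  since the cell that collects the states outside \<open>G\<close> is never visited. Sharing its
  itinerary is thus the same as sharing its word.\<close>

lemma itinerary_level_prob:
  assumes "finite G" "x \<in> space M" "\<forall>k. x k \<in> G"
  defines "P \<equiv> (\<lambda>i. {x \<in> space M. x 0 = i}) ` G \<union> {{x \<in> space M. x 0 \<notin> G}}"
  shows "level_prob M (itinerary (cell P) n) (itinerary (cell P) n x) = prob {y \<in> space M. word n y = word n x}"
proof -
  note sp = state_partition[OF assms(1), folded P_def]
  have cellk: "cell P ((shift ^^ k) x) = {y \<in> space M. y 0 = x k}" for k
    using sp(2)[OF T_iter_space[OF assms(2)], of k] assms(3) by (simp add: shift_iter)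
  have "itinerary (cell P) n y = itinerary (cell P) n x \<longleftrightarrow> word n y = word n x" if y: "y \<in> space M" for y
  proof
    assume eq: "itinerary (cell P) n y = itinerary (cell P) n x"
    have "y k = x k" if "k < n" for k
    proof -
      have "cell P ((shift ^^ k) y) = cell P ((shift ^^ k) x)"
        using eq that by (metis itinerary_nth)
      then have "(shift ^^ k) y \<in> {y \<in> space M. y 0 = x k}"
        using cell(2)[OF sp(1) T_iter_space[OF y], of k] cellk by simp
      then show ?thesis by (simp add: shift_iter)
    qed
    then show "word n y = word n x" by (simp add: word_eq_iff word_nth)
  next
    assume "word n y = word n x"
    then have eq: "y k = x k" if "k < n" for k using that by (simp add: word_eq_iff word_nth)
    have "cell P ((shift ^^ k) y) = cell P ((shift ^^ k) x)" if "k < n" for k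
    proof -
      have "cell P ((shift ^^ k) y) = {z \<in> space M. z 0 = y k}"
        using sp(2)[OF T_iter_space[OF y], of k] assms(3) eq[OF that] by (simp add: shift_iter)
      then show ?thesis using eq[OF that] cellk by simp
    qed
    then show "itinerary (cell P) n y = itinerary (cell P) n x"
      by (simp add: itinerary_eq_iff itinerary_nth)
  qed
  then show ?thesis unfolding level_prob_def by (intro arg_cong[where f = prob]) auto
qed

lemma ext_integral_integrable:
  assumes "integrable M f" shows "ext_integral M f = ereal (expectation f)"
proof -
  have fin: "(\<integral>\<^sup>+ x. ennreal (f x) \<partial>M) < \<infinity>" "(\<integral>\<^sup>+ x. ennreal (- f x) \<partial>M) < \<infinity>"
    using assms by (auto simp: real_integrable_def less_top)
  then have "expectation f = enn2real (\<integral>\<^sup>+ x. ennreal (f x) \<partial>M) - enn2real (\<integral>\<^sup>+ x. ennreal (- f x) \<partial>M)"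
    using real_lebesgue_integral_def[OF assms] by simp
  moreover have "enn2ereal a = ereal (enn2real a)" if "a < \<infinity>" for a
    using that by (cases a) (auto simp: enn2ereal_ennreal)
  ultimately show ?thesis using fin by (simp add: ext_integral_def)
qed

text \<open>Truncation keeps the sign of a coboundary and does not increase its absolute value, so a
  one-sided bound is enough.\<close>

lemma coboundary_expectation:
  fixes f :: "nat \<Rightarrow> real"
  assumes h: "integrable M h" and le: "\<And>x. x \<in> space M \<Longrightarrow> h x \<le> f (x 0) - f (x 1)"
  shows "integrable M (\<lambda>x. f (x 0) - f (x 1))" "expectation (\<lambda>x. f (x 0) - f (x 1)) = 0"
proof -
  let ?g = "\<lambda>x. f (x 0) - f (x 1)"
  define fn where "fn = (\<lambda>n i. max (- real n) (min (real n) (f i)))"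
  let ?gn = "\<lambda>n x. fn n (x 0) - fn n (x 1)"
  have fn_bd: "\<bar>fn n i\<bar> \<le> real n" for n i by (auto simp: fn_def)
  have ifn: "integrable M (\<lambda>x. fn n (x k))" for n k
    by (rule integrable_const_bound[of _ "real n"]) (use fn_bd in auto)
  have ign: "integrable M (?gn n)" for n using ifn by simp
  have Egn: "expectation (?gn n) = 0" for n
    using expectation_T_iter[of "\<lambda>x. fn n (x 0)" 1] ifn by (simp add: shift_def)
  have sgn: "- ?gn n x \<le> max 0 (- ?g x)" "\<bar>?gn n x\<bar> \<le> \<bar>?g x\<bar>" for n x
    by (auto simp: fn_def)
  have lim: "(\<lambda>n. ?gn n x) \<longlonglongrightarrow> ?g x" for x
  proof -
    have "(\<lambda>n. fn n i) \<longlonglongrightarrow> f i" for i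
    proof (rule tendsto_eventually)
      obtain N :: nat where N: "\<bar>f i\<bar> \<le> real N" using real_arch_simple by blast
      show "\<forall>\<^sub>F n in sequentially. fn n i = f i"
        using eventually_ge_at_top[of N] by eventually_elim (use N in \<open>auto simp: fn_def\<close>)
    qed
    then show ?thesis by (intro tendsto_diff)
  qed
  \<comment> \<open>The truncated coboundary has mean zero by invariance, so the integral of its
    positive part equals that of its negative part, which \<open>h\<close> controls uniformly in
    \<open>n\<close>. Fatou's lemma then removes the truncation.\<close>
  have pos_eq: "(\<integral>\<^sup>+ x. ennreal (?gn n x) \<partial>M) = (\<integral>\<^sup>+ x. ennreal (- ?gn n x) \<partial>M)" for n
  proof -
    have fin: "(\<integral>\<^sup>+ x. ennreal (?gn n x) \<partial>M) \<noteq> \<infinity>" "(\<integral>\<^sup>+ x. ennreal (- ?gn n x) \<partial>M) \<noteq> \<infinity>"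
      using ign[of n] by (auto simp: real_integrable_def)
    have "enn2real (\<integral>\<^sup>+ x. ennreal (?gn n x) \<partial>M) = enn2real (\<integral>\<^sup>+ x. ennreal (- ?gn n x) \<partial>M)"
      using real_lebesgue_integral_def[OF ign[of n]] Egn[of n] by simp
    moreover have "a = b" if "a \<noteq> \<infinity>" "b \<noteq> \<infinity>" "enn2real a = enn2real b" for a b
      using that by (cases a; cases b) auto
    ultimately show ?thesis using fin by blast
  qed
  have bound: "(\<integral>\<^sup>+ x. ennreal (?gn n x) \<partial>M) \<le> (\<integral>\<^sup>+ x. ennreal (norm (h x)) \<partial>M)" for n
    unfolding pos_eq
  proof (intro nn_integral_mono ennreal_leI)
    fix x assume "x \<in> space M"
    then show "- ?gn n x \<le> norm (h x)" using sgn(1)[of n x] le[of x] by auto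
  qed
  have "(\<integral>\<^sup>+ x. ennreal (?g x) \<partial>M) = (\<integral>\<^sup>+ x. liminf (\<lambda>n. ennreal (?gn n x)) \<partial>M)"
    by (intro nn_integral_cong lim_imp_Liminf[symmetric] tendsto_ennrealI lim) auto
  also have "\<dots> \<le> liminf (\<lambda>n. \<integral>\<^sup>+ x. ennreal (?gn n x) \<partial>M)"
    by (rule nn_integral_liminf) auto
  also have "\<dots> \<le> (\<integral>\<^sup>+ x. ennreal (norm (h x)) \<partial>M)"
    using bound by (intro Liminf_le always_eventually allI) auto
  also have "\<dots> < \<infinity>" using h by (simp add: integrable_iff_bounded)
  finally have p: "(\<integral>\<^sup>+ x. ennreal (?g x) \<partial>M) \<noteq> \<infinity>" by simp
  have "(\<integral>\<^sup>+ x. ennreal (- ?g x) \<partial>M) \<le> (\<integral>\<^sup>+ x. ennreal (norm (h x)) \<partial>M)"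
  proof (intro nn_integral_mono ennreal_leI)
    fix x assume "x \<in> space M"
    then show "- ?g x \<le> norm (h x)" using le[of x] by auto
  qed
  also have "\<dots> < \<infinity>" using h by (simp add: integrable_iff_bounded)
  finally show int: "integrable M ?g" using p by (auto simp: real_integrable_def)
  have "(\<lambda>n. expectation (?gn n)) \<longlonglongrightarrow> expectation ?g"
  proof (rule integral_dominated_convergence[where w = "\<lambda>x. \<bar>?g x\<bar>"])
    show "integrable M (\<lambda>x. \<bar>?g x\<bar>)" using int by (rule integrable_abs)
    show "AE x in M. (\<lambda>n. ?gn n x) \<longlonglongrightarrow> ?g x" by (intro AE_I2 lim)
    show "AE x in M. norm (?gn n x) \<le> \<bar>?g x\<bar>" for n
      unfolding real_norm_def by (intro AE_I2 sgn)
  qed measurable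
  then show "expectation ?g = 0" unfolding Egn by (simp add: LIMSEQ_const_iff)
qed

end

text \<open>The Markov measure with pair law \<open>u i * W i j * v j / (l * c)\<close>. Its word
  probabilities telescope to a product of factors \<open>W / l\<close> with one boundary factor at
  each end, so the entropy of \<open>Suc m\<close> labels is \<open>m\<close> times
  \<open>ln l - t * \<Psi>\<close> plus a constant. The partition into the states of
  \<open>G\<close> thus already attains the free energy \<open>ln l\<close>.\<close>

theorem perron_measure:
  assumes G: "finite G" "G \<noteq> {}" and pd: "perron_data (transfer_weight A \<psi> t) G l u v"
  shows "\<exists>N. inv_prob A N \<and> integrable N (\<lambda>x. \<psi> (x 0) (x 1)) \<and>
    ereal (ln l) \<le> metric_entropy N shift + ereal (t * (\<integral>x. \<psi> (x 0) (x 1) \<partial>N))"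
proof -
  let ?W = "transfer_weight A \<psi> t"
  have l: "l > 0" and u: "\<And>i. i \<in> G \<Longrightarrow> u i > 0" and v: "\<And>i. i \<in> G \<Longrightarrow> v i > 0"
    and right: "\<And>i. i \<in> G \<Longrightarrow> (\<Sum>j\<in>G. ?W i j * v j) = l * v i"
    and left: "\<And>j. j \<in> G \<Longrightarrow> (\<Sum>i\<in>G. u i * ?W i j) = l * u j"
    using pd by (auto simp: perron_data_def)
  define c where "c = (\<Sum>i\<in>G. u i * v i)"
  have c: "c > 0" unfolding c_def using G u v by (intro sum_pos) auto
  define p where "p = (\<lambda>i j. if i \<in> G \<and> j \<in> G then u i * ?W i j * v j / (l * c) else 0)"
  define \<pi> where "\<pi> = (\<lambda>i. if i \<in> G then u i * v i / c else 0)"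
  have row: "(\<Sum>j\<in>G. p i j) = \<pi> i" for i
  proof (cases "i \<in> G")
    case True
    then have "(\<Sum>j\<in>G. p i j) = u i * (\<Sum>j\<in>G. ?W i j * v j) / (l * c)"
      by (simp add: p_def sum_distrib_left sum_divide_distrib mult_ac)
    then show ?thesis using right[OF True] l True by (simp add: \<pi>_def)
  qed (simp add: p_def \<pi>_def)
  have col: "(\<Sum>j\<in>G. p j i) = \<pi> i" for i
  proof (cases "i \<in> G")
    case True
    then have "(\<Sum>j\<in>G. p j i) = (\<Sum>j\<in>G. u j * ?W j i) * v i / (l * c)"
      by (simp add: p_def sum_distrib_left sum_distrib_right sum_divide_distrib mult_ac)
    then show ?thesis using left[OF True] l True by (simp add: \<pi>_def)
  qed (simp add: p_def \<pi>_def)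
  have "\<exists>N. inv_prob A N \<and>
    (\<forall>i. measure N {x \<in> space N. word 1 x = [i]} = (\<Sum>j\<in>G. p i j)) \<and>
    (\<forall>w y. w \<noteq> [] \<longrightarrow> measure N {x \<in> space N. word (Suc (length w)) x = w @ [y]} * (\<Sum>j\<in>G. p (last w) j) =
       measure N {x \<in> space N. word (length w) x = w} * p (last w) y)"
  proof (rule finite_markov_measure[OF G(1)])
    show "0 \<le> p i j" for i j
      using u v l c transfer_weight_nonneg[of A \<psi> t i j]
      by (auto simp: p_def intro!: divide_nonneg_pos mult_nonneg_nonneg less_imp_le[OF u] less_imp_le[OF v])
    show "i \<in> G \<and> j \<in> G \<and> A i j" if "p i j \<noteq> 0" for i j
      using that by (auto simp: p_def transfer_weight_def split: if_splits)
    have "(\<Sum>i\<in>G. \<pi> i) = 1" using c by (simp add: \<pi>_def c_def sum_divide_distrib[symmetric])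
    then show "(\<Sum>i\<in>G. \<Sum>j\<in>G. p i j) = 1" by (simp add: row)
    show "(\<Sum>j\<in>G. p i j) = (\<Sum>j\<in>G. p j i)" for i by (simp add: row col)
  qed
  then obtain N where inv: "inv_prob A N" and start: "\<And>i. measure N {x \<in> space N. word 1 x = [i]} = \<pi> i"
    and next_word: "\<And>w y. w \<noteq> [] \<Longrightarrow> measure N {x \<in> space N. word (Suc (length w)) x = w @ [y]} * \<pi> (last w) =
       measure N {x \<in> space N. word (length w) x = w} * p (last w) y"
    unfolding row by blast
  interpret shift_measure A N by unfold_locales fact
  have AEG: "AE x in N. \<forall>k. x k \<in> G"
    by (rule AE_coordinates) (use start[unfolded word_1_iff] in \<open>simp add: \<pi>_def\<close>)
  have weight: "measure N {x \<in> space N. word (Suc n) x = w} =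
      u (w ! 0) / c * (\<Prod>k<n. ?W (w ! k) (w ! Suc k) / l) * v (w ! n)"
    if "length w = Suc n" "set w \<subseteq> G" for n w
    using that
  proof (induction n arbitrary: w)
    case 0
    then obtain i where w: "w = [i]" by (cases w) auto
    then show ?case using start[of i] 0 by (simp add: \<pi>_def)
  next
    case (Suc n)
    define w' where "w' = butlast w"
    define y where "y = last w"
    have "w \<noteq> []" using Suc.prems by auto
    then have w: "w = w' @ [y]" "length w' = Suc n"
      using Suc.prems by (simp_all add: w'_def y_def)
    then have w'ne: "w' \<noteq> []" by auto
    have wG: "set w' \<subseteq> G" "y \<in> G" using Suc.prems w by auto
    define z where "z = w' ! n"
    have z: "last w' = z" "z \<in> G" using w w'ne wG by (auto simp: z_def last_conv_nth)
    have IH: "measure N {x \<in> space N. word (Suc n) x = w'} =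
      u (w' ! 0) / c * (\<Prod>k<n. ?W (w' ! k) (w' ! Suc k) / l) * v z"
      unfolding z_def by (rule Suc.IH[OF w(2) wG(1)])
    have "measure N {x \<in> space N. word (Suc (Suc n)) x = w} * (u z * v z / c) =
      (u (w' ! 0) / c * (\<Prod>k<n. ?W (w' ! k) (w' ! Suc k) / l) * v z) * (u z * ?W z y * v y / (l * c))"
      using next_word[OF w'ne, of y] z wG IH w by (simp add: \<pi>_def p_def)
    then have "measure N {x \<in> space N. word (Suc (Suc n)) x = w} =
      u (w' ! 0) / c * (\<Prod>k<n. ?W (w' ! k) (w' ! Suc k) / l) * (?W z y / l) * v y"
      using u[OF z(2)] v[OF z(2)] c l by (simp add: field_simps)
    moreover have "(\<Prod>k<Suc n. ?W (w ! k) (w ! Suc k) / l) = (\<Prod>k<n. ?W (w' ! k) (w' ! Suc k) / l) * (?W z y / l)"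
      using w by (simp add: nth_append z_def)
    moreover have "w ! 0 = w' ! 0" "w ! Suc n = y" using w by (auto simp: nth_append)
    ultimately show ?case by (simp only: mult.assoc)
  qed
  define P where "P = (\<lambda>i. {x \<in> space N. x 0 = i}) ` G \<union> {{x \<in> space N. x 0 \<notin> G}}"
  have P: "fin_partition N P" unfolding P_def by (rule state_partition(1)[OF G(1)])
  define \<Psi> where "\<Psi> = expectation (\<lambda>x. \<psi> (x 0) (x 1))"
  define C where "C = expectation (\<lambda>x. - ln (u (x 0) / c)) + expectation (\<lambda>x. - ln (v (x 0)))"
  have iu: "integrable N (\<lambda>x. - ln (u (x k) / c))" for k
    by (rule integrable_finite_coordinates[OF G(1) AEG, of "\<lambda>i j. - ln (u i / c)" k 0])
  have iv: "integrable N (\<lambda>x. - ln (v (x k)))" for k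
    by (rule integrable_finite_coordinates[OF G(1) AEG, of "\<lambda>i j. - ln (v i)" k 0])
  have i\<psi>: "integrable N (\<lambda>x. \<psi> (x k) (x (Suc k)))" for k
    by (rule integrable_finite_coordinates[OF G(1) AEG])
  have ent: "label_entropy N (itinerary (cell P) (Suc m)) = C + real m * (ln l - t * \<Psi>)" for m
  proof -
    have AEeq: "AE x in N. - ln (level_prob N (itinerary (cell P) (Suc m)) (itinerary (cell P) (Suc m) x)) =
      - ln (u (x 0) / c) + - ln (v (x m)) + (\<Sum>k<m. ln l - t * \<psi> (x k) (x (Suc k)))"
      using AEG AE_space
    proof eventually_elim
      case (elim x)
      have Wk: "?W (x k) (x (Suc k)) = exp (t * \<psi> (x k) (x (Suc k)))" for k
        using elim(2) by (simp add: transfer_weight_def space_M CMS_def)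
      have "level_prob N (itinerary (cell P) (Suc m)) (itinerary (cell P) (Suc m) x) =
        measure N {y \<in> space N. word (Suc m) y = word (Suc m) x}"
        unfolding P_def by (rule itinerary_level_prob[OF G(1) elim(2,1)])
      also have "\<dots> = u (x 0) / c * (\<Prod>k<m. exp (t * \<psi> (x k) (x (Suc k))) / l) * v (x m)"
      proof -
        have "set (word (Suc m) x) \<subseteq> G" using elim(1) by (auto simp: word_def)
        from weight[OF length_word this] show ?thesis by (simp add: word_nth Wk)
      qed
      finally have lp: "level_prob N (itinerary (cell P) (Suc m)) (itinerary (cell P) (Suc m) x) =
        u (x 0) / c * (\<Prod>k<m. exp (t * \<psi> (x k) (x (Suc k))) / l) * v (x m)" .
      have pos: "0 < u (x 0) / c" "0 < (\<Prod>k<m. exp (t * \<psi> (x k) (x (Suc k))) / l)" "0 < v (x m)"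
        using elim(1) u v c l by (auto intro!: prod_pos)
      have lnp: "ln (\<Prod>k<m. exp (t * \<psi> (x k) (x (Suc k))) / l) = (\<Sum>k<m. t * \<psi> (x k) (x (Suc k)) - ln l)"
        using l by (subst ln_prod) (auto simp: ln_div)
      have "- ln (a * b * d) = - ln a + - ln d + - ln b" if "0 < a" "0 < b" "0 < d" for a b d :: real
        using that by (simp add: ln_mult_pos mult_pos_pos)
      from this[OF pos] show ?case unfolding lp lnp by (simp add: sum_negf[symmetric])
    qed
    have isum: "integrable N (\<lambda>x. \<Sum>k<m. ln l - t * \<psi> (x k) (x (Suc k)))" using i\<psi> by simp
    have "label_entropy N (itinerary (cell P) (Suc m)) =
      expectation (\<lambda>x. - ln (u (x 0) / c) + - ln (v (x m)) + (\<Sum>k<m. ln l - t * \<psi> (x k) (x (Suc k))))"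
      unfolding label_entropy_expectation[OF itinerary_measurable[OF cell_measurable[OF P]]]
    proof (rule integral_cong_AE[OF _ _ AEeq])
      show "(\<lambda>x. - ln (level_prob N (itinerary (cell P) (Suc m)) (itinerary (cell P) (Suc m) x))) \<in> borel_measurable N"
        using level_sum_expectation(1)[OF itinerary_measurable[OF cell_measurable[OF P]],
            of "\<lambda>a. - ln (level_prob N (itinerary (cell P) (Suc m)) a)" "Suc m"] by auto
    qed measurable
    also have "\<dots> = expectation (\<lambda>x. - ln (u (x 0) / c)) + expectation (\<lambda>x. - ln (v (x m))) +
       expectation (\<lambda>x. \<Sum>k<m. ln l - t * \<psi> (x k) (x (Suc k)))"
      using Bochner_Integration.integral_add[OF Bochner_Integration.integrable_add[OF iu[of 0] iv[of m]] isum]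
        Bochner_Integration.integral_add[OF iu[of 0] iv[of m]] by simp
    also have "expectation (\<lambda>x. - ln (v (x m))) = expectation (\<lambda>x. - ln (v (x 0)))"
      using expectation_pair_shift[of "\<lambda>i j. - ln (v i)" m] by simp
    also have "expectation (\<lambda>x. \<Sum>k<m. ln l - t * \<psi> (x k) (x (Suc k))) =
        (\<Sum>k<m. expectation (\<lambda>x. ln l - t * \<psi> (x k) (x (Suc k))))"
      using i\<psi> by (intro Bochner_Integration.integral_sum) auto
    also have "\<dots> = (\<Sum>k<m. ln l - t * \<Psi>)"
      using i\<psi> expectation_pair_shift[of \<psi>] by (intro sum.cong refl) (simp add: prob_space \<Psi>_def)
    finally show ?thesis by (simp add: C_def)
  qed
  have "(\<lambda>n. label_entropy N (itinerary (cell P) (Suc n)) / real (Suc n)) \<longlonglongrightarrow> ln l - t * \<Psi>"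
  proof -
    have "(\<lambda>n. (C - (ln l - t * \<Psi>)) / real (Suc n) + (ln l - t * \<Psi>)) \<longlonglongrightarrow> 0 + (ln l - t * \<Psi>)"
      by (intro tendsto_add tendsto_const LIMSEQ_Suc[OF lim_const_over_n])
    moreover have "(C - (ln l - t * \<Psi>)) / real (Suc n) + (ln l - t * \<Psi>) =
      label_entropy N (itinerary (cell P) (Suc n)) / real (Suc n)" for n
      unfolding ent by (simp add: field_simps)
    ultimately show ?thesis by simp
  qed
  then have "entropy_wrt N shift P = ln l - t * \<Psi>"
    using entropy_wrt_limit[OF P] LIMSEQ_unique by blast
  then have "ereal (ln l - t * \<Psi>) \<le> metric_entropy N shift"
    unfolding metric_entropy_def using P by (intro SUP_upper2[of P]) auto
  then have "ereal (ln l - t * \<Psi>) + ereal (t * \<Psi>) \<le> metric_entropy N shift + ereal (t * \<Psi>)"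
    by (rule add_right_mono)
  then show ?thesis using inv i\<psi>[of 0] unfolding \<Psi>_def by (intro exI[of _ N]) simp
qed

section \<open>Equilibrium states are Markov\<close>

lemma ennreal_liminf_mult_left_le:
  "ennreal c * liminf f \<le> liminf (\<lambda>n. ennreal c * f n)"
  unfolding liminf_SUP_INF SUP_mult_left_ennreal
  by (intro SUP_mono) (auto intro!: INF_greatest mult_left_mono INF_lower)

lemma ennreal_liminf_mult_right_le:
  assumes "c > 0" shows "liminf (\<lambda>n. ennreal c * f n) \<le> ennreal c * liminf f"
proof -
  have one: "ennreal c * (ennreal (1 / c) * a) = a" "ennreal (1 / c) * (ennreal c * a) = a" for a
    using assms by (simp_all add: mult.assoc[symmetric] ennreal_mult[symmetric])
  have "liminf (\<lambda>n. ennreal c * f n) = ennreal c * (ennreal (1 / c) * liminf (\<lambda>n. ennreal c * f n))"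
    by (simp only: one)
  also have "\<dots> \<le> ennreal c * liminf (\<lambda>n. ennreal (1 / c) * (ennreal c * f n))"
    by (intro mult_left_mono ennreal_liminf_mult_left_le) simp
  finally show ?thesis by (simp only: one)
qed

locale zero_temperature =
  fixes A :: "nat \<Rightarrow> nat \<Rightarrow> bool" and \<phi> :: "(nat \<Rightarrow> nat) \<Rightarrow> real"
    and \<psi> :: "nat \<Rightarrow> nat \<Rightarrow> real" and s :: "nat \<Rightarrow> real"
  assumes irred: "\<And>i j. (i, j) \<in> (edges_in UNIV A)\<^sup>+"
    and phi: "\<And>x. x \<in> CMS A \<Longrightarrow> \<phi> x = \<psi> (x 0) (x 1)"
    and psi_le: "\<And>i j. A i j \<Longrightarrow> \<psi> i j \<le> s i"
    and summable_s: "summable (\<lambda>i. exp (s i))"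
begin

definition Z :: real where "Z = (\<Sum>i. exp (s i))"

text \<open>A reference law on states. Its code length \<open>ln Z - s i\<close> is at most
  \<open>ln Z - \<psi> i j\<close> for every allowed pair, so finite energy implies finite
  entropy.\<close>

definition a_priori :: "nat \<Rightarrow> real" where "a_priori i = exp (s i) / Z"

lemma Z_pos: "Z > 0"
  unfolding Z_def by (rule suminf_pos[OF summable_s]) simp

lemma s_le: "s i \<le> ln Z"
proof -
  have "exp (s i) \<le> Z"
    unfolding Z_def using sum_le_suminf[OF summable_s, of "{i}"] by simp
  then show ?thesis using Z_pos by (simp add: ln_ge_iff)
qed

lemma a_priori: "0 < a_priori i" "(\<integral>\<^sup>+ i. ennreal (a_priori i) \<partial>count_space UNIV) \<le> 1"
  "- ln (a_priori i) = ln Z - s i"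
proof -
  show "0 < a_priori i" "- ln (a_priori i) = ln Z - s i"
    using Z_pos by (auto simp: a_priori_def ln_div)
  have "(\<integral>\<^sup>+ i. ennreal (a_priori i) \<partial>count_space UNIV) = ennreal (\<Sum>i. a_priori i)"
    unfolding nn_integral_count_space_nat a_priori_def
    using Z_pos by (intro suminf_ennreal2 summable_divide summable_s) simp
  also have "(\<Sum>i. a_priori i) = 1"
    unfolding a_priori_def using Z_pos suminf_divide[OF summable_s, of Z] by (simp add: Z_def)
  finally show "(\<integral>\<^sup>+ i. ennreal (a_priori i) \<partial>count_space UNIV) \<le> 1" by simp
qed

lemma psi_le_CMS: "x \<in> CMS A \<Longrightarrow> \<psi> (x 0) (x 1) \<le> s (x 0)"
  using psi_le[of "x 0" "x 1"] by (auto simp: CMS_def)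

text \<open>The potential is at most \<open>ln Z\<close>, so its integral can only diverge to minus
  infinity, and that is what the hypothesis \<open>fin\<close> excludes.\<close>

lemma potential_integrable:
  assumes inv: "inv_prob A M" and t: "t > 0" and fin: "ext_integral M (\<lambda>x. t * \<phi> x) > - \<infinity>"
  shows "integrable M (\<lambda>x. \<psi> (x 0) (x 1))"
    and "ext_integral M (\<lambda>x. t * \<phi> x) = ereal (t * (\<integral>x. \<psi> (x 0) (x 1) \<partial>M))"
    and "integrable M (\<lambda>x. - ln (a_priori (x 0)))"
    and "(\<integral>x. - ln (a_priori (x 0)) \<partial>M) \<le> ln Z - (\<integral>x. \<psi> (x 0) (x 1) \<partial>M)"
    and "(\<integral>x. \<psi> (x 0) (x 1) \<partial>M) \<le> ln Z"
proof -
  interpret shift_measure A M by unfold_locales fact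
  let ?f = "\<lambda>x. t * \<psi> (x 0) (x 1)"
  have le: "\<psi> (x 0) (x 1) \<le> ln Z" if "x \<in> space M" for x
    using psi_le_CMS[of x] s_le[of "x 0"] that by (simp add: space_M)
  have ext: "ext_integral M (\<lambda>x. t * \<phi> x) = ext_integral M ?f"
    unfolding ext_integral_def by (intro arg_cong2[where f = "(-)"] arg_cong[where f = enn2ereal] nn_integral_cong)
      (auto simp: phi space_M)
  have "(\<integral>\<^sup>+ x. ennreal (?f x) \<partial>M) \<le> (\<integral>\<^sup>+ x. ennreal (t * ln Z) \<partial>M)"
    using le t by (intro nn_integral_mono ennreal_leI mult_left_mono) auto
  also have "\<dots> = ennreal (t * ln Z)" by (simp add: emeasure_space_1)
  finally have p: "(\<integral>\<^sup>+ x. ennreal (?f x) \<partial>M) < \<infinity>" by (auto intro: le_less_trans)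
  have n: "(\<integral>\<^sup>+ x. ennreal (- ?f x) \<partial>M) < \<infinity>"
  proof (rule ccontr)
    assume "\<not> ?thesis"
    then have top: "(\<integral>\<^sup>+ x. ennreal (- ?f x) \<partial>M) = \<infinity>"
      unfolding infinity_ennreal_def using top.not_eq_extremum by blast
    obtain a where "(\<integral>\<^sup>+ x. ennreal (?f x) \<partial>M) = ennreal a" "0 \<le> a"
      using p by (cases "\<integral>\<^sup>+ x. ennreal (?f x) \<partial>M") auto
    then have "ext_integral M ?f = - \<infinity>" unfolding ext_integral_def top by (simp add: enn2ereal_ennreal)
    then show False using fin ext by simp
  qed
  have "integrable M ?f" unfolding real_integrable_def
    by (intro conjI less_imp_neq p n) measurable
  then show i: "integrable M (\<lambda>x. \<psi> (x 0) (x 1))" using t by simp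
  show "ext_integral M (\<lambda>x. t * \<phi> x) = ereal (t * (\<integral>x. \<psi> (x 0) (x 1) \<partial>M))"
    unfolding ext using ext_integral_integrable[OF \<open>integrable M ?f\<close>] by simp
  show ir: "integrable M (\<lambda>x. - ln (a_priori (x 0)))"
  proof (rule Bochner_Integration.integrable_bound[of _ "\<lambda>x. ln Z - \<psi> (x 0) (x 1)"])
    show "integrable M (\<lambda>x. ln Z - \<psi> (x 0) (x 1))" using i by simp
    show "AE x in M. norm (- ln (a_priori (x 0))) \<le> norm (ln Z - \<psi> (x 0) (x 1))"
    proof (rule AE_I2)
      fix x assume "x \<in> space M"
      then show "norm (- ln (a_priori (x 0))) \<le> norm (ln Z - \<psi> (x 0) (x 1))"
        unfolding a_priori(3) using psi_le_CMS[of x] s_le[of "x 0"] by (simp add: space_M)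
    qed
  qed measurable
  have "(\<integral>x. - ln (a_priori (x 0)) \<partial>M) \<le> (\<integral>x. ln Z - \<psi> (x 0) (x 1) \<partial>M)"
  proof (rule integral_mono[OF ir])
    show "integrable M (\<lambda>x. ln Z - \<psi> (x 0) (x 1))" using i by simp
    show "- ln (a_priori (x 0)) \<le> ln Z - \<psi> (x 0) (x 1)" if "x \<in> space M" for x
      unfolding a_priori(3) using psi_le_CMS[of x] that by (simp add: space_M)
  qed
  then show "(\<integral>x. - ln (a_priori (x 0)) \<partial>M) \<le> ln Z - (\<integral>x. \<psi> (x 0) (x 1) \<partial>M)"
    using i by (simp add: prob_space)
  have "(\<integral>x. \<psi> (x 0) (x 1) \<partial>M) \<le> (\<integral>x. ln Z \<partial>M)" using i le by (intro integral_mono) auto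
  then show "(\<integral>x. \<psi> (x 0) (x 1) \<partial>M) \<le> ln Z" by (simp add: prob_space)
qed

text \<open>The lower limit of the normalised Perron vectors of an exhaustion by finite subsystems.\<close>

lemma superharmonic_vector:
  assumes L: "\<Lambda> > 0"
    and le: "\<And>G l u v. finite G \<Longrightarrow> G \<noteq> {} \<Longrightarrow> perron_data (transfer_weight A \<psi> t) G l u v \<Longrightarrow> l \<le> \<Lambda>"
  shows "\<exists>v. (\<forall>i. v i > 0) \<and>
    (\<forall>i. (\<integral>\<^sup>+ j. ennreal (transfer_weight A \<psi> t i j * v j) \<partial>count_space UNIV) \<le> ennreal (\<Lambda> * v i))"
proof -
  let ?W = "transfer_weight A \<psi> t"
  have "\<exists>G. finite G \<and> {..n} \<subseteq> G \<and> strongly_connected G A" for n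
    by (rule finite_strongly_connected_superset[OF irred]) simp
  then obtain G where G: "\<And>n. finite (G n)" "\<And>n. {..n} \<subseteq> G n" "\<And>n. strongly_connected (G n) A" by metis
  have G0: "0 \<in> G n" for n using G(2)[of n] by auto
  have inG: "\<forall>\<^sub>F n in sequentially. i \<in> G n" for i
    using eventually_ge_at_top[of i] by eventually_elim (use G(2) in auto)
  have "\<exists>l u v. perron_data ?W (G n) l u v" for n
    unfolding perron_data_def using perron[OF G(1)[of n], of ?W] G0[of n] G(3)[of n]
    by (auto simp: transfer_weight_nonneg transfer_weight_pos_iff)
  then obtain l u v where pd: "\<And>n. perron_data ?W (G n) (l n) (u n) (v n)" by metis
  have l: "l n \<le> \<Lambda>" "l n > 0" for n using le[OF G(1) _ pd, of n] G0[of n] pd[of n] by (auto simp: perron_data_def)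
  have vpos: "v n i > 0" if "i \<in> G n" for n i using pd[of n] that by (auto simp: perron_data_def)
  have veq: "(\<Sum>j\<in>G n. ?W i j * v n j) = l n * v n i" if "i \<in> G n" for n i
    using pd[of n] that by (auto simp: perron_data_def)
  define w where "w = (\<lambda>n i. if i \<in> G n then v n i / v n 0 else 0)"
  have w0: "0 \<le> w n i" for n i using vpos[of i n] vpos[OF G0[of n]] by (auto simp: w_def)
  have wpos: "w n i > 0" if "i \<in> G n" for n i using vpos[OF that] vpos[OF G0[of n]] that by (simp add: w_def)
  have weq: "(\<Sum>j\<in>G n. ?W i j * w n j) = l n * w n i" if "i \<in> G n" for n i
  proof -
    have "(\<Sum>j\<in>G n. ?W i j * w n j) = (\<Sum>j\<in>G n. ?W i j * v n j) / v n 0"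
      by (simp add: w_def sum_divide_distrib)
    then show ?thesis using veq[OF that] that by (simp add: w_def)
  qed
  \<comment> \<open>A Harnack inequality along a path: one edge costs the factor
    \<open>\<Lambda> / ?W y z\<close>, uniformly in \<open>n\<close> once both states belong to
    \<open>G n\<close>. It keeps the lower limits away from zero and infinity.\<close>
  have ratio: "\<exists>C>0. \<forall>\<^sub>F n in sequentially. w n j \<le> C * w n i" for i j
  proof -
    have "(i, j) \<in> (edges_in UNIV A)\<^sup>*" using irred by (rule trancl_into_rtrancl)
    then show ?thesis
    proof (induction rule: rtrancl_induct)
      case base
      show ?case by (intro exI[of _ 1]) simp
    next
      case (step y z)
      then obtain C where C: "C > 0" "\<forall>\<^sub>F n in sequentially. w n y \<le> C * w n i" by blast
      have W: "?W y z > 0" using step(2) by (simp add: edges_in_def transfer_weight_pos_iff)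
      have "\<forall>\<^sub>F n in sequentially. w n z \<le> (\<Lambda> / ?W y z * C) * w n i"
        using C(2) inG[of y] inG[of z]
      proof eventually_elim
        case (elim n)
        have "?W y z * w n z \<le> (\<Sum>j\<in>G n. ?W y j * w n j)"
          using elim G(1) w0 transfer_weight_nonneg by (intro member_le_sum mult_nonneg_nonneg) auto
        also have "\<dots> \<le> \<Lambda> * w n y" unfolding weq[OF elim(2)] using l w0 by (intro mult_right_mono) auto
        also have "\<dots> \<le> \<Lambda> * (C * w n i)" using elim(1) L by (intro mult_left_mono) auto
        finally show ?case using W by (simp add: field_simps)
      qed
      moreover have "\<Lambda> / ?W y z * C > 0" using L W C by simp
      ultimately show ?case by blast
    qed
  qed
  have w00: "w n 0 = 1" for n using vpos[OF G0[of n]] G0[of n] by (simp add: w_def)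
  define V where "V = (\<lambda>i. liminf (\<lambda>n. ennreal (w n i)))"
  have Vbounds: "V i \<noteq> 0" "V i \<noteq> \<infinity>" for i
  proof -
    obtain C where C: "C > 0" "\<forall>\<^sub>F n in sequentially. w n i \<le> C * w n 0" using ratio by blast
    have "V i \<le> ennreal C" unfolding V_def
    proof (rule Liminf_le)
      show "\<forall>\<^sub>F n in sequentially. ennreal (w n i) \<le> ennreal C"
        using C(2) by eventually_elim (simp add: w00 ennreal_leI)
    qed simp
    then show "V i \<noteq> \<infinity>" by (auto simp: top_unique)
    obtain C' where C': "C' > 0" "\<forall>\<^sub>F n in sequentially. w n 0 \<le> C' * w n i" using ratio by blast
    have "ennreal (1 / C') \<le> V i" unfolding V_def
    proof (rule Liminf_bounded)
      show "\<forall>\<^sub>F n in sequentially. ennreal (1 / C') \<le> ennreal (w n i)"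
        using C'(2) by eventually_elim (use C'(1) in \<open>auto simp: w00 field_simps intro!: ennreal_leI\<close>)
    qed
    moreover have "0 < ennreal (1 / C')" using C'(1) by simp
    ultimately show "V i \<noteq> 0" by auto
  qed
  define v' where "v' = (\<lambda>i. enn2real (V i))"
  have v': "ennreal (v' i) = V i" "v' i > 0" for i
    using Vbounds[of i] by (auto simp: v'_def enn2real_positive_iff top.not_eq_extremum zero_less_iff_neq_zero)
  have "(\<integral>\<^sup>+ j. ennreal (?W i j * v' j) \<partial>count_space UNIV) \<le> ennreal (\<Lambda> * v' i)" for i
  proof -
    have "(\<integral>\<^sup>+ j. ennreal (?W i j * v' j) \<partial>count_space UNIV) = (\<integral>\<^sup>+ j. ennreal (?W i j) * V j \<partial>count_space UNIV)"
      by (intro nn_integral_cong) (simp add: ennreal_mult' transfer_weight_nonneg v'(1)[symmetric])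
    also have "\<dots> \<le> (\<integral>\<^sup>+ j. liminf (\<lambda>n. ennreal (?W i j) * ennreal (w n j)) \<partial>count_space UNIV)"
      unfolding V_def by (intro nn_integral_mono ennreal_liminf_mult_left_le)
    also have "\<dots> \<le> liminf (\<lambda>n. \<integral>\<^sup>+ j. ennreal (?W i j) * ennreal (w n j) \<partial>count_space UNIV)"
      by (rule nn_integral_liminf) simp
    also have "\<dots> \<le> liminf (\<lambda>n. ennreal \<Lambda> * ennreal (w n i))"
    proof (rule Liminf_mono, use inG[of i] in eventually_elim)
      case (elim n)
      have "(\<integral>\<^sup>+ j. ennreal (?W i j) * ennreal (w n j) \<partial>count_space UNIV) =
          (\<integral>\<^sup>+ j. ennreal (?W i j * w n j) \<partial>count_space (G n))"
        by (subst nn_integral_count_space_indicator)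
           (auto intro!: nn_integral_cong simp: w_def ennreal_mult'[symmetric] transfer_weight_nonneg indicator_def)
      also have "\<dots> = ennreal (\<Sum>j\<in>G n. ?W i j * w n j)"
        using G(1) w0 transfer_weight_nonneg by (simp add: nn_integral_count_space_finite)
      also have "\<dots> \<le> ennreal (\<Lambda> * w n i)"
        unfolding weq[OF elim] using l w0 by (intro ennreal_leI mult_right_mono) auto
      finally show ?case using L by (simp add: ennreal_mult')
    qed
    also have "\<dots> \<le> ennreal \<Lambda> * V i" unfolding V_def by (rule ennreal_liminf_mult_right_le[OF L])
    also have "\<dots> = ennreal (\<Lambda> * v' i)" using L by (simp add: ennreal_mult' v'(1))
    finally show ?thesis .
  qed
  then show ?thesis using v'(2) by blast
qed

end

lemma (in shift_measure) pair_pmf: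
  "\<exists>q. (\<forall>i j. pmf q (i, j) = prob {x \<in> space M. word 2 x = [i, j]}) \<and>
     (\<forall>i. pmf (map_pmf fst q) i = prob {x \<in> space M. x 0 = i}) \<and>
     map_pmf snd q = map_pmf fst q"
proof -
  define X where "X = (\<lambda>x :: nat \<Rightarrow> nat. (x 0, x 1))"
  have X: "X \<in> measurable M (count_space UNIV)"
  proof -
    have "X -` {p} \<inter> space M = {x \<in> space M. x 0 = fst p \<and> x 1 = snd p}" for p by (auto simp: X_def)
    moreover have "{x \<in> space M. x 0 = fst p \<and> x 1 = snd p} \<in> events" for p by measurable
    ultimately show ?thesis by (simp add: measurable_count_space_eq2_countable)
  qed
  let ?D = "distr M (count_space UNIV) X"
  interpret D: prob_space ?D by (rule prob_space_distr[OF X])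
  define q where "q = embed_pmf (\<lambda>p. measure ?D {p})"
  have "(\<integral>\<^sup>+ p. ennreal (measure ?D {p}) \<partial>count_space UNIV) = emeasure ?D UNIV"
    by (subst emeasure_countable_singleton) (auto simp: D.emeasure_eq_measure)
  then have "(\<integral>\<^sup>+ p. ennreal (measure ?D {p}) \<partial>count_space UNIV) = 1"
    using D.emeasure_space_1 by simp
  then have pmf_q: "pmf q p = measure ?D {p}" for p
    unfolding q_def by (intro pmf_embed_pmf) auto
  have qD: "measure_pmf q = ?D"
  proof (rule measure_eqI_countable[where A = UNIV])
    show "emeasure q {a} = emeasure ?D {a}" for a
      by (simp add: emeasure_pmf_single pmf_q D.emeasure_eq_measure)
  qed auto
  have meas: "measure q B = prob {x \<in> space M. (x 0, x 1) \<in> B}" for B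
  proof -
    have "measure q B = prob (X -` B \<inter> space M)" unfolding qD by (rule measure_distr[OF X]) simp
    also have "X -` B \<inter> space M = {x \<in> space M. (x 0, x 1) \<in> B}" by (auto simp: X_def)
    finally show ?thesis .
  qed
  have "pmf q (i, j) = prob {x \<in> space M. word 2 x = [i, j]}" for i j
    unfolding pmf.rep_eq meas by (intro arg_cong[where f = prob]) (auto simp: word_eq_iff less_2_cases_iff)
  moreover have fst: "pmf (map_pmf fst q) i = prob {x \<in> space M. x 0 = i}" for i
    unfolding pmf_map meas by (intro arg_cong[where f = prob]) auto
  moreover have "pmf (map_pmf snd q) i = prob {x \<in> space M. x 0 = i}" for i
  proof -
    have "pmf (map_pmf snd q) i = prob {x \<in> space M. x 1 = i}"
      unfolding pmf_map meas by (intro arg_cong[where f = prob]) auto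
    then show ?thesis using prob_coordinate[of 1 i] by simp
  qed
  ultimately show ?thesis by (intro exI[of _ q]) (auto intro: pmf_eqI)
qed

context zero_temperature
begin

lemma ext_integral_potential:
  assumes inv: "inv_prob A M" and int: "integrable M (\<lambda>x. \<psi> (x 0) (x 1))"
  shows "ext_integral M (\<lambda>x. t * \<phi> x) = ereal (t * (\<integral>x. \<psi> (x 0) (x 1) \<partial>M))"
proof -
  interpret shift_measure A M by unfold_locales fact
  have "ext_integral M (\<lambda>x. t * \<phi> x) = ext_integral M (\<lambda>x. t * \<psi> (x 0) (x 1))"
    unfolding ext_integral_def by (intro arg_cong2[where f = "(-)"] arg_cong[where f = enn2ereal] nn_integral_cong)
      (auto simp: phi space_M)
  also have "\<dots> = ereal (t * (\<integral>x. \<psi> (x 0) (x 1) \<partial>M))"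
    using ext_integral_integrable[of "\<lambda>x. t * \<psi> (x 0) (x 1)"] int by simp
  finally show ?thesis .
qed

text \<open>Predicting every state by \<open>a_priori\<close>, without context, bounds the entropy
  of \<open>M\<close>. Being finite, this entropy can be handled as a real number in the variational
  principle.\<close>

lemma equilibrium_pressure:
  assumes t: "t \<ge> 1" and eq: "equilibrium_state A (\<lambda>x. t * \<phi> x) M"
  shows "\<exists>h. metric_entropy M shift = ereal h \<and> 0 \<le> h \<and> h \<le> ln Z - (\<integral>x. \<psi> (x 0) (x 1) \<partial>M) \<and>
    (\<forall>\<nu>. inv_prob A \<nu> \<and> integrable \<nu> (\<lambda>x. \<psi> (x 0) (x 1)) \<longrightarrow>
      metric_entropy \<nu> shift + ereal (t * (\<integral>x. \<psi> (x 0) (x 1) \<partial>\<nu>)) \<le> ereal (h + t * (\<integral>x. \<psi> (x 0) (x 1) \<partial>M)))"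
proof -
  have inv: "inv_prob A M" and fin: "ext_integral M (\<lambda>x. t * \<phi> x) > - \<infinity>"
    and sup: "metric_entropy M shift + ext_integral M (\<lambda>x. t * \<phi> x) =
       (SUP \<nu>\<in>{\<nu>. inv_prob A \<nu> \<and> ext_integral \<nu> (\<lambda>x. t * \<phi> x) > - \<infinity>}. metric_entropy \<nu> shift + ext_integral \<nu> (\<lambda>x. t * \<phi> x))"
    using eq by (auto simp: equilibrium_state_def)
  have t0: "t > 0" using t by simp
  note pot = potential_integrable[OF inv t0 fin]
  interpret shift_measure A M by unfold_locales fact
  define E where "E = expectation (\<lambda>x. \<psi> (x 0) (x 1))"
  have ext: "ext_integral M (\<lambda>x. t * \<phi> x) = ereal (t * E)" using pot(2) by (simp add: E_def)
  have "metric_entropy M shift \<le> ereal (expectation (\<lambda>x. - ln (a_priori (x 0))))"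
    using metric_entropy_le_model[of "\<lambda>_. a_priori" 0 a_priori] a_priori(1,2) pot(3) less_imp_le[OF a_priori(1)] by simp
  also have "\<dots> \<le> ereal (ln Z - E)" using pot(4) by (simp add: E_def)
  finally have hle: "metric_entropy M shift \<le> ereal (ln Z - E)" .
  then obtain h where h: "metric_entropy M shift = ereal h"
    using metric_entropy_nonneg by (cases "metric_entropy M shift") auto
  have S: "(SUP \<nu>\<in>{\<nu>. inv_prob A \<nu> \<and> ext_integral \<nu> (\<lambda>x. t * \<phi> x) > - \<infinity>}.
      metric_entropy \<nu> shift + ext_integral \<nu> (\<lambda>x. t * \<phi> x)) = ereal (h + t * E)"
    unfolding sup[symmetric] h ext by simp
  have "metric_entropy \<nu> shift + ereal (t * (\<integral>x. \<psi> (x 0) (x 1) \<partial>\<nu>)) \<le> ereal (h + t * E)"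
    if "inv_prob A \<nu>" "integrable \<nu> (\<lambda>x. \<psi> (x 0) (x 1))" for \<nu>
    unfolding S[symmetric] ext_integral_potential[OF that, symmetric]
    by (rule SUP_upper) (simp add: that ext_integral_potential[OF that])
  then show ?thesis using h hle metric_entropy_nonneg unfolding E_def by (intro exI[of _ h]) simp
qed

text \<open>With \<open>l\<close> the exponential of the maximal free energy,
  \<open>perron_measure\<close> bounds the eigenvalues of all finite subsystems by \<open>l\<close>,
  so a positive \<open>v\<close> with \<open>W v <= l v\<close> exists. The code length of
  \<open>Q i j = W i j * v j / (l * v i)\<close> is \<open>ln l - t * \<psi>\<close> plus a
  coboundary, hence has mean \<open>ln l - t * E = h\<close>: the entropy bound is attained, and
  \<open>M\<close> must be Markov with transitions \<open>Q\<close>.\<close>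

theorem equilibrium_eigen_flow:
  assumes t: "t \<ge> 1" and eq: "equilibrium_state A (\<lambda>x. t * \<phi> x) M"
  shows "\<exists>q l u v. eigen_flow q (transfer_weight A \<psi> t) l u v \<and> l \<le> exp (ln Z * t) \<and>
    (\<forall>i. measure M {x \<in> space M. x 0 = i} = pmf (map_pmf fst q) i) \<and>
    (\<forall>w y. w \<noteq> [] \<longrightarrow> measure M {x \<in> space M. word (Suc (length w)) x = w @ [y]} * pmf (map_pmf fst q) (last w) =
       measure M {x \<in> space M. word (length w) x = w} * pmf q (last w, y))"
proof -
  let ?W = "transfer_weight A \<psi> t"
  let ?\<psi> = "\<lambda>x :: nat \<Rightarrow> nat. \<psi> (x 0) (x 1)"
  have inv: "inv_prob A M" and fin: "ext_integral M (\<lambda>x. t * \<phi> x) > - \<infinity>"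
    using eq by (auto simp: equilibrium_state_def)
  have t0: "t > 0" using t by simp
  note pot = potential_integrable[OF inv t0 fin]
  interpret shift_measure A M by unfold_locales fact
  define E where "E = expectation ?\<psi>"
  obtain h where h: "metric_entropy M shift = ereal h" and hle: "h \<le> ln Z - E"
    and upper: "\<And>\<nu>. inv_prob A \<nu> \<Longrightarrow> integrable \<nu> ?\<psi> \<Longrightarrow>
      metric_entropy \<nu> shift + ereal (t * (\<integral>x. ?\<psi> x \<partial>\<nu>)) \<le> ereal (h + t * E)"
    using equilibrium_pressure[OF t eq] unfolding E_def by blast
  define l where "l = exp (h + t * E)"
  have l: "l > 0" "ln l = h + t * E" by (auto simp: l_def)
  have "l' \<le> l" if G: "finite G" "G \<noteq> {}" and pd: "perron_data ?W G l' u' v'" for G l' u' v'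
  proof -
    obtain N where N: "inv_prob A N" "integrable N ?\<psi>"
      "ereal (ln l') \<le> metric_entropy N shift + ereal (t * (\<integral>x. ?\<psi> x \<partial>N))"
      using perron_measure[OF G pd] by blast
    from order_trans[OF N(3) upper[OF N(1,2)]] have "ereal (ln l') \<le> ereal (ln l)" by (simp only: l(2))
    then have "ln l' \<le> ln l" by (simp only: ereal_less_eq)
    then show ?thesis using l(1) pd by (simp only: ln_le_cancel_iff perron_data_def)
  qed
  then obtain v where v: "\<And>i. v i > 0"
    "\<And>i. (\<integral>\<^sup>+ j. ennreal (?W i j * v j) \<partial>count_space UNIV) \<le> ennreal (l * v i)"
    using superharmonic_vector[OF l(1), of t] by blast
  define Q where "Q = (\<lambda>i j. ?W i j * v j / (l * v i))"
  have lv: "l * v i > 0" for i using l v by simp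
  have Q0: "0 \<le> Q i j" for i j using lv[of i] v(1)[of j] transfer_weight_nonneg[of A \<psi> t i j] by (simp add: Q_def)
  have Q1: "(\<integral>\<^sup>+ j. ennreal (Q i j) \<partial>count_space UNIV) \<le> 1" for i
  proof -
    have "(\<integral>\<^sup>+ j. ennreal (Q i j) \<partial>count_space UNIV) =
      (\<integral>\<^sup>+ j. ennreal (1 / (l * v i)) * ennreal (?W i j * v j) \<partial>count_space UNIV)"
      using lv[of i] by (intro nn_integral_cong) (simp add: Q_def ennreal_mult'[symmetric])
    also have "\<dots> = ennreal (1 / (l * v i)) * (\<integral>\<^sup>+ j. ennreal (?W i j * v j) \<partial>count_space UNIV)"
      by (rule nn_integral_cmult) simp
    also have "\<dots> \<le> ennreal (1 / (l * v i)) * ennreal (l * v i)" by (intro mult_left_mono v) simp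
    also have "\<dots> = 1" using l(1) v(1)[of i] by (simp add: ennreal_mult'[symmetric])
    finally show ?thesis .
  qed
  have Qle: "Q i j \<le> 1" for i j
  proof -
    have "ennreal (Q i j) \<le> (\<integral>\<^sup>+ j. ennreal (Q i j) \<partial>count_space UNIV)"
      by (rule nn_integral_ge_point) simp
    then show ?thesis using Q1[of i] by (auto simp: ennreal_le_1 dest: order_trans)
  qed
  have WC: "?W (x 0) (x 1) = exp (t * ?\<psi> x)" if "x \<in> space M" for x
    using that by (auto simp: space_M CMS_def transfer_weight_def)
  have Qpos: "0 < Q (x 0) (x 1)" if "x \<in> space M" for x
    using lv v WC[OF that] by (simp add: Q_def)
  have Qln: "- ln (Q (x 0) (x 1)) = (ln l - t * ?\<psi> x) + (ln (v (x 0)) - ln (v (x 1)))" if "x \<in> space M" for x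
    unfolding Q_def WC[OF that] using l(1) v(1)[of "x 0"] v(1)[of "x 1"] by (simp add: ln_div ln_mult)
  have ih: "integrable M (\<lambda>x. t * ?\<psi> x - ln l)" using pot(1) by simp
  \<comment> \<open>\<open>Q <= 1\<close> bounds the coboundary from one side by an integrable
    function; no integrability of \<open>ln (v (x 0))\<close> itself is claimed.\<close>
  have cob: "t * ?\<psi> x - ln l \<le> ln (v (x 0)) - ln (v (x 1))" if "x \<in> space M" for x
    using Qln[OF that] ln_le_zero_iff[OF Qpos[OF that]] Qle[of "x 0" "x 1"] by linarith
  note cb = coboundary_expectation[OF ih, of "\<lambda>i. ln (v i)", OF cob]
  have i1: "integrable M (\<lambda>x. ln l - t * ?\<psi> x)" using pot(1) by simp
  have Qint: "integrable M (\<lambda>x. - ln (Q (x 0) (x 1)))"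
    by (rule Bochner_Integration.integrable_cong[THEN iffD2, OF refl Qln Bochner_Integration.integrable_add[OF i1 cb(1)]])
  have "expectation (\<lambda>x. - ln (Q (x 0) (x 1))) = expectation (\<lambda>x. (ln l - t * ?\<psi> x) + (ln (v (x 0)) - ln (v (x 1))))"
    by (rule Bochner_Integration.integral_cong[OF refl Qln])
  also have "\<dots> = expectation (\<lambda>x. ln l - t * ?\<psi> x) + 0"
    using Bochner_Integration.integral_add[OF i1 cb(1)] cb(2) by (simp only:)
  also have "\<dots> = h" using pot(1) by (simp add: prob_space l E_def)
  finally have EQ: "expectation (\<lambda>x. - ln (Q (x 0) (x 1))) = h" .
  have max: "ereal (expectation (\<lambda>x. - ln (Q (x 0) (x 1)))) \<le> metric_entropy M shift"
    unfolding EQ h by (rule order_refl)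
  have markov: "prob {x \<in> space M. word (Suc (length w)) x = w @ [y]} = prob {x \<in> space M. word (length w) x = w} * Q (last w) y"
    if "w \<noteq> []" for w y
    by (rule markov_of_maximal_entropy[OF Q0 Q1 Qpos Qint a_priori(1,2) pot(3) max that])
  obtain q where q: "\<And>i j. pmf q (i, j) = prob {x \<in> space M. word 2 x = [i, j]}"
    "\<And>i. pmf (map_pmf fst q) i = prob {x \<in> space M. x 0 = i}" "map_pmf snd q = map_pmf fst q"
    using pair_pmf by blast
  define \<pi> where "\<pi> = (\<lambda>i. prob {x \<in> space M. x 0 = i})"
  have q_eq: "pmf q (i, j) = \<pi> i * Q i j" for i j
    using markov[of "[i]" j] by (simp add: q(1) \<pi>_def word_1_iff[unfolded One_nat_def] numeral_2_eq_2)
  obtain a where "a \<in> set_pmf (map_pmf fst q)" using set_pmf_not_empty[of "map_pmf fst q"] by blast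
  then have "pmf (map_pmf fst q) a \<noteq> 0" by (simp only: set_pmf_iff not_False_eq_True)
  then have a: "\<pi> a > 0" by (simp add: q(2) \<pi>_def zero_less_measure_iff)
  \<comment> \<open>Positive mass spreads along every edge, because \<open>Q\<close> is positive
    there and the second marginal is again \<pi>.\<close>
  have \<pi>pos: "\<pi> i > 0" for i
  proof -
    have "(a, i) \<in> (edges_in UNIV A)\<^sup>*" using irred by (rule trancl_into_rtrancl)
    then show ?thesis
    proof (induction rule: rtrancl_induct)
      case (step y z)
      then have "?W y z > 0" by (simp add: edges_in_def transfer_weight_pos_iff)
      then have "0 < pmf q (y, z)" using step.IH lv[of y] v(1)[of z] by (simp add: q_eq Q_def)
      also have "pmf q (y, z) \<le> pmf (map_pmf snd q) z"
        unfolding pmf.rep_eq[of q] pmf_map by (intro measure_pmf.finite_measure_mono) auto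
      finally show ?case using q(2,3) by (simp add: \<pi>_def)
    qed (rule a)
  qed
  define u where "u = (\<lambda>i. \<pi> i / v i)"
  have flow: "eigen_flow q ?W l u v"
  proof
    show "pmf q (i, j) = u i * ?W i j * v j / l" for i j
      using v(1)[of i] by (simp add: q_eq Q_def u_def mult_ac)
    show "pmf (map_pmf fst q) i = u i * v i" for i
      using v(1)[of i] by (simp add: q(2) \<pi>_def u_def)
  qed (use q(3) l(1) v(1) \<pi>pos in \<open>auto simp: u_def transfer_weight_nonneg\<close>)
  \<comment> \<open>\<open>h <= ln Z - E\<close> and \<open>E <= ln Z\<close> give
    \<open>h + t * E <= ln Z + (t - 1) * E <= t * ln Z\<close>.\<close>
  have lle: "l \<le> exp (ln Z * t)"
  proof -
    have "(t - 1) * E \<le> (t - 1) * ln Z" using pot(5) t by (intro mult_left_mono) (auto simp: E_def)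
    then have "h + t * E \<le> ln Z * t" using hle by (simp add: algebra_simps)
    then show ?thesis by (simp add: l_def)
  qed
  have "prob {x \<in> space M. word (Suc (length w)) x = w @ [y]} * pmf (map_pmf fst q) (last w) =
       prob {x \<in> space M. word (length w) x = w} * pmf q (last w, y)" if "w \<noteq> []" for w y
    using markov[OF that, of y] by (simp add: q_eq q(2) \<pi>_def)
  then show ?thesis using flow lle q(2) by (intro exI[of _ q] exI[of _ l] exI[of _ u] exI[of _ v]) simp
qed

end

section \<open>The zero-temperature limit\<close>

text \<open>A pair missing from the finite block has an end outside \<open>G\<close>. With vanishing
  mass outside \<open>G\<close>, row sums, column sums and total mass of the block therefore pass to
  the limit.\<close>

lemma (in stationary_pairs) block_sums:
  assumes G: "finite G"
  shows "\<bar>(\<Sum>j\<in>G. pmf q (i, j)) - pmf marg i\<bar> \<le> measure marg (- G)"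
    and "\<bar>(\<Sum>j\<in>G. pmf q (j, i)) - pmf marg i\<bar> \<le> measure marg (- G)"
    and "\<bar>(\<Sum>i\<in>G. \<Sum>j\<in>G. pmf q (i, j)) - 1\<bar> \<le> 2 * measure marg (- G)"
proof -
  have out: "measure q {x. fst x \<notin> G} = measure marg (- G)" "measure q {x. snd x \<notin> G} = measure marg (- G)"
    using measure_map_pmf[of fst q "- G"] measure_map_pmf[of snd q "- G"]
    by (simp_all add: stationary vimage_def)
  have one: "pmf marg i = measure q {x. fst x = i}" "pmf marg i = measure q {x. snd x = i}"
    using pmf_map[of fst q i] pmf_map[of snd q i] by (simp_all add: stationary vimage_def)
  have sumI: "measure q (f ` G) = (\<Sum>j\<in>G. pmf q (f j))" if "inj_on f G" for f
    using G that by (simp add: measure_measure_pmf_finite sum.reindex)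
  have sandwich: "measure q B \<le> measure q C \<and> measure q C \<le> measure q B + measure q D"
    if "B \<subseteq> C" "C \<subseteq> B \<union> D" for B C D :: "(nat \<times> nat) set"
    using measure_pmf.finite_measure_mono[of B C q] measure_pmf.finite_measure_mono[of C "B \<union> D" q]
      measure_Un_le[of B "measure_pmf q" D] that by auto
  show "\<bar>(\<Sum>j\<in>G. pmf q (i, j)) - pmf marg i\<bar> \<le> measure marg (- G)"
    using sandwich[of "Pair i ` G" "{x. fst x = i}" "{x. snd x \<notin> G}"] sumI[of "Pair i"]
    unfolding out one(1) by (force simp: inj_on_def abs_le_iff)
  show "\<bar>(\<Sum>j\<in>G. pmf q (j, i)) - pmf marg i\<bar> \<le> measure marg (- G)"
    using sandwich[of "(\<lambda>j. (j, i)) ` G" "{x. snd x = i}" "{x. fst x \<notin> G}"] sumI[of "\<lambda>j. (j, i)"]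
    unfolding out one(2) by (force simp: inj_on_def abs_le_iff)
  have "measure q (G \<times> G) = (\<Sum>i\<in>G. \<Sum>j\<in>G. pmf q (i, j))"
    using G by (simp add: measure_measure_pmf_finite sum.cartesian_product)
  moreover have "measure q ({x. fst x \<notin> G} \<union> {x. snd x \<notin> G}) \<le> 2 * measure marg (- G)"
    using measure_Un_le[of "{x. fst x \<notin> G}" "measure_pmf q" "{x. snd x \<notin> G}"] out by simp
  moreover have "measure q UNIV \<le> measure q (G \<times> G) + measure q ({x. fst x \<notin> G} \<union> {x. snd x \<notin> G})"
    by (intro conjunct2[OF sandwich]) auto
  ultimately show "\<bar>(\<Sum>i\<in>G. \<Sum>j\<in>G. pmf q (i, j)) - 1\<bar> \<le> 2 * measure marg (- G)"
    using measure_pmf.prob_le_1[of q "G \<times> G"] by (simp add: abs_le_iff)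
qed

lemma tendsto_of_abs_diff_le:
  fixes f g e :: "'a \<Rightarrow> real"
  assumes "(f \<longlongrightarrow> L) F" "(e \<longlongrightarrow> 0) F" "\<forall>\<^sub>F t in F. \<bar>f t - g t\<bar> \<le> e t"
  shows "(g \<longlongrightarrow> L) F"
proof -
  have "((\<lambda>t. f t - g t) \<longlongrightarrow> 0) F"
    using assms(3) by (intro Lim_null_comparison[OF _ assms(2)]) simp
  then show ?thesis using tendsto_diff[OF assms(1), of "\<lambda>t. f t - g t" 0] by simp
qed

lemma choice4:
  assumes "\<And>t. R t \<Longrightarrow> \<exists>a b c d. P t a b c d"
  shows "\<exists>a b c d. \<forall>t. R t \<longrightarrow> P t (a t) (b t) (c t) (d t)"
  using assms by metis

lemma (in shift_measure) words_le_last: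
  assumes "w \<noteq> []"
  shows "prob {x \<in> space M. word (length w) x = w} \<le> prob {x \<in> space M. x 0 = last w}"
proof -
  have "prob {x \<in> space M. word (length w) x = w} \<le> prob {x \<in> space M. x (length w - 1) = last w}"
  proof (rule finite_measure_mono)
    show "{x \<in> space M. word (length w) x = w} \<subseteq> {x \<in> space M. x (length w - 1) = last w}"
    proof safe
      fix x assume "word (length w) x = w"
      moreover have "word (length w) x ! (length w - 1) = x (length w - 1)" using assms by (intro word_nth) simp
      ultimately have "w ! (length w - 1) = x (length w - 1)" by simp
      then show "x (length w - 1) = last w" by (simp only: last_conv_nth[OF assms])
    qed
  qed measurable
  then show ?thesis unfolding prob_coordinate[of "length w - 1"] .
qed

text \<open>The limiting pair weights live on \<open>G\<close>, are balanced and have total mass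
  one, so they define a Markov measure. Longer words follow by appending letters: each step
  multiplies by the mass of a pair over the mass of its first state, and both converge. If the
  limiting mass of the last state of \<open>w\<close> is zero, the quotient gives nothing, and both
  sides are squeezed to zero by the mass of that state.\<close>

lemma (in zero_temperature) limit_measure:
  assumes eq: "\<And>t. t \<ge> 1 \<Longrightarrow> equilibrium_state A (\<lambda>x. t * \<phi> x) (\<mu> t)"
  shows "\<exists>N G. inv_prob A N \<and> finite G \<and> (AE x in N. \<forall>k. x k \<in> G) \<and>
    (\<forall>w. ((\<lambda>t. measure (\<mu> t) {x \<in> space (\<mu> t). word (length w) x = w}) \<longlongrightarrow>
       measure N {x \<in> space N. word (length w) x = w}) at_top)"
proof -
  define R where "R = (\<lambda>t q l u v. eigen_flow q (transfer_weight A \<psi> t) l u v \<and> l \<le> exp (ln Z * t) \<and>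
    (\<forall>i. measure (\<mu> t) {x \<in> space (\<mu> t). x 0 = i} = pmf (map_pmf fst q) i) \<and>
    (\<forall>w y. w \<noteq> [] \<longrightarrow> measure (\<mu> t) {x \<in> space (\<mu> t). word (Suc (length w)) x = w @ [y]} * pmf (map_pmf fst q) (last w) =
       measure (\<mu> t) {x \<in> space (\<mu> t). word (length w) x = w} * pmf q (last w, y)))"
  have "\<exists>q l u v. R t q l u v" if "t \<ge> 1" for t
    unfolding R_def by (rule equilibrium_eigen_flow[OF that eq[OF that]])
  then have "\<exists>q l u v. \<forall>t. t \<ge> 1 \<longrightarrow> R t (q t) (l t) (u t) (v t)"
    by (rule choice4[where R = "\<lambda>t. t \<ge> 1" and P = R])
  then obtain q l u v where "\<forall>t. t \<ge> 1 \<longrightarrow> R t (q t) (l t) (u t) (v t)" by (elim exE)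
  then have R: "R t (q t) (l t) (u t) (v t)" if "t \<ge> 1" for t using that by simp
  have flow: "eigen_flow (q t) (transfer_weight A \<psi> t) (l t) (u t) (v t)" if "t \<ge> 1" for t
    using R[OF that] by (simp add: R_def)
  have coord: "measure (\<mu> t) {x \<in> space (\<mu> t). x 0 = i} = pmf (map_pmf fst (q t)) i" if "t \<ge> 1" for t i
    using R[OF that] by (simp add: R_def)
  have step: "measure (\<mu> t) {x \<in> space (\<mu> t). word (Suc (length w)) x = w @ [y]} * pmf (map_pmf fst (q t)) (last w) =
       measure (\<mu> t) {x \<in> space (\<mu> t). word (length w) x = w} * pmf (q t) (last w, y)"
    if "t \<ge> 1" "w \<noteq> []" for t w y
    using R[OF that(1)] that(2) by (simp add: R_def)
  interpret T: transfer_family A \<psi> s "ln Z" q l u v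
  proof (rule transfer_family.intro)
    show "l t \<le> exp (ln Z * t)" if "t \<ge> 1" for t using R[OF that] by (simp add: R_def)
  qed (fact irred psi_le summable_s flow)+
  obtain G p where G: "finite G" and p: "\<And>i j. ((\<lambda>t. pmf (q t) (i, j)) \<longlongrightarrow> p i j) at_top"
    and pG: "\<And>i j. p i j \<noteq> 0 \<Longrightarrow> i \<in> G \<and> j \<in> G"
    and tail: "((\<lambda>t. measure (map_pmf fst (q t)) (- G)) \<longlongrightarrow> 0) at_top"
    using T.pair_limit by blast
  have ev1: "\<forall>\<^sub>F t in at_top. (1::real) \<le> t" by (rule eventually_ge_at_top)
  have sp: "stationary_pairs (q t)" if "t \<ge> 1" for t using flow[OF that] by (simp add: eigen_flow_def)
  have p0: "0 \<le> p i j" for i j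
    by (rule tendsto_lowerbound[OF p[of i j]]) auto
  have pA: "A i j" if "p i j \<noteq> 0" for i j
  proof (rule ccontr)
    assume "\<not> A i j"
    then have "\<forall>\<^sub>F t in at_top. pmf (q t) (i, j) = 0"
      by (intro eventually_mono[OF ev1]) (simp add: T.pmf_q transfer_weight_def)
    then have "((\<lambda>t. pmf (q t) (i, j)) \<longlongrightarrow> 0) at_top" by (rule tendsto_eventually)
    then show False using tendsto_unique[OF _ p[of i j]] that by auto
  qed
  define \<pi> where "\<pi> = (\<lambda>i. \<Sum>j\<in>G. p i j)"
  have marg: "((\<lambda>t. pmf (map_pmf fst (q t)) i) \<longlongrightarrow> \<pi> i) at_top" for i
    unfolding \<pi>_def
  proof (rule tendsto_of_abs_diff_le[OF _ tail])
    show "((\<lambda>t. \<Sum>j\<in>G. pmf (q t) (i, j)) \<longlongrightarrow> (\<Sum>j\<in>G. p i j)) at_top" by (intro tendsto_sum p)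
    show "\<forall>\<^sub>F t in at_top. \<bar>(\<Sum>j\<in>G. pmf (q t) (i, j)) - pmf (map_pmf fst (q t)) i\<bar> \<le> measure (map_pmf fst (q t)) (- G)"
      using ev1 by eventually_elim (rule stationary_pairs.block_sums(1)[OF sp G])
  qed
  have marg': "((\<lambda>t. pmf (map_pmf fst (q t)) i) \<longlongrightarrow> (\<Sum>j\<in>G. p j i)) at_top" for i
  proof (rule tendsto_of_abs_diff_le[OF _ tail])
    show "((\<lambda>t. \<Sum>j\<in>G. pmf (q t) (j, i)) \<longlongrightarrow> (\<Sum>j\<in>G. p j i)) at_top" by (intro tendsto_sum p)
    show "\<forall>\<^sub>F t in at_top. \<bar>(\<Sum>j\<in>G. pmf (q t) (j, i)) - pmf (map_pmf fst (q t)) i\<bar> \<le> measure (map_pmf fst (q t)) (- G)"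
      using ev1 by eventually_elim (rule stationary_pairs.block_sums(2)[OF sp G])
  qed
  have balance: "(\<Sum>j\<in>G. p i j) = (\<Sum>j\<in>G. p j i)" for i
    using tendsto_unique[OF _ marg[of i] marg'[of i]] by (simp add: \<pi>_def)
  have "((\<lambda>t :: real. 1 :: real) \<longlongrightarrow> (\<Sum>i\<in>G. \<Sum>j\<in>G. p i j)) at_top"
  proof (rule tendsto_of_abs_diff_le)
    show "((\<lambda>t. \<Sum>i\<in>G. \<Sum>j\<in>G. pmf (q t) (i, j)) \<longlongrightarrow> (\<Sum>i\<in>G. \<Sum>j\<in>G. p i j)) at_top" by (intro tendsto_sum p)
    show "((\<lambda>t. 2 * measure (map_pmf fst (q t)) (- G)) \<longlongrightarrow> 0) at_top" using tendsto_mult_right_zero[OF tail, of 2] .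
    show "\<forall>\<^sub>F t in at_top. \<bar>(\<Sum>i\<in>G. \<Sum>j\<in>G. pmf (q t) (i, j)) - 1\<bar> \<le> 2 * measure (map_pmf fst (q t)) (- G)"
      using ev1 by eventually_elim (rule stationary_pairs.block_sums(3)[OF sp G])
  qed
  then have total: "(\<Sum>i\<in>G. \<Sum>j\<in>G. p i j) = 1" by (simp add: tendsto_const_iff)
  have supp: "i \<in> G \<and> j \<in> G \<and> A i j" if "p i j \<noteq> 0" for i j using pG[OF that] pA[OF that] by blast
  obtain N where N: "inv_prob A N"
    and N1: "\<And>i. measure N {x \<in> space N. word 1 x = [i]} = \<pi> i"
    and Nstep: "\<And>w y. w \<noteq> [] \<Longrightarrow> measure N {x \<in> space N. word (Suc (length w)) x = w @ [y]} * \<pi> (last w) =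
       measure N {x \<in> space N. word (length w) x = w} * p (last w) y"
    using finite_markov_measure[of G p A, OF G p0 supp total balance] unfolding \<pi>_def by blast
  interpret N: shift_measure A N by unfold_locales fact
  have N0: "measure N {x \<in> space N. x 0 = i} = \<pi> i" for i
    using N1[of i] unfolding N.word_1_iff .
  have \<pi>0: "0 \<le> \<pi> i" for i unfolding \<pi>_def by (intro sum_nonneg p0)
  have AE: "AE x in N. \<forall>k. x k \<in> G"
  proof (rule N.AE_coordinates)
    fix i assume "i \<notin> G"
    then show "measure N {x \<in> space N. x 0 = i} = 0"
      unfolding N0 \<pi>_def using pG by (intro sum.neutral) blast
  qed
  have "((\<lambda>t. measure (\<mu> t) {x \<in> space (\<mu> t). word (length w) x = w}) \<longlongrightarrow>
       measure N {x \<in> space N. word (length w) x = w}) at_top" for w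
  proof (induction w rule: rev_induct)
    case Nil
    have "\<forall>\<^sub>F t in at_top. measure (\<mu> t) {x \<in> space (\<mu> t). word (length []) x = []} = 1"
      using ev1
    proof eventually_elim
      case (elim t)
      then interpret M: shift_measure A "\<mu> t"
        using eq[of t] by unfold_locales (simp add: equilibrium_state_def)
      show ?case using M.prob_space by (simp add: word_def)
    qed
    then show ?case using N.prob_space by (intro tendsto_eventually) (simp add: word_def)
  next
    case (snoc y w)
    show ?case
    proof (cases "w = []")
      case True
      have "\<forall>\<^sub>F t in at_top. pmf (map_pmf fst (q t)) y = measure (\<mu> t) {x \<in> space (\<mu> t). word 1 x = [y]}"
        using ev1 by eventually_elim (simp only: N.word_1_iff coord)
      from Lim_transform_eventually[OF marg this] show ?thesis using N1[of y] True by simp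
    next
      case False
      note lim_last = marg[of "last w"]
      show ?thesis
      proof (cases "\<pi> (last w) = 0")
        case True
        have le: "measure (\<mu> t) {x \<in> space (\<mu> t). word (length (w @ [y])) x = w @ [y]} \<le> pmf (map_pmf fst (q t)) (last w)"
          if "t \<ge> 1" for t
        proof -
          interpret M: shift_measure A "\<mu> t"
            using eq[of t] that by unfold_locales (simp add: equilibrium_state_def)
          have "measure (\<mu> t) {x \<in> space (\<mu> t). word (length (w @ [y])) x = w @ [y]} \<le>
              measure (\<mu> t) {x \<in> space (\<mu> t). word (length w) x = w}"
            by (intro M.finite_measure_mono) (auto simp: word_Suc)
          also have "\<dots> \<le> pmf (map_pmf fst (q t)) (last w)"
            using M.words_le_last[OF False] coord[OF that] by simp
          finally show ?thesis .
        qed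
        have "measure N {x \<in> space N. word (length (w @ [y])) x = w @ [y]} \<le>
            measure N {x \<in> space N. word (length w) x = w}"
          by (intro N.finite_measure_mono) (auto simp: word_Suc)
        also have "\<dots> \<le> \<pi> (last w)" using N.words_le_last[OF False] N0 by simp
        finally have Nz: "measure N {x \<in> space N. word (length (w @ [y])) x = w @ [y]} = 0"
          using True measure_nonneg[of N] by (simp add: antisym)
        have "((\<lambda>t. measure (\<mu> t) {x \<in> space (\<mu> t). word (length (w @ [y])) x = w @ [y]}) \<longlongrightarrow> 0) at_top"
        proof (rule tendsto_sandwich[OF _ _ tendsto_const])
          show "((\<lambda>t. pmf (map_pmf fst (q t)) (last w)) \<longlongrightarrow> 0) at_top" using lim_last True by simp
          show "\<forall>\<^sub>F t in at_top. measure (\<mu> t) {x \<in> space (\<mu> t). word (length (w @ [y])) x = w @ [y]} \<le> pmf (map_pmf fst (q t)) (last w)"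
            using ev1 by eventually_elim (rule le)
        qed simp
        then show ?thesis unfolding Nz .
      next
        case nz: False
        have Neq: "measure N {x \<in> space N. word (length w) x = w} * p (last w) y / \<pi> (last w) =
            measure N {x \<in> space N. word (length (w @ [y])) x = w @ [y]}"
          using Nstep[OF False, of y] nz by (simp add: field_simps)
        have "\<forall>\<^sub>F t in at_top. measure (\<mu> t) {x \<in> space (\<mu> t). word (length w) x = w} * pmf (q t) (last w, y) / pmf (map_pmf fst (q t)) (last w) =
            measure (\<mu> t) {x \<in> space (\<mu> t). word (length (w @ [y])) x = w @ [y]}"
          using ev1
        proof eventually_elim
          case (elim t)
          have "pmf (map_pmf fst (q t)) (last w) > 0" using T.pos[OF elim] by (simp add: T.pmf_marg[OF elim])
          then show ?case using step[OF elim False, of y] by (simp add: field_simps)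
        qed
        from Lim_transform_eventually[OF tendsto_divide[OF tendsto_mult[OF snoc p] lim_last nz] this]
        show ?thesis unfolding Neq .
      qed
    qed
  qed
  then show ?thesis using N G AE by blast
qed

lemma finite_words: "finite G \<Longrightarrow> finite {w. set w \<subseteq> G \<and> length w = n}"
  using finite_lists_length_eq[of G n] by simp

text \<open>A nonnegative continuous function is the increasing limit of its infima over cylinders, so
  convergence on cylinders bounds the lower limit of its integrals.\<close>

lemma integral_lower_semicontinuous:
  assumes M: "\<And>t. t \<ge> (1::real) \<Longrightarrow> inv_prob A (M t)" and N: "inv_prob A N"
    and G: "finite G" and AE: "AE x in N. \<forall>k. x k \<in> G"
    and conv: "\<And>w. ((\<lambda>t. measure (M t) {x \<in> space (M t). word (length w) x = w}) \<longlongrightarrow>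
       measure N {x \<in> space N. word (length w) x = w}) at_top"
    and f: "\<And>x. x \<in> CMS A \<Longrightarrow> 0 \<le> f x" "\<And>x. x \<in> CMS A \<Longrightarrow> f x \<le> (K::real)" "f \<in> borel_measurable N"
    and loc: "\<And>x e. x \<in> CMS A \<Longrightarrow> e > 0 \<Longrightarrow> \<exists>n. \<forall>y\<in>CMS A. word n y = word n x \<longrightarrow> \<bar>f y - f x\<bar> < e"
    and c: "c < (\<integral>x. f x \<partial>N)"
  shows "\<forall>\<^sub>F t in at_top. c < (\<integral>x. f x \<partial>(M t))"
proof -
  interpret N: shift_measure A N by unfold_locales fact
  define m where "m = (\<lambda>n w. Inf (f ` {y \<in> CMS A. word n y = w}))"
  define g where "g = (\<lambda>n x. m n (word n x))"
  have bdd: "bdd_below (f ` {y \<in> CMS A. word n y = w})" for n w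
    using f(1) by (intro bdd_belowI[of _ 0]) auto
  have g_le: "g n x \<le> f x" if "x \<in> CMS A" for n x
    unfolding g_def m_def using that bdd by (intro cInf_lower) auto
  have g_ge: "a \<le> g n x" if "x \<in> CMS A" "\<And>y. y \<in> CMS A \<Longrightarrow> word n y = word n x \<Longrightarrow> a \<le> f y" for n x a
    unfolding g_def m_def using that by (intro cInf_greatest) auto
  have g0: "0 \<le> g n x" if "x \<in> CMS A" for n x using that f(1) by (intro g_ge) auto
  have lim: "(\<lambda>n. g n x) \<longlonglongrightarrow> f x" if x: "x \<in> CMS A" for x
  proof (rule LIMSEQ_I)
    fix e :: real assume "e > 0"
    then obtain k where k: "\<forall>y\<in>CMS A. word k y = word k x \<longrightarrow> \<bar>f y - f x\<bar> < e / 2"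
      using loc[OF x, of "e / 2"] by auto
    have "norm (g n x - f x) < e" if "n \<ge> k" for n
    proof -
      have "f x - e / 2 \<le> g n x"
      proof (rule g_ge[OF x])
        fix y assume "y \<in> CMS A" "word n y = word n x"
        then have "\<bar>f y - f x\<bar> < e / 2" using k take_word[OF that, of x] take_word[OF that, of y] by simp
        then show "f x - e / 2 \<le> f y" by linarith
      qed
      then show ?thesis using g_le[OF x, of n] \<open>e > 0\<close> by (simp add: abs_less_iff)
    qed
    then show "\<exists>no. \<forall>n\<ge>no. norm (g n x - f x) < e" by blast
  qed
  have "(\<lambda>n. \<integral>x. g n x \<partial>N) \<longlonglongrightarrow> (\<integral>x. f x \<partial>N)"
  proof (rule integral_dominated_convergence[where w = "\<lambda>_. K"])
    show "AE x in N. (\<lambda>n. g n x) \<longlonglongrightarrow> f x" by (intro AE_I2 lim) (simp add: N.space_M)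
    show "AE x in N. norm (g n x) \<le> K" for n
    proof (rule AE_I2)
      fix x assume "x \<in> space N"
      then show "norm (g n x) \<le> K"
        using g0[of x n] g_le[of x n] f(2)[of x] by (simp add: N.space_M)
    qed
    show "g n \<in> borel_measurable N" for n
      unfolding g_def by (rule measurable_compose[OF N.word_measurable]) simp
  qed (use f(3) in auto)
  then have "\<forall>\<^sub>F n in sequentially. c < (\<integral>x. g n x \<partial>N)" using c by (rule order_tendstoD)
  then obtain n where n: "c < (\<integral>x. g n x \<partial>N)" by (auto simp: eventually_sequentially)
  \<comment> \<open>\<open>N\<close> lives on words over \<open>G\<close>, of which only finitely
    many have length \<open>n\<close>. For the measures at finite \<open>t\<close> the other words
    are dropped, which is harmless in a lower bound because \<open>f\<close> is nonnegative.\<close>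
  define W where "W = {w. set w \<subseteq> G \<and> length w = n}"
  have W: "finite W" unfolding W_def by (rule finite_words[OF G])
  define gW where "gW = (\<lambda>x. \<Sum>w\<in>W. m n w * indicator {x \<in> CMS A. word n x = w} x)"
  have gW_eq: "gW x = (if word n x \<in> W then g n x else 0)" if "x \<in> CMS A" for x
  proof -
    have "gW x = (\<Sum>w\<in>W. if w = word n x then m n w else 0)"
      unfolding gW_def using that by (intro sum.cong) auto
    then show ?thesis using W by (simp add: g_def)
  qed
  have intW: "integrable L gW" "(\<integral>x. gW x \<partial>L) = (\<Sum>w\<in>W. m n w * measure L {x \<in> space L. word n x = w})"
    if "inv_prob A L" for L
  proof -
    interpret L: shift_measure A L by unfold_locales fact
    have i: "integrable L (\<lambda>x. m n w * indicator {x \<in> CMS A. word n x = w} x)" for w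
      using L.word_event[of n w] by (intro integrable_mult_right integrable_real_indicator)
        (auto simp: L.space_M L.emeasure_eq_measure)
    show "integrable L gW" unfolding gW_def by (intro Bochner_Integration.integrable_sum i)
    have "(\<integral>x. gW x \<partial>L) = (\<Sum>w\<in>W. \<integral>x. m n w * indicator {x \<in> CMS A. word n x = w} x \<partial>L)"
      unfolding gW_def by (intro Bochner_Integration.integral_sum i)
    also have "\<dots> = (\<Sum>w\<in>W. m n w * measure L {x \<in> space L. word n x = w})"
      using L.word_event by (intro sum.cong) (auto simp: L.space_M Int_absorb2 Collect_conj_eq)
    finally show "(\<integral>x. gW x \<partial>L) = (\<Sum>w\<in>W. m n w * measure L {x \<in> space L. word n x = w})" .
  qed
  have "(\<integral>x. g n x \<partial>N) = (\<integral>x. gW x \<partial>N)"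
  proof (rule integral_cong_AE)
    show "AE x in N. g n x = gW x"
      using AE AE_space
    proof eventually_elim
      case (elim x)
      then have "word n x \<in> W" by (auto simp: W_def word_def)
      then show ?case using gW_eq[of x] elim by (simp add: N.space_M)
    qed
    show "g n \<in> borel_measurable N"
      unfolding g_def by (rule measurable_compose[OF N.word_measurable]) simp
    show "gW \<in> borel_measurable N" using intW(1)[OF N] by simp
  qed
  then have "c < (\<Sum>w\<in>W. m n w * measure N {x \<in> space N. word n x = w})" using n intW(2)[OF N] by simp
  moreover have "((\<lambda>t. \<Sum>w\<in>W. m n w * measure (M t) {x \<in> space (M t). word n x = w}) \<longlongrightarrow>
      (\<Sum>w\<in>W. m n w * measure N {x \<in> space N. word n x = w})) at_top"
    using conv by (intro tendsto_sum tendsto_mult tendsto_const) (auto simp: W_def)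
  ultimately have "\<forall>\<^sub>F t in at_top. c < (\<Sum>w\<in>W. m n w * measure (M t) {x \<in> space (M t). word n x = w})"
    by (intro order_tendstoD(1))
  then show ?thesis
    using eventually_ge_at_top[of 1]
  proof eventually_elim
    case (elim t)
    interpret L: shift_measure A "M t" using M[OF elim(2)] by unfold_locales
    have fm: "f \<in> borel_measurable (M t)"
      using f(3) measurable_cong_sets[of "M t" N "borel :: real measure" borel] by (simp add: L.sets_M N.sets_M)
    have "(\<integral>x. gW x \<partial>(M t)) \<le> (\<integral>x. f x \<partial>(M t))"
    proof (rule integral_mono[OF intW(1)[OF M[OF elim(2)]]])
      show "integrable (M t) f"
        by (rule L.integrable_const_bound[OF _ fm, of K]) (use f(1,2) in \<open>auto simp: L.space_M\<close>)
      show "gW x \<le> f x" if "x \<in> space (M t)" for x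
        using that g_le[of x n] f(1)[of x] gW_eq[of x] by (simp add: L.space_M)
    qed
    then show ?case using elim(1) intW(2)[OF M[OF elim(2)]] by simp
  qed
qed

text \<open>A basic neighbourhood in the product topology restricts only finitely many coordinates,
  so it contains a cylinder.\<close>

lemma continuous_on_CMS_cylinder:
  fixes f :: "(nat \<Rightarrow> nat) \<Rightarrow> real"
  assumes "continuous_on (CMS A) f" "x \<in> CMS A" "e > 0"
  shows "\<exists>n. \<forall>y\<in>CMS A. word n y = word n x \<longrightarrow> \<bar>f y - f x\<bar> < e"
proof -
  have "\<exists>U. open U \<and> x \<in> U \<and> (\<forall>y\<in>CMS A. y \<in> U \<longrightarrow> f y \<in> ball (f x) e)"
    using assms(1)[unfolded continuous_on_topological, rule_format, of x "ball (f x) e"] assms(2,3) by auto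
  then obtain U where U: "open U" "x \<in> U" "\<And>y. y \<in> CMS A \<Longrightarrow> y \<in> U \<Longrightarrow> \<bar>f y - f x\<bar> < e"
    by (auto simp: dist_real_def abs_minus_commute)
  obtain X where X: "x \<in> (\<Pi>\<^sub>E i\<in>UNIV. X i)" "finite {i. X i \<noteq> UNIV}" "(\<Pi>\<^sub>E i\<in>UNIV. X i) \<subseteq> U"
    using product_topology_open_contains_basis[of "\<lambda>i. euclidean" UNIV U x] U(1,2)
    by (auto simp: open_fun_def)
  obtain n where n: "\<And>i. X i \<noteq> UNIV \<Longrightarrow> i < n"
    using X(2) unfolding finite_nat_set_iff_bounded by auto
  have "y \<in> U" if "word n y = word n x" for y
  proof -
    have "y i = x i" if "i < n" for i using \<open>word n y = word n x\<close> that by (simp add: word_eq_iff word_nth)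
    then have "y i \<in> X i" for i using n[of i] X(1) by (cases "X i = UNIV") (auto simp: PiE_iff)
    then show ?thesis using X(3) by (auto simp: PiE_iff)
  qed
  then show ?thesis using U(3) by blast
qed

text \<open>Lower semicontinuity for the nonnegative functions \<open>B + f\<close> and
  \<open>B - f\<close> gives the two halves of the convergence, since all measures have mass
  one.\<close>

lemma weak_star_lim_of_words:
  assumes M: "\<And>t. t \<ge> (1::real) \<Longrightarrow> inv_prob A (M t)" and N: "inv_prob A N"
    and G: "finite G" and AE: "AE x in N. \<forall>k. x k \<in> G"
    and conv: "\<And>w. ((\<lambda>t. measure (M t) {x \<in> space (M t). word (length w) x = w}) \<longlongrightarrow>
       measure N {x \<in> space N. word (length w) x = w}) at_top"
  shows "weak_star_lim A M N"
  unfolding weak_star_lim_def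
proof (intro allI impI, elim conjE)
  fix f :: "(nat \<Rightarrow> nat) \<Rightarrow> real"
  assume cont: "continuous_on (CMS A) f" and "bounded (f ` CMS A)"
  then obtain B where B: "\<And>x. x \<in> CMS A \<Longrightarrow> \<bar>f x\<bar> \<le> B" by (auto simp: bounded_iff)
  have meas: "f \<in> borel_measurable L" if "inv_prob A L" for L
    using borel_measurable_continuous_on_restrict[OF cont] measurable_cong_sets[of L "restrict_space borel (CMS A)" borel borel] that
    by (auto simp: inv_prob_def)
  have int: "integrable L f" if "inv_prob A L" for L
  proof -
    interpret L: shift_measure A L by unfold_locales fact
    show "integrable L f"
      by (rule L.integrable_const_bound[OF _ meas[OF that], of B]) (use B in \<open>auto simp: L.space_M\<close>)
  qed
  have shiftI: "(\<integral>x. B + \<sigma> * f x \<partial>L) = B + \<sigma> * (\<integral>x. f x \<partial>L)" if "inv_prob A L" for L \<sigma>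
  proof -
    interpret L: shift_measure A L by unfold_locales fact
    show ?thesis using int[OF that] by (simp add: L.prob_space)
  qed
  have half: "\<forall>\<^sub>F t in at_top. \<sigma> * (\<integral>x. f x \<partial>N) - e < \<sigma> * (\<integral>x. f x \<partial>(M t))"
    if \<sigma>: "\<sigma> = 1 \<or> \<sigma> = - 1" and e: "e > 0" for \<sigma> e
  proof -
    have "\<forall>\<^sub>F t in at_top. B + \<sigma> * (\<integral>x. f x \<partial>N) - e < (\<integral>x. B + \<sigma> * f x \<partial>(M t))"
    proof (rule integral_lower_semicontinuous[OF M N G AE conv])
      show "0 \<le> B + \<sigma> * f x" "B + \<sigma> * f x \<le> 2 * B" if "x \<in> CMS A" for x
        using \<sigma> B[OF that] by auto
      show "(\<lambda>x. B + \<sigma> * f x) \<in> borel_measurable N" using meas[OF N] by measurable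
      show "\<exists>n. \<forall>y\<in>CMS A. word n y = word n x \<longrightarrow> \<bar>(B + \<sigma> * f y) - (B + \<sigma> * f x)\<bar> < e'"
        if "x \<in> CMS A" "e' > 0" for x e'
      proof -
        have "\<bar>(B + \<sigma> * a) - (B + \<sigma> * b)\<bar> = \<bar>a - b\<bar>" for a b using \<sigma> by auto
        then show ?thesis using continuous_on_CMS_cylinder[OF cont that] by simp
      qed
      show "B + \<sigma> * (\<integral>x. f x \<partial>N) - e < (\<integral>x. B + \<sigma> * f x \<partial>N)" using shiftI[OF N] e by simp
    qed auto
    then show ?thesis using eventually_ge_at_top[of 1]
      by eventually_elim (simp add: shiftI[OF M])
  qed
  show "((\<lambda>t. \<integral>x. f x \<partial>(M t)) \<longlongrightarrow> (\<integral>x. f x \<partial>N)) at_top"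
  proof (rule tendstoI)
    fix e :: real assume "e > 0"
    then have "\<forall>\<^sub>F t in at_top. 1 * (\<integral>x. f x \<partial>N) - e < 1 * (\<integral>x. f x \<partial>(M t))"
      "\<forall>\<^sub>F t in at_top. - 1 * (\<integral>x. f x \<partial>N) - e < - 1 * (\<integral>x. f x \<partial>(M t))"
      by (intro half; simp)+
    then show "\<forall>\<^sub>F t in at_top. dist (\<integral>x. f x \<partial>(M t)) (\<integral>x. f x \<partial>N) < e"
      by eventually_elim (simp add: dist_real_def abs_less_iff)
  qed
qed

context zero_temperature
begin

text \<open>The potential may be unbounded below, so weak convergence does not give convergence of
  the energies. Semicontinuity of \<open>ln Z - \<psi>\<close> has the required direction: the
  energy of \<open>N\<close> is at least the upper limit of the energies of the equilibrium
  states.\<close>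

lemma limit_maximizing:
  assumes eq: "\<And>t. t \<ge> 1 \<Longrightarrow> equilibrium_state A (\<lambda>x. t * \<phi> x) (\<mu> t)"
    and N: "inv_prob A N" and G: "finite G" and AE: "AE x in N. \<forall>k. x k \<in> G"
    and conv: "\<And>w. ((\<lambda>t. measure (\<mu> t) {x \<in> space (\<mu> t). word (length w) x = w}) \<longlongrightarrow>
       measure N {x \<in> space N. word (length w) x = w}) at_top"
  shows "maximizing A \<phi> N"
proof -
  let ?\<psi> = "\<lambda>x :: nat \<Rightarrow> nat. \<psi> (x 0) (x 1)"
  interpret N: shift_measure A N by unfold_locales fact
  have M: "inv_prob A (\<mu> t)" if "t \<ge> 1" for t using eq[OF that] by (simp add: equilibrium_state_def)
  have iM: "integrable (\<mu> t) ?\<psi>" if "t \<ge> 1" for t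
    using potential_integrable(1)[OF M[OF that], of t] eq[OF that] that by (simp add: equilibrium_state_def)
  have iN: "integrable N ?\<psi>" by (rule N.integrable_finite_coordinates[OF G AE])
  define e where "e = (\<lambda>L. \<integral>x. ?\<psi> x \<partial>L)"
  have "e \<nu> \<le> e N" if \<nu>: "inv_prob A \<nu>" "integrable \<nu> ?\<psi>" for \<nu>
  proof (rule ccontr)
    assume "\<not> e \<nu> \<le> e N"
    then obtain d where d: "e N < d" "d < e \<nu>" using dense[of "e N" "e \<nu>"] by auto
    \<comment> \<open>On pairs from \<open>G\<close> the cut at \<open>k\<close> is inactive, so it
      leaves the integral against \<open>N\<close> unchanged and yet makes the function
      bounded.\<close>
    define k where "k = (\<Sum>i\<in>G. \<Sum>j\<in>G. \<bar>ln Z - \<psi> i j\<bar>)"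
    define f where "f = (\<lambda>x. min (ln Z - ?\<psi> x) k)"
    have k0: "0 \<le> k" unfolding k_def by (intro sum_nonneg) simp
    have le: "?\<psi> x \<le> ln Z" if "x \<in> CMS A" for x
      using psi_le_CMS[OF that] s_le[of "x 0"] by linarith
    have "(\<integral>x. f x \<partial>N) = (\<integral>x. ln Z - ?\<psi> x \<partial>N)"
    proof (rule integral_cong_AE)
      show "AE x in N. f x = ln Z - ?\<psi> x"
        using AE
      proof eventually_elim
        case (elim x)
        have "ln Z - ?\<psi> x \<le> \<bar>ln Z - \<psi> (x 0) (x 1)\<bar>" by simp
        also have "\<dots> \<le> (\<Sum>j\<in>G. \<bar>ln Z - \<psi> (x 0) j\<bar>)"
          using G elim by (intro member_le_sum) auto
        also have "\<dots> \<le> k"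
          unfolding k_def using G elim
          by (intro member_le_sum[of "x 0" G "\<lambda>i. \<Sum>j\<in>G. \<bar>ln Z - \<psi> i j\<bar>"]) (auto intro: sum_nonneg)
        finally show ?case by (simp add: f_def)
      qed
    qed (unfold f_def, measurable)
    also have "\<dots> = ln Z - e N" using iN by (simp add: e_def N.prob_space)
    finally have fN: "ln Z - d < (\<integral>x. f x \<partial>N)" using d(1) by simp
    have "\<forall>\<^sub>F t in at_top. ln Z - d < (\<integral>x. f x \<partial>(\<mu> t))"
    proof (rule integral_lower_semicontinuous[OF M N G AE conv])
      show "0 \<le> f x" "f x \<le> k" if "x \<in> CMS A" for x
        using le[OF that] k0 by (auto simp: f_def)
      show "f \<in> borel_measurable N" unfolding f_def by measurable
      show "\<exists>n. \<forall>y\<in>CMS A. word n y = word n x \<longrightarrow> \<bar>f y - f x\<bar> < e'" if "e' > 0" for x e'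
      proof (intro exI ballI impI)
        fix y assume "word 2 y = word 2 x"
        then have "y 0 = x 0" "y 1 = x 1" by (auto simp: word_eq_iff word_nth)
        then show "\<bar>f y - f x\<bar> < e'" using that by (simp add: f_def)
      qed
    qed (use fN in auto)
    then have ev: "\<forall>\<^sub>F t in at_top. e (\<mu> t) < d"
      using eventually_ge_at_top[of 1]
    proof eventually_elim
      case (elim t)
      interpret M: shift_measure A "\<mu> t" using M[OF elim(2)] by unfold_locales
      have "(\<integral>x. f x \<partial>(\<mu> t)) \<le> (\<integral>x. ln Z - ?\<psi> x \<partial>(\<mu> t))"
      proof (rule integral_mono)
        show "integrable (\<mu> t) f"
          unfolding f_def using iM[OF elim(2)] by (intro integrable_min) auto
        show "integrable (\<mu> t) (\<lambda>x. ln Z - ?\<psi> x)" using iM[OF elim(2)] by simp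
      qed (simp add: f_def)
      also have "\<dots> = ln Z - e (\<mu> t)" using iM[OF elim(2)] by (simp add: e_def M.prob_space)
      finally show ?case using elim(1) by linarith
    qed
    \<comment> \<open>\<open>\<mu> t\<close> competes with \<open>\<mu> 1\<close> for the potential
      at parameter one, and \<nu> competes with \<open>\<mu> t\<close> at parameter
      \<open>t\<close>. Combining the inequalities eliminates the entropy of \<open>\<mu> t\<close>;
      the entropy of \<nu> is dropped because it is nonnegative.\<close>
    have bound: "\<exists>p. \<forall>t\<ge>1. t * e \<nu> \<le> p + (t - 1) * e (\<mu> t)"
    proof -
      obtain h1 where h1: "\<And>\<nu>. inv_prob A \<nu> \<Longrightarrow> integrable \<nu> ?\<psi> \<Longrightarrow>
          metric_entropy \<nu> shift + ereal (e \<nu>) \<le> ereal (h1 + e (\<mu> 1))"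
        using equilibrium_pressure[OF order_refl eq[OF order_refl]] by (auto simp: e_def)
      have "t * e \<nu> \<le> h1 + e (\<mu> 1) + (t - 1) * e (\<mu> t)" if t: "t \<ge> 1" for t
      proof -
        obtain h where h: "metric_entropy (\<mu> t) shift = ereal h"
          "metric_entropy \<nu> shift + ereal (t * e \<nu>) \<le> ereal (h + t * e (\<mu> t))"
          using equilibrium_pressure[OF t eq[OF t]] \<nu> by (auto simp: e_def)
        interpret V: shift_measure A \<nu> using \<nu>(1) by unfold_locales
        have "0 \<le> metric_entropy \<nu> shift" by (rule V.metric_entropy_nonneg)
        then have "ereal (t * e \<nu>) \<le> metric_entropy \<nu> shift + ereal (t * e \<nu>)"
          using add_right_mono[of 0 "metric_entropy \<nu> shift" "ereal (t * e \<nu>)"] by simp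
        from order_trans[OF this h(2)] have "t * e \<nu> \<le> h + t * e (\<mu> t)" by simp
        moreover have "h + e (\<mu> t) \<le> h1 + e (\<mu> 1)" using h1[OF M[OF t] iM[OF t]] h(1) by simp
        ultimately show ?thesis by (simp add: algebra_simps)
      qed
      then show ?thesis by blast
    qed
    then obtain p where p: "\<And>t. t \<ge> 1 \<Longrightarrow> t * e \<nu> \<le> p + (t - 1) * e (\<mu> t)" by blast
    have "\<forall>\<^sub>F t in at_top. t \<ge> 1 \<and> t > (p - d) / (e \<nu> - d) \<and> e (\<mu> t) < d"
      by (intro eventually_conj eventually_ge_at_top eventually_gt_at_top ev)
    \<comment> \<open>Beyond this threshold \<open>t * (e \<nu> - d)\<close> exceeds
      \<open>p - d\<close>, which contradicts the bound together with
      \<open>e (\<mu> t) < d\<close>.\<close>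
    then obtain t where t: "t \<ge> 1" "t > (p - d) / (e \<nu> - d)" "e (\<mu> t) < d"
      by (auto simp: eventually_at_top_linorder)
    have "t * e \<nu> \<le> p + (t - 1) * d"
      using p[OF t(1)] mult_left_mono[of "e (\<mu> t)" d "t - 1"] t(1,3) by simp
    moreover have "p - d < t * (e \<nu> - d)" using t(2) d(2) by (simp add: divide_less_eq)
    ultimately show False by (simp add: algebra_simps)
  qed
  then have le: "ext_integral \<nu> \<phi> \<le> ereal (e N)" if \<nu>: "inv_prob A \<nu>" for \<nu>
  proof (cases "ext_integral \<nu> \<phi> > - \<infinity>")
    case True
    have i: "integrable \<nu> ?\<psi>" using potential_integrable(1)[OF \<nu>, of 1] True by simp
    then show ?thesis
      using ext_integral_potential[OF \<nu> i, of 1] \<open>\<And>\<nu>. inv_prob A \<nu> \<Longrightarrow> integrable \<nu> ?\<psi> \<Longrightarrow> e \<nu> \<le> e N\<close>[OF \<nu> i]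
      by (simp add: e_def)
  qed simp
  have "ext_integral N \<phi> = ereal (e N)" using ext_integral_potential[OF N iN, of 1] by (simp add: e_def)
  moreover have "max_integral A \<phi> = ereal (e N)"
    unfolding max_integral_def
  proof (rule antisym)
    show "(SUP \<nu>\<in>{\<nu>. inv_prob A \<nu>}. ext_integral \<nu> \<phi>) \<le> ereal (e N)" using le by (intro SUP_least) simp
    show "ereal (e N) \<le> (SUP \<nu>\<in>{\<nu>. inv_prob A \<nu>}. ext_integral \<nu> \<phi>)"
      using N unfolding calculation[symmetric] by (intro SUP_upper) simp
  qed
  ultimately show ?thesis using N by (simp add: maximizing_def)
qed

end

text \<open>Every admissible pair begins a point of the shift, so a bound on the potential over
  cylinders applies to every edge.\<close>

lemma extend_edge:
  assumes "no_zero_rows_cols A" "A i j"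
  shows "\<exists>x\<in>CMS A. x 0 = i \<and> x 1 = j"
proof -
  have "\<forall>a. \<exists>b. A a b" using assms(1) by (simp add: no_zero_rows_cols_def)
  then obtain g where g: "\<And>a. A a (g a)" by metis
  define x where "x = (\<lambda>n. case n of 0 \<Rightarrow> i | Suc m \<Rightarrow> (g ^^ m) j)"
  have "A (x k) (x (Suc k))" for k
    using assms(2) g by (cases k) (auto simp: x_def)
  then show ?thesis by (intro bexI[of _ x]) (auto simp: CMS_def x_def)
qed

theorem theorem1:
  fixes A :: "nat \<Rightarrow> nat \<Rightarrow> bool"
    and \<phi> :: "(nat \<Rightarrow> nat) \<Rightarrow> real"
    and \<mu> :: "real \<Rightarrow> (nat \<Rightarrow> nat) measure"
  assumes "no_zero_rows_cols A"
    and "top_transitive A"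
    and "markov_potential A \<phi>"
    and "summable_pot A \<phi>"
    and "finite_var1 A \<phi>"
    and "\<forall>a. gurevich_pressure A \<phi> a < \<infinity>"
    and "\<forall>t\<ge>1. equilibrium_state A (\<lambda>x. t * \<phi> x) (\<mu> t)"
  shows "\<exists>\<mu>inf. inv_prob A \<mu>inf \<and> weak_star_lim A \<mu> \<mu>inf \<and> maximizing A \<phi> \<mu>inf"
proof -
  obtain \<psi> where \<psi>: "\<And>x. x \<in> CMS A \<Longrightarrow> \<phi> x = \<psi> (x 0) (x 1)"
    using assms(3) by (auto simp: markov_potential_def)
  define s where "s = (\<lambda>i. Sup (\<phi> ` cyl1 A i))"
  have path: "(w 0, w (Suc k)) \<in> (edges_in UNIV A)\<^sup>+" if "\<forall>i<Suc k. A (w i) (w (Suc i))" for w k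
    using that
  proof (induction k)
    case (Suc k)
    then have "(w (Suc k), w (Suc (Suc k))) \<in> edges_in UNIV A" by (simp add: edges_in_def)
    moreover have "(w 0, w (Suc k)) \<in> (edges_in UNIV A)\<^sup>+" using Suc by simp
    ultimately show ?case by (rule trancl_into_trancl[rotated])
  qed (auto simp: edges_in_def)
  interpret zero_temperature A \<phi> \<psi> s
  proof
    show "(i, j) \<in> (edges_in UNIV A)\<^sup>+" for i j
    proof -
      obtain n w where w: "n \<ge> 1" "w 0 = i" "w n = j" "\<forall>k<n. A (w k) (w (Suc k))"
        using assms(2) unfolding top_transitive_def by blast
      then show ?thesis using path[of "n - 1" w] by simp
    qed
    show "\<psi> i j \<le> s i" if ij: "A i j" for i j
    proof -
      obtain x where x: "x \<in> CMS A" "x 0 = i" "x 1 = j" using extend_edge[OF assms(1) ij] by blast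
      then have "\<phi> x \<le> s i"
        using assms(4) unfolding s_def summable_pot_def by (intro cSup_upper) (auto simp: cyl1_def)
      then show ?thesis using \<psi>[OF x(1)] x(2,3) by simp
    qed
    show "summable (\<lambda>i. exp (s i))" using assms(4) by (simp add: summable_pot_def s_def)
  qed (rule \<psi>)
  have eq: "equilibrium_state A (\<lambda>x. t * \<phi> x) (\<mu> t)" if "t \<ge> 1" for t using assms(7) that by blast
  then have M: "inv_prob A (\<mu> t)" if "t \<ge> 1" for t using that by (simp add: equilibrium_state_def)
  obtain N G where N: "inv_prob A N" "finite G" "AE x in N. \<forall>k. x k \<in> G"
    and conv: "\<And>w. ((\<lambda>t. measure (\<mu> t) {x \<in> space (\<mu> t). word (length w) x = w}) \<longlongrightarrow>
       measure N {x \<in> space N. word (length w) x = w}) at_top"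
    using limit_measure[OF eq] by blast
  show ?thesis
    using N(1) weak_star_lim_of_words[OF M N conv] limit_maximizing[OF eq N conv] by blast
qed

end
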